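(* Let $\mathbf{sd}=\{(\lambda_n,\alpha_n)\}_{n\in\mathbb{Z}^*}$, $\mathbb{Z}^*:=\mathbb{Z}\setminus\{0\}$, be a set of pairs of real numbers such that (i) the $\lambda_n$ are nonzero, strictly increase with $n\in\mathbb{Z}^*$, and have the representation $\lambda_n=\pi n+h+\tilde\lambda_n$ for some $h\in\mathbb{R}$ and some sequence $(\tilde\lambda_n)\in\ell_2(\mathbb{Z}^* )$; (ii) $\alpha_n>0$ for all $n\in\mathbb{Z}^*$ and the numbers $\tilde\alpha_n:=\alpha_n-1$ form an $\ell_2(\mathbb{Z}^* )$-sequence. Then there exist a real-valued $p\in L_2(0,1)$ and a real-valued distribution $q\in W_2^{-1}(0,1)$, with the Sturm--Liouville operator $A$ with potential $q$ (and Dirichlet boundary conditions) positive, such that $\mathbf{sd}$ is the spectral data of the quadratic operator pencil $T_{p,q}$, i.e. $\mathbf{sd}(T_{p,q})=\mathbf{sd}$.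
   Context: A real-valued distribution $q\in W_2^{-1}(0,1)$ is written as $q=r'$ with a real-valued $r\in L_2(0,1)$. For absolutely continuous $y$, put $y^{[1]}:=y'-ry$ (the quasi-derivative) and $\ell(y):=-\bigl(y^{[1]}\bigr)'-r y^{[1]}-r^2y$ on $\operatorname{dom}\ell=\{y\in AC[0,1]\mid y^{[1]}\in AC[0,1],\ \ell(y)\in L_2(0,1)\}$ (so $\ell(y)=-y''+qy$ in the sense of distributions). The operator $A$ in $L_2(0,1)$ is $Ay=\ell(y)$ on $\operatorname{dom}A=\{y\in\operatorname{dom}\ell\mid y(0)=y(1)=0\}$; it is self-adjoint, bounded below, with simple discrete spectrum. $A$ positive means $(Ay,y)>0$ for all nonzero $y\in\operatorname{dom}A$. $B$ is the operator of multiplication by $p$ in $L_2(0,1)$, and the quadratic operator pencil is $T_{p,q}(\lambda):=\lambda^2I-2\lambda B-A$, $\lambda\in\mathbb{C}$, on the $\lambda$-independent domain $\operatorname{dom}A$. Its spectrum is $\sigma(T_{p,q})=\{\lambda\in\mathbb{C}\mid 0\in\sigma(T_{p,q}(\lambda))\}$. A number $\lambda$ is an eigenvalue if $T_{p,q}(\lambda)y=0$ for some nonzero $y\in\operatorname{dom}A$ (an eigenfunction). It is known that the spectrum consists of eigenvalues only, and that when $A$ is positive all eigenvalues are real, simple and nonzero. For an eigenvalue $\lambda$ of $T_{p,q}$ let $y_\lambda$ be the eigenfunction normalized by $y_\lambda(0)=0$, $y_\lambda^{[1]}(0)=\lambda$. The norming constant corresponding to $\lambda$ is $\alpha:=2\int_0^1y_\lambda^2(t)\,dt-\frac{2}{\lambda}\int_0^1p(t)y_\lambda^2(t)\,dt$.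 The spectral data $\mathbf{sd}(T_{p,q})$ is the set of all pairs $(\lambda,\alpha)$ with $\lambda\in\sigma(T_{p,q})$ and $\alpha$ the corresponding norming constant. *)

theory Defs
  imports "HOL-Analysis.Analysis"
begin

section \<open>The Hilbert space of square integrable functions on the unit interval\<close>

text \<open>Elements of the Hilbert space are represented by functions; equality of elements is equality
  almost everywhere on the open unit interval.\<close>

abbreviation unit_leb :: "real measure" where
  "unit_leb \<equiv> lebesgue_on {0<..<1}"

definition L2 :: "(real \<Rightarrow> 'a::real_normed_vector) \<Rightarrow> bool" where
  "L2 f \<longleftrightarrow> f \<in> borel_measurable unit_leb \<and> integrable unit_leb (\<lambda>t. (norm (f t))\<^sup>2)"

definition L2_norm :: "(real \<Rightarrow> complex) \<Rightarrow> real" where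
  "L2_norm f = sqrt (LINT t|unit_leb. (norm (f t))\<^sup>2)"

definition L2_inner :: "(real \<Rightarrow> complex) \<Rightarrow> (real \<Rightarrow> complex) \<Rightarrow> complex" where
  "L2_inner f g = (LINT t|unit_leb. f t * cnj (g t))"

definition L2_eq :: "(real \<Rightarrow> complex) \<Rightarrow> (real \<Rightarrow> complex) \<Rightarrow> bool" where
  "L2_eq f g \<longleftrightarrow> (AE t in unit_leb. f t = g t)"

text \<open>Spectrum of an operator S with domain D (a set of representatives): z is in the resolvent set
  iff S - z is a bijection from D onto the whole space (modulo almost everywhere equality) with
  bounded inverse.\<close>

definition resolvent_set ::
    "(real \<Rightarrow> complex) set \<Rightarrow> ((real \<Rightarrow> complex) \<Rightarrow> (real \<Rightarrow> complex)) \<Rightarrow> complex set" where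
  "resolvent_set D S = {z.
     (\<forall>y\<in>D. L2_eq (\<lambda>t. S y t - z * y t) (\<lambda>t. 0) \<longrightarrow> L2_eq y (\<lambda>t. 0)) \<and>
     (\<forall>f. L2 f \<longrightarrow> (\<exists>y\<in>D. L2_eq (\<lambda>t. S y t - z * y t) f)) \<and>
     (\<exists>C. \<forall>y\<in>D. L2_norm y \<le> C * L2_norm (\<lambda>t. S y t - z * y t))}"

definition op_spectrum ::
    "(real \<Rightarrow> complex) set \<Rightarrow> ((real \<Rightarrow> complex) \<Rightarrow> (real \<Rightarrow> complex)) \<Rightarrow> complex set" where
  "op_spectrum D S = - resolvent_set D S"

section \<open>Distributional derivatives\<close>

definition test_function :: "(real \<Rightarrow> real) \<Rightarrow> bool" where
  "test_function \<phi> \<longleftrightarrow>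
     (\<forall>n t. (deriv ^^ n) \<phi> differentiable at t) \<and>
     (\<exists>a b. 0 < a \<and> b < 1 \<and> (\<forall>t. t \<notin> {a..b} \<longrightarrow> \<phi> t = 0))"

text \<open>A real-valued distribution on the unit interval is a functional on test functions (its values
  elsewhere are irrelevant).  Those in the Sobolev space of order -1 are the distributional
  derivatives q = r' of real square integrable r.\<close>

definition is_L2_primitive :: "(real \<Rightarrow> real) \<Rightarrow> ((real \<Rightarrow> real) \<Rightarrow> real) \<Rightarrow> bool" where
  "is_L2_primitive r q \<longleftrightarrow>
     L2 r \<and> (\<forall>\<phi>. test_function \<phi> \<longrightarrow> q \<phi> = - (LINT t|unit_leb. r t * deriv \<phi> t))"

section \<open>The Sturm-Liouville operator\<close>

definition abs_cont :: "(real \<Rightarrow> complex) \<Rightarrow> bool" where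
  "abs_cont y \<longleftrightarrow> (\<forall>\<epsilon>>0. \<exists>\<delta>>0. \<forall>D :: (real \<times> real) set.
     finite D \<longrightarrow> (\<forall>(a, b)\<in>D. 0 \<le> a \<and> a < b \<and> b \<le> 1) \<longrightarrow>
     disjoint_family_on (\<lambda>(a, b). {a<..<b}) D \<longrightarrow>
     (\<Sum>(a, b)\<in>D. b - a) < \<delta> \<longrightarrow> (\<Sum>(a, b)\<in>D. norm (y b - y a)) < \<epsilon>)"

text \<open>The expression y' - r y is only defined almost everywhere.  When it has an absolutely
  continuous representative u, that representative is unique on the closed unit interval, so its
  value at 0 makes sense; \<open>quasi_deriv\<close> selects it.  The potential q enters only through its
  primitive r; replacing r by r + c changes neither the domain of A, nor the action of A, nor the
  value of the quasi-derivative at a zero of y.\<close>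

definition is_quasi_deriv :: "(real \<Rightarrow> real) \<Rightarrow> (real \<Rightarrow> complex) \<Rightarrow> (real \<Rightarrow> complex) \<Rightarrow> bool" where
  "is_quasi_deriv r y u \<longleftrightarrow>
     abs_cont u \<and> L2_eq u (\<lambda>t. vector_derivative y (at t) - of_real (r t) * y t)"

definition quasi_deriv :: "(real \<Rightarrow> real) \<Rightarrow> (real \<Rightarrow> complex) \<Rightarrow> real \<Rightarrow> complex" where
  "quasi_deriv r y = (SOME u. is_quasi_deriv r y u)"

definition ell :: "(real \<Rightarrow> real) \<Rightarrow> (real \<Rightarrow> complex) \<Rightarrow> real \<Rightarrow> complex" where
  "ell r y t = - vector_derivative (quasi_deriv r y) (at t)
     - of_real (r t) * quasi_deriv r y t - (of_real (r t))\<^sup>2 * y t"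

definition dom_ell :: "(real \<Rightarrow> real) \<Rightarrow> (real \<Rightarrow> complex) set" where
  "dom_ell r = {y. abs_cont y \<and> (\<exists>u. is_quasi_deriv r y u) \<and> L2 (ell r y)}"

definition dom_A :: "(real \<Rightarrow> real) \<Rightarrow> (real \<Rightarrow> complex) set" where
  "dom_A r = {y \<in> dom_ell r. y 0 = 0 \<and> y 1 = 0}"

definition A_positive :: "(real \<Rightarrow> real) \<Rightarrow> bool" where
  "A_positive r \<longleftrightarrow> (\<forall>y\<in>dom_A r. \<not> L2_eq y (\<lambda>t. 0) \<longrightarrow>
     L2_inner (ell r y) y \<in> \<real> \<and> 0 < Re (L2_inner (ell r y) y))"

section \<open>The quadratic operator pencil and its spectral data\<close>

definition pencil ::
    "(real \<Rightarrow> real) \<Rightarrow> (real \<Rightarrow> real) \<Rightarrow> complex \<Rightarrow> (real \<Rightarrow> complex) \<Rightarrow> real \<Rightarrow> complex" where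
  "pencil p r \<zeta> y t = \<zeta>\<^sup>2 * y t - 2 * \<zeta> * (of_real (p t) * y t) - ell r y t"

definition pencil_spectrum :: "(real \<Rightarrow> real) \<Rightarrow> (real \<Rightarrow> real) \<Rightarrow> complex set" where
  "pencil_spectrum p r = {\<zeta>. 0 \<in> op_spectrum (dom_A r) (pencil p r \<zeta>)}"

definition pencil_eigenfunction ::
    "(real \<Rightarrow> real) \<Rightarrow> (real \<Rightarrow> real) \<Rightarrow> complex \<Rightarrow> (real \<Rightarrow> complex) \<Rightarrow> bool" where
  "pencil_eigenfunction p r \<zeta> y \<longleftrightarrow>
     y \<in> dom_A r \<and> \<not> L2_eq y (\<lambda>t. 0) \<and> L2_eq (pencil p r \<zeta> y) (\<lambda>t. 0)"

definition is_norming_constant ::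
    "(real \<Rightarrow> real) \<Rightarrow> (real \<Rightarrow> real) \<Rightarrow> complex \<Rightarrow> complex \<Rightarrow> bool" where
  "is_norming_constant p r \<zeta> \<alpha> \<longleftrightarrow> (\<exists>y.
     pencil_eigenfunction p r \<zeta> y \<and> y 0 = 0 \<and> quasi_deriv r y 0 = \<zeta> \<and>
     \<alpha> = 2 * (LINT t|unit_leb. (y t)\<^sup>2)
         - 2 / \<zeta> * (LINT t|unit_leb. of_real (p t) * (y t)\<^sup>2))"

definition spectral_data :: "(real \<Rightarrow> real) \<Rightarrow> (real \<Rightarrow> real) \<Rightarrow> (complex \<times> complex) set" where
  "spectral_data p r = {(\<zeta>, \<alpha>). \<zeta> \<in> pencil_spectrum p r \<and> is_norming_constant p r \<zeta> \<alpha>}"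

abbreviation Zstar :: "int set" where
  "Zstar \<equiv> UNIV - {0}"

definition l2_Zstar :: "(int \<Rightarrow> real) \<Rightarrow> bool" where
  "l2_Zstar a \<longleftrightarrow> (\<lambda>n. (a n)\<^sup>2) summable_on Zstar"

end

theory Submission
  imports Defs "HOL-Complex_Analysis.Great_Picard" "HOL-Computational_Algebra.Polynomial" "HOL-Real_Asymp.Real_Asymp"
begin

text \<open>Adding the pair \<open>(0, 1)\<close> to the data makes the index set \<open>\<int>\<close>. For each \<open>N\<close> put the masses
  \<open>1 / (m \<alpha>\<^sub>n)\<close>, \<open>\<bar>n\<bar> \<le> N\<close>, \<open>m = 2 N + 1\<close>, at the points \<open>exp (2 i \<lambda>\<^sub>n / m)\<close> of the unit circle. The data being
  square summable perturbations of \<open>\<pi> n + h\<close> and \<open>1\<close>, polynomials of degree below \<open>m\<close> are sampled stably at these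
  points, which bounds the Verblunsky coefficients: \<open>\<Sum> \<bar>c\<^sub>k\<bar>\<^sup>2 = O(1 / m)\<close>. After a gauge transformation the Szego
  recursion is a difference scheme of step \<open>1 / m\<close> for the Dirac type system
  \<open>y' = \<zeta> u + \<tau> y\<close>, \<open>u' = - \<zeta> y - \<tau> u + 2 p y\<close>, \<open>y(0) = 0\<close>, \<open>u(0) = 1\<close>, and the bound on the coefficients gives a
  limit along a subsequence with \<open>\<tau>, p \<in> L\<^sub>2\<close>. Elimination of \<open>u\<close> yields the pencil with \<open>q = \<tau>' + \<tau>\<^sup>2\<close>, for which
  \<open>A\<close> factorizes and is therefore positive. The node at \<open>1\<close> forces \<open>y(1) = 0\<close> at every \<open>\<lambda>\<^sub>n\<close>; the reciprocal
  Christoffel function at a node is \<open>m \<alpha>\<^sub>n\<close>, which becomes \<open>\<integral> y\<^sup>2 + u\<^sup>2 = \<alpha>\<^sub>n\<close> in the limit; and Parseval's identity for the Christoffel-Darboux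
  kernel excludes all further eigenvalues.\<close>

section \<open>Absolute continuity\<close>

text \<open>On the grid, a bound \<open>O(1 / m)\<close> for the sum of the squared coefficients is
  what square integrability of \<open>\<tau>\<close> and \<open>p\<close> amounts to: about
  \<open>m\<close> terms, each of order \<open>1 / m^2\<close> on average. The obstacle is that the
  frequencies are only square summably close to \<open>\<pi> n + h\<close>; finitely many may lie
  far off, where small perturbation estimates say nothing. These are moved one at a time, each move
  costing a factor independent of \<open>N\<close>. The extra pair at 0 is forced by the Dirac
  system: for \<open>\<zeta> = 0\<close> its solution has \<open>y = 0\<close> whatever
  \<open>\<tau>\<close> and \<open>p\<close> are. With \<open>v = \<zeta> u\<close> the system reads
  \<open>y' - \<tau> y = v\<close>, \<open>- (v' + \<tau> v) = \<zeta>^2 y - 2 \<zeta> p y\<close>,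
  which is the pencil, and \<open>u(0) = 1\<close> is the normalization of the quasi-derivative.
  Integrating \<open>(u y)'\<close> turns the norming constant into
  \<open>\<integral> y^2 + u^2\<close>. The coefficients converge only through their partial sums,
  so the limit is taken in integrated equations; uniqueness for the limit system lets one
  subsequence serve every spectral parameter.\<close>

lemma cover_up_to_negligible:
  assumes "negligible (E - U)" "U \<in> lmeasurable" "measure lebesgue U \<le> e"
  shows "\<exists>T. E \<subseteq> T \<and> T \<in> lmeasurable \<and> measure lebesgue T \<le> e"
proof (intro exI conjI)
  have n: "E - U \<in> null_sets lebesgue" using assms negligible_iff_null_sets by blast
  show "E \<subseteq> U \<union> (E - U)" by blast
  show "U \<union> (E - U) \<in> lmeasurable"
    using assms(2) negligible_imp_measurable[OF assms(1)] by (rule fmeasurable.Un)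
  show "measure lebesgue (U \<union> (E - U)) \<le> e"
    using assms(2,3) n measure_Un_null_set[of U lebesgue "E - U"] by (metis fmeasurableD)
qed

text \<open>Lebesgue differentiation by Vitali covering: the intervals between a bad point and its
  witnesses form a Vitali cover of the bad set, and a finite disjoint subfamily is a fine tagged
  partial division. Henstock's lemma bounds its total error by \<open>e * c\<close>, and each length
  is at most the error divided by \<open>c\<close>.\<close>

lemma integral_bad_points_negligible:
  fixes f :: "real \<Rightarrow> 'b::euclidean_space"
  assumes f: "f integrable_on {a..b}" and c: "c > 0"
  shows "negligible {x \<in> {a<..<b}. \<forall>d>0. \<exists>y\<in>{a..b}. y \<noteq> x \<and> \<bar>y - x\<bar> < d \<and>
    norm (integral {a..y} f - integral {a..x} f - (y - x) *\<^sub>R f x) \<ge> c * \<bar>y - x\<bar>}"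
    (is "negligible ?E")
  unfolding negligible_outer_le
proof (intro allI impI)
  fix e :: real assume e: "e > 0"
  define B where "B = (\<lambda>(x, y). norm (integral {a..y} f - integral {a..x} f - (y - x) *\<^sub>R f x)
    \<ge> c * \<bar>y - x\<bar>)"
  have fc: "f integrable_on cbox a b" using f by simp
  have "e * c > 0" using e c by simp
  from Henstock_lemma[OF fc this] obtain \<gamma> where g: "gauge \<gamma>"
    and gf: "\<And>p. \<lbrakk>p tagged_partial_division_of (cbox a b); \<gamma> fine p\<rbrakk> \<Longrightarrow>
             sum (\<lambda>(x,k). norm(measure lborel k *\<^sub>R f x - integral k f)) p < e * c" by blast
  \<comment> \<open>A pair stores the tag \<open>x\<close>, one end point of its interval, and the
    witness \<open>y\<close>, the other one; \<open>ce\<close> and \<open>rr\<close> present the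
    interval as a ball for the covering theorem.\<close>
  define K where "K = {(x, y). x \<in> ?E \<and> y \<in> {a..b} \<and> y \<noteq> x \<and> {min x y..max x y} \<subseteq> \<gamma> x \<and> B (x, y)}"
  define ce rr :: "real \<times> real \<Rightarrow> real" where "ce = (\<lambda>(x, y). (x + y) / 2)" and "rr = (\<lambda>(x, y). \<bar>y - x\<bar> / 2)"
  have cb: "cball (ce q) (rr q) = {min (fst q) (snd q)..max (fst q) (snd q)}" for q
    by (cases q) (auto simp: ce_def rr_def cball_eq_atLeastAtMost min_def max_def field_simps abs_if)
  have 1: "0 < rr q" if "q \<in> K" for q using that by (auto simp: K_def rr_def)
  have 2: "\<exists>q. q \<in> K \<and> x \<in> cball (ce q) (rr q) \<and> rr q < d" if x: "x \<in> ?E" and d: "0 < d" for x d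
  proof -
    from g obtain s where s: "s > 0" "ball x s \<subseteq> \<gamma> x"
      by (meson gauge_def openE)
    have "0 < min s d" using s d by simp
    then obtain y where y: "y \<in> {a..b}" "y \<noteq> x" "\<bar>y - x\<bar> < min s d" 
      "norm (integral {a..y} f - integral {a..x} f - (y - x) *\<^sub>R f x) \<ge> c * \<bar>y - x\<bar>" using x by blast
    have "{min x y..max x y} \<subseteq> ball x s" using y(3)
      by (auto simp: dist_real_def min_def max_def abs_if split: if_splits)
    then have "(x, y) \<in> K" using s x y by (auto simp: K_def B_def)
    moreover have "x \<in> cball (ce (x,y)) (rr (x,y))" by (simp add: cb)
    moreover have "rr (x,y) < d" using y by (auto simp: rr_def)
    ultimately show ?thesis by blast
  qed
  obtain C where C: "countable C" "C \<subseteq> K"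
     and dj: "pairwise (\<lambda>i j. disjnt (cball (ce i) (rr i)) (cball (ce j) (rr j))) C"
     and ng: "negligible (?E - (\<Union>i \<in> C. cball (ce i) (rr i)))"
    by (rule Vitali_covering_theorem_cballs[of K rr ?E ce, OF 1 2])
  let ?U = "\<Union>i \<in> C. cball (ce i) (rr i)"
  have bd: "measure lebesgue (\<Union>i\<in>D. cball (ce i) (rr i)) \<le> e" if D: "D \<subseteq> C" "finite D" for D
  proof -
    define h where "h = (\<lambda>q. (fst q, cball (ce q) (rr q)))"
    have inj: "inj_on h D"
    proof
      fix p q assume pq: "p \<in> D" "q \<in> D" "h p = h q"
      show "p = q"
      proof (rule ccontr)
        assume "p \<noteq> q"
        then have "disjnt (cball (ce p) (rr p)) (cball (ce q) (rr q))"
          using dj pq D by (auto simp: pairwise_def)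
        then show False using pq 1[of p] C D by (auto simp: h_def disjnt_def)
      qed
    qed
    have KD: "D \<subseteq> K" using D C by auto
    have tp: "h ` D tagged_partial_division_of cbox a b"
      unfolding tagged_partial_division_of_def
    proof (intro conjI allI impI)
      show "finite (h ` D)" using D by simp
    next
      fix x k assume "(x, k) \<in> h ` D"
      then obtain q where q: "q \<in> D" "x = fst q" "k = {min (fst q) (snd q)..max (fst q) (snd q)}" 
        by (auto simp: h_def cb)
      then have "q \<in> K" using KD by auto
      then show "x \<in> k" "k \<subseteq> cbox a b" "\<exists>a b. k = cbox a b" using q by (auto simp: K_def)
    next
      fix x1 k1 x2 k2 assume A: "(x1, k1) \<in> h ` D \<and> (x2, k2) \<in> h ` D \<and> (x1, k1) \<noteq> (x2, k2)"
      then obtain q1 q2 where q: "q1 \<in> D" "q2 \<in> D" "(x1,k1) = h q1" "(x2,k2) = h q2" by auto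
      then have "q1 \<noteq> q2" using A by auto
      then have "disjnt k1 k2" using dj q D by (auto simp: pairwise_def h_def)
      then show "interior k1 \<inter> interior k2 = {}" using interior_subset by (fastforce simp: disjnt_def)
    qed
    have fi: "\<gamma> fine (h ` D)" unfolding fine_def
    proof (rule ballI, unfold split_beta)
      fix xk assume "xk \<in> h ` D"
      then obtain q where q: "q \<in> D" "fst xk = fst q" "snd xk = {min (fst q) (snd q)..max (fst q) (snd q)}"
        by (auto simp: h_def cb)
      have "q \<in> K" using KD q by blast
      then have "{min (fst q) (snd q)..max (fst q) (snd q)} \<subseteq> \<gamma> (fst q)"
        by (cases q) (simp add: K_def)
      then show "snd xk \<subseteq> \<gamma> (fst xk)" using q by simp
    qed
    have ineq: "c * measure lebesgue (cball (ce q) (rr q)) \<le> 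
      norm (measure lborel (cball (ce q) (rr q)) *\<^sub>R f (fst q) - integral (cball (ce q) (rr q)) f)" if q: "q \<in> D" for q
    proof -
      obtain x y where xy: "q = (x, y)" by (cases q)
      then have k: "x \<in> {a<..<b}" "y \<in> {a..b}" "y \<noteq> x" "B (x,y)" using KD q by (auto simp: K_def)
      show ?thesis
      proof (cases "x < y")
        case True
        have "integral {a..x} f + integral {x..y} f = integral {a..y} f"
          using True k f by (intro Henstock_Kurzweil_Integration.integral_combine) (auto intro: integrable_on_subinterval)
        then have e1: "integral {x..y} f = integral {a..y} f - integral {a..x} f" by (simp add: algebra_simps)
        have "norm ((y-x) *\<^sub>R f x - integral {x..y} f) = norm (integral {a..y} f - integral {a..x} f - (y - x) *\<^sub>R f x)"
          unfolding e1 by (simp add: norm_minus_commute)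
        then show ?thesis using k True unfolding cb xy by (simp add: B_def)
      next
        case False
        then have F: "y < x" using k by simp
        have "integral {a..y} f + integral {y..x} f = integral {a..x} f"
          using F k f by (intro Henstock_Kurzweil_Integration.integral_combine) (auto intro: integrable_on_subinterval)
        then have e1: "integral {y..x} f = integral {a..x} f - integral {a..y} f" by (simp add: algebra_simps)
        have "norm ((x-y) *\<^sub>R f x - integral {y..x} f) = norm (integral {a..y} f - integral {a..x} f - (y - x) *\<^sub>R f x)"
          unfolding e1 by (simp add: algebra_simps)
        then show ?thesis using k F unfolding cb xy by (simp add: B_def)
      qed
    qed
    have "measure lebesgue (\<Union>i\<in>D. cball (ce i) (rr i)) \<le> (\<Sum>i\<in>D. measure lebesgue (cball (ce i) (rr i)))"
      using D by (intro measure_UNION_le) auto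
    also have "\<dots> \<le> (\<Sum>q\<in>D. norm (measure lborel (cball (ce q) (rr q)) *\<^sub>R f (fst q) - integral (cball (ce q) (rr q)) f)) / c"
      using c unfolding sum_divide_distrib by (intro sum_mono) (use ineq in \<open>auto simp: field_simps\<close>)
    also have "\<dots> = sum (\<lambda>(x,k). norm(measure lborel k *\<^sub>R f x - integral k f)) (h ` D) / c"
      by (subst sum.reindex[OF inj]) (simp add: h_def)
    also have "\<dots> \<le> e" using gf[OF tp fi] c by (simp add: field_simps)
    finally show ?thesis .
  qed
  \<comment> \<open>Henstock's lemma controls only finite subfamilies; the bound \<open>e\<close>
    passes to the countable union because it is the same for all of them.\<close>
  have U: "?U \<in> lmeasurable" "measure lebesgue ?U \<le> e"
  proof -
    have *: "measure lebesgue (\<Union>\<E>) \<le> e" if E: "\<E> \<subseteq> (\<lambda>i. cball (ce i) (rr i)) ` C" "finite \<E>" for \<E>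
    proof -
      obtain D where "D \<subseteq> C" "finite D" "\<E> = (\<lambda>i. cball (ce i) (rr i)) ` D"
        using finite_subset_image[OF E(2,1)] by blast
      then show ?thesis using bd[of D] by simp
    qed
    show "?U \<in> lmeasurable"
      by (rule fmeasurable_Union_bound[OF _ _ *]) (use C(1) in auto)
    show "measure lebesgue ?U \<le> e"
      by (rule measure_Union_bound[OF _ _ *]) (use C(1) in auto)
  qed
  show "\<exists>T. ?E \<subseteq> T \<and> T \<in> lmeasurable \<and> measure lebesgue T \<le> e"
    by (rule cover_up_to_negligible[OF ng U])
qed

text \<open>Differentiability holds off the union of the bad sets for \<open>c = 1 / Suc n\<close>,
  which is a countable union of negligible sets.\<close>

lemma integral_has_vector_derivative_AE:
  fixes f :: "real \<Rightarrow> 'b::euclidean_space"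
  assumes f: "f integrable_on {a..b}"
  shows "AE x in lebesgue_on {a<..<b}. ((\<lambda>t. integral {a..t} f) has_vector_derivative f x) (at x)"
proof -
  define E where "E c = {x \<in> {a<..<b}. \<forall>d>0. \<exists>y\<in>{a..b}. y \<noteq> x \<and> \<bar>y - x\<bar> < d \<and>
    norm (integral {a..y} f - integral {a..x} f - (y - x) *\<^sub>R f x) \<ge> c * \<bar>y - x\<bar>}" for c :: real
  have "negligible (E (1 / real (Suc n)))" for n
    unfolding E_def by (rule integral_bad_points_negligible[OF f]) simp
  then have "negligible (\<Union>n. E (1 / real (Suc n)))"
    by (intro negligible_countable_Union) auto
  moreover have "((\<lambda>t. integral {a..t} f) has_vector_derivative f x) (at x)"
    if x: "x \<in> {a<..<b}" "x \<notin> (\<Union>n. E (1 / real (Suc n)))" for x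
    unfolding has_vector_derivative_def has_derivative_at_alt
  proof (intro conjI allI impI bounded_linear_scaleR_left)
    fix e :: real assume "e > 0"
    then obtain n where n: "1 / real (Suc n) < e" using nat_approx_posE by blast
    have "x \<notin> E (1 / real (Suc n))" using x by blast
    then obtain d where d: "d > 0" "\<And>y. y \<in> {a..b} \<Longrightarrow> y \<noteq> x \<Longrightarrow> \<bar>y - x\<bar> < d \<Longrightarrow> 
      norm (integral {a..y} f - integral {a..x} f - (y - x) *\<^sub>R f x) < 1 / real (Suc n) * \<bar>y - x\<bar>"
      unfolding E_def using x(1) by (force simp: not_le)
    define d' where "d' = min d (min (x - a) (b - x))"
    show "\<exists>d>0. \<forall>y. norm (y - x) < d \<longrightarrow> norm (integral {a..y} f - integral {a..x} f - (y - x) *\<^sub>R f x) \<le> e * norm (y - x)"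
    proof (intro exI[of _ d'] conjI allI impI)
      show "d' > 0" using d x by (auto simp: d'_def)
      fix y assume y: "norm (y - x) < d'"
      show "norm (integral {a..y} f - integral {a..x} f - (y - x) *\<^sub>R f x) \<le> e * norm (y - x)"
      proof (cases "y = x")
        case False
        have "norm (integral {a..y} f - integral {a..x} f - (y - x) *\<^sub>R f x) < 1 / real (Suc n) * \<bar>y - x\<bar>"
          using y False by (intro d) (auto simp: d'_def)
        also have "\<dots> \<le> e * \<bar>y - x\<bar>" using n by (intro mult_right_mono) auto
        finally show ?thesis by simp
      qed auto
    qed
  qed
  ultimately show ?thesis
    by (subst AE_restrict_space_iff) 
       (auto simp: negligible_iff_null_sets intro!: AE_I'[of "\<Union>n. E (1 / real (Suc n))"])
qed

text \<open>Absolute continuity tested only on families of dyadic cells of a single level. This is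
  easy to check for a variation function built from dyadic grids, and still strong enough for the
  Radon-Nikodym theorem.\<close>

definition dyadic_ac :: "(real \<Rightarrow> real) \<Rightarrow> bool" where
  "dyadic_ac W \<longleftrightarrow> (\<forall>\<epsilon>>0. \<exists>\<delta>>0. \<forall>n S. S \<subseteq> {..<2^n} \<longrightarrow> real (card S) / 2^n < \<delta> \<longrightarrow>
     (\<Sum>k\<in>S. W (real (Suc k) / 2^n) - W (real k / 2^n)) \<le> \<epsilon>)"

text \<open>An interval inside the unit interval shorter than \<open>1 / 2^n\<close> meets at most
  two adjacent cells of level \<open>n\<close>, whose total length \<open>2 / 2^n\<close> is below
  \<open>\<delta>\<close>; other points are clamped, as \<open>W\<close> is constant
  outside.\<close>

lemma dyadic_ac_continuous:
  assumes mono: "mono W" and lo: "\<And>x. x \<le> 0 \<Longrightarrow> W x = W 0" and hi: "\<And>x. x \<ge> 1 \<Longrightarrow> W x = W 1"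
    and ac: "dyadic_ac W"
  shows "isCont W a"
proof -
  have key: "\<exists>d>0. \<forall>x y. x \<le> y \<and> y - x < d \<longrightarrow> W y - W x \<le> e" if e: "e > 0" for e
  proof -
    obtain \<delta> where d: "\<delta> > 0" "\<And>n S. S \<subseteq> {..<2^n} \<Longrightarrow> real (card S) / 2^n < \<delta> \<Longrightarrow>
     (\<Sum>k\<in>S. W (real (Suc k) / 2^n) - W (real k / 2^n)) \<le> e"
      using ac e unfolding dyadic_ac_def by meson
    obtain n where n: "(1/2::real)^n < \<delta> / 2" using real_arch_pow_inv[of "\<delta>/2" "1/2"] d by auto
    have n2: "2 / 2^n < \<delta>" using n by (simp add: power_one_over field_simps)
    show ?thesis
    proof (intro exI[of _ "1/2^n"] conjI allI impI)
      show "0 < 1 / (2::real)^n" by simp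
      fix x y :: real assume xy: "x \<le> y \<and> y - x < 1/2^n"
      define x' y' where "x' = max 0 (min 1 x)" and "y' = max 0 (min 1 y)"
      have W: "W x = W x'" "W y = W y'" using lo[of x] hi[of x] lo[of y] hi[of y] by (auto simp: x'_def y'_def max_def min_def)
      have "0 \<le> x'" "x' \<le> y'" "y' \<le> 1" "y' - x' \<le> y - x" using xy by (auto simp: x'_def y'_def max_def min_def)
      then have b: "0 \<le> x'" "x' \<le> y'" "y' \<le> 1" "y' - x' < 1/2^n" using xy by auto
      show "W y - W x \<le> e"
      proof (cases "x' = 1")
        case True
        then show ?thesis using W b e by auto
      next
        case False
        then have x1: "x' < 1" using b by auto
        define k where "k = nat \<lfloor>2^n * x'\<rfloor>"
        have k: "real k \<le> 2^n * x'" "2^n * x' < real k + 1" using b by (auto simp: k_def)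
        have "real k < 2^n"
        proof -
          have "2^n * x' < (2::real)^n * 1" using x1 by (intro mult_strict_left_mono) auto
          then show ?thesis using k by linarith
        qed
        then have k2: "k < 2^n" by (metis of_nat_less_iff of_nat_numeral of_nat_power)
        have kx: "real k / 2^n \<le> x'" using k by (simp add: field_simps)
        have "y' * 2^n < real k + 2" using b k by (simp add: field_simps)
        then have ky: "y' \<le> real (Suc (Suc k)) / 2^n" by (simp add: field_simps)
        show ?thesis
        proof (cases "Suc k < 2^n")
          case True
          have "(\<Sum>j\<in>{k, Suc k}. W (real (Suc j) / 2^n) - W (real j / 2^n)) \<le> e"
            using True k2 n2 by (intro d) auto
          then have "W (real (Suc (Suc k)) / 2^n) - W (real k / 2^n) \<le> e" by simp
          moreover have "W y' \<le> W (real (Suc (Suc k)) / 2^n)" "W (real k / 2^n) \<le> W x'"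
            using kx ky mono by (auto simp: mono_def)
          ultimately show ?thesis using W by linarith
        next
          \<comment> \<open>The cell is the last one, with right end point 1, so it suffices
            alone.\<close>
          case False
          then have "Suc k = 2^n" using k2 by simp
          then have kk: "real (Suc k) / 2^n = 1" by (metis divide_self of_nat_numeral of_nat_power power_not_zero zero_neq_numeral)
          have "1 / 2^n < \<delta>" using n2 by (smt (verit) divide_right_mono zero_le_power)
          then have "(\<Sum>j\<in>{k}. W (real (Suc j) / 2^n) - W (real j / 2^n)) \<le> e"
            using k2 by (intro d) auto
          then have "W 1 - W (real k / 2^n) \<le> e" using kk by simp
          moreover have "W y' \<le> W 1" "W (real k / 2^n) \<le> W x'"
            using kx b mono by (auto simp: mono_def)
          ultimately show ?thesis using W by linarith
        qed
      qed
    qed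
  qed
  show ?thesis unfolding continuous_at_eps_delta
  proof (intro allI impI)
    fix e :: real assume "e > 0"
    then obtain d where d: "d > 0" "\<And>x y. x \<le> y \<and> y - x < d \<Longrightarrow> W y - W x \<le> e / 2" using key[of "e/2"] by auto
    show "\<exists>d>0. \<forall>x'. dist x' a < d \<longrightarrow> dist (W x') (W a) < e"
    proof (intro exI[of _ d] conjI allI impI d)
      fix x assume x: "dist x a < d"
      show "dist (W x) (W a) < e"
      proof (cases "x \<le> a")
        case True
        then have "W a - W x \<le> e / 2" "W x \<le> W a" using x d(2)[of x a] monoD[OF mono, of x a] by (auto simp: dist_real_def)
        then show ?thesis using \<open>e > 0\<close> by (simp add: dist_real_def)
      next
        case False
        then have "W x - W a \<le> e / 2" "W a \<le> W x" using x d(2)[of a x] monoD[OF mono, of a x] by (auto simp: dist_real_def)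
        then show ?thesis using \<open>e > 0\<close> by (simp add: dist_real_def)
      qed
    qed
  qed
qed

text \<open>Radon-Nikodym is applied to the Stieltjes measure of a monotone function; dyadic covers suffice to see that
  the measure is absolutely continuous.\<close>

lemma dyadic_ac_null_set:
  assumes mono: "mono W" and cont: "\<And>a. isCont W a" and ac: "dyadic_ac W"
    and A: "A \<in> sets borel" "emeasure lborel A = 0" "A \<subseteq> {0<..1}"
  shows "emeasure (interval_measure W) A = 0"
proof -
  let ?M = "interval_measure W"
  have rc: "continuous (at_right a) W" for a using cont by (simp add: continuous_at_imp_continuous_at_within)
  have mo: "x \<le> y \<Longrightarrow> W x \<le> W y" for x y using mono by (simp add: mono_def)
  note em = emeasure_interval_measure_Ioc[OF _ mo rc]
  have *: "emeasure ?M A \<le> ennreal e" if e: "e > 0" for e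
  proof -
    obtain \<delta> where d: "\<delta> > 0" "\<And>n S. S \<subseteq> {..<2^n} \<Longrightarrow> real (card S) / 2^n < \<delta> \<Longrightarrow>
     (\<Sum>k\<in>S. W (real (Suc k) / 2^n) - W (real k / 2^n)) \<le> e"
      using ac e unfolding dyadic_ac_def by meson
    obtain U where U: "open U" "A \<subseteq> U" "emeasure lborel (U - A) < \<delta>"
      using outer_regular_lborel[OF A(1) d(1)] by blast
    have "emeasure lborel U = emeasure lborel (U - A) + emeasure lborel A"
      using U A by (metis Diff_partition add.commute emeasure_Un_null_set null_setsI plus_emeasure sets.Diff sets_lborel borel_open Diff_disjoint inf_commute Un_commute)
    then have Ud: "emeasure lborel U < \<delta>" using U A by simp
    \<comment> \<open>Left-open cells match the half-open intervals on which the Stieltjes measure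
      is an increment of \<open>W\<close>.\<close>
    define cl where "cl n k = {real k / 2^n<..real (Suc k) / 2^n}" for n k :: nat
    define S where "S n = {k. k < 2^n \<and> cl n k \<subseteq> U}" for n :: nat
    have fS: "finite (S n)" for n by (auto simp: S_def)
    have in_cl: "x \<in> cl n k \<longleftrightarrow> real k < x * 2^n \<and> x * 2^n \<le> real (Suc k)" for x n k 
      by (auto simp: cl_def field_simps)
    have clb: "cl n k \<in> sets borel" for n k by (simp add: cl_def)
    have dj: "disjoint_family_on (cl n) (S n)" for n
    proof (unfold disjoint_family_on_def, intro ballI impI)
      fix k l :: nat assume "k \<noteq> l"
      then show "cl n k \<inter> cl n l = {}" by (auto simp: in_cl)
    qed
    \<comment> \<open>The cells of level \<open>n\<close> inside the open set \<open>U\<close>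
      increase with \<open>n\<close> and cover \<open>A\<close> in the limit, so the measure of
      \<open>A\<close> is bounded by a limit of finite sums to which \<open>dyadic_ac\<close>
      applies.\<close>
    define V where "V n = (\<Union>k\<in>S n. cl n k)" for n
    have Vb: "V n \<in> sets borel" for n unfolding V_def using fS clb by (intro sets.finite_UN) auto
    have VU: "V n \<subseteq> U" for n by (auto simp: V_def S_def)
    have inc: "incseq V"
    proof (rule incseq_SucI)
      fix n show "V n \<subseteq> V (Suc n)"
      proof
        fix x assume "x \<in> V n"
        then obtain k where k: "k < 2^n" "cl n k \<subseteq> U" "x \<in> cl n k" by (auto simp: V_def S_def)
        define l where "l = (if x * 2^Suc n \<le> real (2*k+1) then 2*k else 2*k+1)"
        have "x \<in> cl (Suc n) l" using k by (auto simp: in_cl l_def)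
        moreover have "cl (Suc n) l \<subseteq> cl n k" by (auto simp: in_cl l_def split: if_splits)
        moreover have "l < 2^Suc n" using k by (auto simp: l_def)
        ultimately show "x \<in> V (Suc n)" using k by (auto simp: V_def S_def)
      qed
    qed
    have lV: "emeasure lborel (V n) = ennreal (real (card (S n)) / 2^n)" for n
    proof -
      have "emeasure lborel (V n) = (\<Sum>k\<in>S n. emeasure lborel (cl n k))"
        unfolding V_def using fS dj by (intro sum_emeasure[symmetric]) (auto simp: clb)
      also have "\<dots> = (\<Sum>k\<in>S n. ennreal (1 / 2^n))"
        by (intro sum.cong refl) (auto simp: cl_def field_simps divide_right_mono)
      also have "\<dots> = ennreal (real (card (S n)) / 2^n)" 
        by (simp add: ennreal_of_nat_eq_real_of_nat ennreal_mult[symmetric])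
      finally show ?thesis .
    qed
    have MV: "emeasure ?M (V n) \<le> ennreal e" for n
    proof -
      have "emeasure lborel (V n) < \<delta>" 
        using le_less_trans[OF emeasure_mono[OF VU[of n], of lborel] Ud] U(1) by simp
      then have c: "real (card (S n)) / 2^n < \<delta>" using d(1) by (simp add: lV ennreal_less_iff)
      have "emeasure ?M (V n) = (\<Sum>k\<in>S n. emeasure ?M (cl n k))"
        unfolding V_def using fS dj by (intro sum_emeasure[symmetric]) (auto simp: clb)
      also have "\<dots> = (\<Sum>k\<in>S n. ennreal (W (real (Suc k) / 2^n) - W (real k / 2^n)))"
        unfolding cl_def by (intro sum.cong refl em) (auto simp: divide_right_mono)
      also have "\<dots> = ennreal (\<Sum>k\<in>S n. W (real (Suc k) / 2^n) - W (real k / 2^n))"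
        by (intro sum_ennreal) (auto intro!: mo divide_right_mono)
      also have "\<dots> \<le> ennreal e" using d(2)[of "S n" n] c by (intro ennreal_leI) (auto simp: S_def)
      finally show ?thesis .
    qed
    have AV: "A \<subseteq> (\<Union>n. V n)"
    proof
      fix x assume x: "x \<in> A"
      then have xU: "x \<in> U" "0 < x" "x \<le> 1" using U A by auto
      obtain s where s: "s > 0" "ball x s \<subseteq> U" using U xU by (meson openE)
      obtain n where n: "(1/2::real)^n < s" using real_arch_pow_inv[of s "1/2"] s by auto
      define k where "k = nat (\<lceil>x * 2^n\<rceil> - 1)"
      have ck: "\<lceil>x * 2^n\<rceil> \<ge> 1" using xU by simp
      have "real k = of_int (\<lceil>x * 2^n\<rceil> - 1)" using ck unfolding k_def by simp
      then have k: "real k < x * 2^n" "x * 2^n \<le> real (Suc k)" using ceiling_correct[of "x*2^n"] by auto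
      have "x * 2^n \<le> 2^n" using xU by simp
      then have "real k < 2^n" using k by linarith
      then have k2: "k < 2^n" by (metis of_nat_less_iff of_nat_numeral of_nat_power)
      have "cl n k \<subseteq> ball x s"
      proof
        fix y assume "y \<in> cl n k"
        then have "\<bar>x * 2^n - y * 2^n\<bar> < 1" using k by (auto simp: in_cl)
        then have "\<bar>x - y\<bar> * 2^n < 1" by (simp add: abs_mult flip: left_diff_distrib)
        then have "\<bar>x - y\<bar> < (1/2)^n" by (simp add: field_simps)
        then show "y \<in> ball x s" using n by (simp add: dist_real_def)
      qed
      then have "x \<in> V n" using s k k2 by (auto simp: V_def S_def in_cl)
      then show "x \<in> (\<Union>n. V n)" by blast
    qed
    have "emeasure ?M A \<le> emeasure ?M (\<Union>n. V n)" by (rule emeasure_mono[OF AV]) (use Vb in simp)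
    also have "\<dots> = (SUP n. emeasure ?M (V n))" using Vb inc by (intro SUP_emeasure_incseq[symmetric]) auto
    also have "\<dots> \<le> ennreal e" using MV by (intro SUP_least) auto
    finally show ?thesis .
  qed
  have "emeasure ?M A \<le> 0"
    by (rule ennreal_le_epsilon) (simp add: *)
  then show ?thesis by simp
qed

lemma dyadic_ac_density:
  assumes mono: "mono W" and lo: "\<And>x. x \<le> 0 \<Longrightarrow> W x = W 0" and hi: "\<And>x. x \<ge> 1 \<Longrightarrow> W x = W 1"
    and ac: "dyadic_ac W"
  obtains g :: "real \<Rightarrow> real" where "\<And>x. x \<in> {0..1} \<Longrightarrow> (g has_integral (W x - W 0)) {0..x}"
    "\<And>x. g x \<ge> 0"
proof -
  let ?M = "interval_measure W"
  have cont: "isCont W a" for a by (rule dyadic_ac_continuous[OF assms])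
  have rc: "continuous (at_right a) W" for a using cont by (simp add: continuous_at_imp_continuous_at_within)
  have mo: "x \<le> y \<Longrightarrow> W x \<le> W y" for x y using mono by (simp add: mono_def)
  note em = emeasure_interval_measure_Ioc[OF _ mo rc]
  \<comment> \<open>The cut-off to \<open>{0<..1}\<close> confines null sets to the range on which
    \<open>dyadic_ac_null_set\<close> speaks.\<close>
  define M' where "M' = density ?M (indicator {0<..1})"
  have eM': "emeasure M' A = emeasure ?M (A \<inter> {0<..1})" if "A \<in> sets borel" for A
    unfolding M'_def using that by (subst emeasure_density) (auto simp: nn_integral_indicator[symmetric] indicator_inter_arith mult.commute intro!: nn_integral_cong)
  have "absolutely_continuous lborel M'" unfolding absolutely_continuous_def
  proof
    fix A :: "real set" assume "A \<in> null_sets lborel"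
    then have A: "A \<in> sets borel" "emeasure lborel A = 0" by auto
    have "emeasure lborel (A \<inter> {0<..1}) = 0"
      using emeasure_mono[of "A \<inter> {0<..1}" A lborel] A by simp
    then have "emeasure M' A = 0" unfolding eM'[OF A(1)] using A
      by (intro dyadic_ac_null_set mono cont ac) auto
    then show "A \<in> null_sets M'" using A by (auto simp: M'_def)
  qed
  moreover have "sets M' = sets lborel" by (simp add: M'_def)
  ultimately obtain f where f: "f \<in> borel_measurable lborel" "density lborel f = M'"
    using sigma_finite_measure.Radon_Nikodym[OF sigma_finite_lborel] by blast
  have fi: "(\<integral>\<^sup>+t. f t * indicator {0<..x} t \<partial>lborel) = ennreal (W x - W 0)" if x: "x \<in> {0..1}" for x
  proof -
    have "(\<integral>\<^sup>+t. f t * indicator {0<..x} t \<partial>lborel) = emeasure M' {0<..x}"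
      unfolding f(2)[symmetric] using f by (subst emeasure_density) auto
    also have "\<dots> = emeasure ?M {0<..x}" using x by (subst eM') (auto intro: arg_cong[where f="emeasure ?M"])
    also have "\<dots> = ennreal (W x - W 0)" using x by (intro em) auto
    finally show ?thesis .
  qed
  \<comment> \<open>\<open>enn2real\<close> sends the value infinity, taken only on a null set, to
    0; this keeps \<open>g\<close> real and nonnegative everywhere.\<close>
  define g where "g t = enn2real (f t * indicator {0<..1} t)" for t
  have fm: "(\<lambda>t. f t * indicator {0<..1} t) \<in> borel_measurable lborel" using f by measurable
  have "AE t in lborel. f t * indicator {0<..1} t \<noteq> \<infinity>"
    using fi[of 1] fm by (intro nn_integral_PInf_AE) auto
  then have fin: "AE t in lborel. ennreal (g t) = f t * indicator {0<..1} t"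
    by eventually_elim (auto simp: g_def ennreal_enn2real_if)
  show thesis
  proof
    fix x :: real assume x: "x \<in> {0..1}"
    define gx where "gx t = g t * indicator {0<..x} t" for t
    have "(\<integral>\<^sup>+t. ennreal (gx t) \<partial>lborel) = (\<integral>\<^sup>+t. f t * indicator {0<..x} t \<partial>lborel)"
    proof (rule nn_integral_cong_AE)
      show "AE t in lborel. ennreal (gx t) = f t * indicator {0<..x} t"
        using fin by eventually_elim (use x in \<open>auto simp: gx_def indicator_def split: if_splits\<close>)
    qed
    also note fi[OF x]
    moreover have "gx \<in> borel_measurable lborel"
      unfolding gx_def[abs_def] g_def using fm by measurable
    ultimately have "(gx has_integral (W x - W 0)) UNIV"
      using x mo[of 0 x] by (intro nn_integral_has_integral) (auto simp: gx_def g_def)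
    moreover have "gx = (\<lambda>t. if t \<in> {0<..x} then g t else 0)" by (auto simp: gx_def indicator_def)
    ultimately have "(g has_integral (W x - W 0)) {0<..x}"
      using has_integral_restrict_UNIV[of "{0<..x}" g] by simp
    moreover have "{t \<in> {0<..x} - {0..x}. g t \<noteq> 0} = {}" by auto
    moreover have "negligible {t \<in> {0..x} - {0<..x}. g t \<noteq> 0}"
      by (rule negligible_subset[of "{0}"]) auto
    ultimately show "(g has_integral (W x - W 0)) {0..x}"
      using has_integral_spike_set_eq[of "{0<..x}" "{0..x}" g "W x - W 0"] by (metis negligible_empty)
  qed (simp add: g_def)
qed

section \<open>Indefinite integrals and absolutely continuous functions\<close>

lemma sum_integral_disjoint_le:
  fixes h :: "real \<Rightarrow> real"
  assumes D: "finite D" "\<And>a b. (a, b) \<in> D \<Longrightarrow> 0 \<le> a \<and> a < b \<and> b \<le> 1"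
    "disjoint_family_on (\<lambda>(a, b). {a<..<b}) D"
    and h: "h absolutely_integrable_on {0..1}" and h0: "\<And>t. h t \<ge> 0"
  shows "(\<Sum>(a, b)\<in>D. integral {a..b} h) \<le> integral {0..1} h"
proof -
  define p where "p = (\<lambda>q :: real \<times> real. {fst q..snd q})"
  have inj: "inj_on p D"
  proof
    fix q r assume q: "q \<in> D" "r \<in> D" "p q = p r"
    then have "fst q < snd q" "fst r < snd r" using D(2)[of "fst q" "snd q"] D(2)[of "fst r" "snd r"] by auto
    then show "q = r" using q by (auto simp: p_def prod_eq_iff Icc_eq_Icc)
  qed
  have div: "(p ` D) division_of \<Union>(p ` D)"
    unfolding division_of_def
  proof (intro conjI ballI impI refl)
    show "finite (p ` D)" using D by simp
  next
    fix K assume "K \<in> p ` D"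
    then obtain q where q: "q \<in> D" "K = {fst q..snd q}" by (auto simp: p_def)
    then have "fst q < snd q" using D(2)[of "fst q" "snd q"] by auto
    then show "K \<noteq> {}" using q by auto
    show "K \<subseteq> \<Union> (p ` D)" using \<open>K \<in> p ` D\<close> by blast
    show "\<exists>a b. K = cbox a b" using q by auto
  next
    fix K L assume KL: "K \<in> p ` D" "L \<in> p ` D" "K \<noteq> L"
    then obtain q r where q: "q \<in> D" "K = {fst q..snd q}" "r \<in> D" "L = {fst r..snd r}" by (auto simp: p_def)
    then have "q \<noteq> r" using KL by auto
    then show "interior K \<inter> interior L = {}"
      using disjoint_family_onD[OF D(3) q(1) q(3)] by (simp add: split_beta q)
  qed
  have sub: "\<Union>(p ` D) \<subseteq> {0..1}" using D(2) by (fastforce simp: p_def)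
  have meas: "\<Union>(p ` D) \<in> sets lebesgue" by (intro sets.finite_Union) (use D(1) in \<open>auto simp: p_def\<close>)
  have hi: "h absolutely_integrable_on \<Union>(p ` D)" by (rule set_integrable_subset[OF h meas sub])
  have "(\<Sum>(a, b)\<in>D. integral {a..b} h) = (\<Sum>K\<in>p ` D. integral K h)"
    by (subst sum.reindex[OF inj]) (simp add: p_def split_beta)
  also have "\<dots> = integral (\<Union>(p ` D)) h"
    by (rule integral_combine_division_topdown[symmetric])
      (use hi div set_lebesgue_integral_eq_integral in auto)
  also have "\<dots> \<le> integral {0..1} h"
    using sub hi h h0 by (intro integral_subset_le) (auto simp: set_lebesgue_integral_eq_integral)
  finally show ?thesis .
qed

text \<open>Truncation: the excess \<open>h n\<close> of \<open>norm (g t)\<close> over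
  \<open>n\<close> has small integral for large \<open>n\<close> by dominated convergence, and what
  lies below \<open>n\<close> contributes at most \<open>n\<close> times the total length of the
  intervals.\<close>

lemma abs_cont_integral:
  assumes g: "g absolutely_integrable_on {0..1}" and y: "\<And>x. x \<in> {0..1} \<Longrightarrow> y x = c + integral {0..x} g"
  shows "abs_cont y"
  unfolding abs_cont_def
proof (intro allI impI)
  fix e :: real assume e: "e > 0"
  define h where "h n t = norm (g t) - min (norm (g t)) (real n)" for n t
  have gn: "(\<lambda>t. norm (g t)) absolutely_integrable_on {0..1}" using g by (rule absolutely_integrable_norm[unfolded o_def])
  have hi: "h n absolutely_integrable_on {0..1}" for n
    unfolding h_def by (intro set_integral_diff(1) gn absolutely_integrable_min_1) auto
  have "(\<lambda>n. integral {0..1} (h n)) \<longlonglongrightarrow> integral {0..1} (\<lambda>t::real. 0)"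
  proof (rule Equivalence_Lebesgue_Henstock_Integration.dominated_convergence(2))
    show "h n integrable_on {0..1}" for n using hi set_lebesgue_integral_eq_integral by blast
    show "(\<lambda>t. norm (g t)) integrable_on {0..1}" using gn set_lebesgue_integral_eq_integral by blast
    show "norm (h n x) \<le> norm (g x)" for n x by (auto simp: h_def)
    fix x
    obtain N where N: "norm (g x) \<le> real N" using real_arch_simple by blast
    have "eventually (\<lambda>n. h n x = 0) sequentially"
      using eventually_ge_at_top[of N] by eventually_elim (use N in \<open>auto simp: h_def\<close>)
    then show "(\<lambda>n. h n x) \<longlonglongrightarrow> 0" by (rule tendsto_eventually)
  qed
  then have "eventually (\<lambda>n. integral {0..1} (h n) < e / 2) sequentially"
    using e by (intro order_tendstoD) auto
  then obtain n where n: "integral {0..1} (h n) < e / 2" by (auto simp: eventually_sequentially)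
  define d where "d = e / (2 * (real n + 1))"
  show "\<exists>\<delta>>0. \<forall>D. finite D \<longrightarrow> (\<forall>(a, b)\<in>D. 0 \<le> a \<and> a < b \<and> b \<le> 1) \<longrightarrow>
     disjoint_family_on (\<lambda>(a, b). {a<..<b}) D \<longrightarrow>
     (\<Sum>(a, b)\<in>D. b - a) < \<delta> \<longrightarrow> (\<Sum>(a, b)\<in>D. norm (y b - y a)) < e"
  proof (intro exI[of _ d] conjI allI impI)
    show "d > 0" using e by (simp add: d_def)
    fix D :: "(real \<times> real) set"
    assume D: "finite D" "\<forall>(a, b)\<in>D. 0 \<le> a \<and> a < b \<and> b \<le> 1"
      "disjoint_family_on (\<lambda>(a, b). {a<..<b}) D" "(\<Sum>(a, b)\<in>D. b - a) < d"
    have D2: "0 \<le> a \<and> a < b \<and> b \<le> 1" if "(a, b) \<in> D" for a b using D(2) that by auto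
    have io: "f integrable_on {a..b}" if "f absolutely_integrable_on {0..1}" "(a,b) \<in> D" for f :: "real \<Rightarrow> 'z::euclidean_space" and a b
    proof -
      have "f integrable_on {0..1}" using that set_lebesgue_integral_eq_integral by blast
      then show ?thesis using D2[OF that(2)] by (intro integrable_on_subinterval) auto
    qed
    have "(\<Sum>(a, b)\<in>D. norm (y b - y a)) \<le> (\<Sum>(a, b)\<in>D. integral {a..b} (h n) + real n * (b - a))"
    proof (intro sum_mono, clarify)
      fix a b assume ab: "(a, b) \<in> D"
      note D2 = D2[OF ab]
      have "integral {0..a} g + integral {a..b} g = integral {0..b} g"
        using D2 set_lebesgue_integral_eq_integral(1)[OF g]
        by (intro Henstock_Kurzweil_Integration.integral_combine) (auto intro: integrable_on_subinterval)
      then have "y b - y a = integral {a..b} g" using D2 by (simp add: y algebra_simps)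
      then have "norm (y b - y a) = norm (integral {a..b} g)" by simp
      also have "\<dots> \<le> integral {a..b} (\<lambda>t. norm (g t))"
        by (rule Henstock_Kurzweil_Integration.integral_norm_bound_integral[OF io[OF g ab] io[OF gn ab]]) simp
      also have "\<dots> \<le> integral {a..b} (\<lambda>t. h n t + real n)"
        by (rule integral_le[OF io[OF gn ab] integrable_add[OF io[OF hi ab] integrable_const_ivl]]) (simp add: h_def)
      also have "\<dots> = integral {a..b} (h n) + real n * (b - a)"
        using D2 by (subst Henstock_Kurzweil_Integration.integral_add) (auto simp: io[OF hi ab])
      finally show "norm (y b - y a) \<le> integral {a..b} (h n) + real n * (b - a)" .
    qed
    also have "\<dots> = (\<Sum>(a, b)\<in>D. integral {a..b} (h n)) + real n * (\<Sum>(a, b)\<in>D. b - a)"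
      by (simp add: split_beta sum.distrib sum_distrib_left)
    also have "\<dots> \<le> integral {0..1} (h n) + real n * d"
      by (intro add_mono[OF sum_integral_disjoint_le[OF D(1) D2 D(3) hi] mult_left_mono])
        (use D(4) in \<open>auto simp: h_def\<close>)
    also have "\<dots> < e / 2 + real n * d" using n by simp
    also have "\<dots> \<le> e" using e by (simp add: d_def field_simps)
    finally show "(\<Sum>(a, b)\<in>D. norm (y b - y a)) < e" .
  qed
qed

text \<open>Jordan decomposition: \<open>V\<close> is the limit of the variation sums over dyadic
  grids up to the last grid point before \<open>x\<close>, and \<open>W = V - f\<close>. Both
  increase and satisfy \<open>dyadic_ac\<close>, so each is the integral of a nonnegative
  density.\<close>

lemma abs_cont_real_ftc:
  fixes f :: "real \<Rightarrow> real"
  assumes f: "abs_cont (\<lambda>x. of_real (f x))"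
  obtains g :: "real \<Rightarrow> real" where "g absolutely_integrable_on {0..1}"
    "\<And>x. x \<in> {0..1} \<Longrightarrow> (g has_integral (f x - f 0)) {0..x}"
proof -
  have AC: "\<exists>\<delta>>0. \<forall>D. finite D \<longrightarrow> (\<forall>(a, b)\<in>D. 0 \<le> a \<and> a < b \<and> b \<le> 1) \<longrightarrow>
     disjoint_family_on (\<lambda>(a, b). {a<..<b}) D \<longrightarrow>
     (\<Sum>(a, b)\<in>D. b - a) < \<delta> \<longrightarrow> (\<Sum>(a, b)\<in>D. \<bar>f b - f a\<bar>) < e" if "e > 0" for e
    using f that unfolding abs_cont_def by (simp flip: of_real_diff)
  define v where "v m j = \<bar>f (real (Suc j) / 2^m) - f (real j / 2^m)\<bar>" for m j :: nat
  have v0: "v m j \<ge> 0" for m j by (simp add: v_def)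
  define S where "S m k = (\<Sum>j<k. v m j)" for m k :: nat
  have grid: "\<exists>\<delta>>0. \<forall>m T. T \<subseteq> {..<2^m} \<longrightarrow> real (card T) / 2^m < \<delta> \<longrightarrow> (\<Sum>j\<in>T. v m j) \<le> e" if e: "e > 0" for e
  proof -
    obtain \<delta> where d: "\<delta> > 0" "\<And>D. finite D \<Longrightarrow> (\<forall>(a, b)\<in>D. 0 \<le> a \<and> a < b \<and> b \<le> 1) \<Longrightarrow>
     disjoint_family_on (\<lambda>(a, b). {a<..<b}) D \<Longrightarrow>
     (\<Sum>(a, b)\<in>D. b - a) < \<delta> \<Longrightarrow> (\<Sum>(a, b)\<in>D. \<bar>f b - f a\<bar>) < e" using AC[OF e] by blast
    show ?thesis
    proof (intro exI[of _ \<delta>] conjI allI impI d(1))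
      fix m and T :: "nat set" assume T: "T \<subseteq> {..<2^m}" "real (card T) / 2^m < \<delta>"
      define q where "q = (\<lambda>j. (real j / 2^m, real (Suc j) / 2^m))"
      have inj: "inj_on q T" by (auto simp: inj_on_def q_def)
      have fT: "finite T" using T finite_subset by blast
      have "(\<Sum>(a, b)\<in>q ` T. \<bar>f b - f a\<bar>) < e"
      proof (rule d(2))
        show "finite (q ` T)" using fT by simp
        show "\<forall>(a, b)\<in>q ` T. 0 \<le> a \<and> a < b \<and> b \<le> 1"
        proof clarify
          fix a b j assume "(a, b) = q j" and jT: "j \<in> T"
          then have j: "a = real j / 2^m" "b = real (Suc j) / 2^m" by (auto simp: q_def)
          from jT have "Suc j \<le> 2^m" using T by auto
          then have "real (Suc j) \<le> 2^m" by (metis of_nat_le_iff of_nat_numeral of_nat_power)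
          then show "0 \<le> a \<and> a < b \<and> b \<le> 1" unfolding j by (simp add: divide_strict_right_mono)
        qed
        show "disjoint_family_on (\<lambda>(a, b). {a<..<b}) (q ` T)"
        proof (unfold disjoint_family_on_def, intro ballI impI)
          fix r s assume "r \<in> q ` T" "s \<in> q ` T" "r \<noteq> s"
          then obtain i j :: nat where ij: "r = q i" "s = q j" "i \<noteq> j" by auto
          have "x * 2^m > real i \<and> x * 2^m < real (Suc i) \<and> x * 2^m > real j \<and> x * 2^m < real (Suc j)"
            if "x \<in> {fst r<..<snd r}" "x \<in> {fst s<..<snd s}" for x
            using that ij by (auto simp: q_def field_simps)
          then have no: False if "x \<in> {fst r<..<snd r}" "x \<in> {fst s<..<snd s}" for x
            using that ij(3) by fastforce
          then show "(case r of (a, b) \<Rightarrow> {a<..<b}) \<inter> (case s of (a, b) \<Rightarrow> {a<..<b}) = {}"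
            unfolding split_beta disjoint_iff by (auto simp del: greaterThanLessThan_iff)
        qed
        have "(\<Sum>(a, b)\<in>q ` T. b - a) = (\<Sum>j\<in>T. 1 / 2^m)"
          by (subst sum.reindex[OF inj]) (simp add: q_def diff_divide_distrib[symmetric])
        then show "(\<Sum>(a, b)\<in>q ` T. b - a) < \<delta>" using T by simp
      qed
      moreover have "(\<Sum>(a, b)\<in>q ` T. \<bar>f b - f a\<bar>) = (\<Sum>j\<in>T. v m j)"
        by (subst sum.reindex[OF inj]) (simp add: q_def v_def)
      ultimately show "(\<Sum>j\<in>T. v m j) \<le> e" by simp
    qed
  qed
  have Smono: "k \<le> l \<Longrightarrow> S m k \<le> S m l" for m k l unfolding S_def using v0 by (intro sum_mono2) auto
  have Stel: "\<bar>f (real l / 2^m) - f (real k / 2^m)\<bar> \<le> S m l - S m k" if "k \<le> l" for k l m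
    using that
  proof (induction rule: dec_induct)
    case (step n)
    have "S m (Suc n) = S m n + v m n" by (simp add: S_def)
    then show ?case using step by (auto simp: v_def)
  qed simp
  have Sref: "S m k \<le> S (Suc m) (2 * k)" for m k
  proof (induction k)
    case (Suc k)
    have e: "S (Suc m) (2 * Suc k) = S (Suc m) (2*k) + v (Suc m) (2*k) + v (Suc m) (2*k+1)" by (simp add: S_def)
    have *: "real (Suc (2*k+1)) / 2^Suc m = real (Suc k) / 2^m" "real (2*k) / 2^Suc m = real k / 2^m" "Suc (2*k) = 2*k+1"
      by (auto simp: field_simps)
    have "v m k \<le> v (Suc m) (2*k) + v (Suc m) (2*k+1)" unfolding v_def * by linarith
    then show ?case using Suc e by (simp add: S_def)
  qed (simp add: S_def)
  have Spow: "S m k \<le> S (m + r) (k * 2^r)" for m k r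
  proof (induction r)
    case (Suc r)
    then show ?case using Sref[of "m + r" "k * 2^r"] by (simp add: mult.assoc mult.left_commute)
  qed simp
  obtain B where B: "\<And>m. S m (2^m) \<le> B"
  proof -
    obtain \<delta> where d: "\<delta> > 0" "\<And>m T. T \<subseteq> {..<2^m} \<Longrightarrow> real (card T) / 2^m < \<delta> \<Longrightarrow> (\<Sum>j\<in>T. v m j) \<le> 1"
      using grid[of 1] by auto
    \<comment> \<open>The cells of level \<open>m + n\<close> fall into \<open>2^n\<close> blocks of
      \<open>2^m\<close> cells. Each block has total length \<open>1 / 2^n < \<delta>\<close>, hence
      variation at most 1, so \<open>2^n\<close> bounds all variation sums.\<close>
    obtain n where n: "(1/2::real)^n < \<delta>" using real_arch_pow_inv[of "\<delta>" "1/2"] d by auto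
    have "S m (2^m) \<le> 2^n" for m
    proof -
      have "S m (2^m) \<le> S (m + n) (2^m * 2^n)" by (rule Spow)
      also have "2^m * 2^n = 2^n * (2^m::nat)" by simp
      also have "S (m + n) (2^n * 2^m) = (\<Sum>i<2^n. sum (v (m+n)) {i*2^m..<i*2^m+2^m})"
        unfolding S_def by (rule sum.nat_group[symmetric])
      also have "\<dots> \<le> (\<Sum>i<(2^n::nat). 1)"
      proof (intro sum_mono d(2))
        fix i :: nat assume i: "i \<in> {..<2^n}"
        then have "Suc i * 2^m \<le> 2^n * 2^m" by (intro mult_right_mono) auto
        then show "{i*2^m..<i*2^m+2^m} \<subseteq> {..<2^(m+n)}" by (auto simp: power_add mult.commute)
        show "real (card {i*2^m..<i*2^m+2^m}) / 2^(m+n) < \<delta>"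
          using n by (simp add: power_add power_one_over field_simps)
      qed
      finally show ?thesis by simp
    qed
    then show ?thesis using that by blast
  qed
  \<comment> \<open>Clamping makes \<open>V\<close> and \<open>W\<close> constant outside the unit
    interval, as the Stieltjes construction above requires.\<close>
  define c where "c x = max 0 (min 1 x)" for x :: real
  have c: "0 \<le> c x" "c x \<le> 1" "x \<le> y \<Longrightarrow> c x \<le> c y" for x y by (auto simp: c_def)
  define K where "K m x = nat \<lfloor>2^m * c x\<rfloor>" for m x
  have K1: "real (K m x) \<le> 2^m * c x" "2^m * c x < real (K m x) + 1" for m x using c[of x] by (auto simp: K_def)
  have K2: "K m x \<le> 2^m" for m x
  proof -
    have "2^m * c x \<le> 2^m * 1" using c[of x] by (intro mult_left_mono) auto
    then have "real (K m x) \<le> 2^m" using K1[of m x] by linarith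
    then show ?thesis by (metis of_nat_le_iff of_nat_numeral of_nat_power)
  qed
  have K3: "K m x \<le> K m y" if "x \<le> y" for m x y
    unfolding K_def using c that by (intro nat_mono floor_mono mult_left_mono) auto
  have K4: "2 * K m x \<le> K (Suc m) x" for m x
  proof -
    have "real (2 * K m x) < real (K (Suc m) x) + 1" using K1(1)[of m x] K1(2)[of "Suc m" x] by simp
    then show ?thesis by linarith
  qed
  have inc: "incseq (\<lambda>m. S m (K m x))" for x
    by (rule incseq_SucI) (meson K4 Sref Smono order_trans)
  have bd: "S m (K m x) \<le> B" for m x using Smono[OF K2] B order_trans by blast
  define V where "V x = (SUP m. S m (K m x))" for x
  have lim: "(\<lambda>m. S m (K m x)) \<longlonglongrightarrow> V x" for x
    unfolding V_def by (rule LIMSEQ_incseq_SUP[OF _ inc]) (auto intro!: bdd_aboveI bd)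
  have Vmono: "mono V"
  proof
    fix x y :: real assume "x \<le> y"
    then show "V x \<le> V y" by (intro LIMSEQ_le[OF lim lim]) (auto intro!: Smono K3)
  qed
  have Vlo: "V x = V 0" if "x \<le> 0" for x
    using that by (simp add: V_def K_def c_def max_def min_def)
  have Vhi: "V x = V 1" if "x \<ge> 1" for x
    using that by (simp add: V_def K_def c_def max_def min_def)
  have Kd: "K (n + r) (real k / 2^n) = k * 2^r" if "k \<le> 2^n" for n r k
  proof -
    have "real k \<le> 2^n" using that by (metis of_nat_le_iff of_nat_numeral of_nat_power)
    then have "c (real k / 2^n) = real k / 2^n" by (simp add: c_def)
    then have "2^(n+r) * c (real k / 2^n) = real (k * 2^r)" by (simp add: power_add)
    then show ?thesis unfolding K_def by (metis floor_of_nat nat_int)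
  qed
  \<comment> \<open>An increment of \<open>V\<close> over a cell is the limit of variation sums over
    the refined cells inside it, which have the same total length; so the \<open>\<delta>\<close>
    found for grid sums serves \<open>V\<close>.\<close>
  have Vac: "dyadic_ac V"
    unfolding dyadic_ac_def
  proof (intro allI impI)
    fix e :: real assume "e > 0"
    then obtain \<delta> where d: "\<delta> > 0" "\<And>m T. T \<subseteq> {..<2^m} \<Longrightarrow> real (card T) / 2^m < \<delta> \<Longrightarrow> (\<Sum>j\<in>T. v m j) \<le> e"
      using grid by meson
    show "\<exists>\<delta>>0. \<forall>n A. A \<subseteq> {..<2^n} \<longrightarrow> real (card A) / 2^n < \<delta> \<longrightarrow>
     (\<Sum>k\<in>A. V (real (Suc k) / 2^n) - V (real k / 2^n)) \<le> e"
    proof (intro exI[of _ \<delta>] conjI allI impI d(1))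
      fix n and A :: "nat set" assume A: "A \<subseteq> {..<2^n}" "real (card A) / 2^n < \<delta>"
      have fA: "finite A" using A finite_subset by blast
      have lim': "(\<lambda>r. S (r + n) (K (r + n) x)) \<longlonglongrightarrow> V x" for x using LIMSEQ_ignore_initial_segment[OF lim] .
      have "(\<lambda>r. \<Sum>k\<in>A. S (r + n) (K (r + n) (real (Suc k) / 2^n)) - S (r + n) (K (r + n) (real k / 2^n)))
        \<longlonglongrightarrow> (\<Sum>k\<in>A. V (real (Suc k) / 2^n) - V (real k / 2^n))"
        by (intro tendsto_sum tendsto_diff lim')
      moreover have "(\<Sum>k\<in>A. S (r + n) (K (r + n) (real (Suc k) / 2^n)) - S (r + n) (K (r + n) (real k / 2^n))) \<le> e" for r
      proof -
        have "(\<Sum>k\<in>A. S (r + n) (K (r + n) (real (Suc k) / 2^n)) - S (r + n) (K (r + n) (real k / 2^n)))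
          = (\<Sum>k\<in>A. sum (v (n + r)) {k * 2^r..<k * 2^r + 2^r})"
        proof (intro sum.cong refl)
          fix k assume "k \<in> A"
          then have k: "k < 2^n" using A by auto
          have "K (r + n) (real (Suc k) / 2^n) = k * 2^r + 2^r" "K (r + n) (real k / 2^n) = k * 2^r"
            using Kd[of k n r] Kd[of "Suc k" n r] k by (simp_all add: add.commute)
          moreover have "S (n + r) (k * 2^r + 2^r) - S (n + r) (k * 2^r) = sum (v (n + r)) {k * 2^r..<k * 2^r + 2^r}"
            unfolding S_def lessThan_atLeast0 by (subst sum.atLeastLessThan_concat[of 0 "k * 2^r", symmetric]) auto
          ultimately show "S (r + n) (K (r + n) (real (Suc k) / 2^n)) - S (r + n) (K (r + n) (real k / 2^n)) 
            = sum (v (n + r)) {k * 2^r..<k * 2^r + 2^r}" by (simp only: add.commute[of r n])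
        qed
        also have "\<dots> = sum (v (n + r)) (\<Union>k\<in>A. {k * 2^r..<k * 2^r + 2^r})"
        proof (rule sum.UNION_disjoint[symmetric, OF fA])
          show "\<forall>i\<in>A. \<forall>j\<in>A. i \<noteq> j \<longrightarrow> {i * 2^r..<i * 2^r + 2^r} \<inter> {j * 2^r..<j * 2^r + 2^r} = {}"
          proof (intro ballI impI)
            fix i j :: nat assume "i \<noteq> j"
            then have "Suc i * 2^r \<le> j * 2^r \<or> Suc j * 2^r \<le> i * 2^r"
              by (metis mult_le_mono1 nat_neq_iff Suc_leI)
            then show "{i * 2^r..<i * 2^r + 2^r} \<inter> {j * 2^r..<j * 2^r + 2^r} = {}" by auto
          qed
        qed auto
        also have "\<dots> \<le> e"
        proof (rule d(2))
          show "(\<Union>k\<in>A. {k * 2^r..<k * 2^r + 2^r}) \<subseteq> {..<2^(n+r)}"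
          proof clarify
            fix j k assume k: "k \<in> A" and j: "j \<in> {k * 2^r..<k * 2^r + 2^r}"
            have "Suc k \<le> 2^n" using k A by auto
            then have "Suc k * 2^r \<le> 2^n * 2^r" by (rule mult_le_mono1)
            then show "j < 2^(n + r)" using j by (simp add: power_add)
          qed
          have "card (\<Union>k\<in>A. {k * 2^r..<k * 2^r + 2^r}) \<le> (\<Sum>k\<in>A. card {k * 2^r..<k * 2^r + 2^r})"
            by (rule card_UN_le[OF fA])
          then have "card (\<Union>k\<in>A. {k * 2^r..<k * 2^r + 2^r}) \<le> card A * 2^r" by simp
          then have "real (card (\<Union>k\<in>A. {k * 2^r..<k * 2^r + 2^r})) \<le> real (card A * 2^r)"
            by (simp only: of_nat_le_iff)
          then have "real (card (\<Union>k\<in>A. {k * 2^r..<k * 2^r + 2^r})) \<le> real (card A) * 2^r" by simp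
          then have "real (card (\<Union>k\<in>A. {k * 2^r..<k * 2^r + 2^r})) / 2^(n+r) \<le> real (card A) * 2^r / 2^(n+r)"
            by (rule divide_right_mono) simp
          also have "\<dots> < \<delta>" using A by (simp add: power_add)
          finally show "real (card (\<Union>k\<in>A. {k * 2^r..<k * 2^r + 2^r})) / 2^(n+r) < \<delta>" .
        qed
        finally show ?thesis .
      qed
      ultimately show "(\<Sum>k\<in>A. V (real (Suc k) / 2^n) - V (real k / 2^n)) \<le> e"
        by (intro LIMSEQ_le_const2) auto
    qed
  qed
  have fc: "continuous_on {0..1} f"
  proof -
    have "\<exists>d>0. \<forall>x\<in>{0..1}. dist x z < d \<longrightarrow> dist (f x) (f z) < e" if z: "z \<in> {0..1}" and e: "e > 0" for z e
    proof -
      obtain \<delta> where d: "\<delta> > 0" "\<And>D. finite D \<Longrightarrow> (\<forall>(a, b)\<in>D. 0 \<le> a \<and> a < b \<and> b \<le> 1) \<Longrightarrow>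
       disjoint_family_on (\<lambda>(a, b). {a<..<b}) D \<Longrightarrow>
       (\<Sum>(a, b)\<in>D. b - a) < \<delta> \<Longrightarrow> (\<Sum>(a, b)\<in>D. \<bar>f b - f a\<bar>) < e" using AC[OF e] by blast
      have "dist (f x) (f z) < e" if x: "x \<in> {0..1}" "dist x z < \<delta>" for x
      proof (cases "x = z")
        case False
        have "(\<Sum>(a, b)\<in>{(min x z, max x z)}. \<bar>f b - f a\<bar>) < e"
          using x z False by (intro d) (auto simp: disjoint_family_on_def dist_real_def)
        then show ?thesis by (auto simp: dist_real_def min_def max_def abs_minus_commute split: if_splits)
      qed (use e in simp)
      then show ?thesis using d(1) by blast
    qed
    then show ?thesis unfolding continuous_on_iff by blast
  qed
  have fV: "\<bar>f (c y) - f (c x)\<bar> \<le> V y - V x" if xy: "x \<le> y" for x y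
  proof -
    have kl: "(\<lambda>m. real (K m x) / 2^m) \<longlonglongrightarrow> c x" for x
    proof (rule real_tendsto_sandwich[of "\<lambda>m. c x - (1/2)^m" _ _ "\<lambda>m. c x"])
      show "eventually (\<lambda>m. c x - (1/2)^m \<le> real (K m x) / 2^m) sequentially"
      proof (intro always_eventually allI)
        fix m
        have "c x * 2^m \<le> real (K m x) + 1" using K1(2)[of m x] by (simp add: mult.commute)
        then have "c x \<le> (real (K m x) + 1) / 2^m" by (simp add: pos_le_divide_eq)
        then show "c x - (1/2)^m \<le> real (K m x) / 2^m" by (simp add: add_divide_distrib power_one_over)
      qed
      show "eventually (\<lambda>m. real (K m x) / 2^m \<le> c x) sequentially"
        using K1(1)[of _ x] by (intro always_eventually allI) (simp add: field_simps)
      have "(\<lambda>m. c x - (1/2)^m) \<longlonglongrightarrow> c x - 0" by (intro tendsto_intros LIMSEQ_realpow_zero) auto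
      then show "(\<lambda>m. c x - (1/2)^m) \<longlonglongrightarrow> c x" by simp
    qed simp
    have Kin: "real (K m x) / 2^m \<in> {0..1}" for m x
    proof -
      have "real (K m x) \<le> 2^m" using K2 by (metis of_nat_le_iff of_nat_numeral of_nat_power)
      then show ?thesis by simp
    qed
    have fl: "(\<lambda>m. f (real (K m x) / 2^m)) \<longlonglongrightarrow> f (c x)" for x
      using continuous_on_tendsto_compose[OF fc kl[of x]] c[of x] Kin by auto
    show ?thesis
    proof (rule LIMSEQ_le)
      show "(\<lambda>m. \<bar>f (real (K m y) / 2^m) - f (real (K m x) / 2^m)\<bar>) \<longlonglongrightarrow> \<bar>f (c y) - f (c x)\<bar>"
        by (intro tendsto_intros fl)
      show "(\<lambda>m. S m (K m y) - S m (K m x)) \<longlonglongrightarrow> V y - V x" by (intro tendsto_intros lim)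
    qed (use Stel[OF K3[OF xy]] in auto)
  qed
  \<comment> \<open>\<open>W\<close> increases because the variation dominates the increments of
    \<open>f\<close>; for the same reason its increments are at most twice those of
    \<open>V\<close>.\<close>
  define W where "W x = V x - f (c x)" for x
  have Wmono: "mono W" unfolding W_def by (rule monoI) (use fV in fastforce)
  have W2: "W y - W x \<le> 2 * (V y - V x)" if "x \<le> y" for x y
    using abs_le_D2[OF fV[OF that]] by (simp add: W_def algebra_simps)
  have Wac: "dyadic_ac W"
    unfolding dyadic_ac_def
  proof (intro allI impI)
    fix e :: real assume "e > 0"
    then have "e / 2 > 0" by simp
    then obtain \<delta> where d: "\<delta> > 0" "\<And>n A. A \<subseteq> {..<2^n} \<Longrightarrow> real (card A) / 2^n < \<delta> \<Longrightarrow>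
     (\<Sum>k\<in>A. V (real (Suc k) / 2^n) - V (real k / 2^n)) \<le> e / 2" using Vac unfolding dyadic_ac_def by meson
    show "\<exists>\<delta>>0. \<forall>n A. A \<subseteq> {..<2^n} \<longrightarrow> real (card A) / 2^n < \<delta> \<longrightarrow>
     (\<Sum>k\<in>A. W (real (Suc k) / 2^n) - W (real k / 2^n)) \<le> e"
    proof (intro exI[of _ \<delta>] conjI allI impI d(1))
      fix n and A :: "nat set" assume A: "A \<subseteq> {..<2^n}" "real (card A) / 2^n < \<delta>"
      have "(\<Sum>k\<in>A. W (real (Suc k) / 2^n) - W (real k / 2^n)) \<le> (\<Sum>k\<in>A. 2 * (V (real (Suc k) / 2^n) - V (real k / 2^n)))"
      proof (intro sum_mono)
        fix k :: nat
        have "real k / 2^n \<le> real (Suc k) / 2^n" by (simp add: divide_right_mono)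
        from W2[OF this] show "W (real (Suc k) / 2^n) - W (real k / 2^n) \<le> 2 * (V (real (Suc k) / 2^n) - V (real k / 2^n))" .
      qed
      also have "\<dots> \<le> e" using d(2)[OF A] unfolding sum_distrib_left[symmetric] by linarith
      finally show "(\<Sum>k\<in>A. W (real (Suc k) / 2^n) - W (real k / 2^n)) \<le> e" .
    qed
  qed
  obtain g1 where g1: "\<And>x. x \<in> {0..1} \<Longrightarrow> (g1 has_integral (V x - V 0)) {0..x}" "\<And>x. g1 x \<ge> 0"
    using dyadic_ac_density[OF Vmono Vlo Vhi Vac] by blast
  have "W x = W 0" if "x \<le> 0" for x using Vlo[OF that] that by (simp add: W_def c_def max_def min_def)
  moreover have "W x = W 1" if "x \<ge> 1" for x using Vhi[OF that] that by (simp add: W_def c_def max_def min_def)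
  ultimately obtain g2 where g2: "\<And>x. x \<in> {0..1} \<Longrightarrow> (g2 has_integral (W x - W 0)) {0..x}" "\<And>x. g2 x \<ge> 0"
    using dyadic_ac_density[OF Wmono _ _ Wac] by metis
  show thesis
  proof
    have "g1 integrable_on {0..1}" "g2 integrable_on {0..1}" using g1(1)[of 1] g2(1)[of 1] by (auto simp: has_integral_integrable)
    then show "(\<lambda>t. g1 t - g2 t) absolutely_integrable_on {0..1}"
      by (intro set_integral_diff(1) nonnegative_absolutely_integrable_1) (auto simp: g1 g2)
    fix x :: real assume x: "x \<in> {0..1}"
    then have "c x = x" "c 0 = 0" by (auto simp: c_def)
    then have "V x - V 0 - (W x - W 0) = f x - f 0" by (simp add: W_def)
    then show "((\<lambda>t. g1 t - g2 t) has_integral (f x - f 0)) {0..x}"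
      using has_integral_diff[OF g1(1)[OF x] g2(1)[OF x]] by simp
  qed
qed

lemma abs_cont_compose_bound:
  assumes "abs_cont y" "\<And>a b. norm (z b - z a) \<le> norm (y b - y a)"
  shows "abs_cont z"
  unfolding abs_cont_def
proof (intro allI impI)
  fix e :: real assume "e > 0"
  then obtain \<delta> where d: "\<delta> > 0" "\<And>D. finite D \<Longrightarrow> (\<forall>(a, b)\<in>D. 0 \<le> a \<and> a < b \<and> b \<le> 1) \<Longrightarrow>
     disjoint_family_on (\<lambda>(a, b). {a<..<b}) D \<Longrightarrow>
     (\<Sum>(a, b)\<in>D. b - a) < \<delta> \<Longrightarrow> (\<Sum>(a, b)\<in>D. norm (y b - y a)) < e" 
    using assms(1) unfolding abs_cont_def by meson
  have "(\<Sum>(a, b)\<in>D. norm (z b - z a)) \<le> (\<Sum>(a, b)\<in>D. norm (y b - y a))" for D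
    by (intro sum_mono) (use assms(2) in auto)
  with d show "\<exists>\<delta>>0. \<forall>D. finite D \<longrightarrow> (\<forall>(a, b)\<in>D. 0 \<le> a \<and> a < b \<and> b \<le> 1) \<longrightarrow>
     disjoint_family_on (\<lambda>(a, b). {a<..<b}) D \<longrightarrow>
     (\<Sum>(a, b)\<in>D. b - a) < \<delta> \<longrightarrow> (\<Sum>(a, b)\<in>D. norm (z b - z a)) < e"
    by (meson le_less_trans)
qed

lemma abs_cont_ftc:
  assumes y: "abs_cont y"
  obtains g where "g absolutely_integrable_on {0..1}" 
    "\<And>x. x \<in> {0..1} \<Longrightarrow> (g has_integral (y x - y 0)) {0..x}"
proof -
  have "abs_cont (\<lambda>x. of_real (Re (y x)))"
    by (rule abs_cont_compose_bound[OF y]) (metis abs_Re_le_cmod minus_complex.simps(1) norm_of_real of_real_diff)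
  then obtain g1 where g1: "g1 absolutely_integrable_on {0..1}" 
    "\<And>x. x \<in> {0..1} \<Longrightarrow> (g1 has_integral (Re (y x) - Re (y 0))) {0..x}" by (rule abs_cont_real_ftc) (rule that; assumption)
  have "abs_cont (\<lambda>x. of_real (Im (y x)))"
    by (rule abs_cont_compose_bound[OF y]) (metis abs_Im_le_cmod minus_complex.simps(2) norm_of_real of_real_diff)
  then obtain g2 where g2: "g2 absolutely_integrable_on {0..1}" 
    "\<And>x. x \<in> {0..1} \<Longrightarrow> (g2 has_integral (Im (y x) - Im (y 0))) {0..x}" by (rule abs_cont_real_ftc) (rule that; assumption)
  show thesis
  proof
    have a: "(\<lambda>t. of_real (g t) :: complex) absolutely_integrable_on {0..1}" if "g absolutely_integrable_on {0..1}" for g :: "real \<Rightarrow> real"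
      using absolutely_integrable_linear[OF that bounded_linear_of_real[where 'a=complex]] by (simp add: o_def)
    show "(\<lambda>t. of_real (g1 t) + \<i> * of_real (g2 t)) absolutely_integrable_on {0..1}"
      by (intro set_integral_add(1) a g1(1) set_integrable_mult_right impI g2(1))
    fix x :: real assume x: "x \<in> {0..1}"
    have "((\<lambda>t. of_real (g1 t) + \<i> * of_real (g2 t)) has_integral 
      (of_real (Re (y x) - Re (y 0)) + \<i> * of_real (Im (y x) - Im (y 0)))) {0..x}"
      by (intro has_integral_add has_integral_of_real has_integral_mult_right g1(2) g2(2) x)
    moreover have "of_real (Re (y x) - Re (y 0)) + \<i> * of_real (Im (y x) - Im (y 0)) = y x - y 0"
      by (simp add: complex_eq_iff)
    ultimately show "((\<lambda>t. of_real (g1 t) + \<i> * of_real (g2 t)) has_integral (y x - y 0)) {0..x}" by simp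
  qed
qed

section \<open>Orthogonal polynomials on the unit circle\<close>

lemma mult_cnj_norm: "a * cnj a = (complex_of_real (cmod a))\<^sup>2"
  by (metis complex_norm_square of_real_power)

locale circle_data =
  fixes I :: "int set" and z :: "int \<Rightarrow> complex" and w :: "int \<Rightarrow> real"
  assumes fin: "finite I" and ne: "I \<noteq> {}" and inj: "inj_on z I" and circ: "\<And>n. n \<in> I \<Longrightarrow> cmod (z n) = 1"
    and wpos: "\<And>n. n \<in> I \<Longrightarrow> w n > 0"
begin

definition ip :: "complex poly \<Rightarrow> complex poly \<Rightarrow> complex" where
  "ip p q = (\<Sum>n\<in>I. of_real (w n) * poly p (z n) * cnj (poly q (z n)))"

lemma ip_add: "ip (p + q) r = ip p r + ip q r" "ip r (p + q) = ip r p + ip r q"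
  by (simp_all add: ip_def sum.distrib algebra_simps)
lemma ip_diff: "ip (p - q) r = ip p r - ip q r" "ip r (p - q) = ip r p - ip r q"
  by (simp_all add: ip_def sum_subtractf algebra_simps)
lemma ip_smult: "ip (smult c p) r = c * ip p r" "ip r (smult c p) = cnj c * ip r p"
  by (simp_all add: ip_def sum_distrib_left algebra_simps)
lemma ip_sum: "ip (\<Sum>k\<in>A. f k) r = (\<Sum>k\<in>A. ip (f k) r)" "ip r (\<Sum>k\<in>A. f k) = (\<Sum>k\<in>A. ip r (f k))"
proof -
  have "finite A \<or> \<not> finite A" by simp
  then show "ip (\<Sum>k\<in>A. f k) r = (\<Sum>k\<in>A. ip (f k) r)"
  proof
    assume "finite A" then show ?thesis by induction (auto simp: ip_add, simp add: ip_def)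
  qed (simp add: ip_def)
  have "finite A \<or> \<not> finite A" by simp
  then show "ip r (\<Sum>k\<in>A. f k) = (\<Sum>k\<in>A. ip r (f k))"
  proof
    assume "finite A" then show ?thesis by induction (auto simp: ip_add, simp add: ip_def)
  qed (simp add: ip_def)
qed

lemma ip_cnj: "cnj (ip p q) = ip q p"
  by (simp add: ip_def algebra_simps)

lemma ip_self: "ip p p = of_real (\<Sum>n\<in>I. w n * (cmod (poly p (z n)))\<^sup>2)"
  by (simp add: ip_def complex_norm_square[symmetric] mult.assoc)

lemma zcnj: "n \<in> I \<Longrightarrow> z n * cnj (z n) = 1"
  using circ[of n] by (simp add: complex_norm_square[symmetric])

text \<open>Multiplication by \<open>z\<close> is isometric because all nodes have modulus 1; the
  Szego recursion rests on this.\<close>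

lemma ip_shift: "ip (pCons 0 p) (pCons 0 q) = ip p q"
proof -
  have "of_real (w n) * poly (pCons 0 p) (z n) * cnj (poly (pCons 0 q) (z n)) = (of_real (w n) * poly p (z n) * cnj (poly q (z n)))"
    if "n \<in> I" for n
  proof -
    have "of_real (w n) * poly (pCons 0 p) (z n) * cnj (poly (pCons 0 q) (z n)) =
      (z n * cnj (z n)) * (of_real (w n) * poly p (z n) * cnj (poly q (z n)))" by simp
    then show ?thesis by (simp only: zcnj[OF that] mult_1)
  qed
  then show ?thesis unfolding ip_def by (intro sum.cong) auto
qed

text \<open>The Szego recursion: \<open>P k\<close> is the monic orthogonal polynomial of degree \<open>k\<close>, \<open>Q k\<close> the reversed polynomial,
  \<open>c k\<close> the Verblunsky coefficient and \<open>N k\<close> the squared norm of \<open>P k\<close>.\<close>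

primrec sz :: "nat \<Rightarrow> complex poly \<times> complex poly" where
  "sz 0 = (1, 1)"
| "sz (Suc k) = (let P = fst (sz k); Q = snd (sz k); c = ip (pCons 0 P) 1 / ip P P
     in (pCons 0 P - smult c Q, Q - smult (cnj c) (pCons 0 P)))"

definition P :: "nat \<Rightarrow> complex poly" where "P k = fst (sz k)"
definition Q :: "nat \<Rightarrow> complex poly" where "Q k = snd (sz k)"
definition c :: "nat \<Rightarrow> complex" where "c k = ip (pCons 0 (P k)) 1 / ip (P k) (P k)"
definition N :: "nat \<Rightarrow> real" where "N k = (\<Sum>n\<in>I. w n * (cmod (poly (P k) (z n)))\<^sup>2)"

lemma P_0: "P 0 = 1" and Q_0: "Q 0 = 1" by (simp_all add: P_def Q_def)
lemma P_Suc: "P (Suc k) = pCons 0 (P k) - smult (c k) (Q k)"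
  and Q_Suc: "Q (Suc k) = Q k - smult (cnj (c k)) (pCons 0 (P k))"
  unfolding P_def Q_def c_def sz.simps Let_def fst_conv snd_conv by (rule refl)+

lemma ipPP: "ip (P k) (P k) = of_real (N k)" by (simp add: N_def ip_self)

text \<open>This is the sense in which \<open>Q k\<close> is reversed: the recursion of
  \<open>Q\<close> is that of \<open>P\<close> conjugated, and on the circle \<open>cnj t\<close> is
  the inverse of \<open>t\<close>.\<close>

lemma poly_Q: "cmod t = 1 \<Longrightarrow> poly (Q k) t = t ^ k * cnj (poly (P k) t)"
proof (induction k)
  case (Suc k)
  have t: "t * cnj t = 1" using Suc.prems by (simp add: complex_norm_square[symmetric])
  have "cnj (poly (P k) t) = t * cnj t * cnj (poly (P k) t)" using t by simp
  moreover have "poly (P k) t = t * cnj t * poly (P k) t" using t by simp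
  moreover have tk: "t ^ k * cnj (t ^ k) = 1" using t by (metis complex_cnj_power power_mult_distrib power_one)
  ultimately have "poly (Q (Suc k)) t = t^k * cnj (poly (P k) t) * (t * cnj t) - cnj (c k) * t * ((t ^ k * cnj (t ^ k)) * poly (P k) t)"
    using Suc by (simp add: Q_Suc t tk)
  also have "\<dots> = t ^ Suc k * cnj (poly (P (Suc k)) t)" 
    using Suc by (simp add: P_Suc algebra_simps)
  finally show ?case .
qed (simp add: P_0 Q_0)

lemma degree_PQ: "degree (P k) \<le> k" "degree (Q k) \<le> k"
proof (induction k)
  case (Suc k)
  have a: "degree (pCons 0 (P k)) \<le> Suc k" using degree_pCons_le[of 0 "P k"] Suc by linarith
  case 1 show ?case unfolding P_Suc using a Suc degree_smult_le[of "c k" "Q k"] by (intro degree_diff_le) linarith+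
  case 2 show ?case unfolding Q_Suc using a Suc degree_smult_le[of "cnj (c k)" "pCons 0 (P k)"] by (intro degree_diff_le) linarith+
qed (simp_all add: P_0 Q_0)

lemma coeff_Q_0: "coeff (Q k) 0 = 1"
  by (induction k) (simp_all add: Q_0 Q_Suc)

lemma coeff_P_0: "coeff (P (Suc k)) 0 = - c k" by (simp add: P_Suc coeff_Q_0)

lemma coeff_P_lead: "coeff (P k) k = 1"
proof (induction k)
  case (Suc k)
  then show ?case using degree_PQ(2)[of k] by (simp add: P_Suc coeff_eq_0)
qed (simp add: P_0)

definition m :: nat where "m = card I"

lemma low_degree_zero:
  assumes "degree p < m" "\<And>n. n \<in> I \<Longrightarrow> poly p (z n) = 0"
  shows "p = 0"
proof (rule ccontr)
  assume "p \<noteq> 0"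
  have "z ` I \<subseteq> {t. poly p t = 0}" using assms by auto
  then have "card (z ` I) \<le> card {t. poly p t = 0}" using poly_roots_finite[OF \<open>p \<noteq> 0\<close>] by (rule card_mono[rotated])
  also have "\<dots> \<le> degree p" using card_poly_roots_bound[OF \<open>p \<noteq> 0\<close>] .
  also have "card (z ` I) = m" using inj by (simp add: card_image m_def)
  finally show False using assms(1) by simp
qed

lemma ip_self_pos: assumes "degree p < m" "p \<noteq> 0" shows "(\<Sum>n\<in>I. w n * (cmod (poly p (z n)))\<^sup>2) > 0"
proof -
  obtain n where n: "n \<in> I" "poly p (z n) \<noteq> 0" using low_degree_zero assms by blast
  show ?thesis
    by (rule sum_pos2[OF fin n(1)]) (use n wpos in \<open>auto simp: less_imp_le\<close>)
qed

lemma N_pos: "k < m \<Longrightarrow> N k > 0"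
  unfolding N_def using degree_PQ(1)[of k] coeff_P_lead[of k] by (intro ip_self_pos) auto

text \<open>Reversal exchanges the exponents \<open>j\<close> and \<open>k - j\<close>, so
  orthogonality of \<open>P k\<close> to \<open>1, ..., z^(k-1)\<close> becomes orthogonality of
  \<open>Q k\<close> to \<open>z, ..., z^k\<close>.\<close>

lemma ip_Q_monom: assumes "j \<le> k" shows "ip (Q k) (monom 1 j) = cnj (ip (P k) (monom 1 (k - j)))"
proof -
  have "poly (Q k) (z n) * cnj (poly (monom 1 j) (z n)) = cnj (poly (P k) (z n)) * poly (monom 1 (k - j)) (z n)"
    if "n \<in> I" for n
  proof -
    have "z n ^ k * cnj (z n ^ j) = z n ^ (k - j) * (z n * cnj (z n)) ^ j"
      using assms by (simp add: power_mult_distrib mult.assoc[symmetric] power_add[symmetric])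
    also have "\<dots> = z n ^ (k - j)" by (simp only: zcnj[OF that] power_one mult_1_right)
    finally show ?thesis using poly_Q[of "z n" k] circ[OF that] by (simp add: poly_monom mult_ac)
  qed
  then show ?thesis unfolding ip_def by (auto simp: mult.assoc intro!: sum.cong)
qed

lemma ip_lower:
  assumes "degree q < k" "\<And>j. j < k \<Longrightarrow> ip p (monom 1 j) = 0"
  shows "ip p q = 0"
proof -
  have "q = (\<Sum>i\<le>degree q. smult (coeff q i) (monom 1 i))" 
    by (subst poly_as_sum_of_monoms[of q, symmetric]) (simp add: smult_monom)
  then have "ip p q = (\<Sum>i\<le>degree q. ip p (smult (coeff q i) (monom 1 i)))" by (metis ip_sum(2))
  also have "\<dots> = 0" using assms by (intro sum.neutral) (auto simp: ip_smult)
  finally show ?thesis .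
qed

text \<open>Both the shifted \<open>P k\<close> and \<open>Q k\<close> are orthogonal to
  \<open>z, ..., z^k\<close>, and \<open>c k\<close> is chosen to cancel the remaining inner product
  with 1. The range includes \<open>k = m\<close>, since the step divides only by the norm of the
  previous index.\<close>

lemma orth_step:
  assumes "k \<le> m" shows "(\<forall>j<k. ip (P k) (monom 1 j) = 0) \<and> ip (P k) (monom 1 k) = of_real (N k)"
  using assms
proof (induction k)
  case 0
  then show ?case using ipPP[of 0] by (simp add: P_0 monom_0 one_pCons)
next
  case (Suc k)
  then have km: "k < m" and IH: "\<And>j. j < k \<Longrightarrow> ip (P k) (monom 1 j) = 0" "ip (P k) (monom 1 k) = of_real (N k)" by auto
  have Nk: "of_real (N k) \<noteq> (0::complex)" using N_pos[OF km] by simp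
  have Q1: "ip (Q k) (monom 1 j) = 0" if "1 \<le> j" "j \<le> k" for j
    using ip_Q_monom[of j k] that IH by simp
  have Q0: "ip (Q k) 1 = of_real (N k)"
    using ip_Q_monom[of 0 k] IH(2) by (simp add: monom_0 one_pCons)
  have c: "c k * of_real (N k) = ip (pCons 0 (P k)) 1" using Nk by (simp add: c_def ipPP)
  have o: "ip (P (Suc k)) (monom 1 j) = 0" if "j < Suc k" for j
  proof (cases j)
    case 0
    then show ?thesis by (simp add: P_Suc ip_diff ip_smult monom_0 one_pCons[symmetric] Q0 c)
  next
    case (Suc i)
    then show ?thesis using that IH(1)[of i] Q1[of j] 
      by (simp add: P_Suc ip_diff ip_smult monom_Suc ip_shift)
  qed
  have "degree (P (Suc k) - monom 1 (Suc k)) < Suc k"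
  proof -
    have "coeff (P (Suc k) - monom 1 (Suc k)) i = 0" if "i > k" for i
      using that coeff_P_lead[of "Suc k"] degree_PQ(1)[of "Suc k"] by (cases "i = Suc k") (auto simp: coeff_eq_0)
    then have "degree (P (Suc k) - monom 1 (Suc k)) \<le> k" by (intro degree_le) auto
    then show ?thesis by simp
  qed
  then have "ip (P (Suc k)) (P (Suc k) - monom 1 (Suc k)) = 0" by (rule ip_lower) (rule o)
  then have "ip (P (Suc k)) (monom 1 (Suc k)) = of_real (N (Suc k))" by (simp add: ip_diff ipPP)
  with o show ?case by blast
qed

lemma orth_P: "k \<le> m \<Longrightarrow> degree q < k \<Longrightarrow> ip (P k) q = 0"
  using ip_lower orth_step by blast

lemma orth_PP: "j \<le> m \<Longrightarrow> k \<le> m \<Longrightarrow> ip (P j) (P k) = (if j = k then of_real (N k) else 0)"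
proof (cases j k rule: linorder_cases)
  case less
  assume "k \<le> m"
  then have "ip (P k) (P j) = 0" using less degree_PQ(1)[of j] by (intro orth_P) auto
  then show ?thesis using less ip_cnj[of "P k" "P j"] by simp
next
  case greater
  assume "j \<le> m"
  then have "ip (P j) (P k) = 0" using greater degree_PQ(1)[of k] by (intro orth_P) auto
  then show ?thesis using greater by simp
qed (simp add: ipPP)

lemma N_Suc: assumes "k < m" shows "N (Suc k) = N k * (1 - (cmod (c k))\<^sup>2)"
proof -
  have Nk: "N k > 0" using N_pos assms by simp
  have "of_real (N (Suc k)) = ip (P (Suc k)) (monom 1 (Suc k))" using orth_step[of "Suc k"] assms by simp
  also have "\<dots> = ip (P k) (monom 1 k) - c k * ip (Q k) (monom 1 (Suc k))"
    by (simp add: P_Suc ip_diff ip_smult monom_Suc[of _ k] ip_shift)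
  \<comment> \<open>One exponent beyond the range of \<open>ip_Q_monom\<close>: the surplus factor
    \<open>cnj (z n)\<close> is absorbed as a shift of \<open>P k\<close>.\<close>
  also have "ip (Q k) (monom 1 (Suc k)) = cnj (ip (pCons 0 (P k)) 1)"
  proof -
    have "poly (Q k) (z n) * cnj (poly (monom 1 (Suc k)) (z n)) = cnj (poly (pCons 0 (P k)) (z n))" if "n \<in> I" for n
    proof -
      have "z n ^ k * cnj (z n ^ Suc k) = cnj (z n) * (z n * cnj (z n)) ^ k"
        by (simp add: power_mult_distrib)
      also have "\<dots> = cnj (z n)" by (simp only: zcnj[OF that] power_one mult_1_right)
      finally have e: "z n ^ k * cnj (z n ^ Suc k) = cnj (z n)" .
      have "poly (Q k) (z n) * cnj (poly (monom 1 (Suc k)) (z n)) = (z n ^ k * cnj (z n ^ Suc k)) * cnj (poly (P k) (z n))"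
        using poly_Q[of "z n" k] circ[OF that] by (simp add: poly_monom mult_ac)
      then show ?thesis unfolding e by simp
    qed
    then show ?thesis unfolding ip_def by (auto simp: mult.assoc intro!: sum.cong)
  qed
  also have "ip (pCons 0 (P k)) 1 = c k * of_real (N k)" using Nk by (simp add: c_def ipPP)
  also have "ip (P k) (monom 1 k) - c k * cnj (c k * of_real (N k)) = of_real (N k * (1 - (cmod (c k))\<^sup>2))"
    using orth_step[of k] assms by (simp add: mult_cnj_norm[symmetric] algebra_simps)
  finally show ?thesis using of_real_eq_iff by blast
qed

lemma c_less_1: assumes "Suc k < m" shows "cmod (c k) < 1"
proof -
  have "N k > 0" "N (Suc k) > 0" using N_pos assms by auto
  moreover have "N (Suc k) = N k * (1 - (cmod (c k))\<^sup>2)" using N_Suc assms by simp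
  ultimately have "1 - (cmod (c k))\<^sup>2 > 0" by (metis zero_less_mult_pos)
  then show ?thesis using power2_less_imp_less[of "cmod (c k)" 1] by simp
qed

text \<open>\<open>P m\<close> is the nodal polynomial. It is orthogonal to
  \<open>monom 1 m - R\<close> by degree and to \<open>R\<close> because \<open>R\<close> vanishes
  at every node, so its norm \<open>N m\<close> is 0.\<close>

lemma P_m_zero: assumes "n \<in> I" shows "poly (P m) (z n) = 0"
proof -
  define R where "R = (\<Prod>n\<in>I. [:- z n, 1:])"
  have R: "poly R (z n) = 0" if "n \<in> I" for n using that fin by (auto simp: R_def poly_prod)
  have dR: "degree R = m" unfolding R_def m_def by (subst degree_prod_sum_eq) auto
  have "lead_coeff R = 1" unfolding R_def by (simp add: lead_coeff_prod)
  then have "coeff R m = 1" using dR by simp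
  then have "coeff (monom 1 m - R) i = 0" if "i \<ge> m" for i using that dR by (cases "i = m") (auto simp: coeff_eq_0)
  moreover have "m > 0" using fin ne by (simp add: m_def card_gt_0_iff)
  ultimately have "degree (monom 1 m - R) < m"
    by (metis (no_types, lifting) degree_0 leading_coeff_0_iff linorder_not_less)
  then have "ip (P m) (monom 1 m - R) = 0" by (intro orth_P) auto
  moreover have "ip (P m) R = 0" unfolding ip_def using R by (intro sum.neutral) auto
  ultimately have "ip (P m) (monom 1 m) = 0" by (simp add: ip_diff)
  then have "N m = 0" using orth_step[of m] by simp
  then show ?thesis using assms fin wpos unfolding N_def
    by (subst (asm) sum_nonneg_eq_0_iff) (auto simp: less_imp_le, force)
qed

section \<open>The Christoffel-Darboux kernel of the polynomials of degree below
  \<open>m\<close>\<close>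

definition Ker :: "complex \<Rightarrow> complex \<Rightarrow> complex" where
  "Ker s t = (\<Sum>k<m. poly (P k) s * cnj (poly (P k) t) / of_real (N k))"

text \<open>The norm of the kernel section at \<open>t\<close> is computed at the nodes and in the
  orthogonal basis. It lets the energy at a point off the nodes be estimated from kernel values at
  the nodes.\<close>

lemma Ker_parseval: "(\<Sum>n\<in>I. w n * (cmod (Ker (z n) t))\<^sup>2) = (\<Sum>k<m. (cmod (poly (P k) t))\<^sup>2 / N k)"
proof -
  define f where "f = (\<Sum>k<m. smult (cnj (poly (P k) t) / of_real (N k)) (P k))"
  have pf: "poly f s = Ker s t" for s unfolding f_def Ker_def poly_sum by (intro sum.cong) auto
  have "of_real (\<Sum>n\<in>I. w n * (cmod (Ker (z n) t))\<^sup>2) = ip f f" by (simp add: ip_self pf)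
  also have "\<dots> = (\<Sum>k<m. \<Sum>j<m. (cnj (poly (P k) t) / of_real (N k)) * (poly (P j) t / of_real (N j)) * ip (P k) (P j))"
    unfolding f_def by (simp only: ip_sum(1)) (simp add: ip_sum(2) ip_smult sum_distrib_left mult_ac)
  also have "\<dots> = (\<Sum>k<m. \<Sum>j<m. if k = j then (cnj (poly (P k) t) / of_real (N k)) * (poly (P j) t / of_real (N j)) * of_real (N j) else 0)"
    by (intro sum.cong refl) (auto simp: orth_PP)
  also have "\<dots> = (\<Sum>k<m. of_real ((cmod (poly (P k) t))\<^sup>2 / N k))"
    using N_pos by (intro sum.cong refl) (auto simp: mult_cnj_norm field_simps)
  finally have "complex_of_real (\<Sum>n\<in>I. w n * (cmod (Ker (z n) t))\<^sup>2) = of_real (\<Sum>k<m. (cmod (poly (P k) t))\<^sup>2 / N k)"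
    by (simp only: of_real_sum)
  then show ?thesis by (simp only: of_real_eq_iff)
qed

text \<open>Subtracting the multiple of \<open>P d\<close> with the same leading coefficient lowers
  the degree, and for \<open>P d\<close> itself the claim is orthogonality.\<close>

lemma reproducing: assumes "degree p < m" shows "ip p (\<Sum>k<m. smult (cnj (poly (P k) t) / of_real (N k)) (P k)) = poly p t"
  using assms
proof (induction "degree p" arbitrary: p rule: less_induct)
  case less
  define d where "d = degree p"
  define a where "a = coeff p d"
  define p' where "p' = p - smult a (P d)"
  have dm: "d < m" using less by (simp add: d_def)
  let ?f = "\<Sum>k<m. smult (cnj (poly (P k) t) / of_real (N k)) (P k)"
  have "ip (P d) ?f = (\<Sum>k<m. (poly (P k) t / of_real (N k)) * ip (P d) (P k))"
    by (simp add: ip_sum ip_smult)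
  also have "\<dots> = (\<Sum>k<m. if d = k then poly (P k) t else 0)"
    using dm N_pos[OF dm] by (intro sum.cong refl) (auto simp: orth_PP)
  also have "\<dots> = poly (P d) t" using dm by simp
  finally have Pd: "ip (P d) ?f = poly (P d) t" .
  have co: "coeff p' i = 0" if "i \<ge> d" for i
    using that degree_PQ(1)[of d] coeff_P_lead[of d] by (cases "i = d") (auto simp: p'_def a_def coeff_eq_0 d_def)
  have "ip p' ?f = poly p' t"
  proof (cases "p' = 0")
    case True then show ?thesis by (simp add: ip_def)
  next
    case False
    then have "degree p' < d" using co by (metis leading_coeff_0_iff linorder_not_less)
    then show ?thesis using less dm by (auto simp: d_def)
  qed
  then show ?case using Pd by (simp add: p'_def ip_diff ip_smult)
qed

text \<open>Apply the reproducing property to the Lagrange polynomial of the node: its inner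
  products see only the mass \<open>w n\<close>, and its value there is 1.\<close>

lemma christoffel: assumes "n \<in> I" shows "(\<Sum>k<m. (cmod (poly (P k) (z n)))\<^sup>2 / N k) = 1 / w n"
proof -
  define L where "L = smult (1 / (\<Prod>j\<in>I - {n}. z n - z j)) (\<Prod>j\<in>I - {n}. [:- z j, 1:])"
  have nz: "(\<Prod>j\<in>I - {n}. z n - z j) \<noteq> 0" using fin inj assms by (auto simp: inj_on_def)
  have L1: "poly L (z n) = 1" using nz by (simp add: L_def poly_prod)
  have L0: "poly L (z j) = 0" if "j \<in> I" "j \<noteq> n" for j using that fin by (auto simp: L_def poly_prod)
  have "degree (\<Prod>j\<in>I - {n}. [:- z j, 1:]) = card (I - {n})" by (subst degree_prod_sum_eq) auto
  then have "degree L < m" unfolding L_def m_def using fin assms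
    by (metis degree_smult_le card_Diff1_less le_less_trans)
  from reproducing[OF this, of "z n"] have "ip L (\<Sum>k<m. smult (cnj (poly (P k) (z n)) / of_real (N k)) (P k)) = 1" by (simp add: L1)
  moreover have "ip L f = of_real (w n) * cnj (poly f (z n))" for f
  proof -
    have "ip L f = (\<Sum>j\<in>I. if j = n then of_real (w n) * cnj (poly f (z n)) else 0)"
      unfolding ip_def by (intro sum.cong refl) (auto simp: L1 L0)
    then show ?thesis using fin assms by simp
  qed
  ultimately have "of_real (w n) * cnj (\<Sum>k<m. cnj (poly (P k) (z n)) / of_real (N k) * poly (P k) (z n)) = 1"
    by (simp add: poly_sum)
  moreover have "cnj (\<Sum>k<m. cnj (poly (P k) (z n)) / of_real (N k) * poly (P k) (z n)) = of_real (\<Sum>k<m. (cmod (poly (P k) (z n)))\<^sup>2 / N k)"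
    by (simp add: mult_cnj_norm)
  ultimately have "complex_of_real (w n) * of_real (\<Sum>k<m. (cmod (poly (P k) (z n)))\<^sup>2 / N k) = 1"
    by (simp only:)
  then have "w n * (\<Sum>k<m. (cmod (poly (P k) (z n)))\<^sup>2 / N k) = 1"
    by (simp only: of_real_mult[symmetric] of_real_eq_1_iff)
  then show ?thesis using wpos[OF assms] by (simp add: field_simps)
qed

text \<open>One Szego step carries \<open>q - a * p\<close> into \<open>q' - p'\<close> with the
  factor \<open>1 - |c k|^2\<close>, which is also the factor from \<open>N k\<close> to
  \<open>N (Suc k)\<close>; the quotient is preserved, and adding the new summand turns
  \<open>p'\<close> into \<open>a * p'\<close>.\<close>

lemma christoffel_darboux:
  assumes "k < m"
  shows "(1 - s * cnj t) * (\<Sum>j\<le>k. poly (P j) s * cnj (poly (P j) t) / of_real (N j)) =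
    (poly (Q k) s * cnj (poly (Q k) t) - s * cnj t * poly (P k) s * cnj (poly (P k) t)) / of_real (N k)"
  using assms
proof (induction k)
  case 0
  then show ?case by (simp add: P_0 Q_0 diff_divide_distrib)
next
  case (Suc k)
  define a where "a = s * cnj t"
  define p q where "p = poly (P k) s * cnj (poly (P k) t)" and "q = poly (Q k) s * cnj (poly (Q k) t)"
  define p' q' where "p' = poly (P (Suc k)) s * cnj (poly (P (Suc k)) t)" and "q' = poly (Q (Suc k)) s * cnj (poly (Q (Suc k)) t)"
  have Nk: "N k > 0" "N (Suc k) > 0" using N_pos Suc by auto
  have Ns: "of_real (N (Suc k)) = (of_real (N k) * (1 - c k * cnj (c k)) :: complex)"
    using N_Suc[of k] Suc by (simp add: complex_norm_square[symmetric])
  have key: "q' - p' = (1 - c k * cnj (c k)) * (q - a * p)"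
    by (simp add: p'_def q'_def p_def q_def a_def P_Suc Q_Suc algebra_simps)
  have key2: "(q - a * p) / of_real (N k) = (q' - p') / of_real (N (Suc k))"
  proof -
    have "1 - c k * cnj (c k) \<noteq> 0" using Ns Nk by auto
    then show ?thesis unfolding key Ns by simp
  qed
  have IH: "(1 - a) * (\<Sum>j\<le>k. poly (P j) s * cnj (poly (P j) t) / of_real (N j)) = (q - a * p) / of_real (N k)"
    using Suc by (simp add: a_def p_def q_def mult_ac)
  have "(1 - a) * (\<Sum>j\<le>Suc k. poly (P j) s * cnj (poly (P j) t) / of_real (N j)) = 
    (q' - p') / of_real (N (Suc k)) + (1 - a) * (p' / of_real (N (Suc k)))"
    using IH key2 by (simp add: distrib_left p'_def)
  also have "\<dots> = (q' - a * p') / of_real (N (Suc k))" by (simp add: diff_divide_distrib algebra_simps)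
  finally show ?case by (simp add: a_def p'_def q'_def mult_ac)
qed

lemma Ker_eq:
  assumes "s * cnj t \<noteq> 1"
  shows "Ker s t = (poly (Q (m - 1)) s * cnj (poly (Q (m - 1)) t) - s * cnj t * poly (P (m - 1)) s * cnj (poly (P (m - 1)) t)) 
    / (of_real (N (m - 1)) * (1 - s * cnj t))"
proof -
  have "m > 0" using fin ne by (simp add: m_def card_gt_0_iff)
  then have "{..<m} = {..m - 1}" by auto
  then have K: "Ker s t = (\<Sum>j\<le>m - 1. poly (P j) s * cnj (poly (P j) t) / of_real (N j))" by (simp add: Ker_def)
  have "1 - s * cnj t \<noteq> 0" using assms by simp
  then show ?thesis unfolding K divide_divide_eq_left[symmetric]
    using christoffel_darboux[of "m - 1" s t] \<open>m > 0\<close> by (metis (no_types, lifting) diff_less nonzero_mult_div_cancel_left zero_less_one)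
qed

end

section \<open>Sampling at perturbed roots of unity\<close>

text \<open>For \<open>\<theta> n = \<pi> n\<close> these are the roots of unity of order
  \<open>2 N + 1\<close>: the factor 2 turns the spacing \<open>\<pi>\<close> into one full turn
  over the indices \<open>- N..N\<close>.\<close>

definition node :: "(int \<Rightarrow> real) \<Rightarrow> nat \<Rightarrow> int \<Rightarrow> complex" where
  "node \<theta> N n = cis (2 * \<theta> n / real (2 * N + 1))"

abbreviation J :: "nat \<Rightarrow> int set" where "J N \<equiv> {- int N..int N}"

definition coeff_energy :: "nat \<Rightarrow> complex poly \<Rightarrow> real" where
  "coeff_energy m p = (\<Sum>l<m. (cmod (coeff p l))\<^sup>2)"

lemma coeff_energy_nonneg: "coeff_energy m p \<ge> 0" by (simp add: coeff_energy_def sum_nonneg)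

lemma cmod_add_sq: "(cmod (a + b))\<^sup>2 \<le> 2 * (cmod a)\<^sup>2 + 2 * (cmod b)\<^sup>2"
proof -
  have "(cmod (a + b))\<^sup>2 \<le> (cmod a + cmod b)\<^sup>2" by (intro power_mono norm_triangle_ineq) auto
  also have "\<dots> \<le> 2 * (cmod a)\<^sup>2 + 2 * (cmod b)\<^sup>2"
    using sum_squares_bound[of "cmod a" "cmod b"] by (simp add: power2_sum)
  finally show ?thesis .
qed

lemma coeff_energy_add: "coeff_energy m (p + q) \<le> 2 * coeff_energy m p + 2 * coeff_energy m q"
  unfolding coeff_energy_def sum_distrib_left sum.distrib[symmetric] by (intro sum_mono) (simp add: cmod_add_sq)

lemma coeff_energy_smult: "coeff_energy m (smult a p) = (cmod a)\<^sup>2 * coeff_energy m p"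
  by (simp add: coeff_energy_def sum_distrib_left norm_mult power_mult_distrib)

lemma poly_eq_sum: "degree p < m \<Longrightarrow> poly p (t::complex) = (\<Sum>l<m. coeff p l * t ^ l)"
  unfolding poly_altdef by (intro sum.mono_neutral_left) (auto simp: coeff_eq_0)

lemma sum_cs: "(\<Sum>l<m. cmod (a l))\<^sup>2 \<le> real m * (\<Sum>l<m. (cmod (a l))\<^sup>2)" for m :: nat
  using sum_squared_le_sum_of_squares[of "\<lambda>l. cmod (a l)" "{..<m}"] by (simp add: mult.commute)

lemma cmod_cis_diff: "cmod (cis a - cis b) = 2 * \<bar>sin ((a - b) / 2)\<bar>"
proof (rule power2_eq_imp_eq)
  define s where "s = (a - b) / 2"
  have ab: "a - b = 2 * s" by (simp add: s_def)
  have "(cmod (cis a - cis b))\<^sup>2 = (cos a - cos b)\<^sup>2 + (sin a - sin b)\<^sup>2" by (simp add: cmod_power2)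
  also have "\<dots> = 2 - 2 * cos (a - b)"
    using sin_cos_squared_add[of a] sin_cos_squared_add[of b] by (simp add: cos_diff power2_eq_square algebra_simps)
  also have "\<dots> = (2 * \<bar>sin s\<bar>)\<^sup>2" unfolding ab cos_double_sin by (simp add: power_mult_distrib)
  finally show "(cmod (cis a - cis b))\<^sup>2 = (2 * \<bar>sin ((a - b) / 2)\<bar>)\<^sup>2" by (simp only: s_def)
qed auto

lemma cis_diff_le: "cmod (cis a - cis b) \<le> \<bar>a - b\<bar>"
  using abs_sin_x_le_abs_x[of "(a - b) / 2"] by (simp add: cmod_cis_diff)

text \<open>The range must exceed \<open>pi / 2\<close>, since half the angle between two perturbed
  nodes can pass that value, where the sine is no longer monotone. The double angle formula reduces
  to \<open>[0, 1]\<close>, where the cosine is at least 1/2.\<close>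

lemma abs_sin_ge: assumes "\<bar>x\<bar> \<le> 2" shows "\<bar>sin x\<bar> \<ge> \<bar>x\<bar> / (4::real)"
proof -
  have pos: "sin x \<ge> x / 4" if x: "0 \<le> x" "x \<le> 2" for x :: real
  proof -
    have c: "cos y \<ge> 1/2" if "0 \<le> y" "y \<le> 1" for y :: real
    proof -
      have "1 \<le> pi / 3" using pi_gt3 by simp
      then have "cos (pi / 3) \<le> cos y" using that pi_gt3 by (intro cos_monotone_0_pi_le) auto
      then show ?thesis by (simp add: cos_60)
    qed
    define y where "y = x / 2"
    have y: "0 \<le> y" "y \<le> 1" using x by (auto simp: y_def)
    have s: "sin y \<ge> y / 2"
    proof -
      have "(\<lambda>t. sin t - t / 2) 0 \<le> (\<lambda>t. sin t - t / 2) y"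
      proof (rule DERIV_nonneg_imp_nondecreasing[OF y(1)])
        fix t assume t: "0 \<le> t" "t \<le> y"
        have "((\<lambda>t. sin t - t / 2) has_real_derivative cos t - 1 / 2) (at t)" by (auto intro!: derivative_eq_intros)
        then show "\<exists>d. ((\<lambda>t. sin t - t / 2) has_real_derivative d) (at t) \<and> 0 \<le> d" using c[of t] t y by auto
      qed
      then show ?thesis by simp
    qed
    have "x / 4 = 2 * (y / 2) * (1 / 2)" by (simp add: y_def)
    also have "\<dots> \<le> 2 * sin y * cos y" using s c[OF y] y by (intro mult_mono) auto
    also have "\<dots> = sin x" using sin_double[of y] by (simp add: y_def)
    finally show ?thesis .
  qed
  show ?thesis
  proof (cases "x \<ge> 0")
    case True then show ?thesis using pos[of x] assms by auto
  next
    case False then show ?thesis using pos[of "-x"] assms by auto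
  qed
qed

lemma cis_diff_ge: "\<bar>a - b\<bar> \<le> 4 \<Longrightarrow> cmod (cis a - cis b) \<ge> \<bar>a - b\<bar> / 4"
  using abs_sin_ge[of "(a - b) / 2"] by (simp add: cmod_cis_diff)

lemma node_power: "node \<theta> N n ^ l = cis (2 * real l * \<theta> n / real (2 * N + 1))"
  by (simp add: node_def Complex.DeMoivre mult_ac)

lemma node_power_diff:
  assumes "l < 2 * N + 1"
  shows "cmod (node \<theta> N n ^ l - node \<eta> N n ^ l) \<le> 2 * \<bar>\<theta> n - \<eta> n\<bar>"
proof -
  have "cmod (node \<theta> N n ^ l - node \<eta> N n ^ l) \<le> \<bar>2 * real l * \<theta> n / real (2 * N + 1) - 2 * real l * \<eta> n / real (2 * N + 1)\<bar>"
    unfolding node_power by (rule cis_diff_le)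
  also have "\<dots> = real l / real (2 * N + 1) * (2 * \<bar>\<theta> n - \<eta> n\<bar>)"
    by (simp add: abs_mult flip: diff_divide_distrib right_diff_distrib)
  also have "\<dots> \<le> 1 * (2 * \<bar>\<theta> n - \<eta> n\<bar>)" using assms by (intro mult_right_mono) auto
  finally show ?thesis by simp
qed

lemma poly_nd_diff:
  assumes "degree p < 2 * N + 1"
  shows "(cmod (poly p (node \<theta> N n) - poly p (node \<eta> N n)))\<^sup>2 \<le> 4 * (\<theta> n - \<eta> n)\<^sup>2 * real (2 * N + 1) * coeff_energy (2 * N + 1) p"
proof -
  let ?m = "2 * N + 1"
  have "cmod (poly p (node \<theta> N n) - poly p (node \<eta> N n)) = cmod (\<Sum>l<?m. coeff p l * (node \<theta> N n ^ l - node \<eta> N n ^ l))"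
    unfolding poly_eq_sum[OF assms] by (simp add: sum_subtractf algebra_simps)
  also have "\<dots> \<le> (\<Sum>l<?m. cmod (coeff p l * (node \<theta> N n ^ l - node \<eta> N n ^ l)))" by (rule norm_sum)
  also have "\<dots> \<le> (\<Sum>l<?m. cmod (coeff p l) * (2 * \<bar>\<theta> n - \<eta> n\<bar>))"
    unfolding norm_mult by (intro sum_mono mult_left_mono node_power_diff) auto
  also have "\<dots> = (2 * \<bar>\<theta> n - \<eta> n\<bar>) * (\<Sum>l<?m. cmod (coeff p l))" by (simp only: sum_distrib_right[symmetric] mult.commute)
  finally have "(cmod (poly p (node \<theta> N n) - poly p (node \<eta> N n)))\<^sup>2 \<le> ((2 * \<bar>\<theta> n - \<eta> n\<bar>) * (\<Sum>l<?m. cmod (coeff p l)))\<^sup>2"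
    by (intro power_mono) auto
  also have "\<dots> = 4 * (\<theta> n - \<eta> n)\<^sup>2 * (\<Sum>l<?m. cmod (coeff p l))\<^sup>2" by (simp add: power_mult_distrib)
  also have "\<dots> \<le> 4 * (\<theta> n - \<eta> n)\<^sup>2 * (real ?m * (\<Sum>l<?m. (cmod (coeff p l))\<^sup>2))"
    by (intro mult_left_mono sum_cs) auto
  finally show ?thesis by (simp add: coeff_energy_def mult.assoc)
qed

section \<open>The unperturbed nodes and discrete Fourier orthogonality\<close>

definition free_freq :: "real \<Rightarrow> int \<Rightarrow> real" where "free_freq h n = pi * of_int n + h"

lemma cis_neq_1: assumes "0 < x" "x < 2 * pi" shows "cis x \<noteq> 1"
proof
  assume "cis x = 1"
  then have "cos x = 1" by (metis cis.sel(1) one_complex.sel(1))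
  moreover have "cos x = 1 - 2 * (sin (x / 2))\<^sup>2" using cos_double_sin[of "x / 2"] by simp
  ultimately have "sin (x / 2) = 0" by simp
  moreover have "sin (x / 2) > 0" using assms by (intro sin_gt_zero) auto
  ultimately show False by simp
qed

lemma root_sum_zero:
  fixes d :: int
  assumes "0 < \<bar>d\<bar>" "\<bar>d\<bar> < int m"
  shows "(\<Sum>i<m. cis (2 * pi * of_int d * real i / real m)) = 0"
proof -
  have m: "m > 0" using assms by simp
  define \<omega> where "\<omega> = cis (2 * pi * (of_int d / real m))"
  have neq: "cis (2 * pi * s) \<noteq> 1" if "0 < s" "s < 1" for s :: real
    using that by (intro cis_neq_1) auto
  have ne: "\<omega> \<noteq> 1"
  proof (cases "d > 0")
    case True
    have "real_of_int d < real m" using assms by linarith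
    then show ?thesis unfolding \<omega>_def using True m by (intro neq) auto
  next
    case False
    have "- real_of_int d < real m" "0 < - real_of_int d" using assms False by linarith+
    then have "cis (2 * pi * (- real_of_int d / real m)) \<noteq> 1" using m by (intro neq) (auto simp: divide_less_0_iff field_simps)
    then have "cnj \<omega> \<noteq> 1" by (simp add: \<omega>_def cis_cnj)
    then show ?thesis by auto
  qed
  have "(\<Sum>i<m. cis (2 * pi * of_int d * real i / real m)) = (\<Sum>i<m. \<omega> ^ i)"
    unfolding \<omega>_def Complex.DeMoivre by (intro sum.cong refl arg_cong[where f=cis]) (simp add: mult_ac)
  also have "\<dots> = (\<omega> ^ m - 1) / (\<omega> - 1)" by (rule geometric_sum[OF ne])
  also have "\<omega> ^ m = cis (2 * pi * of_int d)" unfolding \<omega>_def Complex.DeMoivre using m by simp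
  also have "\<dots> = 1" by (rule cis_multiple_2pi) simp
  finally show ?thesis by simp
qed

lemma cis_mult_cnj: "cis a * cnj (cis b) = cis (a - b)" by (simp add: cis_cnj cis_mult)

lemma free_freq_orth_nodes:
  assumes "l < 2 * N + 1" "k < 2 * N + 1"
  shows "(\<Sum>n\<in>J N. node (free_freq h) N n ^ l * cnj (node (free_freq h) N n ^ k)) = (if l = k then of_nat (2 * N + 1) else 0)"
proof -
  let ?m = "2 * N + 1"
  have r: "(\<Sum>n\<in>J N. f n) = (\<Sum>i<?m. f (int i - int N))" for f :: "int \<Rightarrow> complex"
    by (rule sum.reindex_bij_witness[of _ "\<lambda>i. int i - int N" "\<lambda>n. nat (n + int N)"]) auto
  \<comment> \<open>The offset \<open>h\<close> and the index shift by \<open>N\<close> both go into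
    a prefactor that does not depend on \<open>i\<close>; a plain sum of roots of unity
    remains.\<close>
  have e: "node (free_freq h) N (int i - int N) ^ l * cnj (node (free_freq h) N (int i - int N) ^ k)
    = cis (2 * (real l - real k) * (h - pi * real N) / real ?m) * cis (2 * pi * of_int (int l - int k) * real i / real ?m)" for i
    unfolding node_power cis_mult_cnj cis_mult by (rule arg_cong[where f=cis]) (simp add: free_freq_def field_simps)
  have "(\<Sum>n\<in>J N. node (free_freq h) N n ^ l * cnj (node (free_freq h) N n ^ k)) = 
    cis (2 * (real l - real k) * (h - pi * real N) / real ?m) * (\<Sum>i<?m. cis (2 * pi * of_int (int l - int k) * real i / real ?m))"
    unfolding r e sum_distrib_left ..
  also have "\<dots> = (if l = k then of_nat ?m else 0)"
  proof (cases "l = k")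
    case False
    then have "(\<Sum>i<?m. cis (2 * pi * of_int (int l - int k) * real i / real ?m)) = 0"
      using assms by (intro root_sum_zero) auto
    then show ?thesis using False by simp
  qed simp
  finally show ?thesis .
qed

lemma free_freq_orth_powers:
  assumes "n \<in> J N" "k \<in> J N"
  shows "(\<Sum>l<2 * N + 1. node (free_freq h) N n ^ l * cnj (node (free_freq h) N k ^ l)) = (if n = k then of_nat (2 * N + 1) else 0)"
proof -
  let ?m = "2 * N + 1"
  have e: "node (free_freq h) N n ^ l * cnj (node (free_freq h) N k ^ l) = cis (2 * pi * of_int (n - k) * real l / real ?m)" for l
    unfolding node_power cis_mult_cnj
    by (rule arg_cong[where f=cis]) (simp add: free_freq_def diff_divide_distrib[symmetric] algebra_simps)
  show ?thesis
  proof (cases "n = k")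
    case False
    then show ?thesis unfolding e using assms by (subst root_sum_zero) auto
  next
    case True
    then show ?thesis unfolding e by simp
  qed
qed

lemma parseval_gen:
  assumes "finite A" "finite B"
    and o: "\<And>l k. l \<in> B \<Longrightarrow> k \<in> B \<Longrightarrow> (\<Sum>n\<in>A. f n l * cnj (f n k)) = (if l = k then of_real M else 0)"
  shows "(\<Sum>n\<in>A. (cmod (\<Sum>l\<in>B. a l * f n l))\<^sup>2) = M * (\<Sum>l\<in>B. (cmod (a l))\<^sup>2)"
proof -
  have "complex_of_real (\<Sum>n\<in>A. (cmod (\<Sum>l\<in>B. a l * f n l))\<^sup>2) = (\<Sum>n\<in>A. (\<Sum>l\<in>B. a l * f n l) * cnj (\<Sum>k\<in>B. a k * f n k))"
    by (simp only: mult_cnj_norm of_real_sum of_real_power)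
  also have "\<dots> = (\<Sum>n\<in>A. \<Sum>l\<in>B. \<Sum>k\<in>B. a l * cnj (a k) * (f n l * cnj (f n k)))"
    by (simp add: sum_product mult_ac)
  also have "\<dots> = (\<Sum>l\<in>B. \<Sum>n\<in>A. \<Sum>k\<in>B. a l * cnj (a k) * (f n l * cnj (f n k)))" by (rule sum.swap)
  also have "\<dots> = (\<Sum>l\<in>B. \<Sum>k\<in>B. \<Sum>n\<in>A. a l * cnj (a k) * (f n l * cnj (f n k)))"
    by (intro sum.cong refl sum.swap)
  also have "\<dots> = (\<Sum>l\<in>B. \<Sum>k\<in>B. if l = k then a l * cnj (a k) * of_real M else 0)"
    unfolding sum_distrib_left[symmetric] by (intro sum.cong refl) (auto simp: o)
  also have "\<dots> = (\<Sum>l\<in>B. of_real (M * (cmod (a l))\<^sup>2))"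
    using assms by (simp add: mult_cnj_norm mult.commute)
  also have "\<dots> = of_real (M * (\<Sum>l\<in>B. (cmod (a l))\<^sup>2))" by (simp add: sum_distrib_left)
  finally show ?thesis by (simp only: of_real_eq_iff)
qed

lemma free_freq_parseval:
  assumes "degree p < 2 * N + 1"
  shows "(\<Sum>n\<in>J N. (cmod (poly p (node (free_freq h) N n)))\<^sup>2) = real (2 * N + 1) * coeff_energy (2 * N + 1) p"
  unfolding poly_eq_sum[OF assms] coeff_energy_def
proof (rule parseval_gen)
  fix l k assume "l \<in> {..<2 * N + 1}" "k \<in> {..<2 * N + 1}"
  then show "(\<Sum>n\<in>J N. node (free_freq h) N n ^ l * cnj (node (free_freq h) N n ^ k)) = (if l = k then of_real (real (2 * N + 1)) else 0)"
    using free_freq_orth_nodes[of l N k h] by (simp only: lessThan_iff of_real_of_nat_eq)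
qed auto

lemma free_freq_parseval_dual:
  "(\<Sum>l<2 * N + 1. (cmod (\<Sum>n\<in>J N. a n * node (free_freq h) N n ^ l))\<^sup>2) = real (2 * N + 1) * (\<Sum>n\<in>J N. (cmod (a n))\<^sup>2)"
proof (rule parseval_gen)
  fix n k assume "n \<in> J N" "k \<in> J N"
  then show "(\<Sum>l<2 * N + 1. node (free_freq h) N n ^ l * cnj (node (free_freq h) N k ^ l)) = (if n = k then of_real (real (2 * N + 1)) else 0)"
    using free_freq_orth_powers[of n N k h] by (simp only: of_real_of_nat_eq)
qed auto

section \<open>Stability of sampling under square summable perturbations\<close>

definition l2_close :: "(int \<Rightarrow> real) \<Rightarrow> real \<Rightarrow> real \<Rightarrow> bool" where
  "l2_close \<theta> h D \<longleftrightarrow> (\<forall>A. finite A \<longrightarrow> (\<Sum>n\<in>A. (\<theta> n - free_freq h n)\<^sup>2) \<le> D)"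

lemma node_deviation:
  assumes "degree p < 2 * N + 1" "l2_close \<theta> h D"
  shows "(\<Sum>n\<in>J N. (cmod (poly p (node \<theta> N n) - poly p (node (free_freq h) N n)))\<^sup>2) \<le> 4 * D * (real (2 * N + 1) * coeff_energy (2 * N + 1) p)"
proof -
  have "(\<Sum>n\<in>J N. (cmod (poly p (node \<theta> N n) - poly p (node (free_freq h) N n)))\<^sup>2) \<le> 
    (\<Sum>n\<in>J N. 4 * (\<theta> n - free_freq h n)\<^sup>2 * real (2 * N + 1) * coeff_energy (2 * N + 1) p)"
    by (intro sum_mono poly_nd_diff assms)
  also have "\<dots> = 4 * (\<Sum>n\<in>J N. (\<theta> n - free_freq h n)\<^sup>2) * (real (2 * N + 1) * coeff_energy (2 * N + 1) p)"
    by (simp only: sum_distrib_right[symmetric] sum_distrib_left[symmetric] mult.assoc)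
  also have "\<dots> \<le> 4 * D * (real (2 * N + 1) * coeff_energy (2 * N + 1) p)"
    using assms(2) by (intro mult_right_mono mult_left_mono) (auto simp: l2_close_def coeff_energy_nonneg)
  finally show ?thesis .
qed

lemma node_bessel:
  assumes "degree p < 2 * N + 1" "l2_close \<theta> h D"
  shows "(\<Sum>n\<in>J N. (cmod (poly p (node \<theta> N n)))\<^sup>2) \<le> (2 + 8 * D) * (real (2 * N + 1) * coeff_energy (2 * N + 1) p)"
proof -
  have "(\<Sum>n\<in>J N. (cmod (poly p (node \<theta> N n)))\<^sup>2) \<le> 
    (\<Sum>n\<in>J N. 2 * (cmod (poly p (node (free_freq h) N n)))\<^sup>2 + 2 * (cmod (poly p (node \<theta> N n) - poly p (node (free_freq h) N n)))\<^sup>2)"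
    by (intro sum_mono order_trans[OF _ cmod_add_sq]) simp
  also have "\<dots> \<le> (2 + 8 * D) * (real (2 * N + 1) * coeff_energy (2 * N + 1) p)"
    using node_deviation[OF assms] unfolding sum.distrib sum_distrib_left[symmetric] free_freq_parseval[OF assms(1)]
    by (simp add: algebra_simps)
  finally show ?thesis .
qed

text \<open>A lower Marcinkiewicz-Zygmund inequality. For the unperturbed nodes Parseval gives it
  with \<open>c = 1\<close>; the aim is a \<open>c\<close> that does not depend on
  \<open>N\<close>.\<close>

definition sampling_bound :: "(int \<Rightarrow> real) \<Rightarrow> real \<Rightarrow> nat \<Rightarrow> bool" where
  "sampling_bound \<theta> c N \<longleftrightarrow> (\<forall>p. degree p < 2 * N + 1 \<longrightarrow> 
     c * (real (2 * N + 1) * coeff_energy (2 * N + 1) p) \<le> (\<Sum>n\<in>J N. (cmod (poly p (node \<theta> N n)))\<^sup>2))"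

text \<open>The value \<open>1/16\<close> makes the deviation at most a quarter of the energy; after
  the factor 2 from squaring a sum, half of the energy is left to be absorbed.\<close>

lemma sampling_bound_small:
  assumes "l2_close \<theta> h (1/16)"
  shows "sampling_bound \<theta> (1/4) N"
  unfolding sampling_bound_def
proof (intro allI impI)
  fix p :: "complex poly" assume p: "degree p < 2 * N + 1"
  have "real (2 * N + 1) * coeff_energy (2 * N + 1) p = (\<Sum>n\<in>J N. (cmod (poly p (node (free_freq h) N n)))\<^sup>2)" using free_freq_parseval[OF p] by simp
  also have "\<dots> \<le> 
    (\<Sum>n\<in>J N. 2 * (cmod (poly p (node \<theta> N n)))\<^sup>2 + 2 * (cmod (poly p (node \<theta> N n) - poly p (node (free_freq h) N n)))\<^sup>2)"
    by (intro sum_mono) (metis (no_types) cmod_add_sq norm_minus_commute diff_add_cancel add.commute)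
  also have "\<dots> \<le> 2 * (\<Sum>n\<in>J N. (cmod (poly p (node \<theta> N n)))\<^sup>2) + 1/2 * (real (2 * N + 1) * coeff_energy (2 * N + 1) p)"
    using node_deviation[OF p assms] unfolding sum.distrib sum_distrib_left[symmetric] by simp
  finally show "1/4 * (real (2 * N + 1) * coeff_energy (2 * N + 1) p) \<le> (\<Sum>n\<in>J N. (cmod (poly p (node \<theta> N n)))\<^sup>2)" by simp
qed

text \<open>Solving the coefficient recursion downwards from index \<open>m\<close>, where
  \<open>q\<close> has no coefficient, bounds each coefficient of \<open>q\<close> by the sum of the
  moduli for \<open>G\<close>, because \<open>mu\<close> has modulus 1. Cauchy-Schwarz gives one
  factor \<open>m\<close> and the summation over coefficients the other.\<close>

lemma coeff_energy_quotient:
  assumes q: "G = [:- mu, 1:] * q" and mu: "cmod mu = 1" and d: "degree G < m"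
  shows "coeff_energy m q \<le> (real m)\<^sup>2 * coeff_energy m G"
proof -
  have co: "coeff G (Suc l) = coeff q l - mu * coeff q (Suc l)" for l using q by (simp add: coeff_pCons)
  have dq: "degree q < m"
  proof (cases "q = 0")
    case False
    then have "degree G = Suc (degree q)" unfolding q by (subst degree_mult_eq) auto
    then show ?thesis using d by simp
  qed (use d in auto)
  have b: "cmod (coeff q (m - Suc i)) \<le> (\<Sum>l<m. cmod (coeff G l))" if "i < m" for i
  proof -
    have "cmod (coeff q (m - Suc i)) \<le> (\<Sum>l\<in>{m - i..<m}. cmod (coeff G l))" using that
    proof (induction i)
      case 0
      have "coeff G m = 0" using d by (intro coeff_eq_0)
      moreover have "coeff q m = 0" using dq by (intro coeff_eq_0)
      ultimately have "coeff q (m - 1) = 0" using co[of "m - 1"] 0 by simp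
      then show ?case by simp
    next
      case (Suc i)
      have e: "Suc (m - Suc (Suc i)) = m - Suc i" using Suc.prems by simp
      have "coeff q (m - Suc (Suc i)) = coeff G (m - Suc i) + mu * coeff q (m - Suc i)"
        using co[of "m - Suc (Suc i)"] unfolding e by simp
      then have "cmod (coeff q (m - Suc (Suc i))) \<le> cmod (coeff G (m - Suc i)) + cmod (coeff q (m - Suc i))"
        using norm_triangle_ineq[of "coeff G (m - Suc i)" "mu * coeff q (m - Suc i)"] mu by (simp add: norm_mult)
      also have "\<dots> \<le> cmod (coeff G (m - Suc i)) + (\<Sum>l\<in>{m - i..<m}. cmod (coeff G l))" using Suc by simp
      also have "\<dots> = (\<Sum>l\<in>{m - Suc i..<m}. cmod (coeff G l))"
      proof -
        have "{m - Suc i..<m} = insert (m - Suc i) {m - i..<m}" using Suc.prems by auto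
        then show ?thesis using Suc.prems by simp
      qed
      finally show ?case .
    qed
    also have "\<dots> \<le> (\<Sum>l<m. cmod (coeff G l))" by (intro sum_mono2) auto
    finally show ?thesis .
  qed
  have "coeff_energy m q \<le> (\<Sum>l<m. real m * coeff_energy m G)" unfolding coeff_energy_def
  proof (intro sum_mono)
    fix l assume l: "l \<in> {..<m}"
    then have "cmod (coeff q l) \<le> (\<Sum>l<m. cmod (coeff G l))" using b[of "m - Suc l"] by (simp add: Suc_diff_Suc)
    then have "(cmod (coeff q l))\<^sup>2 \<le> (\<Sum>l<m. cmod (coeff G l))\<^sup>2" by (intro power_mono) auto
    also have "\<dots> \<le> real m * (\<Sum>l<m. (cmod (coeff G l))\<^sup>2)" by (rule sum_cs)
    finally show "(cmod (coeff q l))\<^sup>2 \<le> real m * (\<Sum>l<m. (cmod (coeff G l))\<^sup>2)" .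
  qed
  then show ?thesis by (simp add: power2_eq_square mult_ac)
qed

text \<open>Multiplying by \<open>(z - \<mu>) / (z - \<lambda>)\<close> turns a polynomial vanishing at the new node \<open>\<lambda>\<close> into one
  vanishing at the old node \<open>\<mu>\<close>.\<close>

lemma sampling_bound_swap:
  assumes sq: "l2_close \<theta> h D" and D: "D \<ge> 0" and lb: "sampling_bound \<theta> c N" and c: "c > 0" and j: "j \<in> J N" and e: "e > 0"
    and sep: "\<And>n. n \<in> J N - {j} \<Longrightarrow> e / real (2 * N + 1) \<le> cmod (node \<theta> N n - node (\<theta>(j := t)) N j)"
    and del: "\<delta> = \<bar>t - \<theta> j\<bar>"
  shows "sampling_bound (\<theta>(j := t)) (1 / (4 * (1 + 4 * \<delta>\<^sup>2) * (1 + 2 * \<delta> / e)\<^sup>2 * (6 + 16 * D) / c + 2)) N"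
  unfolding sampling_bound_def
proof (intro allI impI)
  fix p :: "complex poly" assume dp: "degree p < 2 * N + 1"
  define m where "m = 2 * N + 1"
  have m0: "real m > 0" by (simp add: m_def)
  define la mu where "la = node (\<theta>(j := t)) N j" and "mu = node \<theta> N j"
  have n1: "cmod la = 1" "cmod mu = 1" by (simp_all add: la_def mu_def node_def)
  have lm: "cmod (mu - la) \<le> 2 * \<delta> / real m"
  proof -
    have "cmod (mu - la) \<le> \<bar>2 * \<theta> j / real m - 2 * t / real m\<bar>" unfolding la_def mu_def node_def m_def by (simp add: cis_diff_le)
    also have "2 * \<theta> j / real m - 2 * t / real m = 2 * (\<theta> j - t) / real m"
      by (simp add: diff_divide_distrib right_diff_distrib)
    also have "\<bar>2 * (\<theta> j - t) / real m\<bar> = 2 * \<delta> / real m" 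
      unfolding abs_divide abs_mult del abs_minus_commute[of t] by simp
    finally show ?thesis .
  qed
  \<comment> \<open>The normalized Dirichlet kernel at \<open>la\<close>: it has value 1 there with
    coefficient energy only \<open>1 / m\<close>. Subtracting \<open>a * E\<close> from
    \<open>p\<close> creates the zero at \<open>la\<close> at a controlled price.\<close>
  define E where "E = (\<Sum>l<m. monom (cnj la ^ l / of_nat m) l)"
  have cE: "coeff E l = (if l < m then cnj la ^ l / of_nat m else 0)" for l by (simp add: E_def coeff_sum)
  have dE: "degree E < m"
  proof -
    have "degree E \<le> m - 1" by (intro degree_le) (auto simp: cE)
    then show ?thesis by (simp add: m_def)
  qed
  have "la * cnj la = 1" using n1 by (simp add: mult_cnj_norm)
  then have "cnj la ^ l * la ^ l = 1" for l by (metis mult.commute power_mult_distrib power_one)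
  then have E1: "poly E la = 1" using m0 by (simp add: E_def poly_sum poly_monom)
  have pE: "coeff_energy m E = 1 / real m" using m0 n1 by (simp add: coeff_energy_def cE norm_divide norm_power power_divide) (simp add: power2_eq_square)
  define a where "a = poly p la"
  define P where "P = p - smult a E"
  have dP: "degree P < m" unfolding P_def using dp dE by (intro degree_diff_less) (auto simp: m_def intro: le_less_trans[OF degree_smult_le])
  have "poly P la = 0" by (simp add: P_def a_def E1)
  then obtain q where q: "P = [:- la, 1:] * q" by (meson dvdE poly_eq_0_iff_dvd)
  define G where "G = [:- mu, 1:] * q"
  have dG: "degree G < m"
  proof (cases "q = 0")
    case False
    then have "degree G = Suc (degree q)" "degree P = Suc (degree q)" unfolding G_def q by (subst degree_mult_eq; force)+
    then show ?thesis using dP by simp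
  qed (simp add: G_def m_def)
  have pq: "coeff_energy m q \<le> (real m)\<^sup>2 * coeff_energy m G" by (rule coeff_energy_quotient[OF G_def n1(2) dG])
  have PG: "P = G + smult (mu - la) q" unfolding q G_def by (simp add: algebra_simps smult_diff_left)
  \<comment> \<open>The factor \<open>m^2\<close> lost in dividing by \<open>z - mu\<close> is
    regained from \<open>mu - la\<close>, which is of order \<open>1 / m\<close>.\<close>
  have pnP: "coeff_energy m P \<le> 2 * (1 + 4 * \<delta>\<^sup>2) * coeff_energy m G"
  proof -
    have "coeff_energy m P \<le> 2 * coeff_energy m G + 2 * ((cmod (mu - la))\<^sup>2 * coeff_energy m q)" unfolding PG using coeff_energy_add[of m G "smult (mu - la) q"] by (simp add: coeff_energy_smult)
    also have "(cmod (mu - la))\<^sup>2 * coeff_energy m q \<le> (2 * \<delta> / real m)\<^sup>2 * ((real m)\<^sup>2 * coeff_energy m G)"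
      using lm pq by (intro mult_mono power_mono) (auto simp: coeff_energy_nonneg)
    also have "\<dots> = 4 * \<delta>\<^sup>2 * coeff_energy m G" using m0 by (simp add: power_divide power_mult_distrib)
    finally show ?thesis by (simp add: algebra_simps)
  qed
  \<comment> \<open>A bound for \<open>(z - mu) / (z - la)\<close> at the remaining nodes, where the
    separation keeps \<open>z - la\<close> above \<open>e / m\<close>.\<close>
  define \<kappa> where "\<kappa> = 1 + 2 * \<delta> / e"
  have k0: "\<kappa> \<ge> 1" using e by (simp add: \<kappa>_def del)
  define S where "S = (\<Sum>n\<in>J N. (cmod (poly p (node (\<theta>(j := t)) N n)))\<^sup>2)"
  have S: "S = (cmod a)\<^sup>2 + (\<Sum>n\<in>J N - {j}. (cmod (poly p (node \<theta> N n)))\<^sup>2)"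
    unfolding S_def using j by (subst sum.remove[of _ j]) (auto simp: a_def la_def node_def intro!: sum.cong)
  have GP: "cmod (poly G (node \<theta> N n)) \<le> \<kappa> * cmod (poly P (node \<theta> N n))" if n: "n \<in> J N - {j}" for n
  proof -
    let ?z = "node \<theta> N n"
    have s: "e / real m \<le> cmod (?z - la)" using sep[OF n] by (simp add: la_def m_def)
    have "cmod (?z - mu) \<le> cmod (?z - la) + cmod (mu - la)"
      using norm_triangle_ineq[of "?z - la" "la - mu"] by (simp add: norm_minus_commute)
    also have "\<dots> \<le> cmod (?z - la) + 2 * \<delta> / e * (e / real m)" using lm e by simp
    also have "\<dots> \<le> cmod (?z - la) + 2 * \<delta> / e * cmod (?z - la)" using s e by (intro add_left_mono mult_left_mono) (auto simp: del)
    finally have "cmod (?z - mu) \<le> \<kappa> * cmod (?z - la)" by (simp add: \<kappa>_def algebra_simps)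
    then have "cmod (?z - mu) * cmod (poly q ?z) \<le> \<kappa> * cmod (?z - la) * cmod (poly q ?z)" by (intro mult_right_mono) auto
    moreover have "poly G ?z = (?z - mu) * poly q ?z" "poly P ?z = (?z - la) * poly q ?z"
      by (simp_all add: G_def q algebra_simps)
    ultimately show ?thesis by (simp add: norm_mult mult.assoc)
  qed
  have EB: "(\<Sum>n\<in>J N. (cmod (poly E (node \<theta> N n)))\<^sup>2) \<le> 2 + 8 * D"
    using node_bessel[OF dE[unfolded m_def] sq] pE m0 unfolding m_def[symmetric] by simp
  have PS: "(\<Sum>n\<in>J N - {j}. (cmod (poly P (node \<theta> N n)))\<^sup>2) \<le> (6 + 16 * D) * S"
  proof -
    have "(\<Sum>n\<in>J N - {j}. (cmod (poly P (node \<theta> N n)))\<^sup>2) \<le> 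
      (\<Sum>n\<in>J N - {j}. 2 * (cmod (poly p (node \<theta> N n)))\<^sup>2 + 2 * (cmod a)\<^sup>2 * (cmod (poly E (node \<theta> N n)))\<^sup>2)"
    proof (intro sum_mono)
      fix n
      show "(cmod (poly P (node \<theta> N n)))\<^sup>2 \<le> 2 * (cmod (poly p (node \<theta> N n)))\<^sup>2 + 2 * (cmod a)\<^sup>2 * (cmod (poly E (node \<theta> N n)))\<^sup>2"
        using cmod_add_sq[of "poly p (node \<theta> N n)" "- (a * poly E (node \<theta> N n))"]
        by (simp add: P_def norm_mult power_mult_distrib)
    qed
    also have "\<dots> = 2 * (\<Sum>n\<in>J N - {j}. (cmod (poly p (node \<theta> N n)))\<^sup>2) + 2 * (cmod a)\<^sup>2 * (\<Sum>n\<in>J N - {j}. (cmod (poly E (node \<theta> N n)))\<^sup>2)"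
      by (simp add: sum.distrib sum_distrib_left)
    also have "\<dots> \<le> 2 * S + 2 * S * (2 + 8 * D)"
    proof (intro add_mono mult_mono)
      show "(\<Sum>n\<in>J N - {j}. (cmod (poly E (node \<theta> N n)))\<^sup>2) \<le> 2 + 8 * D"
        by (rule order_trans[OF sum_mono2 EB]) auto
    qed (auto simp: S sum_nonneg)
    finally show ?thesis by (simp add: algebra_simps)
  qed
  have G: "c * (real m * coeff_energy m G) \<le> \<kappa>\<^sup>2 * ((6 + 16 * D) * S)"
  proof -
    have "c * (real m * coeff_energy m G) \<le> (\<Sum>n\<in>J N. (cmod (poly G (node \<theta> N n)))\<^sup>2)"
      using lb dG unfolding sampling_bound_def m_def by blast
    \<comment> \<open>\<open>G\<close> vanishes at the old node, so the old sampling bound now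
      involves only the nodes that both families share.\<close>
    also have "\<dots> = (\<Sum>n\<in>J N - {j}. (cmod (poly G (node \<theta> N n)))\<^sup>2)"
      using j by (subst sum.remove[of _ j]) (auto simp: G_def mu_def)
    also have "\<dots> \<le> (\<Sum>n\<in>J N - {j}. \<kappa>\<^sup>2 * (cmod (poly P (node \<theta> N n)))\<^sup>2)"
      by (intro sum_mono) (metis GP norm_ge_zero power_mono power_mult_distrib)
    also have "\<dots> \<le> \<kappa>\<^sup>2 * ((6 + 16 * D) * S)" unfolding sum_distrib_left[symmetric] using PS by (intro mult_left_mono) auto
    finally show ?thesis .
  qed
  define B where "B = 4 * (1 + 4 * \<delta>\<^sup>2) * \<kappa>\<^sup>2 * (6 + 16 * D) / c + 2"
  have B0: "B > 0" unfolding B_def using D c by (intro add_nonneg_pos divide_nonneg_pos) auto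
  have "coeff_energy m p \<le> 2 * coeff_energy m P + 2 * ((cmod a)\<^sup>2 * (1 / real m))"
    using coeff_energy_add[of m P "smult a E"] by (simp add: P_def coeff_energy_smult pE)
  then have "real m * coeff_energy m p \<le> real m * (2 * coeff_energy m P + 2 * ((cmod a)\<^sup>2 * (1 / real m)))" using m0 by (intro mult_left_mono) auto
  also have "\<dots> = 2 * (real m * coeff_energy m P) + 2 * (cmod a)\<^sup>2" using m0 by (simp add: algebra_simps)
  also have "\<dots> \<le> 2 * (real m * (2 * (1 + 4 * \<delta>\<^sup>2) * coeff_energy m G)) + 2 * S"
    using pnP m0 by (intro add_mono mult_left_mono) (auto simp: S sum_nonneg)
  also have "\<dots> = 4 * (1 + 4 * \<delta>\<^sup>2) / c * (c * (real m * coeff_energy m G)) + 2 * S" using c by (simp add: field_simps)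
  also have "\<dots> \<le> 4 * (1 + 4 * \<delta>\<^sup>2) / c * (\<kappa>\<^sup>2 * ((6 + 16 * D) * S)) + 2 * S" using G c by (intro add_right_mono mult_left_mono) auto
  also have "\<dots> = B * S" using c by (simp add: B_def field_simps)
  finally show "1 / (4 * (1 + 4 * \<delta>\<^sup>2) * (1 + 2 * \<delta> / e)\<^sup>2 * (6 + 16 * D) / c + 2) * (real (2 * N + 1) * coeff_energy (2 * N + 1) p)
    \<le> (\<Sum>n\<in>J N. (cmod (poly p (node (\<theta>(j := t)) N n)))\<^sup>2)"
    using B0 unfolding B_def[symmetric, unfolded \<kappa>_def] S_def[symmetric] m_def[symmetric] by (simp add: field_simps)
qed

lemma l2_close_dev: assumes "l2_close \<theta> h D" shows "\<bar>\<theta> n - free_freq h n\<bar> \<le> sqrt D"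
proof -
  have "(\<theta> n - free_freq h n)\<^sup>2 \<le> D" using assms[unfolded l2_close_def, rule_format, of "{n}"] by simp
  then show ?thesis using real_le_rsqrt by (metis abs_le_iff power2_abs real_le_rsqrt)
qed

text \<open>Only finitely many frequencies come within distance 1 of \<open>t\<close>, so a positive
  minimal distance \<open>e0\<close> exists. For large \<open>N\<close> all angular differences are
  at most 4, short of a full turn, and chords on the circle are then comparable to the differences
  of frequencies divided by \<open>m\<close>.\<close>

lemma separation:
  assumes sq: "l2_close \<theta> h D" and t: "\<And>n. n \<noteq> j \<Longrightarrow> \<theta> n \<noteq> t"
  shows "\<exists>e>0. \<forall>\<^sub>F N in sequentially. \<forall>n\<in>J N - {j}. e / real (2 * N + 1) \<le> cmod (node \<theta> N n - node (\<theta>(j := t)) N j)"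
proof -
  define K where "K = \<bar>h\<bar> + sqrt D + \<bar>t\<bar>"
  have dist1: "\<bar>\<theta> n - t\<bar> \<ge> pi * \<bar>of_int n\<bar> - K" and dist2: "\<bar>\<theta> n - t\<bar> \<le> pi * \<bar>of_int n\<bar> + K" for n
  proof -
    have a: "\<bar>\<theta> n - (pi * of_int n + h)\<bar> \<le> sqrt D" using l2_close_dev[OF sq, of n] by (simp add: free_freq_def)
    have b: "pi * \<bar>of_int n\<bar> = \<bar>pi * of_int n\<bar>" by (simp add: abs_mult)
    show "\<bar>\<theta> n - t\<bar> \<ge> pi * \<bar>of_int n\<bar> - K" "\<bar>\<theta> n - t\<bar> \<le> pi * \<bar>of_int n\<bar> + K"
      unfolding b K_def using a by linarith+
  qed
  define F where "F = {n. n \<noteq> j \<and> \<bar>\<theta> n - t\<bar> < 1}"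
  have "F \<subseteq> {- \<lceil>K + 1\<rceil>..\<lceil>K + 1\<rceil>}"
  proof
    fix n assume "n \<in> F"
    then have "pi * \<bar>of_int n\<bar> < K + 1" using dist1[of n] by (simp add: F_def)
    moreover have "1 * \<bar>of_int n\<bar> \<le> pi * \<bar>real_of_int n\<bar>" using pi_gt3 by (intro mult_right_mono) auto
    ultimately have "\<bar>real_of_int n\<bar> \<le> K + 1" by linarith
    then show "n \<in> {- \<lceil>K + 1\<rceil>..\<lceil>K + 1\<rceil>}" by (simp add: abs_le_iff) linarith
  qed
  then have fF: "finite F" using finite_subset by blast
  define e0 where "e0 = Min (insert 1 ((\<lambda>n. \<bar>\<theta> n - t\<bar>) ` F))"
  have e0: "e0 > 0" unfolding e0_def using fF t by (subst Min_gr_iff) (auto simp: F_def)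
  have e0n: "\<bar>\<theta> n - t\<bar> \<ge> e0" if "n \<noteq> j" for n
  proof (cases "n \<in> F")
    case True
    then show ?thesis unfolding e0_def using fF by (intro Min_le) auto
  next
    case False
    then have "\<bar>\<theta> n - t\<bar> \<ge> 1" using that by (simp add: F_def)
    moreover have "e0 \<le> 1" unfolding e0_def using fF by (intro Min_le) auto
    ultimately show ?thesis by simp
  qed
  \<comment> \<open>Beyond \<open>N0\<close> the constant \<open>K\<close> is at most
    \<open>(4 - pi) * N\<close>, which keeps \<open>pi * N + K\<close> below
    \<open>4 * N\<close>.\<close>
  obtain N0 :: nat where N0: "real N0 > K / (4 - pi)" using reals_Archimedean2 by blast
  show ?thesis
  proof (intro exI[of _ "e0 / 2"] conjI)
    show "e0 / 2 > 0" using e0 by simp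
    show "\<forall>\<^sub>F N in sequentially. \<forall>n\<in>J N - {j}. e0 / 2 / real (2 * N + 1) \<le> cmod (node \<theta> N n - node (\<theta>(j := t)) N j)"
      using eventually_ge_at_top[of N0]
    proof eventually_elim
      case (elim N)
      show ?case
      proof
        fix n assume n: "n \<in> J N - {j}"
        have "\<bar>\<theta> n - t\<bar> \<le> pi * \<bar>of_int n\<bar> + K" by (rule dist2)
        also have "\<dots> \<le> pi * real N + K" using n by (intro add_right_mono mult_left_mono) auto
        also have "K \<le> (4 - pi) * real N"
        proof -
          have "K / (4 - pi) \<le> real N" using N0 elim by linarith
          then show ?thesis using pi_less_4 by (simp add: field_simps)
        qed
        finally have "\<bar>\<theta> n - t\<bar> \<le> 4 * real N" by (simp add: algebra_simps)
        then have b: "\<bar>\<theta> n - t\<bar> / real (2 * N + 1) \<le> 2" by (simp add: field_simps)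
        have "2 * \<theta> n / real (2 * N + 1) - 2 * t / real (2 * N + 1) = 2 * ((\<theta> n - t) / real (2 * N + 1))"
          by (simp add: diff_divide_distrib right_diff_distrib)
        note eq0 = this
        have eq: "\<bar>2 * \<theta> n / real (2 * N + 1) - 2 * t / real (2 * N + 1)\<bar> = 2 * (\<bar>\<theta> n - t\<bar> / real (2 * N + 1))"
          unfolding eq0 abs_mult abs_divide by simp
        have s1: "cmod (node \<theta> N n - node (\<theta>(j := t)) N j) \<ge> 2 * (\<bar>\<theta> n - t\<bar> / real (2 * N + 1)) / 4"
          using cis_diff_ge[of "2 * \<theta> n / real (2 * N + 1)" "2 * t / real (2 * N + 1)"] b unfolding eq node_def by simp
        have s2: "2 * (\<bar>\<theta> n - t\<bar> / real (2 * N + 1)) / 4 \<ge> 2 * (e0 / real (2 * N + 1)) / 4"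
          using e0n[of n] n by (intro divide_right_mono mult_left_mono) auto
        have s3: "2 * (e0 / M) / 4 = e0 / 2 / M" for M :: real by simp
        show "e0 / 2 / real (2 * N + 1) \<le> cmod (node \<theta> N n - node (\<theta>(j := t)) N j)"
          using order_trans[OF s2 s1] unfolding s3 .
      qed
    qed
  qed
qed

text \<open>Replacing the frequencies of a finite block \<open>J L\<close> by nearly free ones makes
  the whole family close enough for \<open>sampling_bound_small\<close>. The true frequencies are
  then restored one at a time; each restoration worsens the constant but keeps it independent of
  \<open>N\<close>.\<close>

lemma sampling_bound_eventually:
  assumes inj: "inj \<theta>" and sq: "(\<lambda>n. (\<theta> n - free_freq h n)\<^sup>2) summable_on UNIV"
  shows "\<exists>c>0. \<forall>\<^sub>F N in sequentially. sampling_bound \<theta> c N"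
proof -
  let ?f = "\<lambda>n. (\<theta> n - free_freq h n)\<^sup>2"
  define D where "D = infsum ?f UNIV"
  have fD: "sum ?f A \<le> D" if "finite A" for A unfolding D_def using that by (intro finite_sum_le_infsum[OF sq]) auto
  obtain F where F: "finite F" "dist (sum ?f F) D \<le> 1/64" using infsum_finite_approximation[OF sq, of "1/64"] by (auto simp: D_def)
  obtain L :: nat where L: "F \<subseteq> J L"
  proof -
    have "finite ((\<lambda>n. nat \<bar>n\<bar>) ` F)" using F by simp
    then obtain L where "\<And>n. n \<in> F \<Longrightarrow> nat \<bar>n\<bar> \<le> L" by (meson finite_nat_set_iff_bounded_le imageI)
    then have "F \<subseteq> J L" by fastforce
    then show ?thesis using that by blast
  qed
  have tail: "sum ?f A \<le> 1/64" if A: "finite A" "A \<inter> J L = {}" for A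
  proof -
    have "sum ?f (A \<union> F) = sum ?f A + sum ?f F" using A F L by (intro sum.union_disjoint) auto
    moreover have "sum ?f (A \<union> F) \<le> D" using A F by (intro fD) auto
    ultimately show ?thesis using F(2) unfolding dist_real_def by linarith
  qed
  \<comment> \<open>For \<open>e < e0\<close> the shifted block adds at most
    \<open>(2 L + 1) * e0 = 1/64\<close> to the squared deviation.\<close>
  define e0 where "e0 = 1 / (64 * (2 * real L + 1))"
  have e0: "e0 > 0" "e0 \<le> 1" by (auto simp: e0_def divide_le_eq_1)
  \<comment> \<open>Shifts to be avoided: for \<open>e\<close> outside \<open>X\<close> no frequency
    being restored meets one that is still shifted, so \<open>separation\<close> applies at every
    stage.\<close>
  define X where "X = (\<lambda>(i, k). \<theta> i - free_freq h k) ` (J L \<times> J L)"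
  have "finite X" by (simp add: X_def)
  then have "infinite ({0<..<e0} - X)" using e0 by (simp add: infinite_Ioo)
  then obtain e where e: "0 < e" "e < e0" "e \<notin> X" by (metis Diff_iff finite.emptyI greaterThanLessThan_iff ex_in_conv)
  \<comment> \<open>\<open>S\<close> is the set of indices already restored.\<close>
  define \<Theta> where "\<Theta> S n = (if n \<in> J L \<and> n \<notin> S then free_freq h n + e else \<theta> n)" for S :: "int set" and n
  have sq': "l2_close (\<Theta> S) h (D + (2 * real L + 1) * e\<^sup>2)" for S
    unfolding l2_close_def
  proof (intro allI impI)
    fix A :: "int set" assume A: "finite A"
    have "(\<Sum>n\<in>A. (\<Theta> S n - free_freq h n)\<^sup>2) \<le> (\<Sum>n\<in>A. ?f n + (if n \<in> J L then e\<^sup>2 else 0))"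
      by (intro sum_mono) (auto simp: \<Theta>_def)
    also have "\<dots> = sum ?f A + (\<Sum>n\<in>A \<inter> J L. e\<^sup>2)" by (simp only: sum.distrib sum.inter_restrict[OF A])
    also have "\<dots> \<le> D + (\<Sum>n\<in>J L. e\<^sup>2)" using A by (intro add_mono fD sum_mono2) auto
    also have "\<dots> = D + (2 * real L + 1) * e\<^sup>2" by simp
    finally show "(\<Sum>n\<in>A. (\<Theta> S n - free_freq h n)\<^sup>2) \<le> D + (2 * real L + 1) * e\<^sup>2" .
  qed
  have D0: "D + (2 * real L + 1) * e\<^sup>2 \<ge> 0" using fD[of "{}"] by simp
  have base: "l2_close (\<Theta> {}) h (1/16)" unfolding l2_close_def
  proof (intro allI impI)
    fix A :: "int set" assume A: "finite A"
    have "(\<Sum>n\<in>A. (\<Theta> {} n - free_freq h n)\<^sup>2) = (\<Sum>n\<in>A - J L. ?f n) + (\<Sum>n\<in>A \<inter> J L. e\<^sup>2)"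
    proof -
      have "A = (A - J L) \<union> (A \<inter> J L)" by blast
      then have "(\<Sum>n\<in>A. (\<Theta> {} n - free_freq h n)\<^sup>2) = (\<Sum>n\<in>A - J L. (\<Theta> {} n - free_freq h n)\<^sup>2) + (\<Sum>n\<in>A \<inter> J L. (\<Theta> {} n - free_freq h n)\<^sup>2)"
        using A by (metis (no_types, lifting) sum.Int_Diff add.commute)
      also have "(\<Sum>n\<in>A - J L. (\<Theta> {} n - free_freq h n)\<^sup>2) = (\<Sum>n\<in>A - J L. ?f n)" by (intro sum.cong) (auto simp: \<Theta>_def)
      also have "(\<Sum>n\<in>A \<inter> J L. (\<Theta> {} n - free_freq h n)\<^sup>2) = (\<Sum>n\<in>A \<inter> J L. e\<^sup>2)" by (intro sum.cong) (auto simp: \<Theta>_def)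
      finally show ?thesis .
    qed
    also have "\<dots> \<le> 1/64 + (\<Sum>n\<in>J L. e\<^sup>2)" using A by (intro add_mono tail sum_mono2) auto
    also have "(\<Sum>n\<in>J L. e\<^sup>2) = (2 * real L + 1) * e\<^sup>2" by simp
    also have "\<dots> \<le> (2 * real L + 1) * (e0 * 1)" using e e0 unfolding power2_eq_square by (intro mult_left_mono mult_mono) auto
    also have "\<dots> = 1/64" by (simp add: e0_def)
    finally show "(\<Sum>n\<in>A. (\<Theta> {} n - free_freq h n)\<^sup>2) \<le> 1/16" by simp
  qed
  have step: "\<exists>c>0. \<forall>\<^sub>F N in sequentially. sampling_bound (\<Theta> S) c N" if "finite S" "S \<subseteq> J L" for S
    using that
  proof (induction S rule: finite_induct)
    case empty
    then show ?case using sampling_bound_small[OF base] by (intro exI[of _ "1/4"]) auto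
  next
    case (insert j S)
    then obtain c where c: "c > 0" "\<forall>\<^sub>F N in sequentially. sampling_bound (\<Theta> S) c N" by auto
    have jL: "j \<in> J L" using insert by simp
    have up: "\<Theta> (insert j S) = (\<Theta> S)(j := \<theta> j)" by (auto simp: \<Theta>_def fun_eq_iff)
    have "\<Theta> S n \<noteq> \<theta> j" if n: "n \<noteq> j" for n
    proof (cases "n \<in> J L \<and> n \<notin> S")
      case True
      have "e \<noteq> \<theta> j - free_freq h n" using e(3) True jL unfolding X_def by force
      then show ?thesis using True by (auto simp: \<Theta>_def)
    next
      case False
      then show ?thesis using inj n by (auto simp: \<Theta>_def inj_def)
    qed
    from separation[OF sq' this] obtain s where s: "s > 0" 
      "\<forall>\<^sub>F N in sequentially. \<forall>n\<in>J N - {j}. s / real (2 * N + 1) \<le> cmod (node (\<Theta> S) N n - node ((\<Theta> S)(j := \<theta> j)) N j)" by blast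
    define c' where "c' = 1 / (4 * (1 + 4 * \<bar>\<theta> j - \<Theta> S j\<bar>\<^sup>2) * (1 + 2 * \<bar>\<theta> j - \<Theta> S j\<bar> / s)\<^sup>2 * (6 + 16 * (D + (2 * real L + 1) * e\<^sup>2)) / c + 2)"
    have "c' > 0" unfolding c'_def using c(1) D0
      by (intro divide_pos_pos add_nonneg_pos divide_nonneg_pos mult_nonneg_nonneg) auto
    moreover have "\<forall>\<^sub>F N in sequentially. sampling_bound (\<Theta> (insert j S)) c' N"
      using c(2) s(2) eventually_ge_at_top[of L]
    proof eventually_elim
      case (elim N)
      then have "j \<in> J N" using jL by auto
      then show ?case unfolding up c'_def using elim s c D0 by (intro sampling_bound_swap[OF sq']) auto
    qed
    ultimately show ?case by blast
  qed
  have "\<Theta> (J L) = \<theta>" by (auto simp: \<Theta>_def)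
  then show ?thesis using step[of "J L"] by simp
qed

section \<open>Verblunsky coefficients of the discretized data\<close>

lemma sum_mult_sq_le:
  fixes f g :: "'a \<Rightarrow> real"
  shows "(\<Sum>i\<in>A. \<bar>f i\<bar> * \<bar>g i\<bar>)\<^sup>2 \<le> (\<Sum>i\<in>A. (f i)\<^sup>2) * (\<Sum>i\<in>A. (g i)\<^sup>2)"
proof -
  have "(\<Sum>i\<in>A. \<bar>f i\<bar> * \<bar>g i\<bar>)\<^sup>2 \<le> (L2_set f A * L2_set g A)\<^sup>2"
    by (intro power_mono L2_set_mult_ineq) (auto intro: sum_nonneg)
  then show ?thesis by (simp add: power_mult_distrib L2_set_def sum_nonneg)
qed

context circle_data
begin

lemma ip_monom: assumes "j \<le> k" shows "ip (monom 1 k) (monom 1 j) = ip (monom 1 (k - j)) 1"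
proof -
  have "poly (monom 1 k) (z n) * cnj (poly (monom 1 j) (z n)) = poly (monom 1 (k - j)) (z n)" if "n \<in> I" for n
  proof -
    have "z n ^ k * cnj (z n ^ j) = z n ^ (k - j) * (z n * cnj (z n)) ^ j"
      using assms by (simp add: power_mult_distrib mult.assoc[symmetric] power_add[symmetric])
    also have "\<dots> = z n ^ (k - j)" by (simp only: zcnj[OF that] power_one mult_1_right)
    finally show ?thesis by (simp add: poly_monom)
  qed
  then show ?thesis unfolding ip_def by (auto simp: mult.assoc intro!: sum.cong)
qed

text \<open>Write \<open>P (Suc k) = z^(k+1) + b\<close>. Orthogonality to \<open>b\<close> gives
  \<open><b, b> = - <z^(k+1), b>\<close>, whence the coefficients of \<open>b\<close> have size
  \<open>sqrt K / \<kappa>\<close> by the sampling bound. Orthogonality to 1 then expresses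
  \<open>c k\<close>, the negated constant term of \<open>b\<close>, by a single moment and a
  correction of size \<open>K / \<kappa>\<close>. With \<open>K\<close> of order
  \<open>1 / m\<close> the sum of squares has that order too.\<close>

lemma verblunsky_bound:
  assumes \<kappa>: "\<kappa> > 0" and lb: "\<And>p. degree p < m \<Longrightarrow> \<kappa> * coeff_energy m p \<le> (\<Sum>n\<in>I. w n * (cmod (poly p (z n)))\<^sup>2)"
    and K: "(\<Sum>l\<in>{1..<m}. (cmod (ip (monom 1 l) 1))\<^sup>2) \<le> K"
  shows "(N 0)\<^sup>2 * (\<Sum>k<m - 1. (cmod (c k))\<^sup>2) \<le> 2 * K + 2 * real m * K\<^sup>2 / \<kappa>\<^sup>2"
proof -
  define M where "M l = ip (monom 1 l) 1" for l
  have K0: "K \<ge> 0" using K by (rule order_trans[rotated]) (simp add: sum_nonneg)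
  have M0: "M 0 = of_real (N 0)" unfolding M_def using ipPP[of 0] by (simp add: P_0 monom_0 one_pCons)
  have each: "(N 0)\<^sup>2 * (cmod (c k))\<^sup>2 \<le> 2 * (cmod (M (Suc k)))\<^sup>2 + 2 * (K\<^sup>2 / \<kappa>\<^sup>2)" if k: "k < m - 1" for k
  proof -
    have km: "Suc k < m" using k by simp
    define b where "b = P (Suc k) - monom 1 (Suc k)"
    have cb0: "coeff b i = 0" if "i > k" for i
      using that coeff_P_lead[of "Suc k"] degree_PQ(1)[of "Suc k"] by (cases "i = Suc k") (auto simp: b_def coeff_eq_0)
    have db: "degree b \<le> k" using cb0 by (intro degree_le) auto
    have bsum: "b = (\<Sum>j\<le>k. smult (coeff b j) (monom 1 j))"
      by (rule poly_eqI) (auto simp: coeff_sum cb0 if_distrib sum.delta cong: if_cong)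
    have Pb: "P (Suc k) = monom 1 (Suc k) + b" by (simp add: b_def)
    have o: "ip (P (Suc k)) b = 0" using db km by (intro orth_P) auto
    have pnb: "coeff_energy m b = (\<Sum>j\<le>k. (cmod (coeff b j))\<^sup>2)"
      unfolding coeff_energy_def using km cb0 by (intro sum.mono_neutral_right) auto
    define x where "x = sqrt (coeff_energy m b)"
    have x: "x \<ge> 0" "x\<^sup>2 = coeff_energy m b" by (simp_all add: x_def coeff_energy_nonneg)
    have sub: "(\<Sum>j\<in>A. (cmod (M (f j)))\<^sup>2) \<le> K" if "inj_on f A" "f ` A \<subseteq> {1..<m}" "finite A" for f :: "nat \<Rightarrow> nat" and A
    proof -
      have "(\<Sum>j\<in>A. (cmod (M (f j)))\<^sup>2) = (\<Sum>l\<in>f ` A. (cmod (M l))\<^sup>2)" by (simp add: sum.reindex[OF that(1)])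
      also have "\<dots> \<le> (\<Sum>l\<in>{1..<m}. (cmod (M l))\<^sup>2)" using that by (intro sum_mono2) auto
      finally show ?thesis using K by (simp add: M_def)
    qed
    have cs: "(\<Sum>j\<in>A. cmod (coeff b j) * cmod (M (f j))) \<le> x * sqrt K" if "inj_on f A" "f ` A \<subseteq> {1..<m}" "A \<subseteq> {..k}" for f :: "nat \<Rightarrow> nat" and A
    proof (rule power2_le_imp_le)
      have fA: "finite A" using that finite_subset by blast
      have "(\<Sum>j\<in>A. cmod (coeff b j) * cmod (M (f j)))\<^sup>2 \<le> (\<Sum>j\<in>A. (cmod (coeff b j))\<^sup>2) * (\<Sum>j\<in>A. (cmod (M (f j)))\<^sup>2)"
        using sum_mult_sq_le[of "\<lambda>j. cmod (coeff b j)" "\<lambda>j. cmod (M (f j))" A] by simp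
      also have "\<dots> \<le> coeff_energy m b * K" unfolding pnb using that fA sub
        by (intro mult_mono sum_mono2) (auto intro: sum_nonneg)
      finally show "(\<Sum>j\<in>A. cmod (coeff b j) * cmod (M (f j)))\<^sup>2 \<le> (x * sqrt K)\<^sup>2" using K0 x by (simp add: power_mult_distrib)
    qed (use x K0 in auto)
    have "ip b b = - ip (monom 1 (Suc k)) b" using o unfolding Pb ip_add by (simp add: eq_neg_iff_add_eq_0 add.commute)
    also have "ip (monom 1 (Suc k)) b = (\<Sum>j\<le>k. ip (monom 1 (Suc k)) (smult (coeff b j) (monom 1 j)))"
      by (subst bsum) (rule ip_sum(2))
    also have "\<dots> = (\<Sum>j\<le>k. cnj (coeff b j) * M (Suc k - j))"
      by (intro sum.cong refl) (auto simp: ip_smult ip_monom M_def)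
    finally have ibb: "cmod (ip b b) = cmod (\<Sum>j\<le>k. cnj (coeff b j) * M (Suc k - j))" by simp
    have "\<kappa> * x\<^sup>2 \<le> cmod (ip b b)" unfolding x ip_self norm_of_real
      using lb[of b] db km by (intro order_trans[OF _ abs_ge_self]) auto
    also have "\<dots> \<le> (\<Sum>j\<le>k. cmod (coeff b j) * cmod (M (Suc k - j)))"
      unfolding ibb by (rule order_trans[OF norm_sum]) (simp add: norm_mult)
    also have "\<dots> \<le> x * sqrt K" using km by (intro cs) (auto simp: inj_on_def)
    finally have "\<kappa> * x\<^sup>2 \<le> x * sqrt K" .
    then have xK: "x \<le> sqrt K / \<kappa>" using x \<kappa> K0 by (cases "x = 0") (auto simp: power2_eq_square field_simps)
    have "ip (P (Suc k)) 1 = 0" using orth_P[of "Suc k" 1] km by simp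
    then have "M (Suc k) + ip b 1 = 0" unfolding Pb ip_add M_def .
    also have "ip b 1 = (\<Sum>j\<le>k. coeff b j * M j)" by (subst bsum) (simp add: ip_sum(1) ip_smult M_def)
    also have "\<dots> = coeff b 0 * M 0 + (\<Sum>j\<in>{1..k}. coeff b j * M j)"
    proof -
      have "{..k} = insert 0 {1..k}" by auto
      then show ?thesis by simp
    qed
    also have "coeff b 0 = - c k" by (simp add: b_def coeff_P_0)
    finally have "of_real (N 0) * c k = M (Suc k) + (\<Sum>j\<in>{1..k}. coeff b j * M j)" by (simp add: M0 algebra_simps)
    then have "N 0 * cmod (c k) = cmod (M (Suc k) + (\<Sum>j\<in>{1..k}. coeff b j * M j))"
      using N_pos[of 0] km by (metis norm_mult norm_of_real abs_of_pos gr_zeroI not_less0 less_trans zero_less_Suc)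
    also have "\<dots> \<le> cmod (M (Suc k)) + (\<Sum>j\<in>{1..k}. cmod (coeff b j) * cmod (M j))"
      by (intro order_trans[OF norm_triangle_ineq] add_left_mono order_trans[OF norm_sum]) (simp add: norm_mult)
    also have "\<dots> \<le> cmod (M (Suc k)) + x * sqrt K" 
    proof (intro add_left_mono)
      have "(\<lambda>j. j) ` {1..k} \<subseteq> {1..<m}" using km by auto
      then show "(\<Sum>j\<in>{1..k}. cmod (coeff b j) * cmod (M j)) \<le> x * sqrt K" using cs[of "\<lambda>j. j" "{1..k}"] by auto
    qed
    also have "x * sqrt K \<le> sqrt K / \<kappa> * sqrt K" using xK K0 by (intro mult_right_mono) auto
    also have "\<dots> = K / \<kappa>" using K0 by simp
    finally have "(N 0 * cmod (c k))\<^sup>2 \<le> (cmod (M (Suc k)) + K / \<kappa>)\<^sup>2"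
      using N_pos[of 0] km by (intro power_mono) auto
    also have "\<dots> \<le> 2 * (cmod (M (Suc k)))\<^sup>2 + 2 * (K / \<kappa>)\<^sup>2"
      using sum_squares_bound[of "cmod (M (Suc k))" "K / \<kappa>"] by (simp add: power2_sum)
    finally show ?thesis by (simp add: power_mult_distrib power_divide)
  qed
  have "(N 0)\<^sup>2 * (\<Sum>k<m - 1. (cmod (c k))\<^sup>2) \<le> (\<Sum>k<m - 1. 2 * (cmod (M (Suc k)))\<^sup>2 + 2 * (K\<^sup>2 / \<kappa>\<^sup>2))"
    unfolding sum_distrib_left by (intro sum_mono each) auto
  also have "\<dots> = 2 * (\<Sum>k<m - 1. (cmod (M (Suc k)))\<^sup>2) + real (m - 1) * (2 * (K\<^sup>2 / \<kappa>\<^sup>2))"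
    by (simp add: sum.distrib sum_distrib_left)
  also have "(\<Sum>k<m - 1. (cmod (M (Suc k)))\<^sup>2) = (\<Sum>l\<in>{1..<m}. (cmod (M l))\<^sup>2)"
    by (rule sum.reindex_bij_witness[of _ "\<lambda>l. l - 1" Suc]) auto
  also have "2 * (\<Sum>l\<in>{1..<m}. (cmod (M l))\<^sup>2) + real (m - 1) * (2 * (K\<^sup>2 / \<kappa>\<^sup>2)) \<le> 2 * K + real m * (2 * (K\<^sup>2 / \<kappa>\<^sup>2))"
    using K \<kappa> by (intro add_mono mult_right_mono mult_left_mono) (auto simp: M_def)
  finally show ?thesis by (simp add: algebra_simps)
qed

end

lemma cis_taylor: "cmod (cis x - 1 - \<i> * of_real x) \<le> x\<^sup>2"
  using Taylor_exp[of "\<i> * of_real x" 1] by (simp add: cis_conv_exp norm_mult power2_eq_square diff_diff_eq)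

text \<open>For \<open>1 \<le> l < m\<close> the unperturbed power sums vanish, so a moment is
  linear in the deviations up to a quadratic remainder. The linear parts are discrete Fourier
  transforms, and their squares sum to \<open>O(m)\<close> by Parseval; the remainders are bounded
  for each \<open>l\<close>. Division by \<open>m^2\<close> leaves \<open>O(1 / m)\<close>.\<close>

lemma moment_bound:
  fixes N :: nat
  assumes sq: "l2_close \<theta> h D" and g: "\<And>A. finite A \<Longrightarrow> (\<Sum>n\<in>A. (\<gamma> n)\<^sup>2) \<le> \<Gamma>"
  defines "m \<equiv> 2 * N + 1"
  shows "(\<Sum>l\<in>{1..<m}. (cmod (\<Sum>n\<in>J N. of_real ((1 + \<gamma> n) / real m) * node \<theta> N n ^ l))\<^sup>2)
    \<le> 2 * (2 * \<Gamma> + 8 * \<Gamma> * D + 8 * D + 32 * D\<^sup>2) / real m"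
proof -
  define z z0 where "z = node \<theta> N" and "z0 = node (free_freq h) N"
  define \<mu> where "\<mu> n = \<theta> n - free_freq h n" for n
  have m0: "real m > 0" by (simp add: m_def)
  have D: "(\<Sum>n\<in>J N. (\<mu> n)\<^sup>2) \<le> D" using sq by (auto simp: l2_close_def \<mu>_def)
  have G: "(\<Sum>n\<in>J N. (\<gamma> n)\<^sup>2) \<le> \<Gamma>" using g by auto
  have D0: "0 \<le> (\<Sum>n\<in>J N. (\<mu> n)\<^sup>2)" "0 \<le> (\<Sum>n\<in>J N. (\<gamma> n)\<^sup>2)" by (simp_all add: sum_nonneg)
  have dif: "cmod (z n ^ l - z0 n ^ l) \<le> 2 * \<bar>\<mu> n\<bar>" if "l < m" for n l
    using node_power_diff[of l N \<theta> n "free_freq h"] that by (simp add: z_def z0_def \<mu>_def m_def)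
  have X: "(cmod (\<Sum>n\<in>J N. of_real (\<gamma> n) * z n ^ l))\<^sup>2 \<le> 2 * (cmod (\<Sum>n\<in>J N. of_real (\<gamma> n) * z0 n ^ l))\<^sup>2 + 8 * (\<Gamma> * D)"
    if l: "l < m" for l
  proof -
    have "cmod (\<Sum>n\<in>J N. of_real (\<gamma> n) * (z n ^ l - z0 n ^ l)) \<le> (\<Sum>n\<in>J N. \<bar>\<gamma> n\<bar> * (2 * \<bar>\<mu> n\<bar>))"
      by (rule order_trans[OF norm_sum]) (auto simp: norm_mult intro!: sum_mono mult_left_mono dif[OF l])
    also have "\<dots> = 2 * (\<Sum>n\<in>J N. \<bar>\<gamma> n\<bar> * \<bar>\<mu> n\<bar>)" by (simp add: sum_distrib_left mult_ac)
    finally have "(cmod (\<Sum>n\<in>J N. of_real (\<gamma> n) * (z n ^ l - z0 n ^ l)))\<^sup>2 \<le> (2 * (\<Sum>n\<in>J N. \<bar>\<gamma> n\<bar> * \<bar>\<mu> n\<bar>))\<^sup>2"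
      by (intro power_mono) auto
    also have "\<dots> \<le> 4 * (\<Gamma> * D)" using sum_mult_sq_le[of \<gamma> \<mu> "J N"] D G D0 mult_mono[OF G D]
      by (simp add: power_mult_distrib) 
    finally have b: "(cmod (\<Sum>n\<in>J N. of_real (\<gamma> n) * (z n ^ l - z0 n ^ l)))\<^sup>2 \<le> 4 * (\<Gamma> * D)" .
    have "(\<Sum>n\<in>J N. of_real (\<gamma> n) * z n ^ l) = (\<Sum>n\<in>J N. of_real (\<gamma> n) * z0 n ^ l) + (\<Sum>n\<in>J N. of_real (\<gamma> n) * (z n ^ l - z0 n ^ l))"
      by (simp add: algebra_simps flip: sum.distrib)
    then show ?thesis using cmod_add_sq[of "\<Sum>n\<in>J N. of_real (\<gamma> n) * z0 n ^ l" "\<Sum>n\<in>J N. of_real (\<gamma> n) * (z n ^ l - z0 n ^ l)"] b by simp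
  qed
  have Y: "(cmod (\<Sum>n\<in>J N. z n ^ l))\<^sup>2 \<le> 8 * (cmod (\<Sum>n\<in>J N. of_real (\<mu> n) * z0 n ^ l))\<^sup>2 + 32 * D\<^sup>2" if l: "1 \<le> l" "l < m" for l
  proof -
    \<comment> \<open>\<open>s\<close> stays below 2 for all powers considered, so the Taylor
      remainder is uniform in \<open>l\<close>.\<close>
    define s where "s = 2 * real l / real m"
    have s: "0 \<le> s" "s \<le> 2" using l m0 by (auto simp: s_def field_simps)
    have zz: "z n ^ l = z0 n ^ l * cis (s * \<mu> n)" for n
      unfolding z_def z0_def node_power cis_mult m_def s_def \<mu>_def
      by (rule arg_cong[where f=cis]) (simp add: add_divide_distrib[symmetric] algebra_simps)
    have z00: "(\<Sum>n\<in>J N. z0 n ^ l) = 0" using free_freq_orth_nodes[of l N 0 h] l by (simp add: z0_def m_def)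
    have nz0: "cmod (z0 n ^ l) = 1" for n by (simp add: z0_def node_def norm_power)
    define R where "R n = cis (s * \<mu> n) - 1 - \<i> * of_real (s * \<mu> n)" for n
    have R: "cmod (R n) \<le> 4 * (\<mu> n)\<^sup>2" for n
    proof -
      have "cmod (R n) \<le> (s * \<mu> n)\<^sup>2" unfolding R_def by (rule cis_taylor)
      also have "\<dots> = s\<^sup>2 * (\<mu> n)\<^sup>2" by (simp add: power_mult_distrib)
      also have "\<dots> \<le> 2\<^sup>2 * (\<mu> n)\<^sup>2" using s by (intro mult_right_mono power_mono) auto
      finally show ?thesis by simp
    qed
    have "z n ^ l = z0 n ^ l + (\<i> * of_real s) * (of_real (\<mu> n) * z0 n ^ l) + z0 n ^ l * R n" for n
      unfolding zz R_def by (simp add: algebra_simps)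
    then have e: "(\<Sum>n\<in>J N. z n ^ l) = (\<i> * of_real s) * (\<Sum>n\<in>J N. of_real (\<mu> n) * z0 n ^ l) + (\<Sum>n\<in>J N. z0 n ^ l * R n)"
      by (simp add: sum.distrib z00 sum_distrib_left)
    have "cmod (\<Sum>n\<in>J N. z0 n ^ l * R n) \<le> (\<Sum>n\<in>J N. 4 * (\<mu> n)\<^sup>2)"
      by (rule order_trans[OF norm_sum]) (auto simp: norm_mult nz0 R intro!: sum_mono)
    also have "\<dots> \<le> 4 * D" using D by (simp flip: sum_distrib_left)
    finally have "(cmod (\<Sum>n\<in>J N. z0 n ^ l * R n))\<^sup>2 \<le> (4 * D)\<^sup>2" by (intro power_mono) auto
    moreover have "(cmod ((\<i> * of_real s) * (\<Sum>n\<in>J N. of_real (\<mu> n) * z0 n ^ l)))\<^sup>2 \<le> 4 * (cmod (\<Sum>n\<in>J N. of_real (\<mu> n) * z0 n ^ l))\<^sup>2"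
    proof -
      have "s\<^sup>2 \<le> 2\<^sup>2" using s by (intro power_mono) auto
      then show ?thesis by (simp add: norm_mult power_mult_distrib mult_right_mono)
    qed
    ultimately show ?thesis unfolding e
      using cmod_add_sq[of "(\<i> * of_real s) * (\<Sum>n\<in>J N. of_real (\<mu> n) * z0 n ^ l)" "\<Sum>n\<in>J N. z0 n ^ l * R n"]
      by (simp add: power_mult_distrib)
  qed
  have dual: "(\<Sum>l\<in>{1..<m}. (cmod (\<Sum>n\<in>J N. of_real (a n) * z0 n ^ l))\<^sup>2) \<le> real m * A" if "(\<Sum>n\<in>J N. (a n)\<^sup>2) \<le> A" for a A
  proof -
    have "(\<Sum>l\<in>{1..<m}. (cmod (\<Sum>n\<in>J N. of_real (a n) * z0 n ^ l))\<^sup>2) \<le> (\<Sum>l<m. (cmod (\<Sum>n\<in>J N. of_real (a n) * z0 n ^ l))\<^sup>2)"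
      by (intro sum_mono2) auto
    also have "\<dots> = real m * (\<Sum>n\<in>J N. (a n)\<^sup>2)"
      using free_freq_parseval_dual[where a="\<lambda>n. of_real (a n)" and N=N and h=h] unfolding m_def[symmetric] z0_def by simp
    also have "\<dots> \<le> real m * A" using that by (intro mult_left_mono) auto
    finally show ?thesis .
  qed
  have "(cmod (\<Sum>n\<in>J N. of_real ((1 + \<gamma> n) / real m) * z n ^ l))\<^sup>2 \<le>
    (2 * (2 * (cmod (\<Sum>n\<in>J N. of_real (\<gamma> n) * z0 n ^ l))\<^sup>2 + 8 * (\<Gamma> * D)) + 2 * (8 * (cmod (\<Sum>n\<in>J N. of_real (\<mu> n) * z0 n ^ l))\<^sup>2 + 32 * D\<^sup>2)) / (real m)\<^sup>2"
    if l: "l \<in> {1..<m}" for l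
  proof -
    have "(\<Sum>n\<in>J N. of_real ((1 + \<gamma> n) / real m) * z n ^ l) = ((\<Sum>n\<in>J N. of_real (\<gamma> n) * z n ^ l) + (\<Sum>n\<in>J N. z n ^ l)) / of_real (real m)"
      by (simp add: sum_divide_distrib add_divide_distrib algebra_simps flip: sum.distrib)
    then have "(cmod (\<Sum>n\<in>J N. of_real ((1 + \<gamma> n) / real m) * z n ^ l))\<^sup>2 = 
      (cmod ((\<Sum>n\<in>J N. of_real (\<gamma> n) * z n ^ l) + (\<Sum>n\<in>J N. z n ^ l)))\<^sup>2 / (real m)\<^sup>2"
      by (simp only: norm_divide norm_of_real abs_of_nat power_divide)
    also have "\<dots> \<le> (2 * (2 * (cmod (\<Sum>n\<in>J N. of_real (\<gamma> n) * z0 n ^ l))\<^sup>2 + 8 * (\<Gamma> * D)) + 2 * (8 * (cmod (\<Sum>n\<in>J N. of_real (\<mu> n) * z0 n ^ l))\<^sup>2 + 32 * D\<^sup>2)) / (real m)\<^sup>2"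
      using l X[of l] Y[of l] by (intro divide_right_mono order_trans[OF cmod_add_sq] add_mono mult_left_mono) auto
    finally show ?thesis .
  qed
  then have "(\<Sum>l\<in>{1..<m}. (cmod (\<Sum>n\<in>J N. of_real ((1 + \<gamma> n) / real m) * z n ^ l))\<^sup>2) \<le>
    (\<Sum>l\<in>{1..<m}. (2 * (2 * (cmod (\<Sum>n\<in>J N. of_real (\<gamma> n) * z0 n ^ l))\<^sup>2 + 8 * (\<Gamma> * D)) + 2 * (8 * (cmod (\<Sum>n\<in>J N. of_real (\<mu> n) * z0 n ^ l))\<^sup>2 + 32 * D\<^sup>2)) / (real m)\<^sup>2)"
    by (rule sum_mono)
  also have "\<dots> = (4 * (\<Sum>l\<in>{1..<m}. (cmod (\<Sum>n\<in>J N. of_real (\<gamma> n) * z0 n ^ l))\<^sup>2) + 16 * (\<Sum>l\<in>{1..<m}. (cmod (\<Sum>n\<in>J N. of_real (\<mu> n) * z0 n ^ l))\<^sup>2)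
    + real (m - 1) * (16 * (\<Gamma> * D) + 64 * D\<^sup>2)) / (real m)\<^sup>2"
    by (simp add: sum.distrib sum_distrib_left algebra_simps flip: sum_divide_distrib)
  also have "\<dots> \<le> (4 * (real m * \<Gamma>) + 16 * (real m * D) + real m * (16 * (\<Gamma> * D) + 64 * D\<^sup>2)) / (real m)\<^sup>2"
    using dual[OF G] dual[OF D] D G D0 by (intro divide_right_mono add_mono mult_left_mono mult_right_mono) auto
  also have "\<dots> = 2 * (2 * \<Gamma> + 8 * \<Gamma> * D + 8 * D + 32 * D\<^sup>2) / real m" using m0 by (simp add: power2_eq_square field_simps)
  finally show ?thesis by (simp add: z_def)
qed

text \<open>If two nodes coincided, the product over the distinct nodes would be a nonzero
  polynomial of degree below \<open>2 N + 1\<close> vanishing at all of them, contrary to the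
  bound.\<close>

lemma sampling_bound_inj:
  assumes "sampling_bound \<theta> c N" "c > 0"
  shows "inj_on (node \<theta> N) (J N)"
proof (rule ccontr)
  assume "\<not> ?thesis"
  then have "card (node \<theta> N ` J N) \<noteq> card (J N)" using eq_card_imp_inj_on[of "J N"] by auto
  then have lt: "card (node \<theta> N ` J N) < 2 * N + 1" using card_image_le[of "J N" "node \<theta> N"] by simp
  define p where "p = (\<Prod>t\<in>node \<theta> N ` J N. [:- t, 1:])"
  have "degree p = card (node \<theta> N ` J N)" unfolding p_def by (subst degree_prod_sum_eq) auto
  then have dp: "degree p < 2 * N + 1" using lt by simp
  have "p \<noteq> 0" by (simp add: p_def)
  then have "coeff p (degree p) \<noteq> 0" by simp
  then have "coeff_energy (2 * N + 1) p > 0" unfolding coeff_energy_def using dp by (intro sum_pos2[of _ "degree p"]) auto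
  moreover have "poly p (node \<theta> N n) = 0" if "n \<in> J N" for n
    unfolding p_def poly_prod by (rule prod_zero) (use that in force)+
  then have "(\<Sum>n\<in>J N. (cmod (poly p (node \<theta> N n)))\<^sup>2) = 0" by simp
  moreover have "c * (real (2 * N + 1) * coeff_energy (2 * N + 1) p) \<le> (\<Sum>n\<in>J N. (cmod (poly p (node \<theta> N n)))\<^sup>2)"
    using assms(1) dp unfolding sampling_bound_def by blast
  ultimately have "c * (real (2 * N + 1) * coeff_energy (2 * N + 1) p) \<le> 0" "c * (real (2 * N + 1) * coeff_energy (2 * N + 1) p) > 0"
    using assms(2) by (simp, intro mult_pos_pos) auto
  then show False by linarith
qed

locale spectral_input =
  fixes lam \<alpha> :: "int \<Rightarrow> real" and h :: real
  assumes lam_inj: "inj lam" and lam_0: "lam 0 = 0" and \<alpha>_pos: "\<And>n. \<alpha> n > 0"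
    and lam_sum: "(\<lambda>n. (lam n - free_freq h n)\<^sup>2) summable_on UNIV" and \<alpha>_sum: "(\<lambda>n. (\<alpha> n - 1)\<^sup>2) summable_on UNIV"
begin

definition wt :: "nat \<Rightarrow> int \<Rightarrow> real" where "wt N n = 1 / (real (2 * N + 1) * \<alpha> n)"

definition D where "D = infsum (\<lambda>n. (lam n - free_freq h n)\<^sup>2) UNIV"

lemma l2_close_lam: "l2_close lam h D"
  unfolding l2_close_def D_def by (intro allI impI finite_sum_le_infsum[OF lam_sum]) auto

lemma \<alpha>_bounds: "\<exists>a b. 0 < a \<and> (\<forall>n. a \<le> \<alpha> n \<and> \<alpha> n \<le> b)"
proof -
  define S where "S = infsum (\<lambda>n. (\<alpha> n - 1)\<^sup>2) UNIV"
  have fS: "sum (\<lambda>n. (\<alpha> n - 1)\<^sup>2) A \<le> S" if "finite A" for A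
    unfolding S_def using that by (intro finite_sum_le_infsum[OF \<alpha>_sum]) auto
  obtain F where F: "finite F" "dist (sum (\<lambda>n. (\<alpha> n - 1)\<^sup>2) F) S \<le> 1/4"
    using infsum_finite_approximation[OF \<alpha>_sum, of "1/4"] by (auto simp: S_def)
  have out: "\<bar>\<alpha> n - 1\<bar> \<le> 1/2" if "n \<notin> F" for n
  proof -
    have "(\<alpha> n - 1)\<^sup>2 + sum (\<lambda>n. (\<alpha> n - 1)\<^sup>2) F \<le> S" using fS[of "insert n F"] F that by simp
    then have "(\<alpha> n - 1)\<^sup>2 \<le> (1/2)\<^sup>2" using F(2) unfolding dist_real_def power2_eq_square by linarith
    then show ?thesis by (metis abs_le_square_iff abs_of_pos half_gt_zero_iff zero_less_one)
  qed
  define a b where "a = Min (insert (1/2) (\<alpha> ` F))" and "b = Max (insert (3/2) (\<alpha> ` F))"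
  have "0 < a" unfolding a_def using F \<alpha>_pos by (subst Min_gr_iff) auto
  moreover have "a \<le> \<alpha> n \<and> \<alpha> n \<le> b" for n
  proof (cases "n \<in> F")
    case True
    then show ?thesis unfolding a_def b_def using F by (auto intro!: Min_le Max_ge)
  next
    case False
    have "a \<le> 1/2" unfolding a_def by (rule Min_le) (use F in auto)
    moreover have "3/2 \<le> b" unfolding b_def by (rule Max_ge) (use F in auto)
    ultimately
    show ?thesis using out[OF False] by linarith
  qed
  ultimately show ?thesis by blast
qed

lemma inverse_\<alpha>_bound: "\<exists>\<Gamma>\<ge>0. \<forall>A. finite A \<longrightarrow> (\<Sum>n\<in>A. (1 / \<alpha> n - 1)\<^sup>2) \<le> \<Gamma>"
proof -
  obtain a where a: "0 < a" "\<And>n. a \<le> \<alpha> n" using \<alpha>_bounds by blast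
  define S where "S = infsum (\<lambda>n. (\<alpha> n - 1)\<^sup>2) UNIV"
  have S0: "S \<ge> 0" unfolding S_def by (intro infsum_nonneg) auto
  have "(\<Sum>n\<in>A. (1 / \<alpha> n - 1)\<^sup>2) \<le> S / a\<^sup>2" if A: "finite A" for A
  proof -
    have "(\<Sum>n\<in>A. (1 / \<alpha> n - 1)\<^sup>2) \<le> (\<Sum>n\<in>A. (\<alpha> n - 1)\<^sup>2 / a\<^sup>2)"
    proof (intro sum_mono)
      fix n
      have "1 / \<alpha> n - 1 = - ((\<alpha> n - 1) / \<alpha> n)" using \<alpha>_pos[of n] by (simp add: field_simps)
      then have "(1 / \<alpha> n - 1)\<^sup>2 = (\<alpha> n - 1)\<^sup>2 / (\<alpha> n)\<^sup>2" by (simp add: power_divide)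
      also have "\<dots> \<le> (\<alpha> n - 1)\<^sup>2 / a\<^sup>2" using a \<alpha>_pos[of n] by (intro divide_left_mono power_mono mult_pos_pos) (auto simp: less_imp_le)
      finally show "(1 / \<alpha> n - 1)\<^sup>2 \<le> (\<alpha> n - 1)\<^sup>2 / a\<^sup>2" .
    qed
    also have "\<dots> \<le> S / a\<^sup>2" unfolding sum_divide_distrib[symmetric] S_def
      using A by (intro divide_right_mono finite_sum_le_infsum[OF \<alpha>_sum]) auto
    finally show ?thesis .
  qed
  then show ?thesis using S0 a by (intro exI[of _ "S / a\<^sup>2"]) auto
qed

abbreviation NN :: "nat \<Rightarrow> nat \<Rightarrow> real" where "NN N \<equiv> circle_data.N (J N) (node lam N) (wt N)"
abbreviation PP :: "nat \<Rightarrow> nat \<Rightarrow> complex poly" where "PP N \<equiv> circle_data.P (J N) (node lam N) (wt N)"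
abbreviation QQ :: "nat \<Rightarrow> nat \<Rightarrow> complex poly" where "QQ N \<equiv> circle_data.Q (J N) (node lam N) (wt N)"
abbreviation cc :: "nat \<Rightarrow> nat \<Rightarrow> complex" where "cc N \<equiv> circle_data.c (J N) (node lam N) (wt N)"

text \<open>The total mass differs from 1 by the mean of \<open>1 / \<alpha> n - 1\<close>, which is
  \<open>O(1 / sqrt m)\<close> by Cauchy-Schwarz.\<close>

lemma NN0_limit: 
  assumes "eventually (\<lambda>N. circle_data (J N) (node lam N) (wt N)) sequentially"
  shows "(\<lambda>N. NN N 0) \<longlonglongrightarrow> 1"
proof -
  obtain \<Gamma> where G: "\<Gamma> \<ge> 0" "\<And>A. finite A \<Longrightarrow> (\<Sum>n\<in>A. (1 / \<alpha> n - 1)\<^sup>2) \<le> \<Gamma>" using inverse_\<alpha>_bound by blast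
  have "eventually (\<lambda>N. \<bar>NN N 0 - 1\<bar> \<le> sqrt (\<Gamma> / real (2 * N + 1))) sequentially"
    using assms
  proof eventually_elim
    case (elim N)
    interpret circle_data "J N" "node lam N" "wt N" by (rule elim)
    let ?m = "real (2 * N + 1)"
    have cJ: "(\<Sum>n\<in>J N. 1) = ?m" by simp
    have "NN N 0 = (\<Sum>n\<in>J N. 1 / ?m * (1 / \<alpha> n))" by (simp add: N_def P_0 wt_def)
    also have "\<dots> = 1 + (\<Sum>n\<in>J N. 1 / \<alpha> n - 1) / ?m"
      unfolding sum_distrib_left[symmetric] sum_subtractf cJ by (simp add: field_simps)
    finally have e: "NN N 0 - 1 = (\<Sum>n\<in>J N. 1 / \<alpha> n - 1) / ?m" by simp
    have "(\<Sum>n\<in>J N. 1 / \<alpha> n - 1)\<^sup>2 \<le> (\<Sum>n\<in>J N. (1 / \<alpha> n - 1)\<^sup>2) * real (card (J N))"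
      by (rule sum_squared_le_sum_of_squares)
    also have "\<dots> \<le> \<Gamma> * ?m" using G(2)[of "J N"] by (intro mult_mono) (auto simp: G(1))
    finally have "(NN N 0 - 1)\<^sup>2 \<le> \<Gamma> * ?m / ?m\<^sup>2" unfolding e power_divide by (rule divide_right_mono) simp
    also have "\<dots> = \<Gamma> / ?m" by (simp add: power2_eq_square)
    finally show ?case by (metis real_sqrt_abs real_sqrt_le_mono)
  qed
  moreover have "(\<lambda>N. sqrt (\<Gamma> / real (2 * N + 1))) \<longlonglongrightarrow> 0"
  proof -
    have "(\<lambda>N. 1 / real (2 * N + 1)) \<longlonglongrightarrow> 0" by real_asymp
    then have "(\<lambda>N. sqrt (\<Gamma> * (1 / real (2 * N + 1)))) \<longlonglongrightarrow> sqrt (\<Gamma> * 0)" by (intro tendsto_intros)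
    then show ?thesis by simp
  qed
  ultimately have "(\<lambda>N. NN N 0 - 1) \<longlonglongrightarrow> 0" 
    by (intro Lim_null_comparison[of "\<lambda>N. NN N 0 - 1"]) auto
  then show ?thesis by (simp add: LIM_zero_iff)
qed

lemma coefficients_bounded:
  "\<exists>C>0. \<forall>\<^sub>F N in sequentially. circle_data (J N) (node lam N) (wt N) \<and>
     (\<Sum>k<2 * N. (cmod (cc N k))\<^sup>2) \<le> C / real (2 * N + 1)"
proof -
  obtain a b where ab: "0 < a" "\<And>n. a \<le> \<alpha> n" "\<And>n. \<alpha> n \<le> b" using \<alpha>_bounds by blast
  obtain \<Gamma> where G: "\<Gamma> \<ge> 0" "\<And>A. finite A \<Longrightarrow> (\<Sum>n\<in>A. (1 / \<alpha> n - 1)\<^sup>2) \<le> \<Gamma>" using inverse_\<alpha>_bound by blast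
  obtain c0 where c: "c0 > 0" "\<forall>\<^sub>F N in sequentially. sampling_bound lam c0 N" using sampling_bound_eventually[OF lam_inj lam_sum] by blast
  have b0: "b > 0" using ab(1) ab(2)[of 0] ab(3)[of 0] by linarith
  have cd: "eventually (\<lambda>N. circle_data (J N) (node lam N) (wt N)) sequentially"
    using c(2)
  proof eventually_elim
    case (elim N)
    show ?case by unfold_locales (use sampling_bound_inj[OF elim c(1)] \<alpha>_pos in \<open>auto simp: node_def wt_def\<close>)
  qed
  have n0: "eventually (\<lambda>N. NN N 0 > 1/2) sequentially"
    using NN0_limit[OF cd] by (rule order_tendstoD) simp
  define K where "K = 2 * (2 * \<Gamma> + 8 * \<Gamma> * D + 8 * D + 32 * D\<^sup>2)"
  have D0: "D \<ge> 0" unfolding D_def by (intro infsum_nonneg) auto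
  have K0: "K \<ge> 0" using D0 G by (simp add: K_def)
  define C where "C = 4 * (2 * K + 2 * K\<^sup>2 / (c0 / b)\<^sup>2) + 1"
  have "C > 0" using K0 by (simp add: C_def add_nonneg_pos)
  moreover have "\<forall>\<^sub>F N in sequentially. circle_data (J N) (node lam N) (wt N) \<and>
     (\<Sum>k<2 * N. (cmod (cc N k))\<^sup>2) \<le> C / real (2 * N + 1)"
    using c(2) cd n0
  proof eventually_elim
    case (elim N)
    interpret circle_data "J N" "node lam N" "wt N" by (rule elim)
    let ?m = "2 * N + 1"
    have m: "m = ?m" by (simp add: m_def)
    have gen: "c0 / b * x \<le> S / (M * b)" if "c0 * (M * x) \<le> S" "M > 0" for M x S :: real
      using that b0 by (simp add: field_simps)
    \<comment> \<open>The weights are at least \<open>1 / (m b)\<close>, which cancels the factor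
      \<open>m\<close> in the sampling bound and leaves a constant independent of
      \<open>N\<close>.\<close>
    have lb: "c0 / b * coeff_energy m p \<le> (\<Sum>n\<in>J N. wt N n * (cmod (poly p (node lam N n)))\<^sup>2)" if "degree p < m" for p
    proof -
      have "c0 * (real ?m * coeff_energy ?m p) \<le> (\<Sum>n\<in>J N. (cmod (poly p (node lam N n)))\<^sup>2)"
        using elim(1) that unfolding sampling_bound_def m by blast
      then have "c0 / b * coeff_energy m p \<le> (\<Sum>n\<in>J N. (cmod (poly p (node lam N n)))\<^sup>2) / (real ?m * b)"
        unfolding m by (rule gen) simp
      also have "\<dots> \<le> (\<Sum>n\<in>J N. wt N n * (cmod (poly p (node lam N n)))\<^sup>2)"
        unfolding sum_divide_distrib
      proof (intro sum_mono)
        fix n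
        have "1 / (real ?m * b) \<le> wt N n" unfolding wt_def using ab(3)[of n] \<alpha>_pos[of n] b0
          by (intro divide_left_mono mult_left_mono mult_pos_pos) auto
        then have "1 / (real ?m * b) * (cmod (poly p (node lam N n)))\<^sup>2 \<le> wt N n * (cmod (poly p (node lam N n)))\<^sup>2"
          by (intro mult_right_mono) auto
        then show "(cmod (poly p (node lam N n)))\<^sup>2 / (real ?m * b) \<le> wt N n * (cmod (poly p (node lam N n)))\<^sup>2" by simp
      qed
      finally show ?thesis .
    qed
    have mom: "(\<Sum>l\<in>{1..<m}. (cmod (ip (monom 1 l) 1))\<^sup>2) \<le> K / real ?m"
    proof -
      have "ip (monom 1 l) 1 = (\<Sum>n\<in>J N. of_real ((1 + (1 / \<alpha> n - 1)) / real ?m) * node lam N n ^ l)" for l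
        unfolding ip_def by (intro sum.cong refl) (simp add: wt_def poly_monom mult.commute)
      then show ?thesis using moment_bound[OF l2_close_lam G(2), of N] unfolding m K_def by simp
    qed
    have "(1/2)\<^sup>2 * (\<Sum>k<2 * N. (cmod (c k))\<^sup>2) \<le> (circle_data.N (J N) (node lam N) (wt N) 0)\<^sup>2 * (\<Sum>k<m - 1. (cmod (c k))\<^sup>2)"
      using elim(3) unfolding m by (intro mult_mono power_mono) (auto simp: sum_nonneg)
    also have "\<dots> \<le> 2 * (K / real ?m) + 2 * real m * (K / real ?m)\<^sup>2 / (c0 / b)\<^sup>2"
      using c(1) b0 by (intro verblunsky_bound lb mom) auto
    also have "\<dots> = (2 * K + 2 * K\<^sup>2 / (c0 / b)\<^sup>2) / real ?m"
    proof -
      have gen2: "2 * (K / x) + 2 * x * (K / x)\<^sup>2 / y = (2 * K + 2 * K\<^sup>2 / y) / x" if "x > 0" for x y :: real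
        using that by (simp add: power_divide power2_eq_square add_divide_distrib)
      show ?thesis unfolding m by (rule gen2) simp
    qed
    finally have "(\<Sum>k<2 * N. (cmod (c k))\<^sup>2) \<le> 4 * ((2 * K + 2 * K\<^sup>2 / (c0 / b)\<^sup>2) / real ?m)"
      by (simp add: power2_eq_square)
    also have "\<dots> \<le> C / real ?m" unfolding C_def times_divide_eq_right by (intro divide_right_mono) auto
    finally show ?case using elim by blast
  qed
  ultimately show ?thesis by blast
qed

end

section \<open>Limits of grid functions\<close>

definition interpolant :: "nat \<Rightarrow> (nat \<Rightarrow> 'b::real_normed_vector) \<Rightarrow> real \<Rightarrow> 'b" where
  "interpolant M v x = (let k = nat \<lfloor>real M * x\<rfloor> in v k + (real M * x - real k) *\<^sub>R (v (Suc k) - v k))"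

lemma interpolant_grid: "M > 0 \<Longrightarrow> interpolant M v (real k / real M) = v k"
  by (simp add: interpolant_def)

lemma sum_diff_norm_le:
  fixes v :: "nat \<Rightarrow> 'b::real_normed_vector"
  assumes "i \<le> j"
  shows "norm (v j - v i) \<le> (\<Sum>k\<in>{i..<j}. norm (v (Suc k) - v k))"
  using assms
proof (induction rule: dec_induct)
  case (step n)
  have "norm (v (Suc n) - v i) \<le> norm (v (Suc n) - v n) + norm (v n - v i)"
    using norm_triangle_ineq[of "v (Suc n) - v n" "v n - v i"] by simp
  then show ?case using step by simp
qed simp

lemma sum_diff_sq_le:
  fixes v :: "nat \<Rightarrow> 'b::real_normed_vector"
  assumes "i \<le> j"
  shows "(norm (v j - v i))\<^sup>2 \<le> real (j - i) * (\<Sum>k\<in>{i..<j}. (norm (v (Suc k) - v k))\<^sup>2)"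
proof -
  have "(norm (v j - v i))\<^sup>2 \<le> (\<Sum>k\<in>{i..<j}. norm (v (Suc k) - v k))\<^sup>2"
    using sum_diff_norm_le[OF assms, of v] by (intro power_mono) auto
  also have "\<dots> \<le> (\<Sum>k\<in>{i..<j}. (norm (v (Suc k) - v k))\<^sup>2) * real (card {i..<j})"
    by (rule sum_squared_le_sum_of_squares)
  finally show ?thesis by (simp add: mult.commute)
qed

text \<open>Cauchy-Schwarz for a telescoping sum: the discrete form of the embedding of
  \<open>H^1\<close> into the Hoelder functions of exponent 1/2.\<close>

lemma grid_holder:
  fixes v :: "nat \<Rightarrow> 'b::real_normed_vector"
  assumes M: "M > 0" and E: "(\<Sum>k<M. (norm (v (Suc k) - v k))\<^sup>2) \<le> E / real M" and ij: "i \<le> j" "j \<le> M"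
  shows "norm (v j - v i) \<le> sqrt (E * (real (j - i) / real M))"
proof (rule real_le_rsqrt)
  have "(norm (v j - v i))\<^sup>2 \<le> real (j - i) * (\<Sum>k\<in>{i..<j}. (norm (v (Suc k) - v k))\<^sup>2)" by (rule sum_diff_sq_le[OF ij(1)])
  also have "\<dots> \<le> real (j - i) * (\<Sum>k<M. (norm (v (Suc k) - v k))\<^sup>2)"
    using ij by (intro mult_left_mono sum_mono2) auto
  also have "\<dots> \<le> real (j - i) * (E / real M)" using E by (intro mult_left_mono) auto
  finally show "(norm (v j - v i))\<^sup>2 \<le> E * (real (j - i) / real M)" by (simp add: mult.commute)
qed

lemma interpolant_holder:
  fixes v :: "nat \<Rightarrow> 'b::real_normed_vector"
  assumes M: "M > 0" and E: "(\<Sum>k<M. (norm (v (Suc k) - v k))\<^sup>2) \<le> E / real M"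
    and xy: "0 \<le> x" "x \<le> y" "y \<le> 1"
  shows "norm (interpolant M v y - interpolant M v x) \<le> 3 * sqrt (E * (y - x))"
proof -
  define i j where "i = nat \<lfloor>real M * x\<rfloor>" and "j = nat \<lfloor>real M * y\<rfloor>"
  define a b where "a = real M * x - real i" and "b = real M * y - real j"
  have m0: "real M > 0" using M by simp
  have E0: "E \<ge> 0"
  proof -
    have "0 \<le> E / real M" using E by (rule order_trans[rotated]) (simp add: sum_nonneg)
    then show ?thesis using m0 by (simp add: zero_le_divide_iff)
  qed
  have ab: "0 \<le> a" "a < 1" "0 \<le> b" "b < 1" 
  proof -
    have "0 \<le> real M * x" "0 \<le> real M * y" using xy by auto
    then have "real i = of_int \<lfloor>real M * x\<rfloor>" "real j = of_int \<lfloor>real M * y\<rfloor>" by (simp_all add: i_def j_def)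
    then show "0 \<le> a" "a < 1" "0 \<le> b" "b < 1" unfolding a_def b_def by linarith+
  qed
  have ij: "i \<le> j" unfolding i_def j_def using xy m0 by (intro nat_mono floor_mono mult_left_mono) auto
  have jM: "j \<le> M"
  proof -
    have "real M * y \<le> real M * 1" using xy by (intro mult_left_mono) auto
    then have "real j \<le> real M" using ab by (simp add: b_def)
    then show ?thesis by simp
  qed
  define d where "d = real M * (y - x)"
  have d: "d = real j - real i + b - a" by (simp add: d_def a_def b_def algebra_simps)
  have ex: "E * (y - x) = E * (d / real M)" using m0 by (simp add: d_def)
  have lx: "interpolant M v x = v i + a *\<^sub>R (v (Suc i) - v i)" by (simp add: interpolant_def Let_def i_def a_def)
  have ly: "interpolant M v y = v j + b *\<^sub>R (v (Suc j) - v j)" by (simp add: interpolant_def Let_def j_def b_def)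
  have inc: "norm (v (Suc k) - v k) \<le> sqrt (E / real M)" if "k < M" for k
    using grid_holder[OF M E, of k "Suc k"] that by simp
  have sc: "norm (s *\<^sub>R (v (Suc k) - v k)) \<le> sqrt (E * (d / real M))" if "k < M" "0 \<le> s" "s \<le> 1" "s \<le> d" for s k
  proof -
    have "s * s \<le> 1 * d" using that by (intro mult_mono) auto
    then have "s \<le> sqrt d" by (intro real_le_rsqrt) (simp add: power2_eq_square)
    then have "s * norm (v (Suc k) - v k) \<le> sqrt d * sqrt (E / real M)" using that inc E0 by (intro mult_mono) auto
    also have "\<dots> = sqrt (E * (d / real M))" by (simp add: mult.commute flip: real_sqrt_mult)
    finally show ?thesis using that by simp
  qed
  have d0: "d \<ge> 0" using xy m0 by (simp add: d_def)
  have s0: "sqrt (E * (d / real M)) \<ge> 0" using E0 d0 by simp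
  \<comment> \<open>At \<open>j = M\<close> the value \<open>v (Suc j)\<close> lies outside the
    grid, but there its factor \<open>b\<close> is 0.\<close>
  have endj: "norm (b *\<^sub>R (v (Suc j) - v j)) \<le> sqrt (E * (d / real M))" if "b \<le> d"
  proof (cases "j = M")
    case True
    have "real M * y \<le> real M * 1" using xy by (intro mult_left_mono) auto
    then have "b = 0" using True ab by (simp add: b_def)
    then show ?thesis using s0 by simp
  qed (use sc[of j b] ab jM that in auto)
  show ?thesis
  proof (cases "i = j")
    case True
    show ?thesis
    proof (cases "j = M")
      case True2: True
      have "real M * y \<le> real M * 1" "real M * x \<le> real M * 1" using xy by (intro mult_left_mono; auto)+
      then have "a = 0" "b = 0" using True True2 ab by (auto simp: a_def b_def)
      then have "interpolant M v y - interpolant M v x = 0" using True by (simp add: lx ly)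
      then show ?thesis using s0 unfolding ex by simp
    next
      case False
      have "interpolant M v y - interpolant M v x = d *\<^sub>R (v (Suc j) - v j)" unfolding lx ly d using True by (simp add: scaleR_left_diff_distrib)
      also have "norm \<dots> \<le> sqrt (E * (d / real M))" using sc[of j d] d0 d True ab jM False by auto
      finally show ?thesis using s0 unfolding ex by linarith
    qed
  next
    case False
    then have lt: "i < j" using ij by simp
    \<comment> \<open>Part of the last cell, whole cells, part of the first cell: each is bounded by
      the same square root, whence the factor 3.\<close>
    have e: "interpolant M v y - interpolant M v x = b *\<^sub>R (v (Suc j) - v j) + (v j - v (Suc i)) + (1 - a) *\<^sub>R (v (Suc i) - v i)"
      unfolding lx ly by (simp add: scaleR_left_diff_distrib)
    have dd: "d = real (j - Suc i) + b + (1 - a)" using lt by (simp add: d of_nat_diff)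
    have n1: "norm (b *\<^sub>R (v (Suc j) - v j)) \<le> sqrt (E * (d / real M))" using ab by (intro endj) (simp add: dd)
    have "norm (v j - v (Suc i)) \<le> sqrt (E * (real (j - Suc i) / real M))"
      using grid_holder[OF M E, of "Suc i" j] lt jM by simp
    also have "\<dots> \<le> sqrt (E * (d / real M))"
      using ab E0 m0 by (intro real_sqrt_le_mono mult_left_mono divide_right_mono) (auto simp: dd)
    finally have n2: "norm (v j - v (Suc i)) \<le> sqrt (E * (d / real M))" .
    have n3: "norm ((1 - a) *\<^sub>R (v (Suc i) - v i)) \<le> sqrt (E * (d / real M))" using ab lt jM by (intro sc) (auto simp: dd)
    show ?thesis unfolding ex e
      using norm_triangle_ineq[of "b *\<^sub>R (v (Suc j) - v j) + (v j - v (Suc i))" "(1 - a) *\<^sub>R (v (Suc i) - v i)"]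
        norm_triangle_ineq[of "b *\<^sub>R (v (Suc j) - v j)" "v j - v (Suc i)"] n1 n2 n3 by linarith
  qed
qed

section \<open>Uniform convergence on grids\<close>

definition grid_converges :: "(nat \<Rightarrow> nat) \<Rightarrow> (nat \<Rightarrow> nat \<Rightarrow> 'b::real_normed_vector) \<Rightarrow> (real \<Rightarrow> 'b) \<Rightarrow> bool" where
  "grid_converges M v V \<longleftrightarrow> continuous_on {0..1} V \<and>
     (\<forall>e>0. \<forall>\<^sub>F n in sequentially. \<forall>k\<le>M n. norm (v n k - V (real k / real (M n))) < e)"

lemma grid_converges_subseq:
  assumes "grid_converges M v V" "strict_mono s"
  shows "grid_converges (M \<circ> s) (v \<circ> s) V"
  unfolding grid_converges_def
proof (intro conjI allI impI)
  show "continuous_on {0..1} V" using assms by (simp add: grid_converges_def)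
  fix e :: real assume "e > 0"
  then have "\<forall>\<^sub>F n in sequentially. \<forall>k\<le>M n. norm (v n k - V (real k / real (M n))) < e"
    using assms by (simp add: grid_converges_def)
  from eventually_subseq[OF assms(2) this]
  show "\<forall>\<^sub>F n in sequentially. \<forall>k\<le>(M \<circ> s) n. norm ((v \<circ> s) n k - V (real k / real ((M \<circ> s) n))) < e"
    by (simp add: o_def)
qed

text \<open>Arzela-Ascoli applied to the piecewise linear interpolants, to which the energy bound
  gives a common Hoelder modulus.\<close>

lemma grid_compact:
  fixes v :: "nat \<Rightarrow> nat \<Rightarrow> 'b::{real_normed_vector, heine_borel}"
  assumes M: "\<And>n. M n > 0" and B: "\<And>n. norm (v n 0) \<le> B"
    and E: "\<And>n. (\<Sum>k<M n. (norm (v n (Suc k) - v n k))\<^sup>2) \<le> E / real (M n)"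
  obtains s V where "strict_mono (s :: nat \<Rightarrow> nat)" "grid_converges (M \<circ> s) (v \<circ> s) V"
proof -
  let ?F = "\<lambda>n x. interpolant (M n) (v n) x"
  have E0: "E \<ge> 0"
  proof -
    have "0 \<le> E / real (M 0)" using E[of 0] by (rule order_trans[rotated]) (simp add: sum_nonneg)
    then show ?thesis using M[of 0] by (simp add: zero_le_divide_iff)
  qed
  have hol: "norm (?F n y - ?F n x) \<le> 3 * sqrt (E * \<bar>x - y\<bar>)" if "x \<in> {0..1}" "y \<in> {0..1}" for n x y
  proof (cases "x \<le> y")
    case True
    then show ?thesis using interpolant_holder[OF M E, of x y n] that by simp
  next
    case False
    then show ?thesis using interpolant_holder[OF M E, of y x n] that by (simp add: norm_minus_commute)
  qed
  have at0: "?F n 0 = v n 0" for n by (simp add: interpolant_def)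
  have bound: "norm (?F n x) \<le> B + 3 * sqrt E" if x: "x \<in> {0..1}" for n x
  proof -
    have "norm (?F n x) \<le> norm (?F n 0) + norm (?F n x - ?F n 0)"
      using norm_triangle_ineq[of "?F n 0" "?F n x - ?F n 0"] by simp
    also have "\<dots> \<le> B + 3 * sqrt (E * \<bar>0 - x\<bar>)" unfolding at0 using B hol[of 0 x n] x at0 by (intro add_mono) auto
    also have "\<dots> \<le> B + 3 * sqrt E" using x E0 by (auto intro!: mult_left_le)
    finally show ?thesis .
  qed
  have equi: "\<exists>d>0. \<forall>n y. y \<in> {0..1} \<and> norm (x - y) < d \<longrightarrow> norm (?F n x - ?F n y) < e"
    if x: "x \<in> {0..1}" and e: "0 < e" for x e :: real
  proof -
    define d where "d = (e / 3)\<^sup>2 / (E + 1)"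
    have d: "d > 0" using e E0 by (simp add: d_def)
    have "norm (?F n x - ?F n y) < e" if y: "y \<in> {0..1}" "norm (x - y) < d" for n y
    proof -
      have "E * \<bar>y - x\<bar> \<le> E * d" using y E0 by (intro mult_left_mono) auto
      also have "\<dots> < (e / 3)\<^sup>2"
      proof -
        have "E * d < (E + 1) * d" using d by simp
        also have "\<dots> = (e / 3)\<^sup>2" using E0 by (simp add: d_def)
        finally show ?thesis .
      qed
      finally have "sqrt (E * \<bar>y - x\<bar>) < e / 3" using e by (intro real_less_lsqrt) auto
      then show ?thesis using hol[of y x n] x y by simp
    qed
    then show ?thesis using d by blast
  qed
  obtain V s where V: "continuous_on {0..1} V" "strict_mono (s :: nat \<Rightarrow> nat)"
    "\<And>e. 0 < e \<Longrightarrow> \<exists>N. \<forall>n x. n \<ge> N \<and> x \<in> {0..1} \<longrightarrow> norm (?F (s n) x - V x) < e"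
    by (rule Arzela_Ascoli[OF compact_Icc bound equi]) (assumption | (rule that; assumption))+
  have "grid_converges (M \<circ> s) (v \<circ> s) V" unfolding grid_converges_def
  proof (intro conjI allI impI)
    show "continuous_on {0..1} V" by (rule V(1))
    fix e :: real assume "e > 0"
    then obtain N where N: "\<And>n x. n \<ge> N \<Longrightarrow> x \<in> {0..1} \<Longrightarrow> norm (?F (s n) x - V x) < e" using V(3) by blast
    show "\<forall>\<^sub>F n in sequentially. \<forall>k\<le>(M \<circ> s) n. norm ((v \<circ> s) n k - V (real k / real ((M \<circ> s) n))) < e"
      using eventually_ge_at_top[of N]
    proof eventually_elim
      case (elim n)
      show ?case
      proof (intro allI impI)
        fix k assume k: "k \<le> (M \<circ> s) n"
        have "real k / real (M (s n)) \<in> {0..1}" using k M[of "s n"] by simp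
        from N[OF elim this] show "norm ((v \<circ> s) n k - V (real k / real ((M \<circ> s) n))) < e"
          unfolding o_def interpolant_grid[OF M] .
      qed
    qed
  qed
  with V(2) show thesis by (rule that)
qed

definition grid_index :: "nat \<Rightarrow> real \<Rightarrow> nat" where "grid_index M x = nat \<lfloor>real M * x\<rfloor>"

lemma grid_index_bounds: assumes "0 \<le> x" shows "real (grid_index M x) \<le> real M * x" "real M * x < real (grid_index M x) + 1"
  using assms by (auto simp: grid_index_def)

lemma grid_index_le: assumes "0 \<le> x" "x \<le> 1" shows "grid_index M x \<le> M"
proof -
  have "real M * x \<le> real M * 1" using assms by (intro mult_left_mono) auto
  then have "real (grid_index M x) \<le> real M" using grid_index_bounds(1)[of x M] assms by linarith
  then show ?thesis by simp
qed

lemma grid_index_mono: "x \<le> y \<Longrightarrow> grid_index M x \<le> grid_index M y"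
  unfolding grid_index_def by (intro nat_mono floor_mono mult_left_mono) auto

lemma grid_index_0: "grid_index M 0 = 0" and grid_index_1: "grid_index M 1 = M" by (simp_all add: grid_index_def)

lemma grid_index_tendsto:
  assumes M: "filterlim M at_top sequentially" and x: "0 \<le> x"
  shows "(\<lambda>n. real (grid_index (M n) x) / real (M n)) \<longlonglongrightarrow> x"
proof (rule real_tendsto_sandwich[of "\<lambda>n. x - 1 / real (M n)" _ _ "\<lambda>n. x"])
  have M0: "\<forall>\<^sub>F n in sequentially. M n > 0" by (rule eventually_compose_filterlim[OF eventually_gt_at_top M])
  show "\<forall>\<^sub>F n in sequentially. x - 1 / real (M n) \<le> real (grid_index (M n) x) / real (M n)"
    using M0
  proof eventually_elim
    case (elim n)
    have "x \<le> (real (grid_index (M n) x) + 1) / real (M n)" using grid_index_bounds(2)[OF x, of "M n"] elim by (simp add: pos_le_divide_eq mult.commute)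
    then show ?case by (simp add: add_divide_distrib)
  qed
  show "\<forall>\<^sub>F n in sequentially. real (grid_index (M n) x) / real (M n) \<le> x"
    using M0 by eventually_elim (use grid_index_bounds(1)[OF x] in \<open>simp add: pos_divide_le_eq mult.commute\<close>)
  have "filterlim (\<lambda>n. real (M n)) at_top sequentially" using filterlim_compose[OF filterlim_real_sequentially M] .
  then have "(\<lambda>n. 1 / real (M n)) \<longlonglongrightarrow> 0" 
    by (rule tendsto_divide_0[OF tendsto_const filterlim_at_top_imp_at_infinity])
  then have "(\<lambda>n. x - 1 / real (M n)) \<longlonglongrightarrow> x - 0" by (intro tendsto_intros)
  then show "(\<lambda>n. x - 1 / real (M n)) \<longlonglongrightarrow> x" by simp
qed simp

lemma grid_converges_tendsto:
  assumes g: "grid_converges M v V" and M: "filterlim M at_top sequentially" and x: "x \<in> {0..1}"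
  shows "(\<lambda>n. v n (grid_index (M n) x)) \<longlonglongrightarrow> V x"
proof -
  have c: "continuous_on {0..1} V" using g by (simp add: grid_converges_def)
  have "\<forall>\<^sub>F n in sequentially. real (grid_index (M n) x) / real (M n) \<in> {0..1}"
    using eventually_compose_filterlim[OF eventually_gt_at_top[of 0] M]
    by eventually_elim (use grid_index_le[of x] x in \<open>auto simp: divide_le_eq_1\<close>)
  then have a: "(\<lambda>n. V (real (grid_index (M n) x) / real (M n))) \<longlonglongrightarrow> V x"
    using grid_index_tendsto[OF M, of x] x by (intro continuous_on_tendsto_compose[OF c]) auto
  have "(\<lambda>n. v n (grid_index (M n) x) - V (real (grid_index (M n) x) / real (M n))) \<longlonglongrightarrow> 0"
  proof (rule tendstoI)
    fix e :: real assume "e > 0"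
    then have "\<forall>\<^sub>F n in sequentially. \<forall>k\<le>M n. norm (v n k - V (real k / real (M n))) < e" using g by (simp add: grid_converges_def)
    then show "\<forall>\<^sub>F n in sequentially. dist (v n (grid_index (M n) x) - V (real (grid_index (M n) x) / real (M n))) 0 < e"
      by eventually_elim (use grid_index_le[of x] x in auto)
  qed
  from tendsto_add[OF this a] show ?thesis by simp
qed

text \<open>On each interval Cauchy-Schwarz compares the squared increment with the energy of the
  cells inside, and disjoint intervals use disjoint cells. Rounding end points to the grid lengthens
  an interval by a factor below \<open>1 + e\<close> eventually, and \<open>e\<close> is
  arbitrary.\<close>

lemma grid_energy_limit:
  fixes v :: "nat \<Rightarrow> nat \<Rightarrow> real"
  assumes g: "grid_converges M v V" and M: "filterlim M at_top sequentially"
    and E: "\<And>n. (\<Sum>k<M n. (v n (Suc k) - v n k)\<^sup>2) \<le> E / real (M n)" and M0: "\<And>n. M n > 0"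
    and D: "finite D" "\<And>a b. (a, b) \<in> D \<Longrightarrow> 0 \<le> a \<and> a < b \<and> b \<le> 1"
    "disjoint_family_on (\<lambda>(a, b). {a<..<b}) D"
  shows "(\<Sum>(a, b)\<in>D. (V b - V a)\<^sup>2 / (b - a)) \<le> E"
proof -
  have E0: "E \<ge> 0"
  proof -
    have "0 \<le> E / real (M 0)" using E[of 0] by (rule order_trans[rotated]) (simp add: sum_nonneg)
    then show ?thesis using M0[of 0] by (simp add: zero_le_divide_iff)
  qed
  define G where "G n q = {grid_index (M n) (fst q)..<grid_index (M n) (snd q)}" for n q
  define W where "W n q = real (M n) * (\<Sum>k\<in>G n q. (v n (Suc k) - v n k)\<^sup>2)" for n q
  have Wsum: "(\<Sum>q\<in>D. W n q) \<le> E" for n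
  proof -
    have dj: "\<forall>q\<in>D. \<forall>r\<in>D. q \<noteq> r \<longrightarrow> G n q \<inter> G n r = {}"
    proof (intro ballI impI)
      fix q r assume qr: "q \<in> D" "r \<in> D" "q \<noteq> r"
      then have o: "fst q < snd q" "fst r < snd r" using D(2)[of "fst q" "snd q"] D(2)[of "fst r" "snd r"] by auto
      have "{fst q<..<snd q} \<inter> {fst r<..<snd r} = {}" using disjoint_family_onD[OF D(3) qr] by (simp add: split_beta)
      then have "snd q \<le> fst r \<or> snd r \<le> fst q"
      proof (rule contrapos_pp)
        assume "\<not> (snd q \<le> fst r \<or> snd r \<le> fst q)"
        then have "max (fst q) (fst r) < min (snd q) (snd r)" using o by auto
        then obtain t where "max (fst q) (fst r) < t" "t < min (snd q) (snd r)" using dense by blast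
        then show "{fst q<..<snd q} \<inter> {fst r<..<snd r} \<noteq> {}" by auto
      qed
      then have "grid_index (M n) (snd q) \<le> grid_index (M n) (fst r) \<or> grid_index (M n) (snd r) \<le> grid_index (M n) (fst q)" using grid_index_mono by blast
      then show "G n q \<inter> G n r = {}" by (auto simp: G_def)
    qed
    have "(\<Sum>q\<in>D. W n q) = real (M n) * (\<Sum>q\<in>D. \<Sum>k\<in>G n q. (v n (Suc k) - v n k)\<^sup>2)" by (simp add: W_def sum_distrib_left)
    also have "(\<Sum>q\<in>D. \<Sum>k\<in>G n q. (v n (Suc k) - v n k)\<^sup>2) = (\<Sum>k\<in>(\<Union>q\<in>D. G n q). (v n (Suc k) - v n k)\<^sup>2)"
      using D(1) dj by (intro sum.UNION_disjoint[symmetric]) (auto simp: G_def)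
    also have "real (M n) * \<dots> \<le> real (M n) * (\<Sum>k<M n. (v n (Suc k) - v n k)\<^sup>2)"
    proof (intro mult_left_mono sum_mono2)
      show "(\<Union>q\<in>D. G n q) \<subseteq> {..<M n}"
      proof
        fix k assume "k \<in> (\<Union>q\<in>D. G n q)"
        then obtain q where q: "q \<in> D" "k < grid_index (M n) (snd q)" by (auto simp: G_def)
        then have "grid_index (M n) (snd q) \<le> M n" using D(2)[of "fst q" "snd q"] by (intro grid_index_le) auto
        then show "k \<in> {..<M n}" using q by simp
      qed
    qed auto
    also have "\<dots> \<le> real (M n) * (E / real (M n))" using E by (intro mult_left_mono) auto
    finally show ?thesis using M0[of n] by simp
  qed
  have W0: "W n q \<ge> 0" for n q by (simp add: W_def sum_nonneg)
  have lim: "(\<lambda>n. \<Sum>q\<in>D. (v n (grid_index (M n) (snd q)) - v n (grid_index (M n) (fst q)))\<^sup>2 / (snd q - fst q)) \<longlonglongrightarrow> (\<Sum>q\<in>D. (V (snd q) - V (fst q))\<^sup>2 / (snd q - fst q))"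
  proof (intro tendsto_sum tendsto_divide tendsto_power tendsto_diff tendsto_const grid_converges_tendsto[OF g M])
    fix q assume q: "q \<in> D"
    then show "snd q \<in> {0..1}" "fst q \<in> {0..1}" "snd q - fst q \<noteq> 0" using D(2)[of "fst q" "snd q"] by auto
  qed
  have "(\<Sum>q\<in>D. (V (snd q) - V (fst q))\<^sup>2 / (snd q - fst q)) \<le> (1 + e) * E" if e: "e > 0" for e
  proof (rule tendsto_upperbound[OF lim])
    have "\<forall>\<^sub>F n in sequentially. \<forall>q\<in>D. real (grid_index (M n) (snd q)) / real (M n) - real (grid_index (M n) (fst q)) / real (M n) < (1 + e) * (snd q - fst q)"
    proof (intro eventually_ball_finite D(1) ballI)
      fix q assume q: "q \<in> D"
      then have o: "0 \<le> fst q" "fst q < snd q" using D(2)[of "fst q" "snd q"] by auto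
      show "\<forall>\<^sub>F n in sequentially. real (grid_index (M n) (snd q)) / real (M n) - real (grid_index (M n) (fst q)) / real (M n) < (1 + e) * (snd q - fst q)"
        using o e by (intro order_tendstoD(2)[OF tendsto_diff[OF grid_index_tendsto[OF M] grid_index_tendsto[OF M]]]) auto
    qed
    then show "\<forall>\<^sub>F n in sequentially. (\<Sum>q\<in>D. (v n (grid_index (M n) (snd q)) - v n (grid_index (M n) (fst q)))\<^sup>2 / (snd q - fst q)) \<le> (1 + e) * E"
    proof eventually_elim
      case (elim n)
      have "(\<Sum>q\<in>D. (v n (grid_index (M n) (snd q)) - v n (grid_index (M n) (fst q)))\<^sup>2 / (snd q - fst q)) \<le> (\<Sum>q\<in>D. (1 + e) * W n q)"
      proof (intro sum_mono)
        fix q assume q: "q \<in> D"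
        then have o: "0 \<le> fst q" "fst q < snd q" using D(2)[of "fst q" "snd q"] by auto
        have gm: "grid_index (M n) (fst q) \<le> grid_index (M n) (snd q)" using o by (intro grid_index_mono) auto
        have "(v n (grid_index (M n) (snd q)) - v n (grid_index (M n) (fst q)))\<^sup>2 \<le> real (grid_index (M n) (snd q) - grid_index (M n) (fst q)) * (\<Sum>k\<in>G n q. (v n (Suc k) - v n k)\<^sup>2)"
          using sum_diff_sq_le[OF gm, of "v n"] by (simp add: G_def)
        also have "\<dots> = (real (grid_index (M n) (snd q)) / real (M n) - real (grid_index (M n) (fst q)) / real (M n)) * W n q"
          using gm M0[of n] by (simp add: W_def of_nat_diff diff_divide_distrib[symmetric])
        also have "\<dots> \<le> ((1 + e) * (snd q - fst q)) * W n q" using elim q W0 by (intro mult_right_mono) (auto simp: less_imp_le)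
        finally show "(v n (grid_index (M n) (snd q)) - v n (grid_index (M n) (fst q)))\<^sup>2 / (snd q - fst q) \<le> (1 + e) * W n q"
          using o by (simp add: pos_divide_le_eq mult_ac)
      qed
      also have "\<dots> \<le> (1 + e) * E" unfolding sum_distrib_left[symmetric] using Wsum e by (intro mult_left_mono) auto
      finally show ?case .
    qed
  qed simp
  then have "(\<Sum>q\<in>D. (V (snd q) - V (fst q))\<^sup>2 / (snd q - fst q)) \<le> E + e" if e: "e > 0" for e
  proof -
    have "e / (E + 1) > 0" using e E0 by simp
    from \<open>\<And>e. e > 0 \<Longrightarrow> (\<Sum>q\<in>D. (V (snd q) - V (fst q))\<^sup>2 / (snd q - fst q)) \<le> (1 + e) * E\<close>[OF this]
    have "(\<Sum>q\<in>D. (V (snd q) - V (fst q))\<^sup>2 / (snd q - fst q)) \<le> E + e * (E / (E + 1))" by (simp add: algebra_simps)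
    also have "\<dots> \<le> E + e * 1" using e E0 by (intro add_left_mono mult_left_mono) auto
    finally show ?thesis by simp
  qed
  then have "(\<Sum>q\<in>D. (V (snd q) - V (fst q))\<^sup>2 / (snd q - fst q)) \<le> E" by (rule field_le_epsilon)
  then show ?thesis by (simp add: split_beta)
qed

section \<open>Square integrable densities from bounded energy\<close>

lemma straddle:
  fixes V :: "real \<Rightarrow> real"
  assumes d: "(V has_vector_derivative g) (at x)" and a: "a \<longlonglongrightarrow> x" and b: "b \<longlonglongrightarrow> x"
    and ab: "\<And>n. a n \<le> x" "\<And>n. x \<le> b n" "\<And>n. a n < b n"
  shows "(\<lambda>n. (V (b n) - V (a n)) / (b n - a n)) \<longlonglongrightarrow> g"
proof (rule tendstoI)
  fix e :: real assume e: "e > 0"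
  then have e2: "e / 2 > 0" by simp
  obtain s where s: "s > 0" "\<And>y. norm (y - x) < s \<Longrightarrow> norm (V y - V x - (y - x) *\<^sub>R g) \<le> e / 2 * norm (y - x)"
    using d e2 unfolding has_vector_derivative_def has_derivative_at_alt by blast
  have "\<forall>\<^sub>F n in sequentially. dist (a n) x < s" "\<forall>\<^sub>F n in sequentially. dist (b n) x < s"
    using a b s(1) by (auto dest: tendstoD)
  then show "\<forall>\<^sub>F n in sequentially. dist ((V (b n) - V (a n)) / (b n - a n)) g < e"
  proof eventually_elim
    case (elim n)
    have 1: "\<bar>V (a n) - V x - (a n - x) * g\<bar> \<le> e / 2 * (x - a n)" using s(2)[of "a n"] elim(1) ab(1)[of n] by (simp add: dist_real_def)
    have 2: "\<bar>V (b n) - V x - (b n - x) * g\<bar> \<le> e / 2 * (b n - x)" using s(2)[of "b n"] elim(2) ab(2)[of n] by (simp add: dist_real_def)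
    have "\<bar>(V (b n) - V (a n)) - (b n - a n) * g\<bar> = \<bar>(V (b n) - V x - (b n - x) * g) - (V (a n) - V x - (a n - x) * g)\<bar>" by (simp add: algebra_simps)
    also have "\<dots> \<le> e / 2 * (b n - x) + e / 2 * (x - a n)" using 1 2 by linarith
    also have "\<dots> = e / 2 * (b n - a n)" unfolding distrib_left[symmetric] by simp
    also have "\<dots> < e * (b n - a n)" using e ab(3)[of n] by simp
    finally have k: "\<bar>(V (b n) - V (a n)) - (b n - a n) * g\<bar> < e * (b n - a n)" .
    have "(V (b n) - V (a n)) / (b n - a n) - g = ((V (b n) - V (a n)) - (b n - a n) * g) / (b n - a n)"
      using ab(3)[of n] by (simp add: field_simps)
    then show ?case using k ab(3)[of n] by (simp add: dist_real_def abs_divide pos_divide_less_eq)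
  qed
qed

text \<open>A form of a theorem of F. Riesz. Cauchy-Schwarz makes \<open>V\<close> absolutely
  continuous, hence the integral of some \<open>g\<close>; its dyadic difference quotients converge
  to \<open>g\<close> almost everywhere with bounded square integrals, so Fatou's lemma puts
  \<open>g\<close> into \<open>L2\<close>.\<close>

lemma energy_density:
  fixes V :: "real \<Rightarrow> real"
  assumes en: "\<And>D. finite D \<Longrightarrow> (\<And>a b. (a, b) \<in> D \<Longrightarrow> 0 \<le> a \<and> a < b \<and> b \<le> 1) \<Longrightarrow>
     disjoint_family_on (\<lambda>(a, b). {a<..<b}) D \<Longrightarrow> (\<Sum>(a, b)\<in>D. (V b - V a)\<^sup>2 / (b - a)) \<le> E"
  obtains g :: "real \<Rightarrow> real" where "L2 g" "g absolutely_integrable_on {0..1}" "\<And>x. x \<in> {0..1} \<Longrightarrow> (g has_integral (V x - V 0)) {0..x}"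
proof -
  have E0: "E \<ge> 0" using en[of "{}"] by (simp add: disjoint_family_on_def)
  have "abs_cont (\<lambda>x. of_real (V x))" unfolding abs_cont_def
  proof (intro allI impI)
    fix e :: real assume e: "e > 0"
    \<comment> \<open>The squared sum of increments is at most the total length times
      \<open>E\<close>; writing \<open>E + 1\<close> avoids a zero denominator and makes the
      inequality strict.\<close>
    define d where "d = e\<^sup>2 / (E + 1)"
    show "\<exists>\<delta>>0. \<forall>D. finite D \<longrightarrow> (\<forall>(a, b)\<in>D. 0 \<le> a \<and> a < b \<and> b \<le> 1) \<longrightarrow>
     disjoint_family_on (\<lambda>(a, b). {a<..<b}) D \<longrightarrow>
     (\<Sum>(a, b)\<in>D. b - a) < \<delta> \<longrightarrow> (\<Sum>(a, b)\<in>D. norm (complex_of_real (V b) - of_real (V a))) < e"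
    proof (intro exI[of _ d] conjI allI impI)
      show "d > 0" using e E0 by (simp add: d_def)
      fix D :: "(real \<times> real) set"
      assume D: "finite D" "\<forall>(a, b)\<in>D. 0 \<le> a \<and> a < b \<and> b \<le> 1" "disjoint_family_on (\<lambda>(a, b). {a<..<b}) D" "(\<Sum>(a, b)\<in>D. b - a) < d"
      have o: "fst q < snd q" if "q \<in> D" for q using D(2) that by (auto simp: split_beta)
      have "(\<Sum>q\<in>D. \<bar>V (snd q) - V (fst q)\<bar>) = (\<Sum>q\<in>D. \<bar>sqrt (snd q - fst q)\<bar> * \<bar>(V (snd q) - V (fst q)) / sqrt (snd q - fst q)\<bar>)"
        using o by (intro sum.cong refl) (simp add: abs_divide)
      then have "(\<Sum>q\<in>D. \<bar>V (snd q) - V (fst q)\<bar>)\<^sup>2 \<le> (\<Sum>q\<in>D. (sqrt (snd q - fst q))\<^sup>2) * (\<Sum>q\<in>D. ((V (snd q) - V (fst q)) / sqrt (snd q - fst q))\<^sup>2)"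
        by (simp only: sum_mult_sq_le)
      also have "(\<Sum>q\<in>D. (sqrt (snd q - fst q))\<^sup>2) = (\<Sum>q\<in>D. snd q - fst q)" using o by (intro sum.cong refl) (simp add: less_imp_le)
      also have "(\<Sum>q\<in>D. ((V (snd q) - V (fst q)) / sqrt (snd q - fst q))\<^sup>2) = (\<Sum>q\<in>D. (V (snd q) - V (fst q))\<^sup>2 / (snd q - fst q))"
        using o by (intro sum.cong refl) (simp add: power_divide less_imp_le)
      also have "(\<Sum>q\<in>D. snd q - fst q) * \<dots> \<le> d * E"
      proof (rule mult_mono)
        have "(\<Sum>(a, b)\<in>D. (V b - V a)\<^sup>2 / (b - a)) \<le> E" using D(2) by (intro en D(1,3)) auto
        then show "(\<Sum>q\<in>D. (V (snd q) - V (fst q))\<^sup>2 / (snd q - fst q)) \<le> E" by (simp add: split_beta)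
        show "(\<Sum>q\<in>D. snd q - fst q) \<le> d" using D(4) by (simp add: split_beta)
        show "0 \<le> (\<Sum>q\<in>D. (V (snd q) - V (fst q))\<^sup>2 / (snd q - fst q))"
          using o by (intro sum_nonneg divide_nonneg_pos) auto
      qed (use \<open>d > 0\<close> in simp)
      also have "\<dots> < e\<^sup>2"
      proof -
        have "d * E < d * (E + 1)" using \<open>d > 0\<close> by simp
        then show ?thesis using E0 by (simp add: d_def)
      qed
      finally have "(\<Sum>q\<in>D. \<bar>V (snd q) - V (fst q)\<bar>) < e" using e by (simp add: power2_less_imp_less)
      then show "(\<Sum>(a, b)\<in>D. norm (complex_of_real (V b) - of_real (V a))) < e"
        by (simp add: split_beta flip: of_real_diff)
    qed
  qed
  then obtain g :: "real \<Rightarrow> real" where g: "g absolutely_integrable_on {0..1}" "\<And>x. x \<in> {0..1} \<Longrightarrow> (g has_integral (V x - V 0)) {0..x}"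
    by (rule abs_cont_real_ftc) (rule that; assumption)
  have gi': "integrable unit_leb g"
  proof -
    have "g absolutely_integrable_on {0<..<1}" by (rule set_integrable_subset[OF g(1)]) auto
    then show ?thesis by (simp add: integrable_restrict_space set_integrable_def)
  qed
  have gm: "g \<in> borel_measurable unit_leb" using gi' by simp
  define k where "k n x = grid_index (2^n) x" for n :: nat and x :: real
  define T where "T n j = (V (real (Suc j) / 2^n) - V (real j / 2^n)) * 2^n" for n j :: nat
  define q where "q n x = T n (k n x)" for n x
  have lim: "AE x in unit_leb. (\<lambda>n. q n x) \<longlonglongrightarrow> g x"
  proof -
    have gio: "g integrable_on {0..1}" using g(1) set_lebesgue_integral_eq_integral by blast
    have "AE x in unit_leb. ((\<lambda>t. integral {0..t} g) has_vector_derivative g x) (at x)"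
      by (rule integral_has_vector_derivative_AE[OF gio])
    then show ?thesis
    proof (rule AE_mp, intro AE_I2 impI)
      fix x assume x: "x \<in> space unit_leb" and dx: "((\<lambda>t. integral {0..t} g) has_vector_derivative g x) (at x)"
      have x01: "0 < x" "x < 1" using x by auto
      have "(V has_vector_derivative g x) (at x)"
      proof -
        have dV: "((\<lambda>t. integral {0..t} g + V 0) has_vector_derivative g x) (at x)"
          using has_vector_derivative_add[OF dx has_vector_derivative_const[of "V 0"]] by simp
        have iu: "integral {0..y} g + V 0 = V y" if "y \<in> {0<..<1}" for y
          using integral_unique[OF g(2)[of y]] that by simp
        show ?thesis
          by (rule has_vector_derivative_transform_within_open[where S="{0<..<1}", OF dV]) (use x01 iu in auto)
      qed
      moreover have f2: "filterlim (\<lambda>n. (2::nat)^n) at_top sequentially" by (rule filterlim_subseq) (simp add: strict_mono_def)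
      have a: "(\<lambda>n. real (k n x) / 2^n) \<longlonglongrightarrow> x" using grid_index_tendsto[OF f2, of x] x01 by (simp add: k_def)
      moreover have "(\<lambda>n. real (Suc (k n x)) / 2^n) \<longlonglongrightarrow> x"
      proof -
        have "(\<lambda>n. real (k n x) / 2^n + (1/2)^n) \<longlonglongrightarrow> x + 0" by (intro tendsto_add a LIMSEQ_realpow_zero) auto
        then show ?thesis by (simp add: add_divide_distrib power_one_over add.commute)
      qed
      ultimately have "(\<lambda>n. (V (real (Suc (k n x)) / 2^n) - V (real (k n x) / 2^n)) / (real (Suc (k n x)) / 2^n - real (k n x) / 2^n)) \<longlonglongrightarrow> g x"
      proof (rule straddle)
        fix n
        have kb: "real (k n x) \<le> 2^n * x" "2^n * x < real (k n x) + 1" using grid_index_bounds[of x "2^n"] x01 by (auto simp: k_def)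
        show "real (k n x) / 2^n \<le> x" "x \<le> real (Suc (k n x)) / 2^n" "real (k n x) / 2^n < real (Suc (k n x)) / 2^n"
          using kb by (auto simp: field_simps)
      qed
      moreover have "real (Suc (k n x)) / 2^n - real (k n x) / 2^n = 1 / 2^n" for n by (simp add: diff_divide_distrib[symmetric])
      ultimately show "(\<lambda>n. q n x) \<longlonglongrightarrow> g x" by (simp add: q_def T_def)
    qed
  qed
  \<comment> \<open>The squared difference quotient as a finite sum over cells: measurability is
    then immediate, and its integral is an energy sum of the kind bounded by
    \<open>E\<close>.\<close>
  define S where "S n x = (\<Sum>j<2^n. ennreal ((T n j)\<^sup>2) * indicator {real j / 2^n..<real (Suc j) / 2^n} x)" for n :: nat and x :: real
  have Sq: "ennreal ((q n x)\<^sup>2) = S n x" if x: "0 \<le> x" "x < 1" for n x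
  proof -
    have kb: "real (k n x) \<le> 2^n * x" "2^n * x < real (k n x) + 1" using grid_index_bounds[of x "2^n"] x by (auto simp: k_def)
    have "real (k n x) < 2^n" using kb(1) x by (smt (verit) mult_left_le zero_less_power mult_less_cancel_left2)
    then have k2: "k n x < 2^n" by (metis of_nat_less_iff of_nat_numeral of_nat_power)
    have i: "x \<in> {real j / 2^n..<real (Suc j) / 2^n} \<longleftrightarrow> j = k n x" for j
    proof -
      have "x \<in> {real j / 2^n..<real (Suc j) / 2^n} \<longleftrightarrow> real j \<le> 2^n * x \<and> 2^n * x < real j + 1" by (auto simp: field_simps)
      also have "\<dots> \<longleftrightarrow> j = k n x" using kb by (auto simp del: of_nat_Suc)
      finally show ?thesis .
    qed
    have "S n x = (\<Sum>j<2^n. if j = k n x then ennreal ((T n j)\<^sup>2) else 0)"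
      unfolding S_def 
      by (intro sum.cong refl) (simp only: indicator_def of_bool_def i if_distrib[of "\<lambda>t. _ * t"] mult_1_right mult_zero_right)
    then show ?thesis using k2 by (simp add: q_def)
  qed
  have Sint: "(\<integral>\<^sup>+x. S n x \<partial>lebesgue) \<le> ennreal E" for n
  proof -
    have "(\<integral>\<^sup>+x. S n x \<partial>lebesgue) = (\<Sum>j<2^n. \<integral>\<^sup>+x. ennreal ((T n j)\<^sup>2) * indicator {real j / 2^n..<real (Suc j) / 2^n} x \<partial>lebesgue)"
      unfolding S_def by (intro nn_integral_sum borel_measurable_times_ennreal borel_measurable_const borel_measurable_indicator) auto
    also have "\<dots> = (\<Sum>j<2^n. ennreal ((V (real (Suc j) / 2^n) - V (real j / 2^n))\<^sup>2 / (real (Suc j) / 2^n - real j / 2^n)))"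
    proof (intro sum.cong refl)
      fix j :: nat
      have "(\<integral>\<^sup>+x. ennreal ((T n j)\<^sup>2) * indicator {real j / 2^n..<real (Suc j) / 2^n} x \<partial>lebesgue) = ennreal ((T n j)\<^sup>2) * emeasure lebesgue {real j / 2^n..<real (Suc j) / 2^n}"
        by (intro nn_integral_cmult_indicator) auto
      also have "emeasure lebesgue {real j / 2^n..<real (Suc j) / 2^n} = ennreal (1 / 2^n)"
        by (simp add: divide_right_mono diff_divide_distrib[symmetric])
      also have "ennreal ((T n j)\<^sup>2) * ennreal (1 / 2^n) = ennreal ((T n j)\<^sup>2 * (1 / 2^n))" by (rule ennreal_mult[symmetric]) auto
      also have "(T n j)\<^sup>2 * (1 / 2^n) = (V (real (Suc j) / 2^n) - V (real j / 2^n))\<^sup>2 / (real (Suc j) / 2^n - real j / 2^n)"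
        by (simp add: T_def power_mult_distrib diff_divide_distrib[symmetric] power2_eq_square)
      finally show "(\<integral>\<^sup>+x. ennreal ((T n j)\<^sup>2) * indicator {real j / 2^n..<real (Suc j) / 2^n} x \<partial>lebesgue) = ennreal ((V (real (Suc j) / 2^n) - V (real j / 2^n))\<^sup>2 / (real (Suc j) / 2^n - real j / 2^n))" .
    qed
    also have "\<dots> = ennreal (\<Sum>j<2^n. (V (real (Suc j) / 2^n) - V (real j / 2^n))\<^sup>2 / (real (Suc j) / 2^n - real j / 2^n))"
      by (intro sum_ennreal) (auto intro!: divide_nonneg_nonneg divide_right_mono)
    also have "\<dots> \<le> ennreal E"
    proof (intro ennreal_leI)
      define c where "c = (\<lambda>j. (real j / 2^n, real (Suc j) / 2^n))"
      have inj: "inj_on c {..<2^n}" by (auto simp: inj_on_def c_def)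
      have "(\<Sum>(a, b)\<in>c ` {..<2^n}. (V b - V a)\<^sup>2 / (b - a)) \<le> E"
      proof (rule en)
        fix a b assume "(a, b) \<in> c ` {..<2^n}"
        then obtain j where j: "j < 2^n" "a = real j / 2^n" "b = real (Suc j) / 2^n" by (auto simp: c_def)
        then have "real (Suc j) \<le> 2^n" by (metis Suc_leI of_nat_le_iff of_nat_numeral of_nat_power)
        then show "0 \<le> a \<and> a < b \<and> b \<le> 1" unfolding j by (simp add: divide_strict_right_mono)
      next
        show "disjoint_family_on (\<lambda>(a, b). {a<..<b}) (c ` {..<2^n})"
        proof (unfold disjoint_family_on_def, intro ballI impI)
          fix r s assume "r \<in> c ` {..<2^n}" "s \<in> c ` {..<2^n}" "r \<noteq> s"
          then obtain i j :: nat where ij: "r = c i" "s = c j" "i \<noteq> j" by auto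
          have no: False if "x \<in> {fst r<..<snd r}" "x \<in> {fst s<..<snd s}" for x
          proof -
            have "real i < x * 2^n" "x * 2^n < real (Suc i)" "real j < x * 2^n" "x * 2^n < real (Suc j)"
              using that ij by (auto simp: c_def field_simps)
            then have "real i < real (Suc j)" "real j < real (Suc i)" by linarith+
            then show False using ij(3) by linarith
          qed
          then show "(case r of (a, b) \<Rightarrow> {a<..<b}) \<inter> (case s of (a, b) \<Rightarrow> {a<..<b}) = {}"
            unfolding split_beta disjoint_iff by (auto simp del: greaterThanLessThan_iff)
        qed
      qed auto
      then show "(\<Sum>j<2^n. (V (real (Suc j) / 2^n) - V (real j / 2^n))\<^sup>2 / (real (Suc j) / 2^n - real j / 2^n)) \<le> E"
        unfolding sum.reindex[OF inj] by (simp add: c_def)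
    qed
    finally show ?thesis .
  qed
  have Sm: "S n \<in> borel_measurable unit_leb" for n
  proof -
    have "S n \<in> borel_measurable lebesgue"
      unfolding S_def[abs_def] by (intro borel_measurable_sum borel_measurable_times_ennreal borel_measurable_const borel_measurable_indicator) auto
    then show ?thesis by (rule measurable_restrict_space1)
  qed
  have "(\<integral>\<^sup>+x. ennreal ((g x)\<^sup>2) \<partial>unit_leb) = (\<integral>\<^sup>+x. liminf (\<lambda>n. S n x) \<partial>unit_leb)"
  proof (rule nn_integral_cong_AE)
    show "AE x in unit_leb. ennreal ((g x)\<^sup>2) = liminf (\<lambda>n. S n x)"
      using lim
    proof (rule AE_mp, intro AE_I2 impI)
      fix x assume x: "x \<in> space unit_leb" and l: "(\<lambda>n. q n x) \<longlonglongrightarrow> g x"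
      have "(\<lambda>n. ennreal ((q n x)\<^sup>2)) \<longlonglongrightarrow> ennreal ((g x)\<^sup>2)" by (intro tendsto_ennrealI tendsto_power l)
      moreover have "ennreal ((q n x)\<^sup>2) = S n x" for n using x by (intro Sq) auto
      ultimately have "(\<lambda>n. S n x) \<longlonglongrightarrow> ennreal ((g x)\<^sup>2)" by (simp only:)
      then show "ennreal ((g x)\<^sup>2) = liminf (\<lambda>n. S n x)" by (simp add: lim_imp_Liminf)
    qed
  qed
  also have "\<dots> \<le> liminf (\<lambda>n. \<integral>\<^sup>+x. S n x \<partial>unit_leb)" using Sm by (rule nn_integral_liminf)
  also have "\<dots> \<le> ennreal E"
  proof (intro Liminf_le always_eventually allI)
    fix n
    have "(\<integral>\<^sup>+x. S n x \<partial>unit_leb) = (\<integral>\<^sup>+x. S n x * indicator {0<..<1} x \<partial>lebesgue)"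
      by (intro nn_integral_restrict_space) auto
    also have "\<dots> \<le> (\<integral>\<^sup>+x. S n x \<partial>lebesgue)" by (intro nn_integral_mono) (auto simp: indicator_def)
    finally show "(\<integral>\<^sup>+x. S n x \<partial>unit_leb) \<le> ennreal E" using Sint[of n] by (rule order_trans)
  qed simp
  finally have fin: "(\<integral>\<^sup>+x. ennreal ((g x)\<^sup>2) \<partial>unit_leb) \<le> ennreal E" .
  have "integrable unit_leb (\<lambda>x. (g x)\<^sup>2)"
    using gm fin by (intro integrableI_bounded) (auto intro: le_less_trans)
  then have "L2 g" using gm by (simp add: L2_def)
  with g show thesis using that by blast
qed

section \<open>The gauge transformed Szego recursion\<close>

text \<open>To first order the phase of \<open>1 - b\<close> is \<open>- Im b\<close>. The real and
  the imaginary error are both quadratic, each with a factor 2 from dividing by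
  \<open>\<rho> \<ge> 1/2\<close>; together they give the 4.\<close>

lemma sgn_one_minus_approx:
  fixes b :: complex
  assumes b: "cmod b \<le> 1/2"
  shows "cmod (cnj (sgn (1 - b)) - 1 - \<i> * of_real (Im b)) \<le> 4 * (cmod b)\<^sup>2"
proof -
  define \<rho> where "\<rho> = cmod (1 - b)"
  have re: "\<bar>Re b\<bar> \<le> 1/2" "\<bar>Im b\<bar> \<le> cmod b" using b abs_Re_le_cmod[of b] abs_Im_le_cmod[of b] by linarith+
  have r1: "\<rho> \<ge> 1 - Re b" unfolding \<rho>_def using complex_Re_le_cmod[of "1 - b"] by simp
  have r2: "\<rho> \<ge> 1/2" using r1 re by linarith
  have r3: "\<bar>\<rho> - 1\<bar> \<le> cmod b" unfolding \<rho>_def using norm_triangle_ineq3[of "1 - b" 1] by simp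
  have rsq: "\<rho>\<^sup>2 = (1 - Re b)\<^sup>2 + (Im b)\<^sup>2" by (simp add: \<rho>_def cmod_power2)
  have im2: "(Im b)\<^sup>2 \<le> (cmod b)\<^sup>2" using re(2) by (metis abs_le_square_iff abs_norm_cancel)
  have "(\<rho> - (1 - Re b)) * (\<rho> + (1 - Re b)) = (Im b)\<^sup>2" using rsq by (simp add: power2_eq_square algebra_simps)
  moreover have "(\<rho> - (1 - Re b)) * 1 \<le> (\<rho> - (1 - Re b)) * (\<rho> + (1 - Re b))" using r1 r2 re by (intro mult_left_mono) auto
  ultimately have d: "0 \<le> \<rho> - (1 - Re b)" "\<rho> - (1 - Re b) \<le> (cmod b)\<^sup>2" using im2 r1 by auto
  have rn: "\<rho> > 0" using r2 by simp
  have e: "cnj (sgn (1 - b)) - 1 - \<i> * of_real (Im b) = Complex (((1 - Re b) - \<rho>) / \<rho>) (Im b * (1 - \<rho>) / \<rho>)"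
    using rn by (simp add: complex_eq_iff sgn_eq \<rho>_def[symmetric] Re_divide_of_real Im_divide_of_real field_simps)
  have "cmod (Complex (((1 - Re b) - \<rho>) / \<rho>) (Im b * (1 - \<rho>) / \<rho>)) \<le> \<bar>((1 - Re b) - \<rho>) / \<rho>\<bar> + \<bar>Im b * (1 - \<rho>) / \<rho>\<bar>"
    using cmod_le[of "Complex (((1 - Re b) - \<rho>) / \<rho>) (Im b * (1 - \<rho>) / \<rho>)"] by simp
  also have "\<bar>((1 - Re b) - \<rho>) / \<rho>\<bar> \<le> 2 * (cmod b)\<^sup>2"
  proof -
    have "\<bar>(1 - Re b) - \<rho>\<bar> \<le> (cmod b)\<^sup>2" using d by linarith
    also have "\<dots> \<le> 2 * (cmod b)\<^sup>2 * \<rho>" using mult_left_mono[OF r2, of "2 * (cmod b)\<^sup>2"] by simp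
    finally show ?thesis using rn by (simp add: abs_divide pos_divide_le_eq)
  qed
  also have "\<bar>Im b * (1 - \<rho>) / \<rho>\<bar> \<le> 2 * (cmod b)\<^sup>2"
  proof -
    have "\<bar>Im b * (1 - \<rho>)\<bar> \<le> cmod b * cmod b" unfolding abs_mult using re r3 by (intro mult_mono) auto
    also have "\<dots> \<le> 2 * (cmod b)\<^sup>2 * \<rho>" using mult_left_mono[OF r2, of "2 * (cmod b)\<^sup>2"] by (simp add: power2_eq_square)
    finally show ?thesis using rn by (simp add: abs_divide pos_divide_le_eq)
  qed
  finally show ?thesis unfolding e by simp
qed

context circle_data
begin

text \<open>The phase \<open>om\<close> normalizes the solution for spectral parameter \<open>0\<close> to be positive, so that the limit system has
  \<open>u > 0\<close>, \<open>y = 0\<close> there. The gauged coefficients \<open>gb\<close> are a discretization of \<open>(\<tau> - i p) / m\<close>.\<close>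

definition om :: "nat \<Rightarrow> complex" where "om k = sgn (poly (P k) 1)"
definition gb :: "nat \<Rightarrow> complex" where "gb k = c k * (cnj (om k))\<^sup>2"

text \<open>At the point 1 the values of \<open>P k\<close> and \<open>Q k\<close> have equal
  modulus, so the subtracted term is strictly smaller as long as \<open>c k\<close> has modulus
  below 1.\<close>

lemma P1_nz: "k < m \<Longrightarrow> poly (P k) 1 \<noteq> 0"
proof (induction k)
  case (Suc k)
  have "poly (P (Suc k)) 1 = poly (P k) 1 - c k * cnj (poly (P k) 1)" using poly_Q[of 1 k] by (simp add: P_Suc)
  moreover have "cmod (c k * cnj (poly (P k) 1)) < cmod (poly (P k) 1)"
    using c_less_1[of k] Suc by (simp add: norm_mult)
  ultimately show ?case by auto
qed (simp add: P_0)

lemma om_norm: "k < m \<Longrightarrow> cmod (om k) = 1" using P1_nz by (simp add: om_def norm_sgn)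

lemma om_cnj: "k < m \<Longrightarrow> om k * cnj (om k) = 1" using om_norm by (simp add: mult_cnj_norm)

lemma gb_norm: "k < m \<Longrightarrow> cmod (gb k) = cmod (c k)" using om_norm by (simp add: gb_def norm_mult norm_power)

lemma om_0: "om 0 = 1" by (simp add: om_def P_0)

lemma om_Suc: assumes "Suc k < m" shows "om (Suc k) = om k * sgn (1 - gb k)"
proof -
  have k: "k < m" using assms by simp
  have nz: "poly (P k) 1 \<noteq> 0" using P1_nz[OF k] .
  have pe: "poly (P k) 1 = of_real (cmod (poly (P k) 1)) * om k" using nz by (simp add: om_def sgn_eq)
  have "poly (P (Suc k)) 1 = poly (P k) 1 - c k * cnj (poly (P k) 1)" using poly_Q[of 1 k] by (simp add: P_Suc)
  also have "\<dots> = of_real (cmod (poly (P k) 1)) * (om k - c k * cnj (om k))" by (subst (1 2) pe) (simp add: algebra_simps)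
  also have "om k - c k * cnj (om k) = om k * (1 - gb k)"
  proof -
    have "om k * gb k = c k * cnj (om k) * (om k * cnj (om k))" by (simp add: gb_def power2_eq_square)
    then show ?thesis using om_cnj[OF k] by (simp add: algebra_simps)
  qed
  finally have "om (Suc k) = sgn (complex_of_real (cmod (poly (P k) 1)) * (om k * (1 - gb k)))" by (simp add: om_def)
  also have "\<dots> = om k * sgn (1 - gb k)" using nz om_norm[OF k] by (simp add: sgn_mult sgn_of_real) (simp add: om_def sgn_sgn)
  finally show ?thesis .
qed

definition ee :: "complex \<Rightarrow> complex" where "ee \<zeta> = exp (\<i> * \<zeta> / of_nat m)"
text \<open>Dividing by \<open>ee \<zeta> ^ k\<close> splits the shift factor
  \<open>(ee \<zeta>)\<^sup>2\<close> of a Szego step evenly: per step \<open>eta\<close> gains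
  \<open>ee\<close> and \<open>ets\<close> its inverse. Without coefficients these discretize
  \<open>exp (i \<zeta> x)\<close> and \<open>exp (- i \<zeta> x)\<close>.\<close>

definition eta :: "nat \<Rightarrow> complex \<Rightarrow> complex" where "eta k \<zeta> = poly (P k) ((ee \<zeta>)\<^sup>2) * cnj (om k) / ee \<zeta> ^ k"
definition ets :: "nat \<Rightarrow> complex \<Rightarrow> complex" where "ets k \<zeta> = poly (Q k) ((ee \<zeta>)\<^sup>2) * om k / ee \<zeta> ^ k"

lemma eta_0: "eta 0 \<zeta> = 1" "ets 0 \<zeta> = 1" by (simp_all add: eta_def ets_def P_0 Q_0 om_0)

lemma ee_nz: "ee \<zeta> \<noteq> 0" by (simp add: ee_def)

lemma eta_Suc:
  assumes "Suc k < m"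
  shows "eta (Suc k) \<zeta> = cnj (sgn (1 - gb k)) * (ee \<zeta> * eta k \<zeta> - gb k / ee \<zeta> * ets k \<zeta>)"
    and "ets (Suc k) \<zeta> = sgn (1 - gb k) * (ets k \<zeta> / ee \<zeta> - cnj (gb k) * ee \<zeta> * eta k \<zeta>)"
proof -
  have k: "k < m" using assms by simp
  define e where "e = ee \<zeta>"
  have e0: "e \<noteq> 0" by (simp add: e_def ee_nz)
  define o1 where "o1 = om k"
  define s where "s = sgn (1 - gb k)"
  have oo: "o1 * cnj o1 = 1" using om_cnj[OF k] by (simp add: o1_def)
  have os: "om (Suc k) = o1 * s" using om_Suc[OF assms] by (simp add: o1_def s_def)
  have ck: "c k = gb k * o1\<^sup>2"
  proof -
    have "gb k * o1\<^sup>2 = c k * (o1 * cnj o1)\<^sup>2" by (simp add: gb_def o1_def power_mult_distrib)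
    then show ?thesis using oo by simp
  qed
  have ck': "cnj (c k) = cnj (gb k) * (cnj o1)\<^sup>2" by (simp add: ck)
  have pP: "poly (P k) (e\<^sup>2) = eta k \<zeta> * o1 * e ^ k"
  proof -
    have "eta k \<zeta> * o1 * e ^ k = poly (P k) (e\<^sup>2) * (o1 * cnj o1)" using e0 by (simp add: eta_def e_def[symmetric] o1_def)
    then show ?thesis using oo by simp
  qed
  have pQ: "poly (Q k) (e\<^sup>2) = ets k \<zeta> * cnj o1 * e ^ k"
  proof -
    have "ets k \<zeta> * cnj o1 * e ^ k = poly (Q k) (e\<^sup>2) * (o1 * cnj o1)" using e0 by (simp add: ets_def e_def[symmetric] o1_def)
    then show ?thesis using oo by simp
  qed
  have "eta (Suc k) \<zeta> = (e\<^sup>2 * (eta k \<zeta> * o1 * e ^ k) - c k * (ets k \<zeta> * cnj o1 * e ^ k)) * cnj (o1 * s) / e ^ Suc k"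
    unfolding eta_def[of "Suc k"] os e_def[symmetric] P_Suc by (simp add: pP[symmetric] pQ[symmetric])
  also have "c k * (ets k \<zeta> * cnj o1 * e ^ k) = gb k * o1 * (o1 * cnj o1) * ets k \<zeta> * e ^ k" by (simp add: ck power2_eq_square)
  also have "gb k * o1 * (o1 * cnj o1) * ets k \<zeta> * e ^ k = gb k * o1 * ets k \<zeta> * e ^ k" unfolding oo by simp
  also have "(e\<^sup>2 * (eta k \<zeta> * o1 * e ^ k) - gb k * o1 * ets k \<zeta> * e ^ k) * cnj (o1 * s) / e ^ Suc k
    = (o1 * cnj o1) * cnj s * (e * eta k \<zeta> - gb k / e * ets k \<zeta>)" using e0 by (simp add: field_simps power2_eq_square)
  finally show "eta (Suc k) \<zeta> = cnj (sgn (1 - gb k)) * (ee \<zeta> * eta k \<zeta> - gb k / ee \<zeta> * ets k \<zeta>)"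
    unfolding oo by (simp add: s_def e_def)
  have "ets (Suc k) \<zeta> = (ets k \<zeta> * cnj o1 * e ^ k - cnj (c k) * (e\<^sup>2 * (eta k \<zeta> * o1 * e ^ k))) * (o1 * s) / e ^ Suc k"
    unfolding ets_def[of "Suc k"] os e_def[symmetric] Q_Suc by (simp add: pP[symmetric] pQ[symmetric])
  also have "cnj (c k) * (e\<^sup>2 * (eta k \<zeta> * o1 * e ^ k)) = cnj (gb k) * cnj o1 * (o1 * cnj o1) * e\<^sup>2 * eta k \<zeta> * e ^ k" by (simp add: ck' power2_eq_square)
  also have "cnj (gb k) * cnj o1 * (o1 * cnj o1) * e\<^sup>2 * eta k \<zeta> * e ^ k = cnj (gb k) * cnj o1 * e\<^sup>2 * eta k \<zeta> * e ^ k" unfolding oo by simp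
  also have "(ets k \<zeta> * cnj o1 * e ^ k - cnj (gb k) * cnj o1 * e\<^sup>2 * eta k \<zeta> * e ^ k) * (o1 * s) / e ^ Suc k
    = (o1 * cnj o1) * s * (ets k \<zeta> / e - cnj (gb k) * e * eta k \<zeta>)" using e0 by (simp add: field_simps power2_eq_square)
  finally show "ets (Suc k) \<zeta> = sgn (1 - gb k) * (ets k \<zeta> / ee \<zeta> - cnj (gb k) * ee \<zeta> * eta k \<zeta>)"
    unfolding oo by (simp add: s_def e_def)
qed

lemma ee_norm: "cmod (ee \<zeta>) = exp (- Im \<zeta> / real m)"
  by (simp add: ee_def norm_exp_eq_Re Re_divide_of_nat)

lemma ee_bounds: "cmod (ee \<zeta>) \<le> exp (cmod \<zeta> / real m)" "cmod (1 / ee \<zeta>) \<le> exp (cmod \<zeta> / real m)"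
proof -
  have "\<bar>Im \<zeta>\<bar> \<le> cmod \<zeta>" by (rule abs_Im_le_cmod)
  then have "- Im \<zeta> / real m \<le> cmod \<zeta> / real m" "Im \<zeta> / real m \<le> cmod \<zeta> / real m" by (intro divide_right_mono; simp)+
  then show "cmod (ee \<zeta>) \<le> exp (cmod \<zeta> / real m)" "cmod (1 / ee \<zeta>) \<le> exp (cmod \<zeta> / real m)"
    unfolding norm_divide ee_norm by (simp_all add: exp_minus[symmetric] inverse_eq_divide[symmetric])
qed

lemma ee_real_norm: "cmod (ee (of_real t)) = 1" by (simp add: ee_norm)

text \<open>The bound \<open>A\<close> is kept general for two uses: real parameters allow
  \<open>A = 1\<close> and an estimate independent of the parameter, while
  \<open>A = exp (cmod \<zeta> / m)\<close> costs at most \<open>exp (cmod \<zeta>)\<close> over all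
  steps.\<close>

lemma eta_bound_gen:
  assumes A: "A \<ge> 1" and e: "cmod (ee \<zeta>) \<le> A" "cmod (1 / ee \<zeta>) \<le> A" and k: "k < m"
  shows "cmod (eta k \<zeta>) \<le> A ^ k * exp (\<Sum>j<k. cmod (gb j)) \<and> cmod (ets k \<zeta>) \<le> A ^ k * exp (\<Sum>j<k. cmod (gb j))"
  using k
proof (induction k)
  case 0 then show ?case by (simp add: eta_0)
next
  case (Suc k)
  define X where "X = A ^ k * exp (\<Sum>j<k. cmod (gb j))"
  have X: "cmod (eta k \<zeta>) \<le> X" "cmod (ets k \<zeta>) \<le> X" using Suc by (auto simp: X_def)
  have s: "cmod (sgn (1 - gb k)) \<le> 1" by (simp add: norm_sgn)
  have X0: "X \<ge> 0" using X(1) norm_ge_zero order_trans by blast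
  have g: "1 + cmod (gb k) \<le> exp (cmod (gb k))" by (rule exp_ge_add_one_self)
  have "A * X + cmod (gb k) * (A * X) = A * X * (1 + cmod (gb k))" by (simp add: algebra_simps)
  also have "\<dots> \<le> A * X * exp (cmod (gb k))" using g X0 A by (intro mult_left_mono) auto
  also have "\<dots> = A ^ Suc k * exp (\<Sum>j<Suc k. cmod (gb j))" by (simp add: X_def exp_add)
  finally have fin: "A * X + cmod (gb k) * (A * X) \<le> A ^ Suc k * exp (\<Sum>j<Suc k. cmod (gb j))" .
  have "cmod (eta (Suc k) \<zeta>) \<le> 1 * (cmod (ee \<zeta>) * cmod (eta k \<zeta>) + cmod (gb k) * (cmod (1 / ee \<zeta>) * cmod (ets k \<zeta>)))"
    unfolding eta_Suc(1)[OF Suc.prems] norm_mult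
    using s by (intro mult_mono order_trans[OF norm_triangle_ineq4]) (auto simp: norm_mult norm_divide)
  also have "\<dots> \<le> A * X + cmod (gb k) * (A * X)"
    using e X A X0 by (simp add: add_mono mult_mono mult_left_mono del: norm_divide norm_one)
  finally have 1: "cmod (eta (Suc k) \<zeta>) \<le> A * X + cmod (gb k) * (A * X)" .
  have "cmod (ets (Suc k) \<zeta>) \<le> 1 * (cmod (1 / ee \<zeta>) * cmod (ets k \<zeta>) + cmod (gb k) * (cmod (ee \<zeta>) * cmod (eta k \<zeta>)))"
    unfolding eta_Suc(2)[OF Suc.prems] norm_mult
    using s by (intro mult_mono order_trans[OF norm_triangle_ineq4]) (auto simp: norm_mult norm_divide)
  also have "\<dots> \<le> A * X + cmod (gb k) * (A * X)"
    using e X A X0 by (simp add: add_mono mult_mono mult_left_mono)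
  finally have 2: "cmod (ets (Suc k) \<zeta>) \<le> A * X + cmod (gb k) * (A * X)" .
  from 1 2 fin show ?case by linarith
qed

lemma eta_bound:
  assumes k: "k < m"
  shows "cmod (eta k \<zeta>) \<le> exp (cmod \<zeta> + (\<Sum>j<m - 1. cmod (gb j)))" "cmod (ets k \<zeta>) \<le> exp (cmod \<zeta> + (\<Sum>j<m - 1. cmod (gb j)))"
proof -
  define A where "A = exp (cmod \<zeta> / real m)"
  have "A ^ k = exp (real k * (cmod \<zeta> / real m))" unfolding A_def exp_of_nat_mult[symmetric] ..
  also have "real k * (cmod \<zeta> / real m) = (real k / real m) * cmod \<zeta>" by simp
  also have "exp \<dots> \<le> exp (cmod \<zeta>)"
  proof -
    have "(real k / real m) * cmod \<zeta> \<le> 1 * cmod \<zeta>" using k by (intro mult_right_mono) auto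
    then show ?thesis by simp
  qed
  finally have Ak: "A ^ k \<le> exp (cmod \<zeta>)" .
  have "(\<Sum>j<k. cmod (gb j)) \<le> (\<Sum>j<m - 1. cmod (gb j))" using k by (intro sum_mono2) auto
  then have "A ^ k * exp (\<Sum>j<k. cmod (gb j)) \<le> exp (cmod \<zeta>) * exp (\<Sum>j<m - 1. cmod (gb j))"
    using Ak by (intro mult_mono) auto
  also have "\<dots> = exp (cmod \<zeta> + (\<Sum>j<m - 1. cmod (gb j)))" by (simp add: exp_add)
  finally have u: "A ^ k * exp (\<Sum>j<k. cmod (gb j)) \<le> exp (cmod \<zeta> + (\<Sum>j<m - 1. cmod (gb j)))" .
  have "A \<ge> 1" by (simp add: A_def)
  from eta_bound_gen[OF this _ _ k, of \<zeta>] ee_bounds[of \<zeta>] u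
  show "cmod (eta k \<zeta>) \<le> exp (cmod \<zeta> + (\<Sum>j<m - 1. cmod (gb j)))" "cmod (ets k \<zeta>) \<le> exp (cmod \<zeta> + (\<Sum>j<m - 1. cmod (gb j)))"
    unfolding A_def by (meson order_trans)+
qed

lemma eta_real: "cmod (ee (of_real t)) = 1 \<Longrightarrow> ets k (of_real t) = cnj (eta k (of_real t))"
proof -
  define e where "e = ee (of_real t)"
  assume "cmod (ee (of_real t)) = 1"
  then have e1: "e * cnj e = 1" "cmod (e\<^sup>2) = 1" by (simp_all add: e_def mult_cnj_norm norm_power)
  have ec: "cnj e = 1 / e" using e1(1) by (metis mult_eq_0_iff nonzero_eq_divide_eq mult.commute zero_neq_one)
  have e0: "e \<noteq> 0" using e1 by auto
  have "ets k (of_real t) = (e\<^sup>2) ^ k * cnj (poly (P k) (e\<^sup>2)) * om k / e ^ k"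
    unfolding ets_def e_def[symmetric] poly_Q[OF e1(2)] ..
  also have "(e\<^sup>2) ^ k = e ^ k * e ^ k" by (simp add: power2_eq_square power_mult_distrib)
  also have "e ^ k * e ^ k * cnj (poly (P k) (e\<^sup>2)) * om k / e ^ k = e ^ k * cnj (poly (P k) (e\<^sup>2)) * om k" using e0 by simp
  also have "\<dots> = cnj (eta k (of_real t))"
    unfolding eta_def e_def[symmetric] using e0 by (simp add: ec power_divide)
  finally show ?thesis .
qed

end

section \<open>Stieltjes sums along grids\<close>

lemma absolutely_integrable_times_continuous:
  fixes G F :: "real \<Rightarrow> complex"
  assumes "G absolutely_integrable_on {a..b}" "continuous_on {a..b} F"
  shows "(\<lambda>t. G t * F t) absolutely_integrable_on {a..b}"
proof -
  have "(\<lambda>t. F t * G t) absolutely_integrable_on {a..b}"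
  proof (rule absolutely_integrable_bounded_measurable_product[where h="(*)"])
    show "bilinear ((*) :: complex \<Rightarrow> complex \<Rightarrow> complex)" by (simp add: bilinear_conv_bounded_bilinear bounded_bilinear_mult)
    show "F \<in> borel_measurable (lebesgue_on {a..b})"
      by (intro continuous_imp_measurable_on_sets_lebesgue assms) auto
    show "bounded (F ` {a..b})" by (intro compact_imp_bounded compact_continuous_image assms) auto
  qed (use assms in auto)
  then show ?thesis by (simp add: mult.commute)
qed

lemma absolutely_integrable_of_real:
  fixes g :: "real \<Rightarrow> real"
  assumes "g absolutely_integrable_on S" shows "(\<lambda>t. complex_of_real (g t)) absolutely_integrable_on S"
  using absolutely_integrable_linear[OF assms bounded_linear_of_real[where 'a=complex]] by (simp add: o_def)

lemma sum_blocks: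
  fixes idx :: "nat \<Rightarrow> nat" and f :: "nat \<Rightarrow> 'a::comm_monoid_add"
  assumes "idx 0 = 0" "\<And>i. i < L \<Longrightarrow> idx i \<le> idx (Suc i)"
  shows "(\<Sum>k<idx L. f k) = (\<Sum>i<L. \<Sum>k\<in>{idx i..<idx (Suc i)}. f k)"
  using assms(2)
proof (induction L)
  case (Suc L)
  have "(\<Sum>k<idx (Suc L). f k) = (\<Sum>k<idx L. f k) + (\<Sum>k\<in>{idx L..<idx (Suc L)}. f k)"
    using Suc.prems[of L] unfolding lessThan_atLeast0 by (subst sum.atLeastLessThan_concat) auto
  then show ?case using Suc by simp
qed (simp add: assms)

text \<open>Single increments of \<open>v\<close> carry no information about \<open>g\<close>; only
  their sums over blocks converge. So the grid sums and the integral are both compared with the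
  Riemann-Stieltjes sum \<open>R\<close> of a fixed fine partition, by uniform continuity of
  \<open>F\<close> and the variation bound \<open>C\<close>.\<close>

lemma grid_stieltjes_limit:
  fixes v :: "nat \<Rightarrow> nat \<Rightarrow> real" and f :: "nat \<Rightarrow> nat \<Rightarrow> complex" and g :: "real \<Rightarrow> real"
  assumes v: "grid_converges M v V" and f: "grid_converges M f F" and M: "filterlim M at_top sequentially"
    and C: "\<And>n. (\<Sum>k<M n. \<bar>v n (Suc k) - v n k\<bar>) \<le> C"
    and g: "g absolutely_integrable_on {0..1}" "\<And>x. x \<in> {0..1} \<Longrightarrow> (g has_integral (V x - V 0)) {0..x}"
    and x: "x \<in> {0..1}"
  shows "(\<lambda>n. \<Sum>k<grid_index (M n) x. of_real (v n (Suc k) - v n k) * f n k) \<longlonglongrightarrow> integral {0..x} (\<lambda>t. of_real (g t) * F t)"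
proof (rule tendstoI)
  fix e :: real assume e: "e > 0"
  have F: "continuous_on {0..1} F" using f by (simp add: grid_converges_def)
  have C0: "C \<ge> 0" using C[of 0] by (rule order_trans[rotated]) (simp add: sum_nonneg)
  have gn: "(\<lambda>t. \<bar>g t\<bar>) absolutely_integrable_on {0..1}" using absolutely_integrable_norm[OF g(1)] by (simp add: o_def)
  define A where "A = integral {0..1} (\<lambda>t. \<bar>g t\<bar>)"
  have gni: "(\<lambda>t. \<bar>g t\<bar>) integrable_on {0..1}" using gn set_lebesgue_integral_eq_integral by blast
  have A0: "A \<ge> 0" unfolding A_def by (intro Henstock_Kurzweil_Integration.integral_nonneg gni) auto
  \<comment> \<open>The errors will add up to
    \<open>2 \<epsilon> C + \<epsilon> + \<epsilon> A\<close>, which this choice keeps within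
    \<open>e / 2\<close>.\<close>
  define \<epsilon> where "\<epsilon> = e / (4 * (C + A + 1))"
  have eps: "\<epsilon> > 0" using e C0 A0 by (simp add: \<epsilon>_def)
  have "uniformly_continuous_on {0..1} F" by (rule compact_uniformly_continuous[OF F]) simp
  then obtain d where d: "d > 0" "\<And>s t. s \<in> {0..1} \<Longrightarrow> t \<in> {0..1} \<Longrightarrow> dist s t < d \<Longrightarrow> dist (F s) (F t) < \<epsilon>"
    unfolding uniformly_continuous_on_def using eps by (metis dist_commute)
  have d2: "d / 2 > 0" using d(1) by simp
  obtain K :: nat where K: "1 / real (Suc K) < d / 2" using nat_approx_posE[OF d2] by blast
  define L where "L = Suc K"
  have L: "real L > 0" "1 / real L < d / 2" using K by (simp_all add: L_def)
  define t where "t i = x * (real i / real L)" for i :: nat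
  have tin: "t i \<in> {0..1}" "t i \<le> x" if "i \<le> L" for i
  proof -
    have "real i / real L \<le> 1" using that L(1) by simp
    then have "x * (real i / real L) \<le> x * 1" using x by (intro mult_left_mono) auto
    then show *: "t i \<le> x" by (simp add: t_def)
    have "0 \<le> t i" using x by (simp add: t_def)
    then show "t i \<in> {0..1}" using * x by auto
  qed
  have t0: "t 0 = 0" and tL: "t L = x" using L by (auto simp: t_def)
  have tS: "t (Suc i) - t i \<le> 1 / real L" "t i \<le> t (Suc i)" for i
  proof -
    have s: "t (Suc i) - t i = x * (1 / real L)" by (simp add: t_def right_diff_distrib[symmetric] diff_divide_distrib[symmetric])
    have "x * (1 / real L) \<le> 1 * (1 / real L)" using x L by (intro mult_right_mono) auto
    then show "t (Suc i) - t i \<le> 1 / real L" by (simp add: s)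
    have "0 \<le> x * (1 / real L)" using x L by simp
    then show "t i \<le> t (Suc i)" using s by linarith
  qed
  define R where "R = (\<Sum>i<L. of_real (V (t (Suc i)) - V (t i)) * F (t i))"
  let ?G = "\<lambda>s. complex_of_real (g s)"
  have Gi: "?G absolutely_integrable_on {0..1}" by (rule absolutely_integrable_of_real[OF g(1)])
  have GFi: "(\<lambda>s. ?G s * F s) absolutely_integrable_on {0..1}" by (rule absolutely_integrable_times_continuous[OF Gi F])
  have io: "h integrable_on {a..b}" if "h absolutely_integrable_on {0..1}" "0 \<le> a" "b \<le> 1" for h :: "real \<Rightarrow> 'z::euclidean_space" and a b
  proof -
    have "h integrable_on {0..1}" using that set_lebesgue_integral_eq_integral by blast
    then show ?thesis using that by (intro integrable_on_subinterval) auto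
  qed
  have split: "integral {0..t j} h = (\<Sum>i<j. integral {t i..t (Suc i)} h)" if "h absolutely_integrable_on {0..1}" "j \<le> L" for h :: "real \<Rightarrow> 'z::euclidean_space" and j
    using that(2)
  proof (induction j)
    case (Suc j)
    have "integral {0..t j} h + integral {t j..t (Suc j)} h = integral {0..t (Suc j)} h"
      using tin[of j] tin[of "Suc j"] tS(2)[of j] Suc.prems that(1)
      by (intro Henstock_Kurzweil_Integration.integral_combine io) auto
    then show ?case using Suc by simp
  qed (simp add: t0)
  have Rdiff: "cmod (integral {0..x} (\<lambda>s. ?G s * F s) - R) \<le> \<epsilon> * A"
  proof -
    have "integral {0..x} (\<lambda>s. ?G s * F s) - R = (\<Sum>i<L. integral {t i..t (Suc i)} (\<lambda>s. ?G s * F s) - of_real (V (t (Suc i)) - V (t i)) * F (t i))"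
      using split[OF GFi, of L] by (simp add: tL R_def sum_subtractf)
    also have "cmod \<dots> \<le> (\<Sum>i<L. \<epsilon> * integral {t i..t (Suc i)} (\<lambda>s. \<bar>g s\<bar>))"
    proof (rule order_trans[OF norm_sum], rule sum_mono)
      fix i assume "i \<in> {..<L}"
      then have iL: "i \<le> L" "Suc i \<le> L" by auto
      have b: "0 \<le> t i" "t (Suc i) \<le> 1" using tin[OF iL(1)] tin[OF iL(2)] by auto
      have "(g has_integral (V (t (Suc i)) - V 0)) {0..t (Suc i)}" "(g has_integral (V (t i) - V 0)) {0..t i}"
        using tin iL by (auto intro!: g(2))
      moreover have "integral {0..t i} g + integral {t i..t (Suc i)} g = integral {0..t (Suc i)} g"
        using b tS(2)[of i] by (intro Henstock_Kurzweil_Integration.integral_combine io g(1)) auto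
      ultimately have Vd: "V (t (Suc i)) - V (t i) = integral {t i..t (Suc i)} g" by (simp add: integral_unique)
      have gi1: "g integrable_on {t i..t (Suc i)}" using b by (intro io g(1))
      have "(?G has_integral of_real (V (t (Suc i)) - V (t i))) {t i..t (Suc i)}"
        unfolding Vd by (rule has_integral_of_real[OF integrable_integral[OF gi1]])
      then have "((\<lambda>s. ?G s * F (t i)) has_integral (of_real (V (t (Suc i)) - V (t i)) * F (t i))) {t i..t (Suc i)}"
        by (rule has_integral_mult_left)
      moreover have "((\<lambda>s. ?G s * F s) has_integral integral {t i..t (Suc i)} (\<lambda>s. ?G s * F s)) {t i..t (Suc i)}"
        using b by (intro integrable_integral io GFi)
      ultimately have hd: "((\<lambda>s. ?G s * F s - ?G s * F (t i)) has_integral 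
        (integral {t i..t (Suc i)} (\<lambda>s. ?G s * F s) - of_real (V (t (Suc i)) - V (t i)) * F (t i))) {t i..t (Suc i)}"
        by (intro has_integral_diff)
      have "cmod (integral {t i..t (Suc i)} (\<lambda>s. ?G s * F s - ?G s * F (t i))) \<le> integral {t i..t (Suc i)} (\<lambda>s. \<epsilon> * \<bar>g s\<bar>)"
      proof (rule Henstock_Kurzweil_Integration.integral_norm_bound_integral)
        show "(\<lambda>s. ?G s * F s - ?G s * F (t i)) integrable_on {t i..t (Suc i)}" using hd by (rule has_integral_integrable)
        show "(\<lambda>s. \<epsilon> * \<bar>g s\<bar>) integrable_on {t i..t (Suc i)}" using b by (intro integrable_on_mult_right io gn)
        fix s assume s: "s \<in> {t i..t (Suc i)}"
        then have "dist s (t i) < d" using tS(1)[of i] L d(1) by (simp add: dist_real_def)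
        then have "dist (F s) (F (t i)) < \<epsilon>" using s b tin(1)[OF iL(1)] by (intro d(2)) auto
        then have "cmod (F s - F (t i)) \<le> \<epsilon>" by (simp add: dist_norm)
        then have "\<bar>g s\<bar> * cmod (F s - F (t i)) \<le> \<bar>g s\<bar> * \<epsilon>" by (rule mult_left_mono) simp
        moreover have "?G s * F s - ?G s * F (t i) = ?G s * (F s - F (t i))" by (simp only: right_diff_distrib)
        ultimately show "cmod (?G s * F s - ?G s * F (t i)) \<le> \<epsilon> * \<bar>g s\<bar>"
          by (simp only: norm_mult norm_of_real mult.commute)
      qed
      then show "cmod (integral {t i..t (Suc i)} (\<lambda>s. ?G s * F s) - of_real (V (t (Suc i)) - V (t i)) * F (t i)) \<le> \<epsilon> * integral {t i..t (Suc i)} (\<lambda>s. \<bar>g s\<bar>)"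
        unfolding integral_unique[OF hd] by simp
    qed
    also have "\<dots> = \<epsilon> * integral {0..x} (\<lambda>s. \<bar>g s\<bar>)" using split[OF gn, of L] by (simp add: tL sum_distrib_left)
    also have "\<dots> \<le> \<epsilon> * A" unfolding A_def using x eps
      by (intro mult_left_mono integral_subset_le io gn) auto
    finally show ?thesis .
  qed
  have "(\<lambda>n. \<Sum>i<L. of_real (v n (grid_index (M n) (t (Suc i))) - v n (grid_index (M n) (t i))) * F (t i)) \<longlonglongrightarrow> R"
    unfolding R_def by (intro tendsto_intros grid_converges_tendsto[OF v M] tin) auto
  then have ev1: "\<forall>\<^sub>F n in sequentially. dist (\<Sum>i<L. of_real (v n (grid_index (M n) (t (Suc i))) - v n (grid_index (M n) (t i))) * F (t i)) R < \<epsilon>"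
    using eps by (rule tendstoD)
  have ev2: "\<forall>\<^sub>F n in sequentially. \<forall>k\<le>M n. cmod (f n k - F (real k / real (M n))) < \<epsilon>" using f eps by (simp add: grid_converges_def)
  obtain m0 :: nat where m0: "1 / real (Suc m0) < d / 2" using nat_approx_posE[OF d2] by blast
  have ev3: "\<forall>\<^sub>F n in sequentially. M n > m0" by (rule eventually_compose_filterlim[OF eventually_gt_at_top M])
  show "\<forall>\<^sub>F n in sequentially. dist (\<Sum>k<grid_index (M n) x. of_real (v n (Suc k) - v n k) * f n k) (integral {0..x} (\<lambda>t. ?G t * F t)) < e"
    using ev1 ev2 ev3
  proof eventually_elim
    case (elim n)
    define idx where "idx i = grid_index (M n) (t i)" for i
    have Mn: "real (M n) > 0" using elim(3) by simp
    have "1 / real (M n) \<le> 1 / real (Suc m0)" using elim(3) by (intro divide_left_mono) auto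
    then have Md: "1 / real (M n) < d / 2" using m0 by linarith
    have im: "idx i \<le> idx (Suc i)" for i unfolding idx_def using tS by (intro grid_index_mono)
    have i0: "idx 0 = 0" by (simp add: idx_def t0 grid_index_0)
    have iL: "idx L = grid_index (M n) x" by (simp add: idx_def tL)
    have iM: "idx i \<le> M n" if "i \<le> L" for i unfolding idx_def using tin[OF that] by (intro grid_index_le) auto
    have bl: "(\<Sum>k<grid_index (M n) x. h k) = (\<Sum>i<L. \<Sum>k\<in>{idx i..<idx (Suc i)}. h k)" for h :: "nat \<Rightarrow> 'z::comm_monoid_add"
      unfolding iL[symmetric] by (rule sum_blocks[of idx L h, OF i0 im])
    have tel: "(\<Sum>k\<in>{idx i..<idx (Suc i)}. of_real (v n (Suc k) - v n k)) = complex_of_real (v n (idx (Suc i)) - v n (idx i))" for i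
      using sum_Suc_diff'[OF im[of i], of "v n"] by (metis of_real_sum)
    have "(\<Sum>k<grid_index (M n) x. of_real (v n (Suc k) - v n k) * f n k) - (\<Sum>i<L. of_real (v n (idx (Suc i)) - v n (idx i)) * F (t i))
      = (\<Sum>i<L. \<Sum>k\<in>{idx i..<idx (Suc i)}. of_real (v n (Suc k) - v n k) * (f n k - F (t i)))"
      unfolding bl tel[symmetric] by (simp only: sum_distrib_right sum_subtractf[symmetric] right_diff_distrib[symmetric])
    also have "cmod \<dots> \<le> (\<Sum>i<L. \<Sum>k\<in>{idx i..<idx (Suc i)}. \<bar>v n (Suc k) - v n k\<bar> * (2 * \<epsilon>))"
    proof (rule order_trans[OF norm_sum], rule sum_mono, rule order_trans[OF norm_sum], rule sum_mono)
      fix i k assume i: "i \<in> {..<L}" and k: "k \<in> {idx i..<idx (Suc i)}"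
      then have iL: "i \<le> L" "Suc i \<le> L" by auto
      have kM: "k \<le> M n" using k iM[OF iL(2)] by simp
      have "real k \<ge> real (idx i)" using k by simp
      moreover have "real (M n) * t i < real (idx i) + 1" unfolding idx_def using tin[OF iL(1)] by (intro grid_index_bounds) auto
      ultimately have "t i * real (M n) < real k + 1" by (simp add: mult.commute)
      then have lo: "t i < real k / real (M n) + 1 / real (M n)" using Mn by (simp add: pos_less_divide_eq add_divide_distrib[symmetric])
      have "real k < real (idx (Suc i))" using k by simp
      moreover have "real (idx (Suc i)) \<le> real (M n) * t (Suc i)" unfolding idx_def using tin[OF iL(2)] by (intro grid_index_bounds) auto
      ultimately have "real k < t (Suc i) * real (M n)" by (simp add: mult.commute)
      then have hi: "real k / real (M n) < t (Suc i)" using Mn by (simp add: pos_divide_less_eq)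
      have "dist (real k / real (M n)) (t i) < d" using lo hi tS[of i] L Md d(1) unfolding dist_real_def by linarith
      then have "dist (F (real k / real (M n))) (F (t i)) < \<epsilon>" using kM Mn tin(1)[OF iL(1)] by (intro d(2)) auto
      moreover have "cmod (f n k - F (real k / real (M n))) < \<epsilon>" using elim(2) kM by blast
      ultimately have "cmod (f n k - F (t i)) \<le> 2 * \<epsilon>"
        using norm_triangle_ineq[of "f n k - F (real k / real (M n))" "F (real k / real (M n)) - F (t i)"] by (simp add: dist_norm)
      then show "cmod (of_real (v n (Suc k) - v n k) * (f n k - F (t i))) \<le> \<bar>v n (Suc k) - v n k\<bar> * (2 * \<epsilon>)"
        unfolding norm_mult norm_of_real by (rule mult_left_mono) simp
    qed
    also have "\<dots> = (\<Sum>k<grid_index (M n) x. \<bar>v n (Suc k) - v n k\<bar>) * (2 * \<epsilon>)" unfolding bl by (simp add: sum_distrib_right)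
    also have "\<dots> \<le> C * (2 * \<epsilon>)"
    proof (rule mult_right_mono)
      have "(\<Sum>k<grid_index (M n) x. \<bar>v n (Suc k) - v n k\<bar>) \<le> (\<Sum>k<M n. \<bar>v n (Suc k) - v n k\<bar>)"
        using grid_index_le[of x "M n"] x by (intro sum_mono2) auto
      then show "(\<Sum>k<grid_index (M n) x. \<bar>v n (Suc k) - v n k\<bar>) \<le> C" using C[of n] by linarith
    qed (use eps in simp)
    finally have 1: "dist (\<Sum>k<grid_index (M n) x. of_real (v n (Suc k) - v n k) * f n k) (\<Sum>i<L. of_real (v n (idx (Suc i)) - v n (idx i)) * F (t i)) \<le> C * (2 * \<epsilon>)"
      by (simp only: dist_norm)
    have 2: "dist (\<Sum>i<L. of_real (v n (idx (Suc i)) - v n (idx i)) * F (t i)) R < \<epsilon>" using elim(1) by (simp only: idx_def)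
    have 3: "dist R (integral {0..x} (\<lambda>t. ?G t * F t)) \<le> \<epsilon> * A" using Rdiff by (simp add: dist_norm norm_minus_commute)
    have "dist (\<Sum>k<grid_index (M n) x. of_real (v n (Suc k) - v n k) * f n k) (integral {0..x} (\<lambda>t. ?G t * F t)) 
      \<le> C * (2 * \<epsilon>) + \<epsilon> + \<epsilon> * A"
      by (intro order_trans[OF dist_triangle[where y=R]] add_mono order_trans[OF dist_triangle[where y="\<Sum>i<L. of_real (v n (idx (Suc i)) - v n (idx i)) * F (t i)"]])
        (use 1 2 3 in auto)
    also have "\<dots> \<le> 2 * \<epsilon> * (C + A + 1)" using eps A0 C0 by (simp add: algebra_simps)
    also have "\<dots> = e / 2"
    proof -
      have "C + A + 1 \<noteq> 0" using A0 C0 by linarith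
      have "2 * (e / (4 * S)) * S = e / 2" if "S \<noteq> 0" for S :: real using that by (simp add: field_simps)
      from this[OF \<open>C + A + 1 \<noteq> 0\<close>] show ?thesis unfolding \<epsilon>_def .
    qed
    also have "\<dots> < e" using e by simp
    finally show ?case .
  qed
qed

text \<open>A step combines a phase close to \<open>1 + \<gamma>\<close>, an exponential close to
  \<open>1 + q\<close> and the coupling \<open>b\<close>. What differs from the linear part is of
  second order, hence bounded by multiples of \<open>(cmod b)^2 + r^2\<close>. The 7 is 4 from the
  phase and 3 from its action on the coupling term.\<close>

lemma step_error:
  fixes \<sigma> \<gamma> e ie b q x1 x2 :: complex and r X c0 c1 c2 :: real
  assumes s: "cmod (\<sigma> - 1 - \<gamma>) \<le> 4 * (cmod b)\<^sup>2" and g: "cmod \<gamma> \<le> cmod b" and b: "cmod b \<le> 1/2"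
    and e: "cmod e \<le> c0" "cmod ie \<le> c0" "cmod (e - 1 - q) \<le> c2 * r\<^sup>2" "cmod (e - 1) \<le> c1 * r" "cmod (ie - 1) \<le> c1 * r"
    and x: "cmod x1 \<le> X" "cmod x2 \<le> X" and r: "r \<ge> 0" and c1: "c1 \<ge> 0" and c20: "c2 \<ge> 0"
  shows "cmod (\<sigma> * (e * x1 - b * ie * x2) - x1 - (q * x1 + \<gamma> * x1 - b * x2)) \<le> (7 * c0 + 2 * c1 + c2) * X * ((cmod b)\<^sup>2 + r\<^sup>2)"
proof -
  have c0: "c0 \<ge> 0" using e(1) norm_ge_zero order_trans by blast
  have c2: "c2 * r\<^sup>2 \<ge> 0" using e(3) norm_ge_zero order_trans by blast
  have X: "X \<ge> 0" using x(1) norm_ge_zero order_trans by blast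
  have br: "cmod b * r \<le> (cmod b)\<^sup>2 + r\<^sup>2"
  proof -
    have "2 * (cmod b * r) \<le> (cmod b)\<^sup>2 + r\<^sup>2" using sum_squares_bound[of "cmod b" r] by simp
    moreover have "0 \<le> (cmod b)\<^sup>2 + r\<^sup>2" by simp
    ultimately show ?thesis by linarith
  qed
  have A: "cmod ((\<sigma> - 1 - \<gamma>) * e + (e - 1 - q) + \<gamma> * (e - 1)) \<le> 4 * (cmod b)\<^sup>2 * c0 + c2 * r\<^sup>2 + cmod b * (c1 * r)"
    by (intro order_trans[OF norm_triangle_ineq] add_mono; (intro order_trans[OF norm_triangle_ineq] add_mono)?;
      (unfold norm_mult)?; (intro mult_mono)?; (use s g e c0 in simp)?)
  have s1: "cmod (\<sigma> - 1) \<le> 3 * cmod b"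
  proof -
    have "cmod (\<sigma> - 1) \<le> cmod (\<sigma> - 1 - \<gamma>) + cmod \<gamma>" using norm_triangle_ineq[of "\<sigma> - 1 - \<gamma>" \<gamma>] by simp
    also have "\<dots> \<le> 4 * (cmod b)\<^sup>2 + cmod b" using s g by linarith
    also have "(cmod b)\<^sup>2 \<le> 1/2 * cmod b" unfolding power2_eq_square using b by (intro mult_right_mono) auto
    finally show ?thesis by simp
  qed
  have "cmod ((\<sigma> - 1) * ie + (ie - 1)) \<le> 3 * cmod b * c0 + c1 * r"
    using norm_triangle_ineq[of "(\<sigma> - 1) * ie" "ie - 1"] e(5) mult_mono[OF s1 e(2)] by (simp add: norm_mult)
  then have B: "cmod (b * ((\<sigma> - 1) * ie + (ie - 1))) \<le> cmod b * (3 * cmod b * c0 + c1 * r)"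
    unfolding norm_mult[of b] by (rule mult_left_mono) simp
  have eq: "\<sigma> * (e * x1 - b * ie * x2) - x1 - (q * x1 + \<gamma> * x1 - b * x2)
    = ((\<sigma> - 1 - \<gamma>) * e + (e - 1 - q) + \<gamma> * (e - 1)) * x1 - (b * ((\<sigma> - 1) * ie + (ie - 1))) * x2"
    by (simp add: algebra_simps)
  have "cmod (\<sigma> * (e * x1 - b * ie * x2) - x1 - (q * x1 + \<gamma> * x1 - b * x2)) \<le>
    (4 * (cmod b)\<^sup>2 * c0 + c2 * r\<^sup>2 + cmod b * (c1 * r)) * X + (cmod b * (3 * cmod b * c0 + c1 * r)) * X"
    unfolding eq
  proof (rule order_trans[OF norm_triangle_ineq4], rule add_mono)
    show "cmod (((\<sigma> - 1 - \<gamma>) * e + (e - 1 - q) + \<gamma> * (e - 1)) * x1) \<le> (4 * (cmod b)\<^sup>2 * c0 + c2 * r\<^sup>2 + cmod b * (c1 * r)) * X"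
      unfolding norm_mult[of _ x1] using A x c0 c1 c2 r by (intro mult_mono) auto
    show "cmod (b * ((\<sigma> - 1) * ie + (ie - 1)) * x2) \<le> cmod b * (3 * cmod b * c0 + c1 * r) * X"
      unfolding norm_mult[of _ x2] using B x c0 c1 r by (intro mult_mono) auto
  qed
  also have "\<dots> = X * (7 * c0 * (cmod b)\<^sup>2 + c2 * r\<^sup>2 + 2 * c1 * (cmod b * r))" by (simp add: power2_eq_square algebra_simps)
  also have "\<dots> \<le> X * (7 * c0 * ((cmod b)\<^sup>2 + r\<^sup>2) + c2 * ((cmod b)\<^sup>2 + r\<^sup>2) + 2 * c1 * ((cmod b)\<^sup>2 + r\<^sup>2))"
  proof (intro mult_left_mono add_mono X)
  qed (use c0 c1 c20 br in auto)
  also have "\<dots> = (7 * c0 + 2 * c1 + c2) * X * ((cmod b)\<^sup>2 + r\<^sup>2)" by (simp add: algebra_simps)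
  finally show ?thesis .
qed

section \<open>The recursion as a perturbed Euler scheme\<close>

context circle_data
begin

text \<open>For real parameters \<open>ets\<close> is the conjugate of \<open>eta\<close>, so
  \<open>yd\<close> and \<open>ud\<close> are its imaginary and real part.\<close>

definition yd :: "nat \<Rightarrow> complex \<Rightarrow> complex" where "yd k \<zeta> = (eta k \<zeta> - ets k \<zeta>) / (2 * \<i>)"
definition ud :: "nat \<Rightarrow> complex \<Rightarrow> complex" where "ud k \<zeta> = (eta k \<zeta> + ets k \<zeta>) / 2"

text \<open>\<open>ee\<close> belongs to the step \<open>1 / m\<close>, whereas the scheme makes
  \<open>M = m - 1\<close> steps over the unit interval. The mismatch
  \<open>1 / M - 1 / m = 1 / (m M)\<close> is of second order and accounts for the summand
  \<open>Z\<close> beside the Taylor remainder.\<close>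

lemma ee_approx:
  fixes \<zeta> :: complex and M :: real
  assumes M: "M = real (m - 1)" "m \<ge> 2"
  defines "Z \<equiv> cmod \<zeta>"
  shows "cmod (ee \<zeta> - 1 - \<i> * \<zeta> / of_real M) \<le> (exp Z * Z\<^sup>2 + Z) * (1 / M)\<^sup>2"
    and "cmod (1 / ee \<zeta> - 1 + \<i> * \<zeta> / of_real M) \<le> (exp Z * Z\<^sup>2 + Z) * (1 / M)\<^sup>2"
    and "cmod (ee \<zeta> - 1) \<le> exp Z * Z * (1 / M)" "cmod (1 / ee \<zeta> - 1) \<le> exp Z * Z * (1 / M)"
proof -
  have M0: "M > 0" "M + 1 = real m" using M by auto
  have Z0: "Z \<ge> 0" by (simp add: Z_def)
  have gen: "cmod (exp w - 1 - w') \<le> (exp Z * Z\<^sup>2 + Z) * (1 / M)\<^sup>2 \<and> cmod (exp w - 1) \<le> exp Z * Z * (1 / M)"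
    if w: "cmod w = Z / real m" "w' = w * of_real (real m / M)" for w w' :: complex
  proof -
    have wZ: "cmod w \<le> Z / M" unfolding w M0(2)[symmetric] using M0 Z0 by (intro divide_left_mono) auto
    have wZ1: "cmod w \<le> Z"
    proof -
      have "Z / M \<le> Z / 1" using M Z0 by (intro divide_left_mono) auto
      then show ?thesis using wZ by simp
    qed
    have re: "exp \<bar>Re w\<bar> \<le> exp Z" using abs_Re_le_cmod[of w] wZ1 by simp
    have "cmod (exp w - 1 - w) \<le> exp \<bar>Re w\<bar> * (cmod w)\<^sup>2" using Taylor_exp[of w 1] by (simp add: power2_eq_square diff_diff_eq)
    also have "\<dots> \<le> exp Z * (Z / M)\<^sup>2" using re wZ by (intro mult_mono power_mono) auto
    finally have 1: "cmod (exp w - 1 - w) \<le> exp Z * Z\<^sup>2 * (1 / M)\<^sup>2" by (simp add: power_divide)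
    have "w' - w = w * of_real (1 / M)" unfolding w M0(2)[symmetric] using M0(1) by (simp add: field_simps)
    then have "cmod (w' - w) = cmod w * (1 / M)" using M0 by (simp add: norm_mult norm_divide)
    also have "\<dots> \<le> Z / M * (1 / M)" using wZ M0 by (intro mult_right_mono) auto
    finally have 2: "cmod (w' - w) \<le> Z * (1 / M)\<^sup>2" by (simp add: power2_eq_square)
    have "cmod (exp w - 1 - w') \<le> cmod (exp w - 1 - w) + cmod (w' - w)"
    proof -
      have "exp w - 1 - w' = (exp w - 1 - w) - (w' - w)" by simp
      then show ?thesis by (metis norm_triangle_ineq4)
    qed
    then have a: "cmod (exp w - 1 - w') \<le> (exp Z * Z\<^sup>2 + Z) * (1 / M)\<^sup>2" using 1 2 by (simp add: distrib_right)
    have "cmod (exp w - 1) \<le> exp \<bar>Re w\<bar> * cmod w" using Taylor_exp[of w 0] by simp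
    also have "\<dots> \<le> exp Z * (Z / M)" using re wZ by (intro mult_mono) auto
    finally show ?thesis using a by simp
  qed
  have i: "1 / ee \<zeta> = exp (- (\<i> * \<zeta> / of_nat m))" by (simp add: ee_def exp_minus inverse_eq_divide)
  have mn: "of_nat m = complex_of_real (real m)" by simp
  have e1: "\<i> * \<zeta> / of_real M = (\<i> * \<zeta> / of_nat m) * of_real (real m / M)" using M0 by simp
  have g1: "cmod (ee \<zeta> - 1 - \<i> * \<zeta> / of_real M) \<le> (exp Z * Z\<^sup>2 + Z) * (1 / M)\<^sup>2 \<and> cmod (ee \<zeta> - 1) \<le> exp Z * Z * (1 / M)"
    unfolding ee_def by (rule gen) (simp_all add: e1 Z_def norm_mult norm_divide)
  have g2: "cmod (1 / ee \<zeta> - 1 - (- (\<i> * \<zeta> / of_real M))) \<le> (exp Z * Z\<^sup>2 + Z) * (1 / M)\<^sup>2 \<and> cmod (1 / ee \<zeta> - 1) \<le> exp Z * Z * (1 / M)"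
    unfolding i by (rule gen) (simp_all add: e1 Z_def norm_mult norm_divide)
  from g1 g2 show "cmod (ee \<zeta> - 1 - \<i> * \<zeta> / of_real M) \<le> (exp Z * Z\<^sup>2 + Z) * (1 / M)\<^sup>2"
    "cmod (1 / ee \<zeta> - 1 + \<i> * \<zeta> / of_real M) \<le> (exp Z * Z\<^sup>2 + Z) * (1 / M)\<^sup>2"
    "cmod (ee \<zeta> - 1) \<le> exp Z * Z * (1 / M)" "cmod (1 / ee \<zeta> - 1) \<le> exp Z * Z * (1 / M)" by auto
qed

lemma dirac_step:
  fixes \<zeta> :: complex
  assumes k: "Suc k < m" and b: "cmod (gb k) \<le> 1/2" and X: "cmod (eta k \<zeta>) \<le> X" "cmod (ets k \<zeta>) \<le> X"
  defines "M \<equiv> real (m - 1)" and "Z \<equiv> cmod \<zeta>"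
  defines "R \<equiv> (7 * exp Z + 2 * (exp Z * Z) + (exp Z * Z\<^sup>2 + Z)) * X * ((cmod (gb k))\<^sup>2 + (1 / M)\<^sup>2)"
  shows "cmod (yd (Suc k) \<zeta> - yd k \<zeta> - (\<zeta> / of_real M * ud k \<zeta> + of_real (Re (gb k)) * yd k \<zeta>)) \<le> R"
    and "cmod (ud (Suc k) \<zeta> - ud k \<zeta> - (- \<zeta> / of_real M * yd k \<zeta> - of_real (Re (gb k)) * ud k \<zeta> - 2 * of_real (Im (gb k)) * yd k \<zeta>)) \<le> R"
proof -
  have m2: "m \<ge> 2" using k by simp
  have M1: "M \<ge> 1" using m2 by (simp add: M_def)
  have Mc: "M \<noteq> 0" using M1 by simp
  define q where "q = \<i> * \<zeta> / of_real M"
  note ap = ee_approx[OF M_def[THEN meta_eq_to_obj_eq] m2, of \<zeta>, folded Z_def, folded q_def]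
  have eb: "cmod (ee \<zeta>) \<le> exp Z" "cmod (1 / ee \<zeta>) \<le> exp Z"
  proof -
    have "Z / real m \<le> Z / 1" using m2 by (intro divide_left_mono) (auto simp: Z_def)
    then have "exp (Z / real m) \<le> exp Z" by simp
    then show "cmod (ee \<zeta>) \<le> exp Z" "cmod (1 / ee \<zeta>) \<le> exp Z" using ee_bounds[of \<zeta>] unfolding Z_def by (meson order_trans)+
  qed
  have ap2: "cmod (1 / ee \<zeta> - 1 - - q) \<le> (exp Z * Z\<^sup>2 + Z) * (1 / M)\<^sup>2" using ap(2) by simp
  define b where "b = gb k"
  define \<gamma> where "\<gamma> = \<i> * of_real (Im b)"
  have g: "cmod \<gamma> \<le> cmod b" "cmod (- \<gamma>) \<le> cmod (cnj b)" using abs_Im_le_cmod[of b] by (simp_all add: \<gamma>_def norm_mult)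
  have s: "cmod (cnj (sgn (1 - b)) - 1 - \<gamma>) \<le> 4 * (cmod b)\<^sup>2" unfolding \<gamma>_def using b by (intro sgn_one_minus_approx) (simp add: b_def)
  have s': "cmod (sgn (1 - b) - 1 - - \<gamma>) \<le> 4 * (cmod (cnj b))\<^sup>2"
  proof -
    have "sgn (1 - b) - 1 - - \<gamma> = cnj (cnj (sgn (1 - b)) - 1 - \<gamma>)" by (simp add: \<gamma>_def)
    then show ?thesis using s by (simp only: complex_mod_cnj)
  qed
  have r: "1 / M \<ge> 0" using M1 by simp
  define x1 x2 where "x1 = eta k \<zeta>" and "x2 = ets k \<zeta>"
  have bb: "cmod b \<le> 1/2" "cmod (cnj b) \<le> 1/2" using b by (simp_all add: b_def)
  have z1: "exp Z * Z \<ge> 0" and z2: "exp Z * Z\<^sup>2 + Z \<ge> 0" by (simp_all add: Z_def)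
  define A where "A = eta (Suc k) \<zeta> - x1 - (q * x1 + \<gamma> * x1 - b * x2)"
  define B where "B = ets (Suc k) \<zeta> - x2 - (- q * x2 + - \<gamma> * x2 - cnj b * x1)"
  have A: "cmod A \<le> R"
    using step_error[OF s g(1) bb(1) eb(1) eb(2) ap(1) ap(3) ap(4) X[folded x1_def x2_def] r z1 z2]
    unfolding A_def eta_Suc(1)[OF k] b_def[symmetric] x1_def[symmetric] x2_def[symmetric] R_def by (simp add: b_def)
  have B: "cmod B \<le> R"
    using step_error[OF s' g(2) bb(2) eb(2) eb(1) ap2 ap(4) ap(3) X(2)[folded x2_def] X(1)[folded x1_def] r z1 z2]
    unfolding B_def eta_Suc(2)[OF k] b_def[symmetric] x1_def[symmetric] x2_def[symmetric] R_def by (simp add: b_def)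
  have bc: "b = of_real (Re b) + \<gamma>" "cnj b = of_real (Re b) - \<gamma>" by (simp_all add: \<gamma>_def complex_eq_iff)
  have "yd (Suc k) \<zeta> - yd k \<zeta> - (\<zeta> / of_real M * ud k \<zeta> + of_real (Re b) * yd k \<zeta>) = (A - B) / (2 * \<i>)"
    unfolding A_def B_def yd_def ud_def x1_def[symmetric] x2_def[symmetric] bc(2) using arg_cong[OF bc(1), of "\<lambda>t. t * x2"]
    by (simp add: q_def field_simps Mc)
  moreover have "cmod ((A - B) / (2 * \<i>)) \<le> R" using norm_triangle_ineq4[of A B] A B by (simp add: norm_divide norm_mult)
  ultimately show "cmod (yd (Suc k) \<zeta> - yd k \<zeta> - (\<zeta> / of_real M * ud k \<zeta> + of_real (Re (gb k)) * yd k \<zeta>)) \<le> R" by (simp add: b_def)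
  have "ud (Suc k) \<zeta> - ud k \<zeta> - (- \<zeta> / of_real M * yd k \<zeta> - of_real (Re b) * ud k \<zeta> - 2 * of_real (Im b) * yd k \<zeta>) = (A + B) / 2"
    unfolding A_def B_def yd_def ud_def x1_def[symmetric] x2_def[symmetric] bc(2) using arg_cong[OF bc(1), of "\<lambda>t. t * x2"]
    by (simp add: q_def \<gamma>_def field_simps Mc)
  moreover have "cmod ((A + B) / 2) \<le> R" using norm_triangle_ineq[of A B] A B by (simp add: norm_divide)
  ultimately show "cmod (ud (Suc k) \<zeta> - ud k \<zeta> - (- \<zeta> / of_real M * yd k \<zeta> - of_real (Re (gb k)) * ud k \<zeta> - 2 * of_real (Im (gb k)) * yd k \<zeta>)) \<le> R" by (simp only: b_def)
qed

end

section \<open>The Dirac system\<close>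

text \<open>Integrated form, suited to coefficients that are mere integrable functions; it contains
  the initial values \<open>Y 0 = 0\<close> and \<open>U 0 = 1\<close>.\<close>

definition dirac_sol :: "(real \<Rightarrow> real) \<Rightarrow> (real \<Rightarrow> real) \<Rightarrow> complex \<Rightarrow> (real \<Rightarrow> complex) \<Rightarrow> (real \<Rightarrow> complex) \<Rightarrow> bool" where
  "dirac_sol \<tau> p \<zeta> Y U \<longleftrightarrow> continuous_on {0..1} Y \<and> continuous_on {0..1} U \<and>
    (\<forall>x\<in>{0..1}. Y x = integral {0..x} (\<lambda>t. \<zeta> * U t + of_real (\<tau> t) * Y t)) \<and>
    (\<forall>x\<in>{0..1}. U x = 1 + integral {0..x} (\<lambda>t. - \<zeta> * Y t - of_real (\<tau> t) * U t + 2 * of_real (p t) * Y t))"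

lemma power2_sum5_le: "(a + b + c + d + e)\<^sup>2 \<le> 5 * (a\<^sup>2 + b\<^sup>2 + c\<^sup>2 + d\<^sup>2 + (e::real)\<^sup>2)"
  using sum_squares_bound[of a b] sum_squares_bound[of a c] sum_squares_bound[of a d] sum_squares_bound[of a e]
    sum_squares_bound[of b c] sum_squares_bound[of b d] sum_squares_bound[of b e]
    sum_squares_bound[of c d] sum_squares_bound[of c e] sum_squares_bound[of d e]
  by (simp add: power2_eq_square algebra_simps)

text \<open>The step equations bound the energies of \<open>y\<close> and \<open>u\<close> by
  \<open>O(1 / M)\<close>, which gives convergent subsequences. Summing the steps turns the
  coefficients into increments of their partial sums, to which \<open>grid_stieltjes_limit\<close>
  applies with the densities \<open>td\<close> and \<open>pd\<close>; the quadratic remainders sum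
  to \<open>O(1 / M)\<close>.\<close>

lemma dirac_limit:
  fixes t p :: "nat \<Rightarrow> nat \<Rightarrow> real" and y u :: "nat \<Rightarrow> nat \<Rightarrow> complex"
  assumes M: "filterlim M at_top sequentially" and M0: "\<And>n. M n > 0"
    and E: "\<And>n. (\<Sum>k<M n. (t n k)\<^sup>2 + (p n k)\<^sup>2) \<le> E / real (M n)"
    and T: "grid_converges M (\<lambda>n k. \<Sum>j<k. t n j) T" and P: "grid_converges M (\<lambda>n k. \<Sum>j<k. p n j) P"
    and td: "td absolutely_integrable_on {0..1}" "\<And>x. x \<in> {0..1} \<Longrightarrow> (td has_integral (T x - T 0)) {0..x}"
    and pd: "pd absolutely_integrable_on {0..1}" "\<And>x. x \<in> {0..1} \<Longrightarrow> (pd has_integral (P x - P 0)) {0..x}"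
    and init: "\<And>n. y n 0 = 0" "\<And>n. u n 0 = 1"
    and X: "\<And>n k. k \<le> M n \<Longrightarrow> cmod (y n k) \<le> X" "\<And>n k. k \<le> M n \<Longrightarrow> cmod (u n k) \<le> X"
    and dy: "\<And>n k. k < M n \<Longrightarrow> cmod (y n (Suc k) - y n k - (\<zeta> / of_nat (M n) * u n k + of_real (t n k) * y n k)) 
      \<le> X * ((t n k)\<^sup>2 + (p n k)\<^sup>2 + (1 / real (M n))\<^sup>2)"
    and du: "\<And>n k. k < M n \<Longrightarrow> cmod (u n (Suc k) - u n k - (- \<zeta> / of_nat (M n) * y n k - of_real (t n k) * u n k + 2 * of_real (p n k) * y n k)) 
      \<le> X * ((t n k)\<^sup>2 + (p n k)\<^sup>2 + (1 / real (M n))\<^sup>2)"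
  obtains s Y U where "strict_mono (s :: nat \<Rightarrow> nat)" "grid_converges (M \<circ> s) (y \<circ> s) Y" "grid_converges (M \<circ> s) (u \<circ> s) U" "dirac_sol td pd \<zeta> Y U"
proof -
  define w where "w n k = (t n k)\<^sup>2 + (p n k)\<^sup>2" for n k
  define Z where "Z = cmod \<zeta>"
  have w0: "w n k \<ge> 0" for n k by (simp add: w_def)
  have Mr: "real (M n) \<ge> 1" for n using M0[of n] by (simp add: Suc_leI)
  have E0: "E \<ge> 0"
  proof -
    have "0 \<le> E / real (M 0)" using E[of 0] by (rule order_trans[rotated]) (simp add: sum_nonneg)
    then show ?thesis using M0[of 0] by (simp add: zero_le_divide_iff)
  qed
  have wsum: "(\<Sum>k<M n. w n k) \<le> E / real (M n)" for n using E[of n] by (simp add: w_def)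
  have wE: "w n k \<le> E" if "k < M n" for n k
  proof -
    have "w n k \<le> (\<Sum>k<M n. w n k)" using that w0 by (intro member_le_sum) auto
    also have "\<dots> \<le> E / real (M n)" by (rule wsum)
    also have "\<dots> \<le> E / 1" using E0 Mr[of n] by (intro divide_left_mono) auto
    finally show ?thesis by simp
  qed
  have X0: "X \<ge> 0" using X(1)[of 0 0] by (simp add: init)
  \<comment> \<open>The 5 counts the terms squared together; \<open>4 * w\<close> covers
    \<open>t^2 + (2 p)^2\<close> and \<open>E * w\<close> covers \<open>w^2\<close>.\<close>
  define EE where "EE = 5 * X\<^sup>2 * (Z\<^sup>2 + (4 + E) * E + 1)"
  have energy: "(\<Sum>k<M n. (cmod (v (Suc k) - v k))\<^sup>2) \<le> EE / real (M n)"
    if v: "\<And>k. k < M n \<Longrightarrow> cmod (v (Suc k) - v k) \<le> X * (Z / real (M n) + \<bar>t n k\<bar> + 2 * \<bar>p n k\<bar> + w n k + (1 / real (M n))\<^sup>2)" for v :: "nat \<Rightarrow> complex" and n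
  proof -
    let ?M = "real (M n)"
    have "(cmod (v (Suc k) - v k))\<^sup>2 \<le> 5 * X\<^sup>2 * ((Z\<^sup>2 + 1) * (1 / ?M)\<^sup>2 + (4 + E) * w n k)" if k: "k < M n" for k
    proof -
      have "(cmod (v (Suc k) - v k))\<^sup>2 \<le> (X * (Z / ?M + \<bar>t n k\<bar> + 2 * \<bar>p n k\<bar> + w n k + (1 / ?M)\<^sup>2))\<^sup>2"
        using v[OF k] by (intro power_mono) auto
      also have "\<dots> \<le> X\<^sup>2 * (5 * ((Z / ?M)\<^sup>2 + \<bar>t n k\<bar>\<^sup>2 + (2 * \<bar>p n k\<bar>)\<^sup>2 + (w n k)\<^sup>2 + ((1 / ?M)\<^sup>2)\<^sup>2))"
        unfolding power_mult_distrib[of X] by (intro mult_left_mono power2_sum5_le) auto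
      also have "\<dots> \<le> X\<^sup>2 * (5 * (Z\<^sup>2 * (1 / ?M)\<^sup>2 + (4 * w n k + E * w n k) + (1 / ?M)\<^sup>2))"
      proof (intro mult_left_mono)
        have 1: "(Z / ?M)\<^sup>2 = Z\<^sup>2 * (1 / ?M)\<^sup>2" by (simp add: power_divide)
        have 2: "\<bar>t n k\<bar>\<^sup>2 + (2 * \<bar>p n k\<bar>)\<^sup>2 \<le> 4 * w n k" by (simp add: w_def power_mult_distrib)
        have 3: "(w n k)\<^sup>2 \<le> E * w n k" unfolding power2_eq_square using wE[OF k] w0 by (intro mult_right_mono)
        have "(1 / ?M)\<^sup>2 \<le> 1" using Mr[of n] by (simp add: power_le_one)
        then have 4: "((1 / ?M)\<^sup>2)\<^sup>2 \<le> (1 / ?M)\<^sup>2" unfolding power2_eq_square[of "(1 / ?M)\<^sup>2"] by (intro mult_left_le) auto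
        show "(Z / ?M)\<^sup>2 + \<bar>t n k\<bar>\<^sup>2 + (2 * \<bar>p n k\<bar>)\<^sup>2 + (w n k)\<^sup>2 + ((1 / ?M)\<^sup>2)\<^sup>2 \<le> Z\<^sup>2 * (1 / ?M)\<^sup>2 + (4 * w n k + E * w n k) + (1 / ?M)\<^sup>2"
          using 1 2 3 4 by linarith
      qed auto
      finally show ?thesis by (simp add: algebra_simps)
    qed
    then have "(\<Sum>k<M n. (cmod (v (Suc k) - v k))\<^sup>2) \<le> (\<Sum>k<M n. 5 * X\<^sup>2 * ((Z\<^sup>2 + 1) * (1 / ?M)\<^sup>2 + (4 + E) * w n k))"
      by (intro sum_mono) auto
    also have "\<dots> = 5 * X\<^sup>2 * (?M * ((Z\<^sup>2 + 1) * (1 / ?M)\<^sup>2) + (4 + E) * (\<Sum>k<M n. w n k))"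
      by (simp add: sum.distrib sum_distrib_left algebra_simps)
    also have "\<dots> \<le> 5 * X\<^sup>2 * ((Z\<^sup>2 + 1) / ?M + (4 + E) * (E / ?M))"
      using wsum[of n] E0 M0[of n] by (intro mult_left_mono add_mono) (auto simp: power2_eq_square)
    also have "\<dots> = EE / ?M" using M0[of n] by (simp add: EE_def field_simps)
    finally show ?thesis .
  qed
  have zM: "cmod (\<zeta> / of_nat (M n)) = Z / real (M n)" for n by (simp add: norm_divide Z_def)
  have yE: "(\<Sum>k<M n. (cmod (y n (Suc k) - y n k))\<^sup>2) \<le> EE / real (M n)" for n
  proof (rule energy)
    fix k assume k: "k < M n"
    let ?D = "\<zeta> / of_nat (M n) * u n k + of_real (t n k) * y n k"
    have "cmod ?D \<le> cmod (\<zeta> / of_nat (M n) * u n k) + cmod (of_real (t n k) * y n k)" by (rule norm_triangle_ineq)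
    also have "\<dots> = Z / real (M n) * cmod (u n k) + \<bar>t n k\<bar> * cmod (y n k)" by (simp add: norm_mult norm_divide Z_def)
    also have "\<dots> \<le> Z / real (M n) * X + \<bar>t n k\<bar> * X" using X k by (intro add_mono mult_left_mono) (auto simp: Z_def)
    finally have "cmod ?D \<le> Z / real (M n) * X + \<bar>t n k\<bar> * X" .
    moreover have "cmod (y n (Suc k) - y n k) \<le> cmod (y n (Suc k) - y n k - ?D) + cmod ?D"
      using norm_triangle_ineq[of "y n (Suc k) - y n k - ?D" ?D] by simp
    moreover have "0 \<le> X * (2 * \<bar>p n k\<bar>)" using X0 by simp
    ultimately show "cmod (y n (Suc k) - y n k) \<le> X * (Z / real (M n) + \<bar>t n k\<bar> + 2 * \<bar>p n k\<bar> + w n k + (1 / real (M n))\<^sup>2)"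
      using dy[OF k] unfolding w_def by (simp add: distrib_left mult.commute)
  qed
  have uE: "(\<Sum>k<M n. (cmod (u n (Suc k) - u n k))\<^sup>2) \<le> EE / real (M n)" for n
  proof (rule energy)
    fix k assume k: "k < M n"
    let ?D = "- \<zeta> / of_nat (M n) * y n k - of_real (t n k) * u n k + 2 * of_real (p n k) * y n k"
    have "cmod ?D \<le> cmod (- \<zeta> / of_nat (M n) * y n k) + cmod (of_real (t n k) * u n k) + cmod (2 * of_real (p n k) * y n k)"
      by (intro order_trans[OF norm_triangle_ineq] add_mono norm_triangle_ineq4) auto
    also have "\<dots> = Z / real (M n) * cmod (y n k) + \<bar>t n k\<bar> * cmod (u n k) + 2 * \<bar>p n k\<bar> * cmod (y n k)"
      by (simp add: norm_mult norm_divide Z_def)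
    also have "\<dots> \<le> Z / real (M n) * X + \<bar>t n k\<bar> * X + 2 * \<bar>p n k\<bar> * X"
      using X k by (intro add_mono mult_left_mono) (auto simp: Z_def)
    finally have D: "cmod ?D \<le> Z / real (M n) * X + \<bar>t n k\<bar> * X + 2 * \<bar>p n k\<bar> * X" .
    have "cmod (u n (Suc k) - u n k) \<le> cmod (u n (Suc k) - u n k - ?D) + cmod ?D"
      using norm_triangle_ineq[of "u n (Suc k) - u n k - ?D" ?D] by simp
    then show "cmod (u n (Suc k) - u n k) \<le> X * (Z / real (M n) + \<bar>t n k\<bar> + 2 * \<bar>p n k\<bar> + w n k + (1 / real (M n))\<^sup>2)"
      using du[OF k] D unfolding w_def by (simp add: distrib_left mult.commute)
  qed
  obtain s1 Y where s1: "strict_mono (s1 :: nat \<Rightarrow> nat)" "grid_converges (M \<circ> s1) (y \<circ> s1) Y"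
    using grid_compact[of M y 1 EE, OF M0 _ yE] init by auto
  obtain s2 U where s2: "strict_mono (s2 :: nat \<Rightarrow> nat)" "grid_converges ((M \<circ> s1) \<circ> s2) ((u \<circ> s1) \<circ> s2) U"
  proof (rule grid_compact[of "M \<circ> s1" "u \<circ> s1" 1 EE])
    show "(\<Sum>k<(M \<circ> s1) n. (cmod ((u \<circ> s1) n (Suc k) - (u \<circ> s1) n k))\<^sup>2) \<le> EE / real ((M \<circ> s1) n)" for n using uE by simp
  qed (auto simp: M0 init)
  define s where "s = s1 \<circ> s2"
  have s: "strict_mono s" unfolding s_def using s1(1) s2(1) by (rule strict_mono_o)
  have Yc: "grid_converges (M \<circ> s) (y \<circ> s) Y" using grid_converges_subseq[OF s1(2) s2(1)] by (simp add: s_def o_assoc)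
  have Uc: "grid_converges (M \<circ> s) (u \<circ> s) U" using s2(2) by (simp add: s_def o_assoc)
  have Tc: "grid_converges (M \<circ> s) ((\<lambda>n k. \<Sum>j<k. t n j) \<circ> s) T" by (rule grid_converges_subseq[OF T s])
  have Pc: "grid_converges (M \<circ> s) ((\<lambda>n k. \<Sum>j<k. p n j) \<circ> s) P" by (rule grid_converges_subseq[OF P s])
  have Ms: "filterlim (M \<circ> s) at_top sequentially" using filterlim_compose[OF M filterlim_subseq[OF s]] by (simp add: o_def)
  have Ic: "grid_converges (M \<circ> s) (\<lambda>n k. real k / real ((M \<circ> s) n)) (\<lambda>x. x)" by (simp add: grid_converges_def)
  have cY: "continuous_on {0..1} Y" and cU: "continuous_on {0..1} U" using Yc Uc by (auto simp: grid_converges_def)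
  have abs_sum: "(\<Sum>k<(M \<circ> s) n. \<bar>f k\<bar>) \<le> sqrt E" if "\<And>k. (f k)\<^sup>2 \<le> w (s n) k" for f n
  proof (rule real_le_rsqrt)
    have "(\<Sum>k<M (s n). \<bar>f k\<bar>)\<^sup>2 \<le> (\<Sum>k<M (s n). \<bar>f k\<bar>\<^sup>2) * real (card {..<M (s n)})"
      by (rule sum_squared_le_sum_of_squares)
    also have "\<dots> \<le> (E / real (M (s n))) * real (M (s n))"
      using order_trans[OF sum_mono wsum[of "s n"], of "\<lambda>k. \<bar>f k\<bar>\<^sup>2"] that by (intro mult_mono) (auto simp: E0)
    also have "\<dots> = E" using M0[of "s n"] by simp
    finally show "(\<Sum>k<(M \<circ> s) n. \<bar>f k\<bar>)\<^sup>2 \<le> E" by simp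
  qed
  have Tb: "(\<Sum>k<(M \<circ> s) n. \<bar>((\<lambda>n k. \<Sum>j<k. t n j) \<circ> s) n (Suc k) - ((\<lambda>n k. \<Sum>j<k. t n j) \<circ> s) n k\<bar>) \<le> sqrt E" for n
    using abs_sum[of "t (s n)" n] by (simp add: w_def)
  have Pb: "(\<Sum>k<(M \<circ> s) n. \<bar>((\<lambda>n k. \<Sum>j<k. p n j) \<circ> s) n (Suc k) - ((\<lambda>n k. \<Sum>j<k. p n j) \<circ> s) n k\<bar>) \<le> sqrt E" for n
    using abs_sum[of "p (s n)" n] by (simp add: w_def)
  have Ib: "(\<Sum>k<(M \<circ> s) n. \<bar>real (Suc k) / real ((M \<circ> s) n) - real k / real ((M \<circ> s) n)\<bar>) \<le> 1" for n
    using M0[of "s n"] by (simp add: diff_divide_distrib[symmetric])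
  have one: "(\<lambda>t::real. 1::real) absolutely_integrable_on {0..1}" by (rule absolutely_integrable_continuous_real) simp
  have one2: "((\<lambda>t::real. 1::real) has_integral (x - 0)) {0..x}" if "x \<in> {0..1}" for x :: real
    using has_integral_const_real[of "1::real" 0 x] that by simp
  note lim1 = grid_stieltjes_limit[OF Ic _ Ms Ib one one2]
  note limT = grid_stieltjes_limit[OF Tc _ Ms Tb td]
  note limP = grid_stieltjes_limit[OF Pc _ Ms Pb pd]
  have err0: "(\<lambda>n. \<Sum>k<grid_index ((M \<circ> s) n) x. f (s n) k) \<longlonglongrightarrow> 0" if x: "x \<in> {0..1}" and f: "\<And>n k. k < M n \<Longrightarrow> cmod (f n k) \<le> X * (w n k + (1 / real (M n))\<^sup>2)" for f x
  proof (rule Lim_null_comparison)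
    show "\<forall>\<^sub>F n in sequentially. norm (\<Sum>k<grid_index ((M \<circ> s) n) x. f (s n) k) \<le> X * (E + 1) * (1 / real ((M \<circ> s) n))"
    proof (intro always_eventually allI)
      fix n
      let ?M = "M (s n)"
      have "norm (\<Sum>k<grid_index ((M \<circ> s) n) x. f (s n) k) \<le> (\<Sum>k<grid_index ?M x. cmod (f (s n) k))" by (simp add: norm_sum)
      also have "\<dots> \<le> (\<Sum>k<?M. cmod (f (s n) k))" using grid_index_le[of x ?M] x by (intro sum_mono2) auto
      also have "\<dots> \<le> (\<Sum>k<?M. X * (w (s n) k + (1 / real ?M)\<^sup>2))" by (intro sum_mono f) auto
      also have "\<dots> = X * ((\<Sum>k<?M. w (s n) k) + real ?M * (1 / real ?M)\<^sup>2)" by (simp add: sum_distrib_left[symmetric] sum.distrib)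
      also have "\<dots> \<le> X * (E / real ?M + 1 / real ?M)" using wsum[of "s n"] X0 M0[of "s n"]
        by (intro mult_left_mono add_mono) (auto simp: power2_eq_square)
      also have "\<dots> = X * (E + 1) * (1 / real ((M \<circ> s) n))" by (simp add: distrib_left add_divide_distrib)
      finally show "norm (\<Sum>k<grid_index ((M \<circ> s) n) x. f (s n) k) \<le> X * (E + 1) * (1 / real ((M \<circ> s) n))" .
    qed
    have "filterlim (\<lambda>n. real ((M \<circ> s) n)) at_top sequentially" using filterlim_compose[OF filterlim_real_sequentially Ms] .
    then have "(\<lambda>n. 1 / real ((M \<circ> s) n)) \<longlonglongrightarrow> 0" by (rule tendsto_divide_0[OF tendsto_const filterlim_at_top_imp_at_infinity])
    then have "(\<lambda>n. X * (E + 1) * (1 / real ((M \<circ> s) n))) \<longlonglongrightarrow> X * (E + 1) * 0" by (intro tendsto_intros)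
    then show "(\<lambda>n. X * (E + 1) * (1 / real ((M \<circ> s) n))) \<longlonglongrightarrow> 0" by simp
  qed
  have ai: "(\<lambda>t. complex_of_real (g t) * F t) integrable_on {0..x}" if "g absolutely_integrable_on {0..1}" "continuous_on {0..1} F" "x \<in> {0..1}" for g :: "real \<Rightarrow> real" and F x
  proof -
    have "(\<lambda>t. complex_of_real (g t) * F t) integrable_on {0..1}"
      using absolutely_integrable_times_continuous[OF absolutely_integrable_of_real[OF that(1)] that(2)] set_lebesgue_integral_eq_integral by blast
    then show ?thesis using that(3) by (intro integrable_on_subinterval) auto
  qed
  have ci: "F integrable_on {0..x}" if "continuous_on {0..1} F" "x \<in> {0..1}" for F :: "real \<Rightarrow> complex" and x
    using that by (intro integrable_continuous_interval continuous_on_subset[OF that(1)]) auto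
  have "dirac_sol td pd \<zeta> Y U" unfolding dirac_sol_def
  proof (intro conjI ballI cY cU)
    fix x :: real assume x: "x \<in> {0..1}"
    let ?g = "\<lambda>n. grid_index ((M \<circ> s) n) x"
    have "(\<lambda>n. \<zeta> * (\<Sum>k<?g n. of_real (real (Suc k) / real ((M \<circ> s) n) - real k / real ((M \<circ> s) n)) * (u \<circ> s) n k)
      + (\<Sum>k<?g n. of_real (((\<lambda>n k. \<Sum>j<k. t n j) \<circ> s) n (Suc k) - ((\<lambda>n k. \<Sum>j<k. t n j) \<circ> s) n k) * (y \<circ> s) n k)
      + (\<Sum>k<?g n. (\<lambda>n k. y n (Suc k) - y n k - (\<zeta> / of_nat (M n) * u n k + of_real (t n k) * y n k)) (s n) k))
      \<longlonglongrightarrow> \<zeta> * integral {0..x} (\<lambda>t. of_real 1 * U t) + integral {0..x} (\<lambda>t. of_real (td t) * Y t) + 0"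
      using dy by (intro tendsto_intros lim1[OF Uc _ x] limT[OF Yc _ x] err0[OF x]) (auto simp: w_def)
    moreover have "(\<lambda>n. \<zeta> * (\<Sum>k<?g n. of_real (real (Suc k) / real ((M \<circ> s) n) - real k / real ((M \<circ> s) n)) * (u \<circ> s) n k)
      + (\<Sum>k<?g n. of_real (((\<lambda>n k. \<Sum>j<k. t n j) \<circ> s) n (Suc k) - ((\<lambda>n k. \<Sum>j<k. t n j) \<circ> s) n k) * (y \<circ> s) n k)
      + (\<Sum>k<?g n. (\<lambda>n k. y n (Suc k) - y n k - (\<zeta> / of_nat (M n) * u n k + of_real (t n k) * y n k)) (s n) k)) = (\<lambda>n. (y \<circ> s) n (?g n))"
    proof
      fix n
      have "(\<Sum>k<?g n. y (s n) (Suc k) - y (s n) k) = y (s n) (?g n)" using sum_lessThan_telescope[of "y (s n)" "?g n"] by (simp add: init)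
      moreover have "of_real (real (Suc k) / real (M (s n)) - real k / real (M (s n))) = 1 / complex_of_nat (M (s n))" for k
        by (simp add: diff_divide_distrib[symmetric])
      ultimately show "\<zeta> * (\<Sum>k<?g n. of_real (real (Suc k) / real ((M \<circ> s) n) - real k / real ((M \<circ> s) n)) * (u \<circ> s) n k)
      + (\<Sum>k<?g n. of_real (((\<lambda>n k. \<Sum>j<k. t n j) \<circ> s) n (Suc k) - ((\<lambda>n k. \<Sum>j<k. t n j) \<circ> s) n k) * (y \<circ> s) n k)
      + (\<Sum>k<?g n. (\<lambda>n k. y n (Suc k) - y n k - (\<zeta> / of_nat (M n) * u n k + of_real (t n k) * y n k)) (s n) k) = (y \<circ> s) n (?g n)"
        by (simp add: sum_subtractf sum.distrib sum_distrib_left mult.assoc del: of_real_diff of_real_divide)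
    qed
    ultimately have "Y x = \<zeta> * integral {0..x} (\<lambda>t. of_real 1 * U t) + integral {0..x} (\<lambda>t. of_real (td t) * Y t) + 0"
      using LIMSEQ_unique[OF grid_converges_tendsto[OF Yc Ms x]] by metis
    then show "Y x = integral {0..x} (\<lambda>t. \<zeta> * U t + of_real (td t) * Y t)"
      by (subst Henstock_Kurzweil_Integration.integral_add) (auto intro!: integrable_on_mult_right ci[OF cU x] ai[OF td(1) cY x])
  next
    fix x :: real assume x: "x \<in> {0..1}"
    let ?g = "\<lambda>n. grid_index ((M \<circ> s) n) x"
    have "(\<lambda>n. - \<zeta> * (\<Sum>k<?g n. of_real (real (Suc k) / real ((M \<circ> s) n) - real k / real ((M \<circ> s) n)) * (y \<circ> s) n k)
      - (\<Sum>k<?g n. of_real (((\<lambda>n k. \<Sum>j<k. t n j) \<circ> s) n (Suc k) - ((\<lambda>n k. \<Sum>j<k. t n j) \<circ> s) n k) * (u \<circ> s) n k)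
      + 2 * (\<Sum>k<?g n. of_real (((\<lambda>n k. \<Sum>j<k. p n j) \<circ> s) n (Suc k) - ((\<lambda>n k. \<Sum>j<k. p n j) \<circ> s) n k) * (y \<circ> s) n k)
      + (\<Sum>k<?g n. (\<lambda>n k. u n (Suc k) - u n k - (- \<zeta> / of_nat (M n) * y n k - of_real (t n k) * u n k + 2 * of_real (p n k) * y n k)) (s n) k))
      \<longlonglongrightarrow> - \<zeta> * integral {0..x} (\<lambda>t. of_real 1 * Y t) - integral {0..x} (\<lambda>t. of_real (td t) * U t) + 2 * integral {0..x} (\<lambda>t. of_real (pd t) * Y t) + 0"
      using du by (intro tendsto_intros lim1[OF Yc _ x] limT[OF Uc _ x] limP[OF Yc _ x] err0[OF x]) (auto simp: w_def)
    moreover have "(\<lambda>n. - \<zeta> * (\<Sum>k<?g n. of_real (real (Suc k) / real ((M \<circ> s) n) - real k / real ((M \<circ> s) n)) * (y \<circ> s) n k)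
      - (\<Sum>k<?g n. of_real (((\<lambda>n k. \<Sum>j<k. t n j) \<circ> s) n (Suc k) - ((\<lambda>n k. \<Sum>j<k. t n j) \<circ> s) n k) * (u \<circ> s) n k)
      + 2 * (\<Sum>k<?g n. of_real (((\<lambda>n k. \<Sum>j<k. p n j) \<circ> s) n (Suc k) - ((\<lambda>n k. \<Sum>j<k. p n j) \<circ> s) n k) * (y \<circ> s) n k)
      + (\<Sum>k<?g n. (\<lambda>n k. u n (Suc k) - u n k - (- \<zeta> / of_nat (M n) * y n k - of_real (t n k) * u n k + 2 * of_real (p n k) * y n k)) (s n) k))
      = (\<lambda>n. (u \<circ> s) n (?g n) - 1)"
    proof
      fix n
      have "(\<Sum>k<?g n. u (s n) (Suc k) - u (s n) k) = u (s n) (?g n) - 1" using sum_lessThan_telescope[of "u (s n)" "?g n"] by (simp add: init)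
      moreover have "of_real (real (Suc k) / real (M (s n)) - real k / real (M (s n))) = 1 / complex_of_nat (M (s n))" for k
        by (simp add: diff_divide_distrib[symmetric])
      ultimately show "- \<zeta> * (\<Sum>k<?g n. of_real (real (Suc k) / real ((M \<circ> s) n) - real k / real ((M \<circ> s) n)) * (y \<circ> s) n k)
      - (\<Sum>k<?g n. of_real (((\<lambda>n k. \<Sum>j<k. t n j) \<circ> s) n (Suc k) - ((\<lambda>n k. \<Sum>j<k. t n j) \<circ> s) n k) * (u \<circ> s) n k)
      + 2 * (\<Sum>k<?g n. of_real (((\<lambda>n k. \<Sum>j<k. p n j) \<circ> s) n (Suc k) - ((\<lambda>n k. \<Sum>j<k. p n j) \<circ> s) n k) * (y \<circ> s) n k)
      + (\<Sum>k<?g n. (\<lambda>n k. u n (Suc k) - u n k - (- \<zeta> / of_nat (M n) * y n k - of_real (t n k) * u n k + 2 * of_real (p n k) * y n k)) (s n) k)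
      = (u \<circ> s) n (?g n) - 1"
        by (simp add: sum_subtractf sum.distrib sum_distrib_left mult.assoc sum_negf del: of_real_diff of_real_divide)
    qed
    ultimately have "(\<lambda>n. (u \<circ> s) n (?g n) - 1) \<longlonglongrightarrow> - \<zeta> * integral {0..x} (\<lambda>t. of_real 1 * Y t) - integral {0..x} (\<lambda>t. of_real (td t) * U t) + 2 * integral {0..x} (\<lambda>t. of_real (pd t) * Y t) + 0"
      by metis
    from LIMSEQ_unique[OF tendsto_diff[OF grid_converges_tendsto[OF Uc Ms x] tendsto_const] this]
    have "U x = 1 + (- \<zeta> * integral {0..x} Y - integral {0..x} (\<lambda>t. of_real (td t) * U t) + 2 * integral {0..x} (\<lambda>t. of_real (pd t) * Y t))"
      by (simp add: algebra_simps)
    also have "- \<zeta> * integral {0..x} Y - integral {0..x} (\<lambda>t. of_real (td t) * U t) + 2 * integral {0..x} (\<lambda>t. of_real (pd t) * Y t)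
      = integral {0..x} (\<lambda>t. - \<zeta> * Y t - of_real (td t) * U t + 2 * (of_real (pd t) * Y t))"
      by (subst Henstock_Kurzweil_Integration.integral_add, (intro integrable_diff integrable_on_mult_right ci[OF cY x] ai[OF td(1) cU x] ai[OF pd(1) cY x])+,
        subst Henstock_Kurzweil_Integration.integral_diff, (intro integrable_on_mult_right ci[OF cY x] ai[OF td(1) cU x])+, simp)
    finally show "U x = 1 + integral {0..x} (\<lambda>t. - \<zeta> * Y t - of_real (td t) * U t + 2 * of_real (pd t) * Y t)" by (simp add: mult.assoc)
  qed
  with s Yc Uc show thesis by (rule that)
qed

text \<open>Advance in steps so short that \<open>\<kappa>\<close> has integral below 1/2 over each:
  there the maximum of \<open>D\<close> is at most half of itself, hence 0. The step length comes
  from uniform continuity of the indefinite integral of \<open>\<kappa>\<close>.\<close>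

lemma gronwall_zero:
  fixes D \<kappa> :: "real \<Rightarrow> real"
  assumes D: "continuous_on {0..1} D" "\<And>x. x \<in> {0..1} \<Longrightarrow> D x \<ge> 0"
    and \<kappa>: "\<kappa> absolutely_integrable_on {0..1}" "\<And>x. \<kappa> x \<ge> 0"
    and le: "\<And>x. x \<in> {0..1} \<Longrightarrow> D x \<le> integral {0..x} (\<lambda>t. \<kappa> t * D t)"
    and x: "x \<in> {0..1}"
  shows "D x = 0"
proof -
  have ki: "\<kappa> integrable_on {0..1}" using \<kappa>(1) set_lebesgue_integral_eq_integral by blast
  have "(\<lambda>t. D t * \<kappa> t) absolutely_integrable_on {0..1}"
  proof (rule absolutely_integrable_bounded_measurable_product_real)
    show "D \<in> borel_measurable (lebesgue_on {0..1})"
      by (intro continuous_imp_measurable_on_sets_lebesgue D) auto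
    show "bounded (D ` {0..1})" by (intro compact_imp_bounded compact_continuous_image D) auto
  qed (use \<kappa> in auto)
  then have kD: "(\<lambda>t. \<kappa> t * D t) integrable_on {0..1}" using set_lebesgue_integral_eq_integral by (metis (no_types, lifting) integrable_cong mult.commute)
  define K where "K x = integral {0..x} \<kappa>" for x
  have "continuous_on {0..1} K" unfolding K_def by (rule indefinite_integral_continuous_1[OF ki])
  then have "uniformly_continuous_on {0..1} K" by (rule compact_uniformly_continuous) simp
  then obtain d where d: "d > 0" "\<And>s t. s \<in> {0..1} \<Longrightarrow> t \<in> {0..1} \<Longrightarrow> dist s t < d \<Longrightarrow> dist (K s) (K t) < 1/2"
    unfolding uniformly_continuous_on_def by (metis dist_commute half_gt_zero zero_less_one)
  have sub: "\<kappa> integrable_on {a..b}" "(\<lambda>t. \<kappa> t * D t) integrable_on {a..b}" if "0 \<le> a" "b \<le> 1" for a b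
    using that by (auto intro!: integrable_on_subinterval[OF ki] integrable_on_subinterval[OF kD])
  have step: "\<forall>t\<in>{0..b}. D t = 0" if z: "\<forall>t\<in>{0..a}. D t = 0" and ab: "0 \<le> a" "a \<le> b" "b \<le> 1" "b - a < d" for a b
  proof -
    have "continuous_on {a..b} D" using ab by (intro continuous_on_subset[OF D(1)]) auto
    then obtain s where s: "s \<in> {a..b}" "\<And>t. t \<in> {a..b} \<Longrightarrow> D t \<le> D s"
      using continuous_attains_sup[of "{a..b}" D] ab by auto
    have s01: "0 \<le> s" "s \<le> 1" using s(1) ab by auto
    have "D s \<le> integral {0..s} (\<lambda>t. \<kappa> t * D t)" using s01 by (intro le) auto
    also have "\<dots> = integral {0..a} (\<lambda>t. \<kappa> t * D t) + integral {a..s} (\<lambda>t. \<kappa> t * D t)"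
      using s(1) ab s01 by (intro Henstock_Kurzweil_Integration.integral_combine[symmetric] sub) auto
    also have "integral {0..a} (\<lambda>t. \<kappa> t * D t) = integral {0..a} (\<lambda>t. 0)"
      using z by (intro integral_cong) auto
    also have "integral {a..s} (\<lambda>t. \<kappa> t * D t) \<le> integral {a..s} (\<lambda>t. \<kappa> t * D s)"
      using s ab s01 \<kappa>(2) by (intro integral_le sub integrable_on_mult_left mult_left_mono) auto
    also have "\<dots> = integral {a..s} \<kappa> * D s" by simp
    also have "integral {a..s} \<kappa> = K s - K a" unfolding K_def
      using Henstock_Kurzweil_Integration.integral_combine[of 0 a s \<kappa>] s(1) ab s01 sub by auto
    also have "\<dots> \<le> 1/2"
    proof -
      have "dist (K s) (K a) < 1/2" using s(1) ab by (intro d(2)) (auto simp: dist_real_def)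
      then show ?thesis unfolding dist_real_def by linarith
    qed
    finally have "D s \<le> 1/2 * D s" using D(2)[of s] s01 by (simp add: mult_right_mono)
    then have "D s \<le> 0" by simp
    then show ?thesis using z s(2) D(2) ab by (metis atLeastAtMost_iff antisym order_trans linear)
  qed
  obtain n :: nat where n: "1 / real (Suc n) < d" using nat_approx_posE[OF d(1)] by blast
  have "i \<le> Suc n \<Longrightarrow> \<forall>t\<in>{0..real i / real (Suc n)}. D t = 0" for i
  proof (induction i)
    case 0
    have "D 0 \<le> 0" using le[of 0] by simp
    then show ?case using D(2)[of 0] by auto
  next
    case (Suc i)
    show ?case
    proof (rule step[of "real i / real (Suc n)"])
      show "\<forall>t\<in>{0..real i / real (Suc n)}. D t = 0" using Suc by simp
      show "real (Suc i) / real (Suc n) - real i / real (Suc n) < d" using n by (simp only: diff_divide_distrib[symmetric]) simp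
      show "real (Suc i) / real (Suc n) \<le> 1" using Suc.prems by simp
    qed (auto intro: divide_right_mono)
  qed
  from this[of "Suc n"] show ?thesis using x by simp
qed

lemma absolutely_integrable_comm_times:
  fixes g :: "real \<Rightarrow> real" and F :: "real \<Rightarrow> complex"
  assumes "g absolutely_integrable_on {0..1}" "continuous_on {0..1} F"
  shows "(\<lambda>t. of_real (g t) * F t) absolutely_integrable_on {0..1}"
  using absolutely_integrable_times_continuous[OF absolutely_integrable_of_real[OF assms(1)] assms(2)] .

lemma dirac_integrands:
  fixes Y U :: "real \<Rightarrow> complex"
  assumes \<tau>: "\<tau> absolutely_integrable_on {0..1}" and p: "p absolutely_integrable_on {0..1}"
    and Y: "continuous_on {0..1} Y" and U: "continuous_on {0..1} U"
  shows "(\<lambda>t. \<zeta> * U t + of_real (\<tau> t) * Y t) absolutely_integrable_on {0..1}"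
    and "(\<lambda>t. - \<zeta> * Y t - of_real (\<tau> t) * U t + 2 * of_real (p t) * Y t) absolutely_integrable_on {0..1}"
proof -
  have c: "(\<lambda>t. c * F t) absolutely_integrable_on {0..1}" if "continuous_on {0..1} F" for c and F :: "real \<Rightarrow> complex"
    using that by (intro absolutely_integrable_continuous_real continuous_intros)
  have p2: "(\<lambda>t. 2 * p t) absolutely_integrable_on {0..1}" by (rule set_integrable_mult_right) (rule p)
  show "(\<lambda>t. \<zeta> * U t + of_real (\<tau> t) * Y t) absolutely_integrable_on {0..1}"
    by (intro set_integral_add c absolutely_integrable_comm_times \<tau> Y U)
  have "(\<lambda>t. - \<zeta> * Y t - of_real (\<tau> t) * U t + of_real (2 * p t) * Y t) absolutely_integrable_on {0..1}"
    by (intro set_integral_add set_integral_diff c absolutely_integrable_comm_times \<tau> p2 Y U)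
  then show "(\<lambda>t. - \<zeta> * Y t - of_real (\<tau> t) * U t + 2 * of_real (p t) * Y t) absolutely_integrable_on {0..1}" by simp
qed

lemma dirac_sol_unique:
  assumes \<tau>: "\<tau> absolutely_integrable_on {0..1}" and p: "p absolutely_integrable_on {0..1}"
    and s1: "dirac_sol \<tau> p \<zeta> Y1 U1" and s2: "dirac_sol \<tau> p \<zeta> Y2 U2" and x: "x \<in> {0..1}"
  shows "Y1 x = Y2 x \<and> U1 x = U2 x"
proof -
  define y u where "y x = Y1 x - Y2 x" and "u x = U1 x - U2 x" for x
  have c: "continuous_on {0..1} Y1" "continuous_on {0..1} U1" "continuous_on {0..1} Y2" "continuous_on {0..1} U2"
    using s1 s2 by (auto simp: dirac_sol_def)
  have cy: "continuous_on {0..1} y" and cu: "continuous_on {0..1} u" unfolding y_def u_def by (intro continuous_intros c)+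
  let ?f = "\<lambda>t. \<zeta> * u t + of_real (\<tau> t) * y t"
  let ?g = "\<lambda>t. - \<zeta> * y t - of_real (\<tau> t) * u t + 2 * of_real (p t) * y t"
  define \<kappa> where "\<kappa> t = 2 * cmod \<zeta> + 2 * \<bar>\<tau> t\<bar> + 2 * \<bar>p t\<bar>" for t
  have absi: "(\<lambda>t. \<bar>g t\<bar>) absolutely_integrable_on {0..1}" if "g absolutely_integrable_on {0..1}" for g :: "real \<Rightarrow> real"
    using absolutely_integrable_norm[OF that] by (simp add: o_def)
  have ka: "\<kappa> absolutely_integrable_on {0..1}" unfolding \<kappa>_def
    by (intro set_integral_add set_integrable_mult_right absi \<tau> p absolutely_integrable_continuous_real continuous_intros)
  have sub: "f integrable_on {0..x}" if "f absolutely_integrable_on {0..1}" "x \<in> {0..1}" for f :: "real \<Rightarrow> complex" and x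
  proof -
    have "f integrable_on {0..1}" using that set_lebesgue_integral_eq_integral by blast
    then show ?thesis using that by (intro integrable_on_subinterval) auto
  qed
  note I1 = dirac_integrands[OF \<tau> p c(1,2), of \<zeta>] and I2 = dirac_integrands[OF \<tau> p c(3,4), of \<zeta>] and I = dirac_integrands[OF \<tau> p cy cu, of \<zeta>]
  have yx: "y x = integral {0..x} ?f" if x: "x \<in> {0..1}" for x
  proof -
    have "y x = integral {0..x} (\<lambda>t. \<zeta> * U1 t + of_real (\<tau> t) * Y1 t) - integral {0..x} (\<lambda>t. \<zeta> * U2 t + of_real (\<tau> t) * Y2 t)"
      using s1 s2 x by (simp add: dirac_sol_def y_def)
    also have "\<dots> = integral {0..x} (\<lambda>t. (\<zeta> * U1 t + of_real (\<tau> t) * Y1 t) - (\<zeta> * U2 t + of_real (\<tau> t) * Y2 t))"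
      by (intro Henstock_Kurzweil_Integration.integral_diff[symmetric] sub[OF I1(1) x] sub[OF I2(1) x])
    finally show ?thesis by (simp add: y_def u_def algebra_simps)
  qed
  have ux: "u x = integral {0..x} ?g" if x: "x \<in> {0..1}" for x
  proof -
    have "u x = integral {0..x} (\<lambda>t. - \<zeta> * Y1 t - of_real (\<tau> t) * U1 t + 2 * of_real (p t) * Y1 t) - integral {0..x} (\<lambda>t. - \<zeta> * Y2 t - of_real (\<tau> t) * U2 t + 2 * of_real (p t) * Y2 t)"
      using s1 s2 x by (simp add: dirac_sol_def u_def)
    also have "\<dots> = integral {0..x} (\<lambda>t. (- \<zeta> * Y1 t - of_real (\<tau> t) * U1 t + 2 * of_real (p t) * Y1 t) - (- \<zeta> * Y2 t - of_real (\<tau> t) * U2 t + 2 * of_real (p t) * Y2 t))"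
      by (intro Henstock_Kurzweil_Integration.integral_diff[symmetric] sub[OF I1(2) x] sub[OF I2(2) x])
    finally show ?thesis by (simp add: y_def u_def algebra_simps)
  qed
  let ?D = "\<lambda>t. cmod (y t) + cmod (u t)"
  have cD: "continuous_on {0..1} ?D" by (intro continuous_intros cy cu)
  have fn: "(\<lambda>t. cmod (?f t)) absolutely_integrable_on {0..1}" "(\<lambda>t. cmod (?g t)) absolutely_integrable_on {0..1}"
    using absolutely_integrable_norm[OF I(1)] absolutely_integrable_norm[OF I(2)] by (simp_all add: o_def)
  have kD: "(\<lambda>t. \<kappa> t * ?D t) absolutely_integrable_on {0..1}"
  proof -
    have "(\<lambda>t. ?D t * \<kappa> t) absolutely_integrable_on {0..1}"
    proof (rule absolutely_integrable_bounded_measurable_product_real)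
      show "?D \<in> borel_measurable (lebesgue_on {0..1})"
        by (intro continuous_imp_measurable_on_sets_lebesgue cD) auto
      show "bounded (?D ` {0..1})" by (intro compact_imp_bounded compact_continuous_image cD) auto
    qed (use ka in auto)
    then show ?thesis by (simp only: mult.commute)
  qed
  have subr: "f integrable_on {0..x}" if "f absolutely_integrable_on {0..1}" "x \<in> {0..1}" for f :: "real \<Rightarrow> real" and x
  proof -
    have "f integrable_on {0..1}" using that set_lebesgue_integral_eq_integral by blast
    then show ?thesis using that by (intro integrable_on_subinterval) auto
  qed
  have "?D x = 0"
  proof (rule gronwall_zero[OF cD _ ka _ _ x])
    fix x :: real assume x: "x \<in> {0..1}"
    have "cmod (y x) \<le> integral {0..x} (\<lambda>t. cmod (?f t))" unfolding yx[OF x]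
      by (intro Henstock_Kurzweil_Integration.integral_norm_bound_integral sub[OF I(1) x] subr[OF fn(1) x]) auto
    moreover have "cmod (u x) \<le> integral {0..x} (\<lambda>t. cmod (?g t))" unfolding ux[OF x]
      by (intro Henstock_Kurzweil_Integration.integral_norm_bound_integral sub[OF I(2) x] subr[OF fn(2) x]) auto
    ultimately have "?D x \<le> integral {0..x} (\<lambda>t. cmod (?f t)) + integral {0..x} (\<lambda>t. cmod (?g t))" by linarith
    also have "\<dots> = integral {0..x} (\<lambda>t. cmod (?f t) + cmod (?g t))"
      by (intro Henstock_Kurzweil_Integration.integral_add[symmetric] subr[OF fn(1) x] subr[OF fn(2) x])
    also have "\<dots> \<le> integral {0..x} (\<lambda>t. \<kappa> t * ?D t)"
    proof (rule integral_le)
      show "(\<lambda>t. cmod (?f t) + cmod (?g t)) integrable_on {0..x}" by (intro integrable_add subr[OF fn(1) x] subr[OF fn(2) x])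
      show "(\<lambda>t. \<kappa> t * ?D t) integrable_on {0..x}" by (rule subr[OF kD x])
      fix t
      have "cmod (?f t) \<le> cmod \<zeta> * cmod (u t) + \<bar>\<tau> t\<bar> * cmod (y t)" 
        using norm_triangle_ineq[of "\<zeta> * u t" "of_real (\<tau> t) * y t"] by (simp add: norm_mult)
      moreover have "cmod (?g t) \<le> cmod \<zeta> * cmod (y t) + \<bar>\<tau> t\<bar> * cmod (u t) + 2 * \<bar>p t\<bar> * cmod (y t)"
        using norm_triangle_ineq[of "- \<zeta> * y t - of_real (\<tau> t) * u t" "2 * of_real (p t) * y t"] 
          norm_triangle_ineq4[of "- \<zeta> * y t" "of_real (\<tau> t) * u t"] by (simp add: norm_mult)
      moreover have "0 \<le> cmod \<zeta> * cmod (u t)" "0 \<le> cmod \<zeta> * cmod (y t)" "0 \<le> \<bar>\<tau> t\<bar> * cmod (u t)" "0 \<le> \<bar>\<tau> t\<bar> * cmod (y t)" "0 \<le> \<bar>p t\<bar> * cmod (u t)" by simp_all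
      ultimately show "cmod (?f t) + cmod (?g t) \<le> \<kappa> t * ?D t" unfolding \<kappa>_def distrib_left distrib_right by linarith
    qed
    finally show "?D x \<le> integral {0..x} (\<lambda>t. \<kappa> t * ?D t)" .
  qed (auto simp: \<kappa>_def)
  then have "y x = 0" "u x = 0" by (simp_all add: add_nonneg_eq_0_iff)
  then show ?thesis by (simp add: y_def u_def)
qed

section \<open>Calculus of grid convergence\<close>

lemma grid_converges_cong:
  assumes "grid_converges M v V" "\<And>x. x \<in> {0..1} \<Longrightarrow> V x = W x"
  shows "grid_converges M v W"
proof -
  have a: "real k / real (M n) \<in> {0..1}" if "k \<le> M n" for k n using that by (auto simp: divide_le_eq_1)
  have "continuous_on {0..1} W \<longleftrightarrow> continuous_on {0..1} V" using assms(2) by (intro continuous_on_cong) auto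
  then show ?thesis using assms(1) unfolding grid_converges_def using assms(2)[OF a] by simp
qed

text \<open>Were convergence to fail, the infinitely many bad indices would form a subsequence of
  which no further subsequence converges to \<open>V\<close>.\<close>

lemma grid_converges_of_subsequences:
  assumes c: "continuous_on {0..1} V" and s: "\<And>s0. strict_mono (s0 :: nat \<Rightarrow> nat) \<Longrightarrow> \<exists>s. strict_mono s \<and> grid_converges (M \<circ> (s0 \<circ> s)) (v \<circ> (s0 \<circ> s)) V"
  shows "grid_converges M v V"
  unfolding grid_converges_def
proof (intro conjI c allI impI)
  fix e :: real assume e: "e > 0"
  let ?P = "\<lambda>n. \<forall>k\<le>M n. norm (v n k - V (real k / real (M n))) < e"
  show "eventually ?P sequentially"
  proof (rule ccontr)
    assume "\<not> eventually ?P sequentially"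
    then have "infinite {n. \<not> ?P n}" unfolding cofinite_eq_sequentially[symmetric] eventually_cofinite .
    from infinite_enumerate[OF this] obtain s0 :: "nat \<Rightarrow> nat" where s0: "strict_mono s0 \<and> (\<forall>n. s0 n \<in> {n. \<not> ?P n})" ..
    from s[OF conjunct1[OF s0]] obtain s :: "nat \<Rightarrow> nat" where st: "strict_mono s \<and> grid_converges (M \<circ> (s0 \<circ> s)) (v \<circ> (s0 \<circ> s)) V" ..
    have "\<forall>e>0. \<forall>\<^sub>F n in sequentially. \<forall>k\<le>(M \<circ> (s0 \<circ> s)) n. norm ((v \<circ> (s0 \<circ> s)) n k - V (real k / real ((M \<circ> (s0 \<circ> s)) n))) < e"
      using conjunct2[OF st] unfolding grid_converges_def by (rule conjunct2)
    from this[rule_format, OF e] have "\<forall>\<^sub>F n in sequentially. ?P (s0 (s n))" unfolding o_def by (rule eventually_mono) blast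
    from eventually_happens'[OF sequentially_bot this] obtain n where "?P (s0 (s n))" ..
    then show False by (rule notE[OF conjunct2[OF s0, THEN spec, THEN CollectD]])
  qed
qed

lemma grid_converges_mult:
  fixes f g :: "nat \<Rightarrow> nat \<Rightarrow> 'a::real_normed_algebra"
  assumes f: "grid_converges M f F" and g: "grid_converges M g G"
  shows "grid_converges M (\<lambda>n k. f n k * g n k) (\<lambda>x. F x * G x)"
  unfolding grid_converges_def
proof (intro conjI allI impI)
  have c: "continuous_on {0..1} F" "continuous_on {0..1} G" using f g by (auto simp: grid_converges_def)
  then show "continuous_on {0..1} (\<lambda>x. F x * G x)" by (intro continuous_intros)
  fix e :: real assume e: "e > 0"
  have "bounded (F ` {0..1})" "bounded (G ` {0..1})" by (intro compact_imp_bounded compact_continuous_image c; simp)+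
  then obtain A B where A: "A > 0" "\<And>x. x \<in> {0..1} \<Longrightarrow> norm (F x) \<le> A" and B: "B > 0" "\<And>x. x \<in> {0..1} \<Longrightarrow> norm (G x) \<le> B"
    unfolding bounded_pos by blast
  define d where "d = min 1 (e / (A + B + 1))"
  have S: "A + B + 1 > 0" using A B by simp
  have d: "d > 0" "d \<le> 1" using e S by (auto simp: d_def)
  have dS: "d * (A + B + 1) \<le> e"
  proof -
    have "d * (A + B + 1) \<le> e / (A + B + 1) * (A + B + 1)" using S by (intro mult_right_mono) (auto simp: d_def)
    then show ?thesis using S by simp
  qed
  have a: "real k / real (M n) \<in> {0..1}" if "k \<le> M n" for k n using that by (auto simp: divide_le_eq_1)
  have "\<forall>\<^sub>F n in sequentially. \<forall>k\<le>M n. norm (f n k - F (real k / real (M n))) < d"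
    "\<forall>\<^sub>F n in sequentially. \<forall>k\<le>M n. norm (g n k - G (real k / real (M n))) < d" using f g d(1) by (auto simp: grid_converges_def)
  then show "\<forall>\<^sub>F n in sequentially. \<forall>k\<le>M n. norm (f n k * g n k - F (real k / real (M n)) * G (real k / real (M n))) < e"
  proof eventually_elim
    case (elim n)
    show ?case
    proof (intro allI impI)
      fix k assume k: "k \<le> M n"
      let ?x = "real k / real (M n)"
      have n: "norm (f n k - F ?x) < d" "norm (g n k - G ?x) < d" using elim k by auto
      have gb: "norm (g n k) \<le> B + 1" using n(2) d(2) B(2)[OF a[OF k]] norm_triangle_ineq[of "g n k - G ?x" "G ?x"] by simp
      have "f n k * g n k - F ?x * G ?x = (f n k - F ?x) * g n k + F ?x * (g n k - G ?x)" by (simp add: algebra_simps)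
      also have "norm \<dots> \<le> norm (f n k - F ?x) * norm (g n k) + norm (F ?x) * norm (g n k - G ?x)"
        by (intro order_trans[OF norm_triangle_ineq] add_mono norm_mult_ineq)
      also have "\<dots> \<le> norm (f n k - F ?x) * (B + 1) + A * norm (g n k - G ?x)"
        using gb A(2)[OF a[OF k]] by (intro add_mono mult_left_mono mult_right_mono) auto
      also have "\<dots> < d * (B + 1) + A * d"
        using n A B by (intro add_strict_mono mult_strict_right_mono mult_strict_left_mono) auto
      also have "\<dots> = d * (A + B + 1)" by (simp add: algebra_simps)
      finally show "norm (f n k * g n k - F ?x * G ?x) < e" using dS by simp
    qed
  qed
qed

lemma grid_converges_linear:
  fixes f g :: "nat \<Rightarrow> nat \<Rightarrow> complex"
  assumes f: "grid_converges M f F" and g: "grid_converges M g G"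
  shows "grid_converges M (\<lambda>n k. f n k + c * g n k) (\<lambda>x. F x + c * G x)"
  unfolding grid_converges_def
proof (intro conjI allI impI)
  show "continuous_on {0..1} (\<lambda>x. F x + c * G x)" using f g unfolding grid_converges_def by (intro continuous_intros) auto
  fix e :: real assume e: "e > 0"
  define d where "d = e / (1 + cmod c)"
  have S: "1 + cmod c > 0" by (smt (verit) norm_ge_zero)
  have d: "d > 0" using e S by (simp add: d_def)
  have "\<forall>\<^sub>F n in sequentially. \<forall>k\<le>M n. norm (f n k - F (real k / real (M n))) < d"
    "\<forall>\<^sub>F n in sequentially. \<forall>k\<le>M n. norm (g n k - G (real k / real (M n))) < d" using f g d(1) by (auto simp: grid_converges_def)
  then show "\<forall>\<^sub>F n in sequentially. \<forall>k\<le>M n. norm (f n k + c * g n k - (F (real k / real (M n)) + c * G (real k / real (M n)))) < e"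
  proof eventually_elim
    case (elim n)
    show ?case
    proof (intro allI impI)
      fix k assume k: "k \<le> M n"
      let ?x = "real k / real (M n)"
      have n: "norm (f n k - F ?x) < d" "norm (g n k - G ?x) \<le> d" using elim k by (auto simp: less_imp_le)
      have "f n k + c * g n k - (F ?x + c * G ?x) = (f n k - F ?x) + c * (g n k - G ?x)" by (simp add: algebra_simps)
      also have "norm \<dots> \<le> norm (f n k - F ?x) + cmod c * norm (g n k - G ?x)"
        using norm_triangle_ineq[of "f n k - F ?x" "c * (g n k - G ?x)"] by (simp add: norm_mult)
      also have "\<dots> < d + cmod c * d" using n by (intro add_less_le_mono mult_left_mono) auto
      also have "\<dots> = (1 + cmod c) * d" by (simp add: algebra_simps)
      also have "\<dots> = e" using S by (simp add: d_def)
      finally show "norm (f n k + c * g n k - (F ?x + c * G ?x)) < e" .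
    qed
  qed
qed

text \<open>The subtracted term makes the bound telescope in the induction; what is wanted is a
  bound uniform in \<open>N\<close>.\<close>

lemma inverse_square_sum: "(\<Sum>n\<in>J N. 1 / (1 + (real_of_int n)\<^sup>2)) \<le> 5 - 4 / (real N + 1)"
proof (induction N)
  case 0
  then show ?case by simp
next
  case (Suc N)
  have eq: "J (Suc N) = insert (int (Suc N)) (insert (- int (Suc N)) (J N))" by auto
  have "(\<Sum>n\<in>J (Suc N). 1 / (1 + (real_of_int n)\<^sup>2)) = 2 / (1 + (real N + 1)\<^sup>2) + (\<Sum>n\<in>J N. 1 / (1 + (real_of_int n)\<^sup>2))"
    unfolding eq by (subst sum.insert, simp, simp, subst sum.insert) (auto simp: algebra_simps power2_eq_square)
  also have "\<dots> \<le> 2 / (1 + (real N + 1)\<^sup>2) + (5 - 4 / (real N + 1))" using Suc by simp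
  also have "2 / (1 + (real N + 1)\<^sup>2) \<le> 4 / ((real N + 1) * (real N + 2))"
  proof -
    have "(real N + 1) * (real N + 2) \<le> 2 * (1 + (real N + 1)\<^sup>2)" by (simp add: power2_eq_square algebra_simps)
    then have "4 / (2 * (1 + (real N + 1)\<^sup>2)) \<le> 4 / ((real N + 1) * (real N + 2))" by (intro divide_left_mono) (auto simp: add_pos_nonneg)
    moreover have "4 / (2 * X) = 2 / X" for X :: real by simp
    ultimately show "2 / (1 + (real N + 1)\<^sup>2) \<le> 4 / ((real N + 1) * (real N + 2))" by metis
  qed
  also have "4 / ((real N + 1) * (real N + 2)) = 4 / (real N + 1) - 4 / (real N + 2)" by (simp add: field_simps)
  finally show ?case by (simp add: algebra_simps)
qed


lemma grid_converges_cnj: "grid_converges M f F \<Longrightarrow> grid_converges M (\<lambda>n k. cnj (f n k)) (\<lambda>x. cnj (F x))"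
  unfolding grid_converges_def complex_cnj_diff[symmetric] complex_mod_cnj by (auto intro: continuous_intros)

text \<open>The squared modulus of \<open>sin (x + i y)\<close> is
  \<open>sin^2 x + sinh^2 y\<close>; the first term is handled by \<open>abs_sin_ge\<close>, the
  second by \<open>1 + y \<le> exp y\<close>.\<close>

lemma cmod_sin_ge:
  assumes "\<bar>Re w\<bar> \<le> 2" shows "cmod w / 4 \<le> cmod (sin w)"
proof (rule power2_le_imp_le)
  define x y where "x = Re w" and "y = Im w"
  have e1: "exp (2 * y) = (exp y)\<^sup>2" "exp (- (2 * y)) = (exp (- y))\<^sup>2" by (simp_all add: power2_eq_square exp_add[symmetric])
  have e2: "exp y * exp (- y) = 1" by (simp add: exp_add[symmetric])
  have "(cmod (sin w))\<^sup>2 = (exp (2 * y) + exp (- (2 * y)) - 2 * cos (2 * x)) / 4"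
    unfolding norm_sin_squared by (simp add: x_def y_def exp_minus)
  also have "\<dots> = (sin x)\<^sup>2 + (exp y - exp (- y))\<^sup>2 / 4"
    unfolding e1 cos_double_sin using e2 by (simp add: power2_eq_square algebra_simps add_divide_distrib diff_divide_distrib)
  finally have eq: "(cmod (sin w))\<^sup>2 = (sin x)\<^sup>2 + (exp y - exp (- y))\<^sup>2 / 4" .
  have "\<bar>x\<bar> / 4 \<le> \<bar>sin x\<bar>" using abs_sin_ge assms by (simp add: x_def)
  then have "(\<bar>x\<bar> / 4)\<^sup>2 \<le> \<bar>sin x\<bar>\<^sup>2" by (rule power_mono) simp
  moreover have "\<bar>y\<bar> \<le> \<bar>exp y - exp (- y)\<bar>"
  proof (cases "y \<ge> 0")
    case True
    then have "1 + y \<le> exp y" "exp (- y) \<le> 1" using exp_ge_add_one_self by auto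
    then show ?thesis using True by linarith
  next
    case False
    then have "1 + (- y) \<le> exp (- y)" "exp y \<le> 1" using exp_ge_add_one_self[of "- y"] by auto
    then show ?thesis using False by linarith
  qed
  then have "\<bar>y\<bar>\<^sup>2 \<le> \<bar>exp y - exp (- y)\<bar>\<^sup>2" by (rule power_mono) simp
  moreover have "(cmod w)\<^sup>2 = x\<^sup>2 + y\<^sup>2" by (simp add: cmod_power2 x_def y_def)
  moreover have "(\<bar>x\<bar> / 4)\<^sup>2 = x\<^sup>2 / 16" "(cmod w / 4)\<^sup>2 = (cmod w)\<^sup>2 / 16" "\<bar>sin x\<bar>\<^sup>2 = (sin x)\<^sup>2"
    "\<bar>y\<bar>\<^sup>2 = y\<^sup>2" "\<bar>exp y - exp (- y)\<bar>\<^sup>2 = (exp y - exp (- y))\<^sup>2" "0 \<le> (exp y - exp (- y))\<^sup>2"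
    by (simp_all add: power_divide)
  ultimately show "(cmod w / 4)\<^sup>2 \<le> (cmod (sin w))\<^sup>2" unfolding eq by linarith
qed simp

text \<open>Everything follows from \<open>1 - exp (2 i w) = - 2 i exp (i w) sin w\<close>.\<close>

lemma one_minus_exp_ge:
  assumes "\<bar>Re w\<bar> \<le> 2" shows "exp (- Im w) * cmod w / 2 \<le> cmod (1 - exp (2 * \<i> * w))"
proof -
  have e: "exp (2 * \<i> * w) = exp (\<i> * w) * exp (\<i> * w)" by (simp add: exp_add[symmetric] mult_2[symmetric] mult.assoc)
  have f: "exp (\<i> * w) * exp (- (\<i> * w)) = 1" by (simp add: exp_add[symmetric])
  have s: "2 * \<i> * sin w = exp (\<i> * w) - exp (- (\<i> * w))" by (simp add: sin_exp_eq)
  have "- 2 * \<i> * exp (\<i> * w) * sin w = - (exp (\<i> * w) * (2 * \<i> * sin w))" by (simp add: mult_ac)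
  also have "\<dots> = 1 - exp (2 * \<i> * w)" unfolding s e right_diff_distrib f by simp
  finally have "1 - exp (2 * \<i> * w) = - 2 * \<i> * exp (\<i> * w) * sin w" ..
  then have "cmod (1 - exp (2 * \<i> * w)) = exp (- Im w) * (2 * cmod (sin w))" by (simp add: norm_mult norm_exp_eq_Re)
  also have "\<dots> \<ge> exp (- Im w) * (2 * (cmod w / 4))" using cmod_sin_ge[OF assms] by (intro mult_left_mono) auto
  finally show ?thesis by simp
qed

section \<open>The last step: boundary condition and kernel at the nodes\<close>

context circle_data
begin

text \<open>The product of the factors \<open>1 - |c j|^2\<close> is at least one minus the sum of
  the squares. With that sum \<open>O(1 / m)\<close>, all norms are asymptotically equal.\<close>

lemma N_bounds: "k < m \<Longrightarrow> N 0 * (1 - (\<Sum>j<k. (cmod (c j))\<^sup>2)) \<le> N k \<and> N k \<le> N 0"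
proof (induction k)
  case (Suc k)
  then have IH: "N 0 * (1 - (\<Sum>j<k. (cmod (c j))\<^sup>2)) \<le> N k" "N k \<le> N 0" by auto
  have "N k > 0" using N_pos Suc.prems by simp
  then have "N k * (cmod (c k))\<^sup>2 \<le> N 0 * (cmod (c k))\<^sup>2" "0 \<le> N k * (cmod (c k))\<^sup>2" using IH(2) by (auto intro: mult_right_mono)
  moreover have "N (Suc k) = N k - N k * (cmod (c k))\<^sup>2" using N_Suc[of k] Suc.prems by (simp add: right_diff_distrib)
  moreover have "N 0 * (1 - (\<Sum>j<Suc k. (cmod (c j))\<^sup>2)) = N 0 * (1 - (\<Sum>j<k. (cmod (c j))\<^sup>2)) - N 0 * (cmod (c k))\<^sup>2"
    by (simp add: algebra_simps)
  ultimately show ?case using IH by linarith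
qed simp

lemma m_pos: "m > 0" using fin ne by (simp add: m_def card_gt_0_iff)

text \<open>\<open>P m\<close> vanishes at all nodes, so the last Szego step reads
  \<open>z P = c Q\<close> there, with index \<open>m - 1\<close> throughout. Evaluation at the node
  1 identifies this last coefficient as the unimodular \<open>(om (m - 1))\<^sup>2\<close>.\<close>

lemma end_poly:
  assumes i: "i \<in> I" and j: "j \<in> I" "z j = 1"
  shows "z i * poly (P (m - 1)) (z i) = (om (m - 1))\<^sup>2 * poly (Q (m - 1)) (z i)"
proof -
  define k where "k = m - 1"
  have km: "k < m" "m = Suc k" using m_pos by (auto simp: k_def)
  have rel: "z n * poly (P k) (z n) = c k * poly (Q k) (z n)" if "n \<in> I" for n
    using P_m_zero[OF that] unfolding km(2) by (simp add: P_Suc)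
  have nz: "poly (P k) 1 \<noteq> 0" using P1_nz km(1) .
  define \<rho> where "\<rho> = complex_of_real (cmod (poly (P k) 1))"
  have pe: "poly (P k) 1 = \<rho> * om k" using nz by (simp add: om_def sgn_eq \<rho>_def)
  have "poly (P k) 1 = c k * cnj (poly (P k) 1)" using rel[OF j(1)] poly_Q[of 1 k] by (simp add: j(2))
  then have "\<rho> * om k = c k * (\<rho> * cnj (om k))" unfolding pe by (simp add: \<rho>_def)
  then have "om k = c k * cnj (om k)" using nz by (simp add: \<rho>_def)
  then have "(om k)\<^sup>2 = c k * (om k * cnj (om k))" by (metis power2_eq_square mult.commute mult.left_commute)
  then have "(om k)\<^sup>2 = c k" using om_cnj[OF km(1)] by simp
  then show ?thesis using rel[OF i] by (simp add: k_def)
qed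

text \<open>The Dirichlet condition in discrete form: when \<open>ee\<close> tends to 1, it makes
  \<open>eta\<close> and \<open>ets\<close> agree at the last step, that is, \<open>yd\<close>
  vanish.\<close>

lemma end_relation:
  assumes i: "i \<in> I" and j: "j \<in> I" "z j = 1" and e: "(ee \<zeta>)\<^sup>2 = z i"
  shows "ets (m - 1) \<zeta> = (ee \<zeta>)\<^sup>2 * eta (m - 1) \<zeta>"
proof -
  define k where "k = m - 1"
  have km: "k < m" using m_pos by (auto simp: k_def)
  have "(ee \<zeta>)\<^sup>2 * eta k \<zeta> = (z i * poly (P k) (z i)) * cnj (om k) / ee \<zeta> ^ k" by (simp add: eta_def e)
  also have "\<dots> = (om k * cnj (om k)) * (om k * poly (Q k) (z i)) / ee \<zeta> ^ k"
    using end_poly[OF i j] by (simp add: k_def power2_eq_square)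
  also have "\<dots> = ets k \<zeta>" using om_cnj[OF km] by (simp add: ets_def e)
  finally show ?thesis by (simp add: k_def)
qed

lemma P_eta: assumes "k < m" shows "cmod (poly (P k) ((ee \<zeta>)\<^sup>2)) = cmod (eta k \<zeta>) * cmod (ee \<zeta>) ^ k"
  using om_norm[OF assms] ee_nz[of \<zeta>] by (simp add: eta_def norm_mult norm_divide norm_power)

text \<open>By \<open>end_poly\<close> the Christoffel-Darboux numerator splits into a factor from
  the node and the defect \<open>ets - ee^2 eta\<close>, which depends on \<open>\<zeta>\<close>
  only. A small defect therefore acts on all nodes at once.\<close>

lemma Ker_node:
  assumes i: "i \<in> I" and j: "j \<in> I" "z j = 1" and ne: "z i * cnj ((ee \<zeta>)\<^sup>2) \<noteq> 1"
  shows "cmod (Ker (z i) ((ee \<zeta>)\<^sup>2)) = cmod (poly (P (m - 1)) (z i)) * cmod (ee \<zeta>) ^ (m - 1) * 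
    cmod (ets (m - 1) \<zeta> - (ee \<zeta>)\<^sup>2 * eta (m - 1) \<zeta>) / (N (m - 1) * cmod (1 - z i * cnj ((ee \<zeta>)\<^sup>2)))"
proof -
  define k where "k = m - 1"
  have km: "k < m" using m_pos by (auto simp: k_def)
  define t where "t = (ee \<zeta>)\<^sup>2"
  define o1 where "o1 = om k"
  have oo: "o1 * cnj o1 = 1" using om_cnj[OF km] by (simp add: o1_def)
  have q: "poly (Q k) (z i) = z i * poly (P k) (z i) * (cnj o1)\<^sup>2"
  proof -
    have "z i * poly (P k) (z i) * (cnj o1)\<^sup>2 = (o1 * cnj o1)\<^sup>2 * poly (Q k) (z i)"
      using end_poly[OF i j] by (simp add: k_def o1_def power_mult_distrib)
    then show ?thesis by (simp add: oo)
  qed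
  have e0: "ee \<zeta> ^ k \<noteq> 0" using ee_nz by simp
  have Qt: "o1\<^sup>2 * poly (Q k) t = o1 * ee \<zeta> ^ k * ets k \<zeta>" using ee_nz[of \<zeta>] by (simp add: ets_def t_def o1_def power2_eq_square)
  have Pt: "t * poly (P k) t = o1 * ee \<zeta> ^ k * (t * eta k \<zeta>)"
  proof -
    have "o1 * ee \<zeta> ^ k * (t * eta k \<zeta>) = (o1 * cnj o1) * (t * poly (P k) t)" using ee_nz[of \<zeta>] by (simp add: eta_def t_def o1_def)
    then show ?thesis by (simp only: oo mult_1_left)
  qed
  have "poly (Q k) (z i) * cnj (poly (Q k) t) - z i * cnj t * poly (P k) (z i) * cnj (poly (P k) t)
    = z i * poly (P k) (z i) * cnj (o1\<^sup>2 * poly (Q k) t - t * poly (P k) t)"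
    unfolding q by (simp add: algebra_simps)
  also have "\<dots> = z i * poly (P k) (z i) * cnj (o1 * ee \<zeta> ^ k * (ets k \<zeta> - t * eta k \<zeta>))"
    unfolding Qt Pt by (simp add: algebra_simps)
  finally have num: "cmod (poly (Q k) (z i) * cnj (poly (Q k) t) - z i * cnj t * poly (P k) (z i) * cnj (poly (P k) t))
    = cmod (poly (P k) (z i)) * cmod (ee \<zeta>) ^ k * cmod (ets k \<zeta> - t * eta k \<zeta>)"
    using circ[OF i] om_norm[OF km] by (simp only: norm_mult complex_mod_cnj o1_def norm_power mult_1_left)
  show ?thesis
    using Ker_eq[OF ne] N_pos[OF km] unfolding t_def[symmetric] k_def[symmetric] by (simp add: norm_divide num norm_mult)
qed

end

section \<open>Passage to the limit\<close>

text \<open>\<open>K\<close> selects the orders \<open>N\<close> of a subsequence, and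
  \<open>2 * K n = m - 1\<close> is the number of steps. Convergence is asked only of the partial
  sums of the gauged coefficients.\<close>

locale dirac_approx = spectral_input lam \<alpha> h for lam \<alpha> :: "int \<Rightarrow> real" and h :: real +
  fixes K :: "nat \<Rightarrow> nat" and C :: real and Tp Pp \<tau> p :: "real \<Rightarrow> real"
  assumes K_lim: "filterlim K at_top sequentially" and K_pos: "\<And>n. K n > 0"
    and cd: "\<And>n. circle_data (J (K n)) (node lam (K n)) (wt (K n))"
    and gb_half: "\<And>n k. k < 2 * K n \<Longrightarrow> cmod (circle_data.gb (J (K n)) (node lam (K n)) (wt (K n)) k) \<le> 1/2"
    and gb_sum: "\<And>n. (\<Sum>k<2 * K n. (cmod (circle_data.gb (J (K n)) (node lam (K n)) (wt (K n)) k))\<^sup>2) \<le> C / real (2 * K n)"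
    and T_lim: "grid_converges (\<lambda>n. 2 * K n) (\<lambda>n k. \<Sum>j<k. Re (circle_data.gb (J (K n)) (node lam (K n)) (wt (K n)) j)) Tp"
    and P_lim: "grid_converges (\<lambda>n. 2 * K n) (\<lambda>n k. \<Sum>j<k. - Im (circle_data.gb (J (K n)) (node lam (K n)) (wt (K n)) j)) Pp"
    and \<tau>: "L2 \<tau>" "\<tau> absolutely_integrable_on {0..1}" "\<And>x. x \<in> {0..1} \<Longrightarrow> (\<tau> has_integral (Tp x - Tp 0)) {0..x}"
    and p: "L2 p" "p absolutely_integrable_on {0..1}" "\<And>x. x \<in> {0..1} \<Longrightarrow> (p has_integral (Pp x - Pp 0)) {0..x}"

lemma (in spectral_input) dirac_approx_exists: "\<exists>K C Tp Pp \<tau> p. dirac_approx lam \<alpha> h K C Tp Pp \<tau> p"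
proof -
  let ?gb = "\<lambda>N. circle_data.gb (J N) (node lam N) (wt N)"
  let ?good = "\<lambda>N. circle_data (J N) (node lam N) (wt N)"
  obtain C where C: "C > 0" "\<forall>\<^sub>F N in sequentially. ?good N \<and> (\<Sum>k<2 * N. (cmod (cc N k))\<^sup>2) \<le> C / real (2 * N + 1)"
    using coefficients_bounded by blast
  obtain N0 where N0: "\<And>N. N \<ge> N0 \<Longrightarrow> ?good N \<and> (\<Sum>k<2 * N. (cmod (cc N k))\<^sup>2) \<le> C / real (2 * N + 1)"
    using C(2) unfolding eventually_sequentially by blast
  obtain N1 :: nat where N1: "4 * C \<le> real N1" using real_arch_simple by blast
  \<comment> \<open>Beyond \<open>N0\<close> the coefficient bound holds; beyond \<open>N1\<close>
    it forces every single coefficient below 1/2, as \<open>step_error\<close> requires.\<close>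
  define K0 where "K0 n = n + N0 + N1 + 1" for n
  have good: "?good (K0 n)" for n using N0[of "K0 n"] by (simp add: K0_def)
  have gbc: "cmod (?gb N k) = cmod (cc N k)" if "?good N" "k < 2 * N" for N k
  proof -
    interpret cd: circle_data "J N" "node lam N" "wt N" by (rule that)
    show ?thesis using that(2) by (intro cd.gb_norm) (simp add: cd.m_def)
  qed
  have gsum: "(\<Sum>k<2 * K0 n. (cmod (?gb (K0 n) k))\<^sup>2) \<le> C / real (2 * K0 n + 1)" for n
  proof -
    have "(\<Sum>k<2 * K0 n. (cmod (?gb (K0 n) k))\<^sup>2) = (\<Sum>k<2 * K0 n. (cmod (cc (K0 n) k))\<^sup>2)"
      using gbc[OF good[of n]] by (intro sum.cong) auto
    then show ?thesis using N0[of "K0 n"] by (simp only: K0_def)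
  qed
  have gsum2: "(\<Sum>k<2 * K0 n. (cmod (?gb (K0 n) k))\<^sup>2) \<le> C / real (2 * K0 n)" for n
  proof -
    have "C / real (2 * K0 n + 1) \<le> C / real (2 * K0 n)" using C(1) by (intro divide_left_mono) (auto simp: K0_def)
    then show ?thesis using gsum[of n] by linarith
  qed
  have half: "cmod (?gb (K0 n) k) \<le> 1/2" if k: "k < 2 * K0 n" for n k
  proof -
    have "(cmod (?gb (K0 n) k))\<^sup>2 \<le> (\<Sum>k<2 * K0 n. (cmod (?gb (K0 n) k))\<^sup>2)" using k by (intro member_le_sum) auto
    also have "\<dots> \<le> C / real (2 * K0 n + 1)" by (rule gsum)
    also have "\<dots> \<le> 1/4" using N1 by (simp add: K0_def divide_le_eq)
    also have "\<dots> = (1/2)\<^sup>2" by (simp add: power2_eq_square)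
    finally show ?thesis by (rule power2_le_imp_le) simp
  qed
  have K0p: "2 * K0 n > 0" for n by (simp add: K0_def)
  have Esq: "(\<Sum>k<2 * K0 n. (norm ((\<Sum>j<Suc k. f (?gb (K0 n) j)) - (\<Sum>j<k. f (?gb (K0 n) j))))\<^sup>2) \<le> C / real (2 * K0 n)"
    if "\<And>x. \<bar>f x\<bar> \<le> cmod x" for f :: "complex \<Rightarrow> real" and n
  proof -
    have "(\<Sum>k<2 * K0 n. (norm ((\<Sum>j<Suc k. f (?gb (K0 n) j)) - (\<Sum>j<k. f (?gb (K0 n) j))))\<^sup>2) \<le> (\<Sum>k<2 * K0 n. (cmod (?gb (K0 n) k))\<^sup>2)"
      using that by (intro sum_mono power_mono) auto
    then show ?thesis using gsum2[of n] by linarith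
  qed
  have re: "\<bar>Re x\<bar> \<le> cmod x" "\<bar>- Im x\<bar> \<le> cmod x" for x using abs_Re_le_cmod abs_Im_le_cmod by auto
  obtain s1 Tp where s1: "strict_mono (s1 :: nat \<Rightarrow> nat)" "grid_converges ((\<lambda>n. 2 * K0 n) \<circ> s1) ((\<lambda>n k. \<Sum>j<k. Re (?gb (K0 n) j)) \<circ> s1) Tp"
    using grid_compact[of "\<lambda>n. 2 * K0 n" "\<lambda>n k. \<Sum>j<k. Re (?gb (K0 n) j)" 0 C, OF K0p _ Esq[of Re, OF re(1)]] by auto
  obtain s2 Pp where s2: "strict_mono (s2 :: nat \<Rightarrow> nat)"
    "grid_converges (((\<lambda>n. 2 * K0 n) \<circ> s1) \<circ> s2) (((\<lambda>n k. \<Sum>j<k. - Im (?gb (K0 n) j)) \<circ> s1) \<circ> s2) Pp"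
  proof (rule grid_compact[of "(\<lambda>n. 2 * K0 n) \<circ> s1" "(\<lambda>n k. \<Sum>j<k. - Im (?gb (K0 n) j)) \<circ> s1" 0 C])
    show "(\<Sum>k<((\<lambda>n. 2 * K0 n) \<circ> s1) n. (norm (((\<lambda>n k. \<Sum>j<k. - Im (?gb (K0 n) j)) \<circ> s1) n (Suc k) - ((\<lambda>n k. \<Sum>j<k. - Im (?gb (K0 n) j)) \<circ> s1) n k))\<^sup>2)
       \<le> C / real (((\<lambda>n. 2 * K0 n) \<circ> s1) n)" for n
      using Esq[of "\<lambda>x. - Im x", OF re(2), of "s1 n"] by (simp only: o_def)
  qed (use K0p in auto)
  define s where "s = s1 \<circ> s2"
  define K where "K = K0 \<circ> s"
  have s: "strict_mono s" unfolding s_def using s1(1) s2(1) by (rule strict_mono_o)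
  have T: "grid_converges (\<lambda>n. 2 * K n) (\<lambda>n k. \<Sum>j<k. Re (?gb (K n) j)) Tp"
    using grid_converges_subseq[OF s1(2) s2(1)] by (simp add: s_def K_def o_def)
  have Pc: "grid_converges (\<lambda>n. 2 * K n) (\<lambda>n k. \<Sum>j<k. - Im (?gb (K n) j)) Pp"
    using s2(2) by (simp add: s_def K_def o_def)
  have Kl: "filterlim K at_top sequentially"
  proof -
    have "strict_mono K0" by (simp add: K0_def strict_mono_def)
    then have "strict_mono K" unfolding K_def using s by (rule strict_mono_o)
    then show ?thesis by (rule filterlim_subseq)
  qed
  then have K2: "filterlim (\<lambda>n. 2 * K n) at_top sequentially"
    by (rule filterlim_at_top_mono) auto
  have E1: "(\<Sum>k<2 * K n. ((\<Sum>j<Suc k. f (?gb (K n) j)) - (\<Sum>j<k. f (?gb (K n) j)))\<^sup>2) \<le> C / real (2 * K n)"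
    if "\<And>x. \<bar>f x\<bar> \<le> cmod x" for f :: "complex \<Rightarrow> real" and n
    using Esq[of f, OF that, of "s n"] unfolding real_norm_def power2_abs K_def o_def .
  have Kp: "2 * K n > 0" for n using K0p by (simp add: K_def)
  obtain \<tau> where \<tau>: "L2 \<tau>" "\<tau> absolutely_integrable_on {0..1}" "\<And>x. x \<in> {0..1} \<Longrightarrow> (\<tau> has_integral (Tp x - Tp 0)) {0..x}"
  proof (rule energy_density[of Tp C])
    fix D :: "(real \<times> real) set"
    assume D: "finite D" "\<And>a b. (a, b) \<in> D \<Longrightarrow> 0 \<le> a \<and> a < b \<and> b \<le> 1" "disjoint_family_on (\<lambda>(a, b). {a<..<b}) D"
    show "(\<Sum>(a, b)\<in>D. (Tp b - Tp a)\<^sup>2 / (b - a)) \<le> C" by (rule grid_energy_limit[OF T K2 E1[of Re, OF re(1)] Kp D])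
  qed (rule that; assumption)
  obtain p where p: "L2 p" "p absolutely_integrable_on {0..1}" "\<And>x. x \<in> {0..1} \<Longrightarrow> (p has_integral (Pp x - Pp 0)) {0..x}"
  proof (rule energy_density[of Pp C])
    fix D :: "(real \<times> real) set"
    assume D: "finite D" "\<And>a b. (a, b) \<in> D \<Longrightarrow> 0 \<le> a \<and> a < b \<and> b \<le> 1" "disjoint_family_on (\<lambda>(a, b). {a<..<b}) D"
    show "(\<Sum>(a, b)\<in>D. (Pp b - Pp a)\<^sup>2 / (b - a)) \<le> C" by (rule grid_energy_limit[OF Pc K2 E1[of "\<lambda>x. - Im x", OF re(2)] Kp D])
  qed (rule that; assumption)
  have "dirac_approx lam \<alpha> h K C Tp Pp \<tau> p"
  proof (intro dirac_approx.intro dirac_approx_axioms.intro)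
    show "spectral_input lam \<alpha> h" by (rule spectral_input_axioms)
    show "circle_data (J (K n)) (node lam (K n)) (wt (K n))" for n using good by (simp add: K_def)
  qed (use Kl Kp half gsum2 T Pc \<tau> p in \<open>auto simp: K_def\<close>)
  then show ?thesis by blast
qed

context dirac_approx
begin

abbreviation M :: "nat \<Rightarrow> nat" where "M n \<equiv> 2 * K n"
abbreviation gbN :: "nat \<Rightarrow> nat \<Rightarrow> complex" where "gbN n \<equiv> circle_data.gb (J (K n)) (node lam (K n)) (wt (K n))"
abbreviation etaN :: "complex \<Rightarrow> nat \<Rightarrow> nat \<Rightarrow> complex" where "etaN \<zeta> n k \<equiv> circle_data.eta (J (K n)) (node lam (K n)) (wt (K n)) k \<zeta>"
abbreviation etsN :: "complex \<Rightarrow> nat \<Rightarrow> nat \<Rightarrow> complex" where "etsN \<zeta> n k \<equiv> circle_data.ets (J (K n)) (node lam (K n)) (wt (K n)) k \<zeta>"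
abbreviation ydN :: "complex \<Rightarrow> nat \<Rightarrow> nat \<Rightarrow> complex" where "ydN \<zeta> n k \<equiv> circle_data.yd (J (K n)) (node lam (K n)) (wt (K n)) k \<zeta>"
abbreviation udN :: "complex \<Rightarrow> nat \<Rightarrow> nat \<Rightarrow> complex" where "udN \<zeta> n k \<equiv> circle_data.ud (J (K n)) (node lam (K n)) (wt (K n)) k \<zeta>"
abbreviation eeN :: "complex \<Rightarrow> nat \<Rightarrow> complex" where "eeN \<zeta> n \<equiv> circle_data.ee (J (K n)) \<zeta>"
abbreviation NK :: "nat \<Rightarrow> nat \<Rightarrow> real" where "NK n k \<equiv> NN (K n) k"

lemma mK: "circle_data.m (J (K n)) = Suc (M n)"
proof -
  interpret cd: circle_data "J (K n)" "node lam (K n)" "wt (K n)" by (rule cd)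
  show ?thesis by (simp add: cd.m_def)
qed

lemma M_lim: "filterlim M at_top sequentially"
  by (rule filterlim_at_top_mono[OF K_lim]) auto

lemma C0: "C \<ge> 0"
proof -
  have "0 \<le> C / real (2 * K 0)" by (rule order_trans[OF _ gb_sum[of 0]]) (simp add: sum_nonneg)
  then show ?thesis using K_pos[of 0] by (simp add: zero_le_divide_iff)
qed

lemma gb_l1: "(\<Sum>k<M n. cmod (gbN n k)) \<le> sqrt C"
proof (rule real_le_rsqrt)
  have "(\<Sum>k<M n. cmod (gbN n k))\<^sup>2 \<le> (\<Sum>k<M n. (cmod (gbN n k))\<^sup>2) * real (card {..<M n})"
    by (rule sum_squared_le_sum_of_squares)
  also have "\<dots> \<le> (C / real (M n)) * real (M n)" using gb_sum[of n] by (intro mult_mono) (auto simp: C0)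
  also have "\<dots> = C" using K_pos[of n] by simp
  finally show "(\<Sum>k<M n. cmod (gbN n k))\<^sup>2 \<le> C" .
qed

lemma eta_le: assumes "k \<le> M n"
  shows "cmod (etaN \<zeta> n k) \<le> exp (cmod \<zeta> + sqrt C)" "cmod (etsN \<zeta> n k) \<le> exp (cmod \<zeta> + sqrt C)"
proof -
  interpret cd: circle_data "J (K n)" "node lam (K n)" "wt (K n)" by (rule cd)
  have "exp (cmod \<zeta> + (\<Sum>j<cd.m - 1. cmod (cd.gb j))) \<le> exp (cmod \<zeta> + sqrt C)" using gb_l1[of n] by (simp add: mK)
  moreover have "k < cd.m" using assms by (simp add: mK)
  ultimately show "cmod (etaN \<zeta> n k) \<le> exp (cmod \<zeta> + sqrt C)" "cmod (etsN \<zeta> n k) \<le> exp (cmod \<zeta> + sqrt C)"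
    using cd.eta_bound[of k \<zeta>] by linarith+
qed

text \<open>The bound is free of \<open>t\<close>, so it covers all nodes simultaneously however
  large \<open>lam i\<close> becomes.\<close>

lemma eta_real_le: assumes "k \<le> M n" shows "cmod (etaN (of_real t) n k) \<le> exp (sqrt C)"
proof -
  interpret cd: circle_data "J (K n)" "node lam (K n)" "wt (K n)" by (rule cd)
  have "(\<Sum>j<k. cmod (cd.gb j)) \<le> (\<Sum>j<M n. cmod (cd.gb j))" using assms by (intro sum_mono2) auto
  then have "exp (\<Sum>j<k. cmod (cd.gb j)) \<le> exp (sqrt C)" using gb_l1[of n] by simp
  moreover have "k < cd.m" using assms by (simp add: mK)
  then have "cmod (etaN (of_real t) n k) \<le> exp (\<Sum>j<k. cmod (cd.gb j))"
    using cd.eta_bound_gen[of 1 "of_real t" k] cd.ee_real_norm[of t] by (simp add: norm_divide)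
  ultimately show ?thesis by linarith
qed

lemma yu_eta:
  "ydN \<zeta> n k = (etaN \<zeta> n k - etsN \<zeta> n k) / (2 * \<i>)" "udN \<zeta> n k = (etaN \<zeta> n k + etsN \<zeta> n k) / 2"
  "etaN \<zeta> n k = udN \<zeta> n k + \<i> * ydN \<zeta> n k" "etsN \<zeta> n k = udN \<zeta> n k + (- \<i>) * ydN \<zeta> n k"
proof -
  interpret cd: circle_data "J (K n)" "node lam (K n)" "wt (K n)" by (rule cd)
  show "ydN \<zeta> n k = (etaN \<zeta> n k - etsN \<zeta> n k) / (2 * \<i>)" "udN \<zeta> n k = (etaN \<zeta> n k + etsN \<zeta> n k) / 2"
    "etaN \<zeta> n k = udN \<zeta> n k + \<i> * ydN \<zeta> n k" "etsN \<zeta> n k = udN \<zeta> n k + (- \<i>) * ydN \<zeta> n k"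
    by (simp_all add: cd.yd_def cd.ud_def field_simps)
qed

lemma subsequence_solution:
  assumes s0: "strict_mono (s0 :: nat \<Rightarrow> nat)"
  shows "\<exists>s Y U. strict_mono s \<and> grid_converges (M \<circ> (s0 \<circ> s)) (ydN \<zeta> \<circ> (s0 \<circ> s)) Y \<and> grid_converges (M \<circ> (s0 \<circ> s)) (udN \<zeta> \<circ> (s0 \<circ> s)) U \<and> dirac_sol \<tau> p \<zeta> Y U"
proof -
  define Z where "Z = cmod \<zeta>"
  define B where "B = exp (Z + sqrt C)"
  \<comment> \<open>A single constant that bounds the solutions and also serves in the step error,
    as \<open>dirac_limit\<close> asks.\<close>
  define X where "X = (7 * exp Z + 2 * (exp Z * Z) + (exp Z * Z\<^sup>2 + Z)) * B"
  have Z0: "Z \<ge> 0" by (simp add: Z_def)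
  have B0: "B > 0" by (simp add: B_def)
  have "1 * B \<le> X" unfolding X_def
  proof (rule mult_right_mono)
    have "exp Z \<ge> 1" "exp Z * Z \<ge> 0" "exp Z * Z\<^sup>2 \<ge> 0" using Z0 by simp_all
    then show "1 \<le> 7 * exp Z + 2 * (exp Z * Z) + (exp Z * Z\<^sup>2 + Z)" using Z0 by linarith
  qed (use B0 in simp)
  then have BX: "B \<le> X" by simp
  have eb: "cmod (etaN \<zeta> n k) \<le> B" "cmod (etsN \<zeta> n k) \<le> B" if "k \<le> M n" for n k
    using eta_le[OF that, of \<zeta>] by (auto simp: B_def Z_def)
  have yb: "cmod (ydN \<zeta> n k) \<le> X" "cmod (udN \<zeta> n k) \<le> X" if "k \<le> M n" for n k
  proof -
    have "cmod (ydN \<zeta> n k) \<le> B" using eb[OF that] norm_triangle_ineq4[of "etaN \<zeta> n k" "etsN \<zeta> n k"]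
      unfolding yu_eta(1) by (simp add: norm_divide norm_mult)
    moreover have "cmod (udN \<zeta> n k) \<le> B" using eb[OF that] norm_triangle_ineq[of "etaN \<zeta> n k" "etsN \<zeta> n k"]
      unfolding yu_eta(2) by (simp add: norm_divide)
    ultimately show "cmod (ydN \<zeta> n k) \<le> X" "cmod (udN \<zeta> n k) \<le> X" using BX by auto
  qed
  have sq: "(cmod b)\<^sup>2 = (Re b)\<^sup>2 + (- Im b)\<^sup>2" for b by (simp add: cmod_power2)
  have steps: "cmod (ydN \<zeta> n (Suc k) - ydN \<zeta> n k - (\<zeta> / of_nat (M n) * udN \<zeta> n k + of_real (Re (gbN n k)) * ydN \<zeta> n k))
      \<le> X * ((Re (gbN n k))\<^sup>2 + (- Im (gbN n k))\<^sup>2 + (1 / real (M n))\<^sup>2)"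
    "cmod (udN \<zeta> n (Suc k) - udN \<zeta> n k - (- \<zeta> / of_nat (M n) * ydN \<zeta> n k - of_real (Re (gbN n k)) * udN \<zeta> n k + 2 * of_real (- Im (gbN n k)) * ydN \<zeta> n k))
      \<le> X * ((Re (gbN n k))\<^sup>2 + (- Im (gbN n k))\<^sup>2 + (1 / real (M n))\<^sup>2)" if k: "k < M n" for n k
  proof -
    interpret cd: circle_data "J (K n)" "node lam (K n)" "wt (K n)" by (rule cd)
    have "Suc k < cd.m" using k by (simp add: mK)
    note st = cd.dirac_step[OF this gb_half[OF k] eb[OF less_imp_le[OF k]], folded Z_def, folded X_def, unfolded sq mK diff_Suc_1 of_real_of_nat_eq]
    show "cmod (ydN \<zeta> n (Suc k) - ydN \<zeta> n k - (\<zeta> / of_nat (M n) * udN \<zeta> n k + of_real (Re (gbN n k)) * ydN \<zeta> n k))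
      \<le> X * ((Re (gbN n k))\<^sup>2 + (- Im (gbN n k))\<^sup>2 + (1 / real (M n))\<^sup>2)" by (rule st(1))
    have "2 * of_real (- Im (gbN n k)) * ydN \<zeta> n k = - (2 * of_real (Im (gbN n k)) * ydN \<zeta> n k)" by simp
    then show "cmod (udN \<zeta> n (Suc k) - udN \<zeta> n k - (- \<zeta> / of_nat (M n) * ydN \<zeta> n k - of_real (Re (gbN n k)) * udN \<zeta> n k + 2 * of_real (- Im (gbN n k)) * ydN \<zeta> n k))
      \<le> X * ((Re (gbN n k))\<^sup>2 + (- Im (gbN n k))\<^sup>2 + (1 / real (M n))\<^sup>2)"
      using st(2) by (simp only: diff_conv_add_uminus)
  qed
  have init: "ydN \<zeta> n 0 = 0" "udN \<zeta> n 0 = 1" for n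
  proof -
    interpret cd: circle_data "J (K n)" "node lam (K n)" "wt (K n)" by (rule cd)
    show "ydN \<zeta> n 0 = 0" "udN \<zeta> n 0 = 1" unfolding yu_eta(1,2) cd.eta_0 by simp_all
  qed
  have E: "(\<Sum>k<M n. (Re (gbN n k))\<^sup>2 + (- Im (gbN n k))\<^sup>2) \<le> C / real (M n)" for n
    using gb_sum[of n] unfolding sq .
  obtain s Y U where "strict_mono (s :: nat \<Rightarrow> nat)" "grid_converges ((\<lambda>n. M (s0 n)) \<circ> s) ((\<lambda>n. ydN \<zeta> (s0 n)) \<circ> s) Y"
     "grid_converges ((\<lambda>n. M (s0 n)) \<circ> s) ((\<lambda>n. udN \<zeta> (s0 n)) \<circ> s) U" "dirac_sol \<tau> p \<zeta> Y U"
  proof (rule dirac_limit[where M="\<lambda>n. M (s0 n)" and t="\<lambda>n k. Re (gbN (s0 n) k)" and p="\<lambda>n k. - Im (gbN (s0 n) k)" and E=C and T=Tp and P=Pp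
        and td=\<tau> and pd=p and y="\<lambda>n. ydN \<zeta> (s0 n)" and u="\<lambda>n. udN \<zeta> (s0 n)" and X=X and \<zeta>=\<zeta>])
    show "filterlim (\<lambda>n. M (s0 n)) at_top sequentially" using filterlim_compose[OF M_lim filterlim_subseq[OF s0]] .
    show "M (s0 n) > 0" for n using K_pos[of "s0 n"] by simp
    show "grid_converges (\<lambda>n. M (s0 n)) (\<lambda>n k. \<Sum>j<k. Re (gbN (s0 n) j)) Tp" using grid_converges_subseq[OF T_lim s0] by (simp add: o_def)
    show "grid_converges (\<lambda>n. M (s0 n)) (\<lambda>n k. \<Sum>j<k. - Im (gbN (s0 n) j)) Pp" using grid_converges_subseq[OF P_lim s0] by (simp only: o_def)
  qed (rule E init yb steps \<tau>(2,3) p(2,3); assumption)+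
  then show ?thesis by (auto simp: o_def)
qed

text \<open>\<open>K\<close> was fixed before \<open>\<zeta>\<close>. Every subsequence has a
  further one converging to a solution of the Dirac system, and that solution is unique; so the full
  sequence converges for each \<open>\<zeta>\<close>.\<close>

lemma solution_exists: "\<exists>Y U. dirac_sol \<tau> p \<zeta> Y U \<and> grid_converges M (ydN \<zeta>) Y \<and> grid_converges M (udN \<zeta>) U"
proof -
  obtain Y U where YU: "dirac_sol \<tau> p \<zeta> Y U" using subsequence_solution[of id \<zeta>] strict_mono_id by blast
  have sub: "\<exists>s. strict_mono s \<and> grid_converges (M \<circ> (s0 \<circ> s)) (ydN \<zeta> \<circ> (s0 \<circ> s)) Y \<and> grid_converges (M \<circ> (s0 \<circ> s)) (udN \<zeta> \<circ> (s0 \<circ> s)) U"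
    if s0: "strict_mono s0" for s0 :: "nat \<Rightarrow> nat"
  proof -
    obtain s Y' U' where s: "strict_mono s" "grid_converges (M \<circ> (s0 \<circ> s)) (ydN \<zeta> \<circ> (s0 \<circ> s)) Y'" "grid_converges (M \<circ> (s0 \<circ> s)) (udN \<zeta> \<circ> (s0 \<circ> s)) U'" "dirac_sol \<tau> p \<zeta> Y' U'"
      using subsequence_solution[OF s0] by blast
    have "Y' x = Y x" "U' x = U x" if "x \<in> {0..1}" for x using dirac_sol_unique[OF \<tau>(2) p(2) s(4) YU that] by auto
    then show ?thesis using s(1) grid_converges_cong[OF s(2)] grid_converges_cong[OF s(3)] by blast
  qed
  have "grid_converges M (ydN \<zeta>) Y"
  proof (rule grid_converges_of_subsequences)
    show "continuous_on {0..1} Y" using YU by (simp add: dirac_sol_def)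
    show "\<exists>s. strict_mono s \<and> grid_converges (M \<circ> (s0 \<circ> s)) (ydN \<zeta> \<circ> (s0 \<circ> s)) Y" if s0: "strict_mono s0" for s0 :: "nat \<Rightarrow> nat"
      using sub[OF s0] by (rule ex_forward) blast
  qed
  moreover have "grid_converges M (udN \<zeta>) U"
  proof (rule grid_converges_of_subsequences)
    show "continuous_on {0..1} U" using YU by (simp add: dirac_sol_def)
    show "\<exists>s. strict_mono s \<and> grid_converges (M \<circ> (s0 \<circ> s)) (udN \<zeta> \<circ> (s0 \<circ> s)) U" if s0: "strict_mono s0" for s0 :: "nat \<Rightarrow> nat"
      using sub[OF s0] by (rule ex_forward) blast
  qed
  ultimately show ?thesis using YU by blast
qed

definition Ys :: "complex \<Rightarrow> real \<Rightarrow> complex" where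
  "Ys \<zeta> = (SOME Y. \<exists>U. dirac_sol \<tau> p \<zeta> Y U \<and> grid_converges M (ydN \<zeta>) Y \<and> grid_converges M (udN \<zeta>) U)"
definition Us :: "complex \<Rightarrow> real \<Rightarrow> complex" where
  "Us \<zeta> = (SOME U. dirac_sol \<tau> p \<zeta> (Ys \<zeta>) U \<and> grid_converges M (ydN \<zeta>) (Ys \<zeta>) \<and> grid_converges M (udN \<zeta>) U)"

lemma sol: "dirac_sol \<tau> p \<zeta> (Ys \<zeta>) (Us \<zeta>)" "grid_converges M (ydN \<zeta>) (Ys \<zeta>)" "grid_converges M (udN \<zeta>) (Us \<zeta>)"
proof -
  have "\<exists>U. dirac_sol \<tau> p \<zeta> (Ys \<zeta>) U \<and> grid_converges M (ydN \<zeta>) (Ys \<zeta>) \<and> grid_converges M (udN \<zeta>) U"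
    using someI_ex[OF solution_exists[of \<zeta>]] unfolding Ys_def .
  then have "dirac_sol \<tau> p \<zeta> (Ys \<zeta>) (Us \<zeta>) \<and> grid_converges M (ydN \<zeta>) (Ys \<zeta>) \<and> grid_converges M (udN \<zeta>) (Us \<zeta>)"
    unfolding Us_def by (rule someI_ex)
  then show "dirac_sol \<tau> p \<zeta> (Ys \<zeta>) (Us \<zeta>)" "grid_converges M (ydN \<zeta>) (Ys \<zeta>)" "grid_converges M (udN \<zeta>) (Us \<zeta>)" by auto
qed

abbreviation G :: "complex \<Rightarrow> real \<Rightarrow> complex" where "G \<zeta> x \<equiv> Us \<zeta> x + \<i> * Ys \<zeta> x"

lemma eta_conv: "grid_converges M (etaN \<zeta>) (G \<zeta>)"
proof -
  have "grid_converges M (\<lambda>n k. udN \<zeta> n k + \<i> * ydN \<zeta> n k) (G \<zeta>)" by (rule grid_converges_linear[OF sol(3,2)])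
  then show ?thesis by (simp only: yu_eta(3)[symmetric])
qed

lemma sol_real:
  assumes "x \<in> {0..1}" shows "Im (Ys (of_real t) x) = 0" "Im (Us (of_real t) x) = 0"
proof -
  have r: "Im (ydN (of_real t) n k) = 0" "Im (udN (of_real t) n k) = 0" for n k
  proof -
    interpret cd: circle_data "J (K n)" "node lam (K n)" "wt (K n)" by (rule cd)
    have "etsN (of_real t) n k = cnj (etaN (of_real t) n k)" by (rule cd.eta_real) (rule cd.ee_real_norm)
    then show "Im (ydN (of_real t) n k) = 0" "Im (udN (of_real t) n k) = 0"
      unfolding yu_eta(1,2) by (simp_all add: complex_diff_cnj complex_add_cnj)
  qed
  show "Im (Ys (of_real t) x) = 0"
    using tendsto_Im[OF grid_converges_tendsto[OF sol(2)[of "of_real t"] M_lim assms]] by (simp add: r LIMSEQ_const_iff)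
  show "Im (Us (of_real t) x) = 0"
    using tendsto_Im[OF grid_converges_tendsto[OF sol(3)[of "of_real t"] M_lim assms]] by (simp add: r LIMSEQ_const_iff)
qed

section \<open>Eigenvalues, norming constants and energy in the limit\<close>

lemma eventually_node: "\<forall>\<^sub>F n in sequentially. i \<in> J (K n)"
proof -
  have "\<forall>\<^sub>F n in sequentially. nat \<bar>i\<bar> \<le> K n" using K_lim by (simp add: filterlim_at_top)
  then show ?thesis by eventually_elim auto
qed

lemma node_0: "0 \<in> J (K n)" "node lam (K n) 0 = 1" by (simp_all add: node_def lam_0)

lemma ee_sq: "(eeN (of_real (lam i)) n)\<^sup>2 = node lam (K n) i"
proof -
  interpret cd: circle_data "J (K n)" "node lam (K n)" "wt (K n)" by (rule cd)
  show ?thesis unfolding cd.ee_def mK node_def cis_conv_exp exp_double[symmetric]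
    by (simp add: mult_ac)
qed

lemma ee_to_1: "(\<lambda>n. eeN \<zeta> n) \<longlonglongrightarrow> 1"
proof -
  have "(\<lambda>n. exp (\<i> * \<zeta> / of_nat (Suc (M n)))) \<longlonglongrightarrow> exp 0"
  proof (intro tendsto_exp)
    have "(\<lambda>n. 1 / real (Suc (M n))) \<longlonglongrightarrow> 0"
      using filterlim_compose[OF lim_inverse_n'[unfolded inverse_eq_divide[symmetric]] ] LIMSEQ_Suc lim_1_over_n
      by (rule_tac filterlim_compose[OF LIMSEQ_Suc[OF lim_1_over_n] M_lim])
    then have "(\<lambda>n. \<i> * \<zeta> * of_real (1 / real (Suc (M n)))) \<longlonglongrightarrow> \<i> * \<zeta> * of_real 0" by (intro tendsto_intros)
    then show "(\<lambda>n. \<i> * \<zeta> / of_nat (Suc (M n))) \<longlonglongrightarrow> 0" by simp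
  qed
  moreover have "eeN \<zeta> n = exp (\<i> * \<zeta> / of_nat (Suc (M n)))" for n
  proof -
    interpret cd: circle_data "J (K n)" "node lam (K n)" "wt (K n)" by (rule cd)
    show ?thesis unfolding cd.ee_def mK ..
  qed
  ultimately show ?thesis by simp
qed

lemma end_lim: "(\<lambda>n. etaN \<zeta> n (M n)) \<longlonglongrightarrow> G \<zeta> 1" "(\<lambda>n. ydN \<zeta> n (M n)) \<longlonglongrightarrow> Ys \<zeta> 1" "(\<lambda>n. udN \<zeta> n (M n)) \<longlonglongrightarrow> Us \<zeta> 1"
  using grid_converges_tendsto[OF eta_conv M_lim, of 1] grid_converges_tendsto[OF sol(2) M_lim, of 1] grid_converges_tendsto[OF sol(3) M_lim, of 1]
  by (simp_all add: grid_index_1)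

text \<open>By \<open>end_relation\<close> the last value of \<open>yd\<close> is
  \<open>(1 - ee^2) eta / (2 i)\<close>, where \<open>ee\<close> tends to 1 and \<open>eta\<close>
  converges.\<close>

lemma eigenvalue: "Ys (of_real (lam i)) 1 = 0"
proof -
  let ?\<zeta> = "complex_of_real (lam i)"
  have "\<forall>\<^sub>F n in sequentially. ydN ?\<zeta> n (M n) = (1 - (eeN ?\<zeta> n)\<^sup>2) * etaN ?\<zeta> n (M n) / (2 * \<i>)"
    using eventually_node[of i]
  proof eventually_elim
    case (elim n)
    interpret cd: circle_data "J (K n)" "node lam (K n)" "wt (K n)" by (rule cd)
    show ?case using cd.end_relation[OF elim node_0 ee_sq] unfolding yu_eta(1) mK diff_Suc_1 by (simp add: algebra_simps)
  qed
  moreover have "(\<lambda>n. (1 - (eeN ?\<zeta> n)\<^sup>2) * etaN ?\<zeta> n (M n) / (2 * \<i>)) \<longlonglongrightarrow> (1 - 1\<^sup>2) * G ?\<zeta> 1 / (2 * \<i>)"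
    by (intro tendsto_intros ee_to_1 end_lim) auto
  ultimately have "(\<lambda>n. ydN ?\<zeta> n (M n)) \<longlonglongrightarrow> (1 - 1\<^sup>2) * G ?\<zeta> 1 / (2 * \<i>)" by (simp only: tendsto_cong)
  from LIMSEQ_unique[OF end_lim(2) this] show ?thesis by simp
qed

lemma NK_limits: "(\<lambda>n. NK n 0) \<longlonglongrightarrow> 1" "(\<lambda>n. NK n 0 * (1 - C / real (M n))) \<longlonglongrightarrow> 1"
proof -
  have ev: "eventually (\<lambda>N. circle_data (J N) (node lam N) (wt N)) sequentially"
    using coefficients_bounded by (auto elim: eventually_mono)
  show 1: "(\<lambda>n. NK n 0) \<longlonglongrightarrow> 1" by (rule filterlim_compose[OF NN0_limit[OF ev] K_lim])
  have "(\<lambda>n. 1 / real (M n)) \<longlonglongrightarrow> 0" by (rule filterlim_compose[OF lim_1_over_n M_lim])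
  then have "(\<lambda>n. NK n 0 * (1 - C * (1 / real (M n)))) \<longlonglongrightarrow> 1 * (1 - C * 0)" by (intro tendsto_intros 1)
  then show "(\<lambda>n. NK n 0 * (1 - C / real (M n))) \<longlonglongrightarrow> 1" by simp
qed

lemma NK_between: assumes "k \<le> M n" shows "NK n 0 * (1 - C / real (M n)) \<le> NK n k" "NK n k \<le> NK n 0" "NK n k > 0"
proof -
  interpret cd: circle_data "J (K n)" "node lam (K n)" "wt (K n)" by (rule cd)
  have km: "k < cd.m" using assms by (simp add: mK)
  have "(\<Sum>j<k. (cmod (cd.c j))\<^sup>2) = (\<Sum>j<k. (cmod (cd.gb j))\<^sup>2)" using km by (intro sum.cong) (auto simp: cd.gb_norm)
  also have "\<dots> \<le> (\<Sum>j<M n. (cmod (cd.gb j))\<^sup>2)" using assms by (intro sum_mono2) auto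
  also have "\<dots> \<le> C / real (M n)" by (rule gb_sum)
  finally have "cd.N 0 * (1 - C / real (M n)) \<le> cd.N 0 * (1 - (\<Sum>j<k. (cmod (cd.c j))\<^sup>2))"
    using cd.N_pos[of 0] cd.m_pos by (intro mult_left_mono) auto
  from order_trans[OF this conjunct1[OF cd.N_bounds[OF km]]] show "NK n 0 * (1 - C / real (M n)) \<le> NK n k" .
  show "NK n k \<le> NK n 0" "NK n k > 0" using cd.N_bounds[OF km] cd.N_pos[OF km] by auto
qed

text \<open>All norms lie between two quantities tending to 1, so they disappear from the limit of
  the energy.\<close>

lemma inverse_NK_conv: "grid_converges M (\<lambda>n k. complex_of_real (1 / NK n k)) (\<lambda>x. 1)"
  unfolding grid_converges_def
proof (intro conjI allI impI)
  fix e :: real assume e: "e > 0"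
  have "(\<lambda>n. 1 / NK n 0) \<longlonglongrightarrow> 1 / 1" "(\<lambda>n. 1 / (NK n 0 * (1 - C / real (M n)))) \<longlonglongrightarrow> 1 / 1" by (intro tendsto_divide tendsto_const NK_limits; simp)+
  then have "\<forall>\<^sub>F n in sequentially. dist (1 / NK n 0) 1 < e" "\<forall>\<^sub>F n in sequentially. dist (1 / (NK n 0 * (1 - C / real (M n)))) 1 < e"
    using e by (auto dest: tendstoD)
  moreover have "\<forall>\<^sub>F n in sequentially. NK n 0 * (1 - C / real (M n)) > 0" using NK_limits(2) by (rule order_tendstoD) simp
  ultimately show "\<forall>\<^sub>F n in sequentially. \<forall>k\<le>M n. cmod (complex_of_real (1 / NK n k) - 1) < e"
  proof eventually_elim
    case (elim n)
    show ?case
    proof (intro allI impI)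
      fix k assume k: "k \<le> M n"
      have "1 / NK n 0 \<le> 1 / NK n k" "1 / NK n k \<le> 1 / (NK n 0 * (1 - C / real (M n)))"
        using NK_between[OF k] NK_between(3)[of 0 n] elim(3) by (auto intro!: divide_left_mono mult_pos_pos)
      then have "\<bar>1 / NK n k - 1\<bar> < e" using elim(1,2) unfolding dist_real_def by linarith
      moreover have "complex_of_real (1 / NK n k) - 1 = of_real (1 / NK n k - 1)" by simp
      ultimately show "cmod (complex_of_real (1 / NK n k) - 1) < e" by (simp only: norm_of_real)
    qed
  qed
qed simp

lemma energy_limit:
  "(\<lambda>n. (\<Sum>k<Suc (M n). (cmod (etaN \<zeta> n k))\<^sup>2 / NK n k) / real (M n)) \<longlonglongrightarrow> integral {0..1} (\<lambda>t. (cmod (G \<zeta> t))\<^sup>2)"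
proof -
  let ?f = "\<lambda>n k. etaN \<zeta> n k * cnj (etaN \<zeta> n k) * complex_of_real (1 / NK n k)"
  have f: "grid_converges M ?f (\<lambda>x. G \<zeta> x * cnj (G \<zeta> x) * 1)"
    by (intro grid_converges_mult inverse_NK_conv eta_conv grid_converges_cnj)
  have feq: "?f n k = complex_of_real ((cmod (etaN \<zeta> n k))\<^sup>2 / NK n k)" for n k by (simp add: mult_cnj_norm)
  have Ic: "grid_converges M (\<lambda>n k. real k / real (M n)) (\<lambda>x. x)" by (simp add: grid_converges_def)
  have Ib: "(\<Sum>k<M n. \<bar>real (Suc k) / real (M n) - real k / real (M n)\<bar>) \<le> 1" for n
    using K_pos[of n] by (simp add: diff_divide_distrib[symmetric])
  have one: "(\<lambda>t::real. 1::real) absolutely_integrable_on {0..1}" by (rule absolutely_integrable_continuous_real) simp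
  have one2: "((\<lambda>t::real. 1::real) has_integral (x - 0)) {0..x}" if "x \<in> {0..1}" for x :: real
    using has_integral_const_real[of "1::real" 0 x] that by simp
  have "(\<lambda>n. \<Sum>k<grid_index (M n) 1. of_real (real (Suc k) / real (M n) - real k / real (M n)) * ?f n k) \<longlonglongrightarrow> integral {0..1} (\<lambda>t. of_real 1 * (G \<zeta> t * cnj (G \<zeta> t) * 1))"
    by (rule grid_stieltjes_limit[OF Ic f M_lim Ib one one2]) auto
  moreover have "(\<Sum>k<grid_index (M n) 1. of_real (real (Suc k) / real (M n) - real k / real (M n)) * ?f n k) = of_real ((\<Sum>k<M n. (cmod (etaN \<zeta> n k))\<^sup>2 / NK n k) / real (M n))" for n
  proof -
    have "real (Suc k) / real (M n) - real k / real (M n) = 1 / real (M n)" for k by (simp add: diff_divide_distrib[symmetric])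
    then show ?thesis unfolding feq grid_index_1 of_real_mult[symmetric] of_real_sum[symmetric] by (simp add: sum_divide_distrib mult_ac)
  qed
  moreover have "integral {0..1} (\<lambda>t. of_real 1 * (G \<zeta> t * cnj (G \<zeta> t) * 1)) = complex_of_real (integral {0..1} (\<lambda>t. (cmod (G \<zeta> t))\<^sup>2))"
  proof -
    have cG: "continuous_on {0..1} (G \<zeta>)" using eta_conv by (simp add: grid_converges_def)
    have "(\<lambda>t. (cmod (G \<zeta> t))\<^sup>2) integrable_on {0..1}" by (intro integrable_continuous_real continuous_intros cG)
    then have "((\<lambda>t. complex_of_real ((cmod (G \<zeta> t))\<^sup>2)) has_integral of_real (integral {0..1} (\<lambda>t. (cmod (G \<zeta> t))\<^sup>2))) {0..1}"
      by (intro has_integral_of_real integrable_integral)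
    from integral_unique[OF this] show ?thesis by (simp only: of_real_1 mult_1_left mult_1_right mult_cnj_norm of_real_power)
  qed
  ultimately have L: "(\<lambda>n. (\<Sum>k<M n. (cmod (etaN \<zeta> n k))\<^sup>2 / NK n k) / real (M n)) \<longlonglongrightarrow> integral {0..1} (\<lambda>t. (cmod (G \<zeta> t))\<^sup>2)"
    by (simp only: tendsto_of_real_iff)
  \<comment> \<open>The energy has \<open>m = Suc (M n)\<close> summands but the grid only
    \<open>M n\<close> cells; the surplus summand \<open>k = M n\<close> is negligible after
    division by \<open>M n\<close>.\<close>
  have "(\<lambda>n. of_real (1 / real (M n)) * ?f n (grid_index (M n) 1)) \<longlonglongrightarrow> of_real 0 * (G \<zeta> 1 * cnj (G \<zeta> 1) * 1)"
    by (intro tendsto_intros grid_converges_tendsto[OF f M_lim] filterlim_compose[OF lim_1_over_n M_lim]) auto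
  then have "(\<lambda>n. complex_of_real ((cmod (etaN \<zeta> n (M n)))\<^sup>2 / NK n (M n) / real (M n))) \<longlonglongrightarrow> of_real 0"
    unfolding feq grid_index_1 of_real_mult[symmetric] by (simp add: mult.commute)
  then have "(\<lambda>n. (cmod (etaN \<zeta> n (M n)))\<^sup>2 / NK n (M n) / real (M n)) \<longlonglongrightarrow> 0" by (simp only: tendsto_of_real_iff)
  from tendsto_add[OF L this] show ?thesis by (simp add: add_divide_distrib)
qed

lemma M_ratio: "(\<lambda>n. real (Suc (M n)) / real (M n)) \<longlonglongrightarrow> 1"
proof -
  have "(\<lambda>n. 1 + 1 / real (M n)) \<longlonglongrightarrow> 1 + 0" by (intro tendsto_intros filterlim_compose[OF lim_1_over_n M_lim])
  moreover have "1 + 1 / real (M n) = real (Suc (M n)) / real (M n)" for n using K_pos[of n] by (simp add: field_simps)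
  ultimately show ?thesis by simp
qed

lemma norming: "integral {0..1} (\<lambda>t. (cmod (G (of_real (lam i)) t))\<^sup>2) = \<alpha> i"
proof -
  let ?\<zeta> = "complex_of_real (lam i)"
  have "\<forall>\<^sub>F n in sequentially. (\<Sum>k<Suc (M n). (cmod (etaN ?\<zeta> n k))\<^sup>2 / NK n k) / real (M n) = real (Suc (M n)) / real (M n) * \<alpha> i"
    using eventually_node[of i]
  proof eventually_elim
    case (elim n)
    interpret cd: circle_data "J (K n)" "node lam (K n)" "wt (K n)" by (rule cd)
    have "(\<Sum>k<Suc (M n). (cmod (etaN ?\<zeta> n k))\<^sup>2 / NK n k) = (\<Sum>k<cd.m. (cmod (poly (cd.P k) (node lam (K n) i)))\<^sup>2 / cd.N k)"
      unfolding mK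
    proof (rule sum.cong)
      fix k assume "k \<in> {..<Suc (M n)}"
      then have "cmod (poly (cd.P k) ((cd.ee ?\<zeta>)\<^sup>2)) = cmod (cd.eta k ?\<zeta>)" using cd.P_eta[of k ?\<zeta>] by (simp add: mK cd.ee_real_norm)
      then show "(cmod (etaN ?\<zeta> n k))\<^sup>2 / NK n k = (cmod (poly (cd.P k) (node lam (K n) i)))\<^sup>2 / cd.N k" by (simp add: ee_sq)
    qed simp
    also have "\<dots> = 1 / wt (K n) i" by (rule cd.christoffel[OF elim])
    finally show ?case by (simp add: wt_def)
  qed
  then have "(\<lambda>n. real (Suc (M n)) / real (M n) * \<alpha> i) \<longlonglongrightarrow> integral {0..1} (\<lambda>t. (cmod (G ?\<zeta> t))\<^sup>2)"
    using energy_limit[of ?\<zeta>] by (simp only: tendsto_cong)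
  moreover have "(\<lambda>n. real (Suc (M n)) / real (M n) * \<alpha> i) \<longlonglongrightarrow> 1 * \<alpha> i" by (intro tendsto_intros M_ratio)
  ultimately show ?thesis using LIMSEQ_unique by fastforce
qed

lemma energy_pos: "integral {0..1} (\<lambda>t. (cmod (G \<zeta> t))\<^sup>2) > 0"
proof -
  have "continuous_on {0..1} (G \<zeta>)" using eta_conv[of \<zeta>] by (simp add: grid_converges_def)
  then have cG: "continuous_on {0..1} (\<lambda>t. (cmod (G \<zeta> t))\<^sup>2)" by (rule continuous_on_power[OF continuous_on_norm])
  have "Ys \<zeta> 0 = 0" "Us \<zeta> 0 = 1" using sol(1)[of \<zeta>] by (auto simp: dirac_sol_def)
  then have "(cmod (G \<zeta> 0))\<^sup>2 \<noteq> 0" by simp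
  then have "integral {0..1} (\<lambda>t. (cmod (G \<zeta> t))\<^sup>2) \<noteq> 0" using integral_eq_0_iff[OF cG] by force
  moreover have "integral {0..1} (\<lambda>t. (cmod (G \<zeta> t))\<^sup>2) \<ge> 0"
    by (intro Henstock_Kurzweil_Integration.integral_nonneg integrable_continuous_real cG) auto
  ultimately show ?thesis by simp
qed

section \<open>Exclusion of further eigenvalues\<close>

lemma lam_growth: "\<bar>lam i\<bar> \<ge> pi * \<bar>of_int i\<bar> - (\<bar>h\<bar> + sqrt D)" "\<bar>lam i\<bar> \<le> pi * \<bar>of_int i\<bar> + (\<bar>h\<bar> + sqrt D)"
proof -
  have a: "\<bar>lam i - (pi * of_int i + h)\<bar> \<le> sqrt D" using l2_close_dev[OF l2_close_lam, of i] by (simp add: free_freq_def)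
  have b: "pi * \<bar>of_int i\<bar> = \<bar>pi * of_int i\<bar>" by (simp add: abs_mult)
  show "\<bar>lam i\<bar> \<ge> pi * \<bar>of_int i\<bar> - (\<bar>h\<bar> + sqrt D)" "\<bar>lam i\<bar> \<le> pi * \<bar>of_int i\<bar> + (\<bar>h\<bar> + sqrt D)"
    unfolding b using a by linarith+
qed

text \<open>Comparison with \<open>1 / (1 + i^2)\<close>: outside a finite block the distance from
  \<open>\<zeta>\<close> to \<open>lam i\<close> is at least \<open>|i| + 1\<close>, and inside it
  the finitely many distances are positive.\<close>

lemma resolvent_sum:
  assumes \<zeta>: "\<And>i. \<zeta> \<noteq> of_real (lam i)"
  shows "\<exists>S. \<forall>N. (\<Sum>i\<in>J N. 1 / (cmod (\<zeta> - of_real (lam i)))\<^sup>2) \<le> S"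
proof -
  let ?d = "\<lambda>i. cmod (\<zeta> - of_real (lam i))"
  define R where "R = cmod \<zeta> + \<bar>h\<bar> + sqrt D + 1"
  obtain L :: nat where L: "R \<le> real L" using real_arch_simple by blast
  define f where "f i = (1 + (real_of_int i)\<^sup>2) / (?d i)\<^sup>2" for i
  have fin: "finite (f ` J L)" by simp
  define B where "B = max 2 (Max (f ` J L))"
  have fB: "f i \<le> B" for i
  proof (cases "i \<in> J L")
    case True
    then have "f i \<le> Max (f ` J L)" using fin by simp
    then show ?thesis by (simp add: B_def)
  next
    case False
    then have iL: "\<bar>real_of_int i\<bar> \<ge> real L" by auto
    have "cmod (complex_of_real (lam i)) - cmod \<zeta> \<le> ?d i" by (metis norm_minus_commute norm_triangle_ineq2)
    then have "\<bar>lam i\<bar> - cmod \<zeta> \<le> ?d i" by simp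
    then have "pi * \<bar>of_int i\<bar> - R + 1 \<le> ?d i" using lam_growth(1)[of i] by (simp add: R_def)
    moreover have "3 * \<bar>real_of_int i\<bar> \<le> pi * \<bar>real_of_int i\<bar>" using pi_gt3 by (intro mult_right_mono) auto
    ultimately have d: "\<bar>real_of_int i\<bar> + 1 \<le> ?d i" using iL L by linarith
    have "(\<bar>real_of_int i\<bar> + 1)\<^sup>2 \<le> (?d i)\<^sup>2" using d by (intro power_mono) auto
    then have "1 + (real_of_int i)\<^sup>2 \<le> (?d i)\<^sup>2" by (simp add: power2_eq_square algebra_simps)
    moreover have "(?d i)\<^sup>2 > 0" using \<zeta>[of i] by simp
    ultimately have "f i \<le> 1" by (simp add: f_def divide_le_eq_1)
    then show ?thesis by (simp add: B_def)
  qed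
  have "(\<Sum>i\<in>J N. 1 / (?d i)\<^sup>2) \<le> B * 5" for N
  proof -
    have "(\<Sum>i\<in>J N. 1 / (?d i)\<^sup>2) \<le> (\<Sum>i\<in>J N. B * (1 / (1 + (real_of_int i)\<^sup>2)))"
    proof (rule sum_mono)
      fix i
      have p: "1 + (real_of_int i)\<^sup>2 > 0" by (simp add: add_pos_nonneg)
      have "1 / (?d i)\<^sup>2 = f i * (1 / (1 + (real_of_int i)\<^sup>2))" using p by (simp add: f_def)
      also have "\<dots> \<le> B * (1 / (1 + (real_of_int i)\<^sup>2))" using p fB[of i] by (intro mult_right_mono) auto
      finally show "1 / (?d i)\<^sup>2 \<le> B * (1 / (1 + (real_of_int i)\<^sup>2))" .
    qed
    also have "\<dots> = B * (\<Sum>i\<in>J N. 1 / (1 + (real_of_int i)\<^sup>2))" by (simp only: sum_distrib_left)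
    also have "\<dots> \<le> B * 5"
    proof (rule mult_left_mono)
      have "4 / (real N + 1) \<ge> 0" by simp
      then show "(\<Sum>i\<in>J N. 1 / (1 + (real_of_int i)\<^sup>2)) \<le> 5" using inverse_square_sum[of N] by linarith
    qed (simp add: B_def)
    finally show ?thesis .
  qed
  then show ?thesis by blast
qed

text \<open>Up to conjugation the right side is the modulus of \<open>1 - exp (2 i w)\<close> with
  \<open>w = (\<zeta> - lam i) / m\<close>. For large \<open>K n\<close> the real part of
  \<open>w\<close> stays within 2, away from the further zeros at multiples of \<open>pi\<close>, so
  the linear lower bound is uniform over the nodes.\<close>

lemma denominator_bound:
  assumes i: "i \<in> J (K n)" and big: "4 * (\<bar>h\<bar> + sqrt D + cmod \<zeta>) \<le> real (K n)" 
  shows "exp (- cmod \<zeta>) * cmod (\<zeta> - of_real (lam i)) / (2 * real (Suc (M n))) \<le> cmod (1 - node lam (K n) i * cnj ((eeN \<zeta> n)\<^sup>2))"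
proof -
  interpret cd: circle_data "J (K n)" "node lam (K n)" "wt (K n)" by (rule cd)
  define m where "m = real (Suc (M n))"
  have m1: "m \<ge> 1" by (simp add: m_def)
  define w where "w = (\<zeta> - of_real (lam i)) / of_real m"
  have "cnj (node lam (K n) i * cnj ((eeN \<zeta> n)\<^sup>2)) = exp (2 * \<i> * w)"
  proof -
    have "cnj (node lam (K n) i) = exp (- (2 * \<i> * of_real (lam i) / of_real m))"
    proof -
      have "cnj (cis x) = cis (- x)" for x by (simp add: complex_eq_iff)
      then show ?thesis by (simp only: node_def) (simp add: cis_conv_exp m_def mult_ac)
    qed
    moreover have "(eeN \<zeta> n)\<^sup>2 = exp (2 * \<i> * \<zeta> / of_real m)" unfolding cd.ee_def mK exp_double[symmetric] m_def by (simp add: mult_ac)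
    ultimately show ?thesis by (simp add: w_def exp_add[symmetric] right_diff_distrib diff_divide_distrib)
  qed
  then have eq: "cmod (1 - node lam (K n) i * cnj ((eeN \<zeta> n)\<^sup>2)) = cmod (1 - exp (2 * \<i> * w))"
    by (metis complex_cnj_diff complex_cnj_one complex_mod_cnj)
  have wRe: "Re w = (Re \<zeta> - lam i) / m" and wIm: "Im w = Im \<zeta> / m" by (simp_all add: w_def Re_divide_of_real Im_divide_of_real)
  have "\<bar>Re \<zeta> - lam i\<bar> \<le> cmod \<zeta> + (pi * \<bar>of_int i\<bar> + (\<bar>h\<bar> + sqrt D))" using abs_Re_le_cmod[of \<zeta>] lam_growth(2)[of i] by linarith
  moreover have "pi * \<bar>real_of_int i\<bar> \<le> pi * real (K n)" using i by (intro mult_left_mono) auto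
  \<comment> \<open>\<open>pi < 16 / 5\<close> leaves room for the quarter of \<open>K n\<close>
    granted by \<open>big\<close>: the sum stays below \<open>4 * K n\<close>.\<close>
  moreover have "pi * real (K n) \<le> 16 / 5 * real (K n)" using pi_approx by (intro mult_right_mono) auto
  moreover have "a \<le> 4 * k + 2" if "a \<le> z + (b + (c1 + c2))" "b \<le> d" "d \<le> 16 / 5 * k" "4 * (c1 + c2 + z) \<le> k" "0 \<le> k" for a z b c1 c2 d k :: real
  proof -
    have "a \<le> 16 / 5 * k + 1 / 4 * k" using that by (simp add: field_simps)
    also have "\<dots> = 69 / 20 * k" by simp
    also have "\<dots> \<le> 4 * k" using that(5) by (intro mult_right_mono) auto
    finally show ?thesis by simp
  qed
  ultimately have "\<bar>Re \<zeta> - lam i\<bar> \<le> 4 * real (K n) + 2" using big of_nat_0_le_iff by blast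
  then have "\<bar>Re \<zeta> - lam i\<bar> \<le> 2 * m" by (simp add: m_def)
  then have re2: "\<bar>Re w\<bar> \<le> 2" unfolding wRe using m1 by (simp add: divide_le_eq)
  have "Im w \<le> cmod \<zeta>"
  proof -
    have "Im w \<le> \<bar>Im \<zeta>\<bar> / m" unfolding wIm using m1 by (intro divide_right_mono) auto
    also have "\<dots> \<le> \<bar>Im \<zeta>\<bar> / 1" using m1 by (intro divide_left_mono) auto
    finally show ?thesis using abs_Im_le_cmod[of \<zeta>] by simp
  qed
  then have "exp (- cmod \<zeta>) * cmod w / 2 \<le> exp (- Im w) * cmod w / 2" by (intro divide_right_mono mult_right_mono) auto
  also have "\<dots> \<le> cmod (1 - exp (2 * \<i> * w))" by (rule one_minus_exp_ge[OF re2])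
  finally have "exp (- cmod \<zeta>) * cmod w / 2 \<le> cmod (1 - exp (2 * \<i> * w))" .
  moreover have "cmod w = cmod (\<zeta> - of_real (lam i)) / m" using m1 by (simp add: w_def norm_divide)
  ultimately show ?thesis unfolding eq m_def by (simp add: mult.commute)
qed

text \<open>If \<open>y(1)\<close> vanished, the kernel at the nodes would be negligible because its Christoffel-Darboux numerator
  tends to \<open>0\<close> uniformly in the node, whereas the energy has a positive limit.\<close>

lemma no_other_eigenvalue:
  assumes \<zeta>: "\<And>i. \<zeta> \<noteq> of_real (lam i)"
  shows "Ys \<zeta> 1 \<noteq> 0"
proof
  assume Y1: "Ys \<zeta> 1 = 0"
  obtain S where S: "\<And>N. (\<Sum>i\<in>J N. 1 / (cmod (\<zeta> - of_real (lam i)))\<^sup>2) \<le> S" using resolvent_sum[OF \<zeta>] by blast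
  obtain a b where ab: "0 < a" "\<And>n. a \<le> \<alpha> n" "\<And>n. \<alpha> n \<le> b" using \<alpha>_bounds by blast
  define Z where "Z = cmod \<zeta>"
  define \<Delta> where "\<Delta> n = cmod (etsN \<zeta> n (M n) - (eeN \<zeta> n)\<^sup>2 * etaN \<zeta> n (M n))" for n
  \<comment> \<open>\<open>exp (sqrt C)\<close> bounds \<open>P\<close> at the nodes, one
    \<open>exp Z\<close> the power of \<open>ee\<close>, the other one the denominator; the 4 comes
    from the norm being at least 1/2 and the 2 in \<open>denominator_bound\<close>.\<close>
  define A where "A = exp (sqrt C) * exp Z * 4 * exp Z"
  \<comment> \<open>The upper bound of the energy, vanishing with \<open>\<Delta> n\<close>. Squared
    kernel values are of order \<open>m^2\<close> and weights of order \<open>1 / m\<close>, so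
    after division by \<open>M n\<close> only the bounded factor \<open>m / M\<close>
    remains.\<close>
  define Q where "Q n = exp (2 * Z) * (real (Suc (M n)) / real (M n) * (A\<^sup>2 / a * (\<Delta> n)\<^sup>2 * S))" for n
  have "(\<lambda>n. (udN \<zeta> n (M n) + (- \<i>) * ydN \<zeta> n (M n)) - (eeN \<zeta> n)\<^sup>2 * etaN \<zeta> n (M n)) \<longlonglongrightarrow> (Us \<zeta> 1 + (- \<i>) * Ys \<zeta> 1) - 1\<^sup>2 * G \<zeta> 1"
    by (intro tendsto_intros end_lim ee_to_1)
  then have "(\<lambda>n. etsN \<zeta> n (M n) - (eeN \<zeta> n)\<^sup>2 * etaN \<zeta> n (M n)) \<longlonglongrightarrow> 0" by (simp only: yu_eta(4)[symmetric]) (simp add: Y1)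
  then have D0: "\<Delta> \<longlonglongrightarrow> 0" unfolding \<Delta>_def by (rule tendsto_norm_zero)
  have "Q \<longlonglongrightarrow> exp (2 * Z) * (1 * (A\<^sup>2 / a * 0\<^sup>2 * S))" unfolding Q_def by (intro tendsto_intros M_ratio D0)
  then have Q0: "Q \<longlonglongrightarrow> 0" by simp
  have ev1: "\<forall>\<^sub>F n in sequentially. 4 * (\<bar>h\<bar> + sqrt D + cmod \<zeta>) \<le> real (K n)"
    using filterlim_compose[OF filterlim_real_sequentially K_lim] unfolding filterlim_at_top by blast
  have ev2: "\<forall>\<^sub>F n in sequentially. NK n 0 * (1 - C / real (M n)) > 1/2" using NK_limits(2) by (rule order_tendstoD) simp
  have "\<forall>\<^sub>F n in sequentially. (\<Sum>k<Suc (M n). (cmod (etaN \<zeta> n k))\<^sup>2 / NK n k) / real (M n) \<le> Q n"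
    using ev1 ev2
  proof eventually_elim
    case (elim n)
    interpret cd: circle_data "J (K n)" "node lam (K n)" "wt (K n)" by (rule cd)
    define m where "m = real (Suc (M n))"
    have m1: "m \<ge> 1" by (simp add: m_def)
    define t where "t = (eeN \<zeta> n)\<^sup>2"
    define e where "e = cmod (eeN \<zeta> n)"
    have ek: "e ^ k \<le> exp Z" "exp (- Z) \<le> e ^ k" if k: "k \<le> M n" for k
    proof -
      have "e ^ k = exp (real k * (- Im \<zeta> / m))" unfolding e_def cd.ee_norm mK m_def exp_of_nat_mult ..
      moreover have "\<bar>real k * (- Im \<zeta> / m)\<bar> \<le> Z"
      proof -
        have "\<bar>real k * (- Im \<zeta> / m)\<bar> = real k / m * \<bar>Im \<zeta>\<bar>" using m1 by (simp add: abs_mult)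
        also have "\<dots> \<le> 1 * \<bar>Im \<zeta>\<bar>" using k by (intro mult_right_mono) (auto simp: m_def)
        finally show ?thesis using abs_Im_le_cmod[of \<zeta>] by (simp add: Z_def)
      qed
      ultimately show "e ^ k \<le> exp Z" "exp (- Z) \<le> e ^ k" unfolding abs_le_iff by (simp_all only: exp_le_cancel_iff) linarith
    qed
    have each: "wt (K n) i * (cmod (cd.Ker (node lam (K n) i) t))\<^sup>2 \<le> m * (A\<^sup>2 / a * (\<Delta> n)\<^sup>2) * (1 / (cmod (\<zeta> - of_real (lam i)))\<^sup>2)" if i: "i \<in> J (K n)" for i
    proof -
      define d where "d = cmod (\<zeta> - of_real (lam i))"
      have d0: "d > 0" using \<zeta>[of i] by (simp add: d_def)
      have den: "exp (- Z) * d / (2 * m) \<le> cmod (1 - node lam (K n) i * cnj t)"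
        using denominator_bound[OF i elim(1)] by (simp add: Z_def d_def m_def t_def)
      have dp: "exp (- Z) * d / (2 * m) > 0" using d0 m1 by simp
      have ne: "node lam (K n) i * cnj t \<noteq> 1" using den dp by auto
      have "cmod (poly (cd.P (M n)) (node lam (K n) i)) = cmod (etaN (of_real (lam i)) n (M n))"
        using cd.P_eta[of "M n" "of_real (lam i)"] unfolding ee_sq by (simp add: mK cd.ee_real_norm)
      then have P: "cmod (poly (cd.P (M n)) (node lam (K n) i)) \<le> exp (sqrt C)" using eta_real_le[of "M n" n "lam i"] by simp
      have Nm: "cd.N (M n) \<ge> 1/2" using NK_between(1)[of "M n" n] elim(2) by simp
      have "cmod (cd.Ker (node lam (K n) i) t) = cmod (poly (cd.P (M n)) (node lam (K n) i)) * e ^ M n * \<Delta> n / (cd.N (M n) * cmod (1 - node lam (K n) i * cnj t))"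
        using cd.Ker_node[OF i node_0 ne[unfolded t_def]] by (simp add: mK t_def \<Delta>_def e_def)
      also have "\<dots> \<le> exp (sqrt C) * exp Z * \<Delta> n / (1/2 * (exp (- Z) * d / (2 * m)))"
        using P ek(1)[of "M n"] Nm den dp by (intro frac_le mult_mono mult_nonneg_nonneg mult_pos_pos) (auto simp: \<Delta>_def e_def)
      also have "\<dots> = A * \<Delta> n * m / d" using d0 m1 by (simp add: A_def exp_minus field_simps)
      finally have ker: "cmod (cd.Ker (node lam (K n) i) t) \<le> A * \<Delta> n * m / d" .
      have "wt (K n) i \<le> 1 / (m * a)" unfolding wt_def using ab(1) ab(2)[of i] m1 by (intro divide_left_mono mult_mono) (auto simp: m_def)
      then have "wt (K n) i * (cmod (cd.Ker (node lam (K n) i) t))\<^sup>2 \<le> 1 / (m * a) * (A * \<Delta> n * m / d)\<^sup>2"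
        using ker ab(1) m1 by (intro mult_mono power_mono) auto
      also have "\<dots> = m * (A\<^sup>2 / a * (\<Delta> n)\<^sup>2) * (1 / d\<^sup>2)" using m1 by (simp add: power2_eq_square)
      finally show ?thesis by (simp only: d_def)
    qed
    have "(\<Sum>k<Suc (M n). (cmod (etaN \<zeta> n k))\<^sup>2 / NK n k) \<le> (\<Sum>k<Suc (M n). exp (2 * Z) * ((cmod (poly (cd.P k) t))\<^sup>2 / NK n k))"
    proof (rule sum_mono)
      fix k assume "k \<in> {..<Suc (M n)}"
      then have k: "k \<le> M n" by auto
      have "cmod (etaN \<zeta> n k) = exp Z * (cmod (etaN \<zeta> n k) * exp (- Z))" by (simp add: exp_minus)
      also have "\<dots> \<le> exp Z * (cmod (etaN \<zeta> n k) * e ^ k)" using ek(2)[OF k] by (intro mult_left_mono) auto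
      also have "\<dots> = exp Z * cmod (poly (cd.P k) t)" using cd.P_eta[of k \<zeta>] k by (simp add: mK t_def e_def)
      finally have "(cmod (etaN \<zeta> n k))\<^sup>2 \<le> (exp Z * cmod (poly (cd.P k) t))\<^sup>2" by (intro power_mono) auto
      then have "(cmod (etaN \<zeta> n k))\<^sup>2 \<le> exp (2 * Z) * (cmod (poly (cd.P k) t))\<^sup>2" by (simp add: power_mult_distrib exp_double)
      then show "(cmod (etaN \<zeta> n k))\<^sup>2 / NK n k \<le> exp (2 * Z) * ((cmod (poly (cd.P k) t))\<^sup>2 / NK n k)"
        using divide_right_mono[of _ _ "NK n k"] NK_between(3)[OF k] by (simp add: less_imp_le)
    qed
    also have "\<dots> = exp (2 * Z) * (\<Sum>k<cd.m. (cmod (poly (cd.P k) t))\<^sup>2 / cd.N k)" unfolding mK by (simp only: sum_distrib_left)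
    also have "\<dots> = exp (2 * Z) * (\<Sum>i\<in>J (K n). wt (K n) i * (cmod (cd.Ker (node lam (K n) i) t))\<^sup>2)" by (simp only: cd.Ker_parseval)
    also have "\<dots> \<le> exp (2 * Z) * (\<Sum>i\<in>J (K n). m * (A\<^sup>2 / a * (\<Delta> n)\<^sup>2) * (1 / (cmod (\<zeta> - of_real (lam i)))\<^sup>2))"
      using each by (intro mult_left_mono sum_mono) auto
    also have "\<dots> = exp (2 * Z) * (m * (A\<^sup>2 / a * (\<Delta> n)\<^sup>2) * (\<Sum>i\<in>J (K n). 1 / (cmod (\<zeta> - of_real (lam i)))\<^sup>2))" by (simp only: sum_distrib_left)
    also have "\<dots> \<le> exp (2 * Z) * (m * (A\<^sup>2 / a * (\<Delta> n)\<^sup>2) * S)"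
      using S m1 ab(1) by (intro mult_left_mono) auto
    finally have "(\<Sum>k<Suc (M n). (cmod (etaN \<zeta> n k))\<^sup>2 / NK n k) / real (M n) \<le> exp (2 * Z) * (m * (A\<^sup>2 / a * (\<Delta> n)\<^sup>2) * S) / real (M n)"
      by (rule divide_right_mono) simp
    then show ?case by (simp add: Q_def m_def mult_ac)
  qed
  from tendsto_le[OF sequentially_bot Q0 energy_limit this] energy_pos[of \<zeta>] show False by simp
qed

end


section \<open>Integration, absolute continuity and square integrability on the unit
  interval\<close>

lemma absolutely_integrable_sub:
  fixes f :: "real \<Rightarrow> 'a::euclidean_space"
  assumes "f absolutely_integrable_on {0..1}" "x \<in> {0..1::real}"
  shows "f integrable_on {0..x}"
proof -
  have "f integrable_on {0..1}" using assms set_lebesgue_integral_eq_integral by blast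
  then show ?thesis using assms by (intro integrable_on_subinterval) auto
qed

lemma absolutely_integrable_unit:
  fixes f :: "real \<Rightarrow> 'a::euclidean_space"
  assumes "f absolutely_integrable_on {0..1}"
  shows "integrable unit_leb f" "(LINT t|unit_leb. f t) = integral {0..1} f"
proof -
  have "f absolutely_integrable_on {0<..<1}" by (rule set_integrable_subset[OF assms]) auto
  then show i: "integrable unit_leb f" by (rule absolutely_integrable_imp_integrable) auto
  show "(LINT t|unit_leb. f t) = integral {0..1} f"
    using lebesgue_integral_eq_integral[OF i] by (simp add: integral_open_interval_real)
qed

lemma integrable_unit_absolutely:
  fixes f :: "real \<Rightarrow> real"
  assumes "integrable unit_leb f" "\<And>t. f t \<ge> 0"
  shows "f absolutely_integrable_on {0..1}"
proof -
  have "f integrable_on {0<..<1}" using integrable_on_lebesgue_on[OF assms(1)] by simp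
  then have "f integrable_on {0..1}" by (simp only: integrable_on_open_interval_real)
  then show ?thesis by (rule nonnegative_absolutely_integrable_1) (rule assms(2))
qed

lemma AE_unit_negligible:
  assumes "AE t in unit_leb. Q t"
  obtains S where "negligible S" "\<And>t. t \<in> {0..1} - S \<Longrightarrow> Q t" "0 \<in> S" "1 \<in> S"
proof -
  from assms obtain N where N: "{t \<in> space unit_leb. \<not> Q t} \<subseteq> N" "N \<in> sets unit_leb" "emeasure unit_leb N = 0" by (rule AE_E)
  have sub: "N \<subseteq> {0<..<1}" "N \<in> sets lebesgue" using N(2) by (auto simp: sets_restrict_space)
  then have "N \<in> null_sets lebesgue" using N(3) by (simp add: null_sets_def emeasure_restrict_space)
  then have n: "negligible N" by (simp add: negligible_iff_null_sets)
  show thesis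
  proof (rule that[of "insert 0 (insert 1 N)"])
    fix t :: real assume "t \<in> {0..1} - insert 0 (insert 1 N)"
    then have "t \<in> {0<..<1}" "t \<notin> N" by auto
    then show "Q t" using N(1) by auto
  qed (use n in auto)
qed

text \<open>The integrand \<open>f\<close> is left free up to almost everywhere equality, so that
  explicit formulas for derivatives can be inserted in place of
  \<open>vector_derivative\<close>.\<close>

lemma abs_cont_AE:
  assumes y: "abs_cont y"
  shows "AE t in unit_leb. (y has_vector_derivative vector_derivative y (at t)) (at t)"
    and "\<And>f. AE t in unit_leb. vector_derivative y (at t) = f t \<Longrightarrow> f absolutely_integrable_on {0..1}"
    and "\<And>f x. AE t in unit_leb. vector_derivative y (at t) = f t \<Longrightarrow> x \<in> {0..1} \<Longrightarrow> (f has_integral (y x - y 0)) {0..x}"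
    and "continuous_on {0..1} y"
proof -
  obtain g where g: "g absolutely_integrable_on {0..1}" "\<And>x. x \<in> {0..1} \<Longrightarrow> (g has_integral (y x - y 0)) {0..x}"
    by (rule abs_cont_ftc[OF y]) (rule that; assumption)
  have gi: "g integrable_on {0..1}" using g(1) set_lebesgue_integral_eq_integral by blast
  have yx: "y x = y 0 + integral {0..x} g" if "x \<in> {0..1}" for x using integral_unique[OF g(2)[OF that]] by simp
  have "continuous_on {0..1} (\<lambda>x. y 0 + integral {0..x} g)" by (intro continuous_intros indefinite_integral_continuous_1 gi)
  then show "continuous_on {0..1} y" by (subst continuous_on_cong[OF refl yx]) auto
  have d: "AE t in unit_leb. (y has_vector_derivative g t) (at t)"
    using integral_has_vector_derivative_AE[OF gi] AE_space
  proof eventually_elim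
    case (elim t)
    have "((\<lambda>x. y 0 + integral {0..x} g) has_vector_derivative 0 + g t) (at t)"
      by (intro has_vector_derivative_add has_vector_derivative_const elim)
    then have "((\<lambda>x. y 0 + integral {0..x} g) has_vector_derivative g t) (at t)" by simp
    then show ?case
    proof (rule has_vector_derivative_transform_within_open[of _ _ _ "{0<..<1}"])
      show "t \<in> {0<..<1}" using elim(2) by simp
      show "y 0 + integral {0..x} g = y x" if "x \<in> {0<..<1}" for x using yx[of x] that by simp
    qed simp
  qed
  then show "AE t in unit_leb. (y has_vector_derivative vector_derivative y (at t)) (at t)"
    by eventually_elim (simp add: vector_derivative_at)
  have neg: "\<exists>S. negligible S \<and> (\<forall>t\<in>{0..1} - S. f t = g t)" if f: "AE t in unit_leb. vector_derivative y (at t) = f t" for f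
  proof -
    have "AE t in unit_leb. f t = g t" using f d by eventually_elim (simp add: vector_derivative_at)
    then show ?thesis by (rule AE_unit_negligible) blast
  qed
  show "f absolutely_integrable_on {0..1}" if f: "AE t in unit_leb. vector_derivative y (at t) = f t" for f
    using neg[OF f] absolutely_integrable_spike[OF g(1)] by blast
  show "(f has_integral (y x - y 0)) {0..x}" if f: "AE t in unit_leb. vector_derivative y (at t) = f t" and x: "x \<in> {0..1}" for f x
  proof -
    obtain S where S: "negligible S" "\<And>t. t \<in> {0..1} - S \<Longrightarrow> f t = g t" using neg[OF f] by blast
    show ?thesis by (rule has_integral_spike[OF S(1) _ g(2)[OF x]]) (use S(2) x in auto)
  qed
qed

lemma abs_cont_const: "abs_cont (\<lambda>x. c)"
  by (rule abs_cont_integral[of "\<lambda>x. 0" _ c]) auto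

lemma integral_abs_cont:
  fixes f :: "real \<Rightarrow> complex"
  assumes f: "f absolutely_integrable_on {0..1}" and y: "\<And>x. x \<in> {0..1} \<Longrightarrow> y x = c + integral {0..x} f"
  shows "abs_cont y" "AE t in unit_leb. (y has_vector_derivative f t) (at t)"
proof -
  show "abs_cont y" by (rule abs_cont_integral[OF f y])
  have fi: "f integrable_on {0..1}" using f set_lebesgue_integral_eq_integral by blast
  show "AE t in unit_leb. (y has_vector_derivative f t) (at t)"
    using integral_has_vector_derivative_AE[OF fi] AE_space
  proof eventually_elim
    case (elim t)
    have "((\<lambda>x. c + integral {0..x} f) has_vector_derivative 0 + f t) (at t)"
      by (intro has_vector_derivative_add has_vector_derivative_const elim)
    then have "((\<lambda>x. c + integral {0..x} f) has_vector_derivative f t) (at t)" by simp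
    then show ?case
    proof (rule has_vector_derivative_transform_within_open[of _ _ _ "{0<..<1}"])
      show "t \<in> {0<..<1}" using elim(2) by simp
      show "c + integral {0..x} f = y x" if "x \<in> {0<..<1}" for x using y[of x] that by simp
    qed simp
  qed
qed

lemma abs_cont_dominated:
  assumes f: "abs_cont f" and g: "abs_cont g" and A: "A > 0" 
    and le: "\<And>a b. 0 \<le> a \<Longrightarrow> a < b \<Longrightarrow> b \<le> 1 \<Longrightarrow> norm (y b - y a) \<le> A * (norm (f b - f a) + norm (g b - g a))"
  shows "abs_cont y"
  unfolding abs_cont_def
proof (intro allI impI)
  fix e :: real assume e: "e > 0"
  then have e2: "e / (2 * A) > 0" using A by simp
  obtain d1 where d1: "d1 > 0" "\<And>D :: (real \<times> real) set. finite D \<Longrightarrow> (\<forall>(a, b)\<in>D. 0 \<le> a \<and> a < b \<and> b \<le> 1) \<Longrightarrow>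
     disjoint_family_on (\<lambda>(a, b). {a<..<b}) D \<Longrightarrow> (\<Sum>(a, b)\<in>D. b - a) < d1 \<Longrightarrow> (\<Sum>(a, b)\<in>D. norm (f b - f a)) < e / (2 * A)"
    using f[unfolded abs_cont_def, rule_format, OF e2] by auto
  obtain d2 where d2: "d2 > 0" "\<And>D :: (real \<times> real) set. finite D \<Longrightarrow> (\<forall>(a, b)\<in>D. 0 \<le> a \<and> a < b \<and> b \<le> 1) \<Longrightarrow>
     disjoint_family_on (\<lambda>(a, b). {a<..<b}) D \<Longrightarrow> (\<Sum>(a, b)\<in>D. b - a) < d2 \<Longrightarrow> (\<Sum>(a, b)\<in>D. norm (g b - g a)) < e / (2 * A)"
    using g[unfolded abs_cont_def, rule_format, OF e2] by auto
  show "\<exists>\<delta>>0. \<forall>D :: (real \<times> real) set. finite D \<longrightarrow> (\<forall>(a, b)\<in>D. 0 \<le> a \<and> a < b \<and> b \<le> 1) \<longrightarrow>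
     disjoint_family_on (\<lambda>(a, b). {a<..<b}) D \<longrightarrow> (\<Sum>(a, b)\<in>D. b - a) < \<delta> \<longrightarrow> (\<Sum>(a, b)\<in>D. norm (y b - y a)) < e"
  proof (intro exI[of _ "min d1 d2"] conjI allI impI)
    show "min d1 d2 > 0" using d1(1) d2(1) by simp
    fix D :: "(real \<times> real) set"
    assume D: "finite D" "\<forall>(a, b)\<in>D. 0 \<le> a \<and> a < b \<and> b \<le> 1" "disjoint_family_on (\<lambda>(a, b). {a<..<b}) D" "(\<Sum>(a, b)\<in>D. b - a) < min d1 d2"
    have "(\<Sum>(a, b)\<in>D. norm (y b - y a)) \<le> (\<Sum>(a, b)\<in>D. A * norm (f b - f a) + A * norm (g b - g a))"
      using D(2) le by (intro sum_mono) (auto simp: distrib_left)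
    also have "\<dots> = A * ((\<Sum>(a, b)\<in>D. norm (f b - f a)) + (\<Sum>(a, b)\<in>D. norm (g b - g a)))"
      by (simp add: case_prod_unfold sum.distrib sum_distrib_left distrib_left)
    also have "\<dots> < A * (e / (2 * A) + e / (2 * A))"
      using d1(2)[OF D(1-3)] d2(2)[OF D(1-3)] D(4) A by (intro mult_strict_left_mono add_strict_mono) auto
    also have "\<dots> = e" using A by (simp add: field_simps)
    finally show "(\<Sum>(a, b)\<in>D. norm (y b - y a)) < e" .
  qed
qed

lemma abs_cont_mult:
  assumes f: "abs_cont f" and g: "abs_cont g"
  shows "abs_cont (\<lambda>x. f x * g x)"
proof -
  have "bounded (f ` {0..1})" "bounded (g ` {0..1})"
    by (intro compact_imp_bounded compact_continuous_image abs_cont_AE(4) f g; simp)+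
  then obtain A B where A: "A > 0" "\<And>x. x \<in> {0..1} \<Longrightarrow> norm (f x) \<le> A" and B: "B > 0" "\<And>x. x \<in> {0..1} \<Longrightarrow> norm (g x) \<le> B"
    unfolding bounded_pos by blast
  show ?thesis
  proof (rule abs_cont_dominated[OF f g, of "A + B"])
    fix a b :: real assume ab: "0 \<le> a" "a < b" "b \<le> 1"
    have "f b * g b - f a * g a = (f b - f a) * g b + f a * (g b - g a)" by (simp add: algebra_simps)
    also have "norm \<dots> \<le> norm (f b - f a) * norm (g b) + norm (f a) * norm (g b - g a)"
      using norm_triangle_ineq[of "(f b - f a) * g b" "f a * (g b - g a)"] by (simp add: norm_mult)
    also have "\<dots> \<le> norm (f b - f a) * (A + B) + (A + B) * norm (g b - g a)"
      using A(2)[of a] B(2)[of b] A(1) B(1) ab by (intro add_mono mult_left_mono mult_right_mono) auto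
    finally show "norm (f b * g b - f a * g a) \<le> (A + B) * (norm (f b - f a) + norm (g b - g a))" by (simp add: algebra_simps)
  qed (use A B in simp)
qed

lemma abs_cont_add:
  assumes f: "abs_cont f" and g: "abs_cont g"
  shows "abs_cont (\<lambda>x. f x + g x)"
proof (rule abs_cont_dominated[OF f g, of 1])
  fix a b :: real
  show "norm (f b + g b - (f a + g a)) \<le> 1 * (norm (f b - f a) + norm (g b - g a))"
    using norm_triangle_ineq[of "f b - f a" "g b - g a"] by (simp add: algebra_simps)
qed simp

lemma abs_cont_diff:
  assumes f: "abs_cont f" and g: "abs_cont g"
  shows "abs_cont (\<lambda>x. f x - g x)"
proof -
  have "(\<lambda>x. f x - g x) = (\<lambda>x. f x + (- 1) * g x)" by (rule ext) simp
  then show ?thesis using abs_cont_add[OF f abs_cont_mult[OF abs_cont_const[of "-1"] g]] by (simp only:)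
qed

lemma abs_cont_cnj: assumes "abs_cont f" shows "abs_cont (\<lambda>x. cnj (f x))"
  by (rule abs_cont_dominated[OF assms assms, of 1]) (simp_all add: complex_cnj_diff[symmetric] del: complex_cnj_diff)

lemma AE_eq_continuous:
  fixes f g :: "real \<Rightarrow> complex"
  assumes c: "continuous_on {0..1} f" "continuous_on {0..1} g" and ae: "AE t in unit_leb. f t = g t" and x: "x \<in> {0..1}"
  shows "f x = g x"
proof -
  let ?h = "\<lambda>t. cmod (f t - g t)"
  have ch: "continuous_on {0..1} ?h" by (intro continuous_intros c)
  obtain S where S: "negligible S" "\<And>t. t \<in> {0..1} - S \<Longrightarrow> f t = g t" using AE_unit_negligible[OF ae] by metis
  have "(?h has_integral 0) {0..1}" by (rule has_integral_spike[OF S(1) _ has_integral_0]) (use S(2) in auto)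
  then have "\<forall>t\<in>{0..1}. ?h t = 0" using integral_eq_0_iff[OF ch] by (auto simp: integral_unique)
  then show ?thesis using x by simp
qed

lemma volterra_zero:
  fixes f :: "real \<Rightarrow> complex" and \<kappa> :: "real \<Rightarrow> real"
  assumes c: "continuous_on {0..1} f" and \<kappa>: "\<kappa> absolutely_integrable_on {0..1}"
    and eq: "\<And>x. x \<in> {0..1} \<Longrightarrow> ((\<lambda>t. of_real (\<kappa> t) * f t) has_integral f x) {0..x}" and x: "x \<in> {0..1}"
  shows "f x = 0"
proof -
  have cn: "continuous_on {0..1} (\<lambda>t. cmod (f t))" by (intro continuous_intros c)
  have ka: "(\<lambda>t. \<bar>\<kappa> t\<bar>) absolutely_integrable_on {0..1}" using absolutely_integrable_norm[OF \<kappa>] by (simp add: o_def)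
  have kf: "(\<lambda>t. \<bar>\<kappa> t\<bar> * cmod (f t)) absolutely_integrable_on {0..1}"
    using absolutely_integrable_norm[OF absolutely_integrable_comm_times[OF \<kappa> c]] by (simp add: o_def norm_mult)
  have "cmod (f x) = 0"
  proof (rule gronwall_zero[OF cn _ ka _ _ x])
    fix x :: real assume x: "x \<in> {0..1}"
    have "cmod (integral {0..x} (\<lambda>t. of_real (\<kappa> t) * f t)) \<le> integral {0..x} (\<lambda>t. \<bar>\<kappa> t\<bar> * cmod (f t))"
      using eq[OF x] absolutely_integrable_sub[OF kf x]
      by (intro Henstock_Kurzweil_Integration.integral_norm_bound_integral) (auto simp: norm_mult)
    then show "cmod (f x) \<le> integral {0..x} (\<lambda>t. \<bar>\<kappa> t\<bar> * cmod (f t))" using integral_unique[OF eq[OF x]] by simp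
  qed auto
  then show ?thesis by simp
qed

lemma L2_continuous:
  fixes f :: "real \<Rightarrow> 'a::euclidean_space"
  assumes c: "continuous_on {0..1} f" shows "L2 f"
proof -
  have c2: "continuous_on {0<..<1} f" by (rule continuous_on_subset[OF c]) auto
  have "(\<lambda>t. (norm (f t))\<^sup>2) absolutely_integrable_on {0..1}" by (intro absolutely_integrable_continuous_real continuous_intros c)
  then show ?thesis unfolding L2_def
    using absolutely_integrable_unit(1) continuous_imp_measurable_on_sets_lebesgue[OF c2] by auto
qed

lemma L2_add:
  fixes f g :: "real \<Rightarrow> 'a::euclidean_space"
  assumes f: "L2 f" and g: "L2 g" shows "L2 (\<lambda>t. f t + g t)"
  unfolding L2_def
proof
  have m: "f \<in> borel_measurable unit_leb" "g \<in> borel_measurable unit_leb" using f g by (auto simp: L2_def)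
  then show fg: "(\<lambda>t. f t + g t) \<in> borel_measurable unit_leb" by measurable
  have "integrable unit_leb (\<lambda>t. 2 * (norm (f t))\<^sup>2 + 2 * (norm (g t))\<^sup>2)" using f g by (simp add: L2_def)
  then show "integrable unit_leb (\<lambda>t. (norm (f t + g t))\<^sup>2)"
  proof (rule Bochner_Integration.integrable_bound)
    show "(\<lambda>t. (norm (f t + g t))\<^sup>2) \<in> borel_measurable unit_leb" using fg by measurable
    have "(norm (f t + g t))\<^sup>2 \<le> 2 * (norm (f t))\<^sup>2 + 2 * (norm (g t))\<^sup>2" for t
    proof -
      have "(norm (f t + g t))\<^sup>2 \<le> (norm (f t) + norm (g t))\<^sup>2" by (intro power_mono norm_triangle_ineq) auto
      also have "\<dots> \<le> 2 * (norm (f t))\<^sup>2 + 2 * (norm (g t))\<^sup>2"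
        using sum_squares_bound[of "norm (f t)" "norm (g t)"] by (simp add: power2_sum)
      finally show ?thesis .
    qed
    then show "AE t in unit_leb. norm ((norm (f t + g t))\<^sup>2) \<le> norm (2 * (norm (f t))\<^sup>2 + 2 * (norm (g t))\<^sup>2)"
      by (intro AE_I2) (auto intro!: order_trans[OF _ abs_ge_self])
  qed
qed

lemma L2_times_continuous:
  fixes f :: "real \<Rightarrow> real" and F :: "real \<Rightarrow> complex"
  assumes f: "L2 f" and c: "continuous_on {0..1} F" shows "L2 (\<lambda>t. of_real (f t) * F t)"
  unfolding L2_def
proof
  have "bounded (F ` {0..1})" by (intro compact_imp_bounded compact_continuous_image c; simp)
  then obtain B where B: "B > 0" "\<And>x. x \<in> {0..1} \<Longrightarrow> norm (F x) \<le> B" unfolding bounded_pos by blast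
  have m: "f \<in> borel_measurable unit_leb" "F \<in> borel_measurable unit_leb" using f L2_continuous[OF c] by (auto simp: L2_def)
  then show fF: "(\<lambda>t. of_real (f t) * F t) \<in> borel_measurable unit_leb" by measurable
  have "integrable unit_leb (\<lambda>t. B\<^sup>2 * (norm (f t))\<^sup>2)" using f by (simp add: L2_def)
  then show "integrable unit_leb (\<lambda>t. (norm (of_real (f t) * F t))\<^sup>2)"
  proof (rule Bochner_Integration.integrable_bound)
    show "(\<lambda>t. (norm (of_real (f t) * F t))\<^sup>2) \<in> borel_measurable unit_leb" using fF by measurable
    show "AE t in unit_leb. norm ((norm (of_real (f t) * F t))\<^sup>2) \<le> norm (B\<^sup>2 * (norm (f t))\<^sup>2)"
      using AE_space
    proof eventually_elim
      case (elim t)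
      then have "(norm (F t))\<^sup>2 \<le> B\<^sup>2" using B(2)[of t] by (intro power_mono) auto
      then have "(norm (F t))\<^sup>2 * (f t)\<^sup>2 \<le> B\<^sup>2 * (f t)\<^sup>2" by (rule mult_right_mono) simp
      then show ?case by (simp add: norm_mult power_mult_distrib mult.commute)
    qed
  qed
qed

lemma L2_cong_AE:
  fixes f g :: "real \<Rightarrow> complex"
  assumes f: "L2 f" and ae: "AE t in unit_leb. f t = g t" shows "L2 g"
proof -
  obtain S where S: "negligible S" "\<And>t. t \<in> {0..1} - S \<Longrightarrow> f t = g t" using AE_unit_negligible[OF ae] by metis
  have f1: "f \<in> borel_measurable unit_leb" "integrable unit_leb (\<lambda>t. (norm (f t))\<^sup>2)" using f by (auto simp: L2_def)
  have "f measurable_on {0<..<1}" using f1(1) by (simp add: measurable_on_iff_borel_measurable)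
  then have "g measurable_on {0<..<1}" by (rule measurable_on_spike[OF _ S(1)]) (use S(2) in auto)
  then have gm: "g \<in> borel_measurable unit_leb" by (simp add: measurable_on_iff_borel_measurable)
  have "integrable unit_leb (\<lambda>t. (norm (g t))\<^sup>2)"
    by (rule integrable_cong_AE_imp[OF f1(2)]) (use gm ae in \<open>auto elim: eventually_mono\<close>)
  then show ?thesis using gm by (simp add: L2_def)
qed

section \<open>The factorized Sturm-Liouville operator\<close>

locale dirac_potential =
  fixes \<tau> p :: "real \<Rightarrow> real"
  assumes \<tau>_L2: "L2 \<tau>" and \<tau>_int: "\<tau> absolutely_integrable_on {0..1}" and p_L2: "L2 p" and p_int: "p absolutely_integrable_on {0..1}"
begin

text \<open>With this choice \<open>r' = \<tau>' + \<tau>\<^sup>2\<close>, so that \<open>- y'' + q y = - (d/dx + \<tau>) (d/dx - \<tau>) y\<close>.\<close>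

definition T :: "real \<Rightarrow> real" where "T x = integral {0..x} (\<lambda>t. (\<tau> t)\<^sup>2)"
definition r :: "real \<Rightarrow> real" where "r t = \<tau> t + T t"

lemma \<tau>_sq: "(\<lambda>t. (\<tau> t)\<^sup>2) absolutely_integrable_on {0..1}"
  using \<tau>_L2 by (intro integrable_unit_absolutely) (auto simp: L2_def)

lemma T_cont: "continuous_on {0..1} T"
  unfolding T_def using \<tau>_sq set_lebesgue_integral_eq_integral by (intro indefinite_integral_continuous_1) blast

lemma T_ac: "abs_cont (\<lambda>x. complex_of_real (T x))"
  and T_derivative: "AE t in unit_leb. ((\<lambda>x. complex_of_real (T x)) has_vector_derivative of_real ((\<tau> t)\<^sup>2)) (at t)"
proof -
  have i: "(\<lambda>t. complex_of_real ((\<tau> t)\<^sup>2)) absolutely_integrable_on {0..1}" by (rule absolutely_integrable_of_real[OF \<tau>_sq])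
  have e: "complex_of_real (T x) = 0 + integral {0..x} (\<lambda>t. complex_of_real ((\<tau> t)\<^sup>2))" if "x \<in> {0..1}" for x
    unfolding T_def add_0
    by (rule integral_unique[OF has_integral_of_real[OF integrable_integral[OF absolutely_integrable_sub[OF \<tau>_sq that]]], symmetric])
  show "abs_cont (\<lambda>x. complex_of_real (T x))" by (rule integral_abs_cont(1)[OF i e])
  show "AE t in unit_leb. ((\<lambda>x. complex_of_real (T x)) has_vector_derivative of_real ((\<tau> t)\<^sup>2)) (at t)"
    by (rule integral_abs_cont(2)[OF i e])
qed

lemma r_L2: "L2 r"
  unfolding r_def using L2_add[OF \<tau>_L2 L2_continuous[OF T_cont]] .

text \<open>This is the absolutely continuous representative of \<open>y' - \<tau> y\<close>.\<close>

definition vq :: "(real \<Rightarrow> complex) \<Rightarrow> real \<Rightarrow> complex" where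
  "vq y x = quasi_deriv r y x + of_real (T x) * y x"

text \<open>Insert \<open>y^[1] = vq y - T y\<close> and \<open>r = \<tau> + T\<close>: with
  \<open>T' = \<tau>^2\<close> the terms containing \<open>T\<close> and those quadratic in
  \<open>\<tau>\<close> cancel, and \<open>ell r y = - (vq y)' - \<tau> vq y\<close>
  remains.\<close>

lemma quasi_system:
  assumes y: "abs_cont y" and u: "is_quasi_deriv r y u"
  shows "is_quasi_deriv r y (quasi_deriv r y)" and "abs_cont (vq y)"
    and "AE t in unit_leb. (y has_vector_derivative (vq y t + of_real (\<tau> t) * y t)) (at t)"
    and "AE t in unit_leb. (vq y has_vector_derivative (- ell r y t - of_real (\<tau> t) * vq y t)) (at t)"
proof -
  show q: "is_quasi_deriv r y (quasi_deriv r y)" using someI[of "is_quasi_deriv r y", OF u] unfolding quasi_deriv_def .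
  then have qa: "abs_cont (quasi_deriv r y)" and qe: "AE t in unit_leb. quasi_deriv r y t = vector_derivative y (at t) - of_real (r t) * y t"
    by (auto simp: is_quasi_deriv_def L2_eq_def)
  show "abs_cont (vq y)" unfolding vq_def by (intro abs_cont_add abs_cont_mult qa T_ac y)
  show d: "AE t in unit_leb. (y has_vector_derivative (vq y t + of_real (\<tau> t) * y t)) (at t)"
    using abs_cont_AE(1)[OF y] qe
  proof eventually_elim
    case (elim t)
    have "vector_derivative y (at t) = vq y t + of_real (\<tau> t) * y t" using elim(2) by (simp add: vq_def r_def algebra_simps)
    then show ?case using elim(1) by simp
  qed
  show "AE t in unit_leb. (vq y has_vector_derivative (- ell r y t - of_real (\<tau> t) * vq y t)) (at t)"
    using d abs_cont_AE(1)[OF qa] T_derivative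
  proof eventually_elim
    case (elim t)
    have "(vq y has_vector_derivative (vector_derivative (quasi_deriv r y) (at t) + 
      (of_real (T t) * (vq y t + of_real (\<tau> t) * y t) + of_real ((\<tau> t)\<^sup>2) * y t))) (at t)"
      unfolding vq_def[abs_def] by (intro has_vector_derivative_add has_vector_derivative_mult elim[unfolded vq_def])
    moreover have "vector_derivative (quasi_deriv r y) (at t) + (of_real (T t) * (vq y t + of_real (\<tau> t) * y t) + of_real ((\<tau> t)\<^sup>2) * y t)
      = - ell r y t - of_real (\<tau> t) * vq y t"
      by (simp add: ell_def vq_def r_def power2_eq_square algebra_simps)
    ultimately show ?case by simp
  qed
qed

text \<open>The converse of \<open>quasi_system\<close>. The quasi-derivative is selected by choice,
  but continuous functions equal almost everywhere agree on the closed interval, so there it must be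
  \<open>v - T y\<close>.\<close>

lemma system_quasi:
  assumes y: "abs_cont y" and v: "abs_cont v" and dy: "AE t in unit_leb. (y has_vector_derivative (v t + of_real (\<tau> t) * y t)) (at t)"
    and dv: "AE t in unit_leb. (v has_vector_derivative g t) (at t)"
  shows "is_quasi_deriv r y (\<lambda>x. v x - of_real (T x) * y x)" and "\<And>x. x \<in> {0..1} \<Longrightarrow> vq y x = v x"
    and "AE t in unit_leb. ell r y t = - g t - of_real (\<tau> t) * v t"
proof -
  have ac: "abs_cont (\<lambda>x. v x - of_real (T x) * y x)" by (intro abs_cont_diff abs_cont_mult T_ac y v)
  have ae: "AE t in unit_leb. v t - of_real (T t) * y t = vector_derivative y (at t) - of_real (r t) * y t"
    using dy by eventually_elim (simp add: vector_derivative_at r_def algebra_simps)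
  show q: "is_quasi_deriv r y (\<lambda>x. v x - of_real (T x) * y x)" using ac ae by (simp add: is_quasi_deriv_def L2_eq_def)
  note S = quasi_system[OF y q]
  have qa: "abs_cont (quasi_deriv r y)" and qe: "AE t in unit_leb. quasi_deriv r y t = vector_derivative y (at t) - of_real (r t) * y t"
    using S(1) by (auto simp: is_quasi_deriv_def L2_eq_def)
  show e: "vq y x = v x" if x: "x \<in> {0..1}" for x
  proof -
    have "AE t in unit_leb. quasi_deriv r y t = v t - of_real (T t) * y t" using qe ae by eventually_elim simp
    from AE_eq_continuous[OF abs_cont_AE(4)[OF qa] abs_cont_AE(4)[OF ac] this x] show ?thesis by (simp add: vq_def)
  qed
  show "AE t in unit_leb. ell r y t = - g t - of_real (\<tau> t) * v t"
    using S(4) dv AE_space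
  proof eventually_elim
    case (elim t)
    then have t: "t \<in> {0<..<1}" by simp
    have "(v has_vector_derivative (- ell r y t - of_real (\<tau> t) * vq y t)) (at t)"
      by (rule has_vector_derivative_transform_within_open[OF elim(1) open_greaterThanLessThan t]) (simp add: e)
    then have g: "g t = - ell r y t - of_real (\<tau> t) * vq y t" using elim(2) by (rule vector_derivative_unique_at[symmetric])
    show ?case unfolding g using e[of t] t by simp
  qed
qed

lemma dirac_sol_properties:
  assumes s: "dirac_sol \<tau> p \<zeta> Y U"
  shows "continuous_on {0..1} Y" "continuous_on {0..1} U" "Y 0 = 0" "U 0 = 1" "abs_cont Y" "abs_cont U"
    and "AE t in unit_leb. (Y has_vector_derivative (\<zeta> * U t + of_real (\<tau> t) * Y t)) (at t)"
    and "AE t in unit_leb. (U has_vector_derivative (- \<zeta> * Y t - of_real (\<tau> t) * U t + 2 * of_real (p t) * Y t)) (at t)"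
proof -
  show c: "continuous_on {0..1} Y" "continuous_on {0..1} U" using s by (auto simp: dirac_sol_def)
  show "Y 0 = 0" "U 0 = 1" using s by (auto simp: dirac_sol_def)
  note i = dirac_integrands[OF \<tau>_int p_int c, of \<zeta>]
  have Yx: "Y x = 0 + integral {0..x} (\<lambda>t. \<zeta> * U t + of_real (\<tau> t) * Y t)" if "x \<in> {0..1}" for x using s that by (simp add: dirac_sol_def)
  have Ux: "U x = 1 + integral {0..x} (\<lambda>t. - \<zeta> * Y t - of_real (\<tau> t) * U t + 2 * of_real (p t) * Y t)" if "x \<in> {0..1}" for x using s that by (simp add: dirac_sol_def)
  show "abs_cont Y" by (rule integral_abs_cont(1)[OF i(1) Yx])
  show "AE t in unit_leb. (Y has_vector_derivative (\<zeta> * U t + of_real (\<tau> t) * Y t)) (at t)"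
    by (rule integral_abs_cont(2)[OF i(1) Yx])
  show "abs_cont U" by (rule integral_abs_cont(1)[OF i(2) Ux])
  show "AE t in unit_leb. (U has_vector_derivative (- \<zeta> * Y t - of_real (\<tau> t) * U t + 2 * of_real (p t) * Y t)) (at t)"
    by (rule integral_abs_cont(2)[OF i(2) Ux])
qed

text \<open>\<open>v = \<zeta> U\<close> completes \<open>Y\<close> to the first order system of the
  pencil, and \<open>U 0 = 1\<close> is the normalization. Were \<open>Y\<close> zero, the first
  Dirac equation would give \<open>\<zeta> U = 0\<close> almost everywhere, against
  \<open>U 0 = 1\<close>.\<close>

lemma dirac_sol_eigenfunction:
  assumes s: "dirac_sol \<tau> p \<zeta> Y U" and Y1: "Y 1 = 0" and \<zeta>: "\<zeta> \<noteq> 0"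
  shows "pencil_eigenfunction p r \<zeta> Y" "quasi_deriv r Y 0 = \<zeta>"
proof -
  note P = dirac_sol_properties[OF s]
  define v where "v x = \<zeta> * U x" for x
  have va: "abs_cont v" unfolding v_def by (intro abs_cont_mult abs_cont_const P(6))
  have dY: "AE t in unit_leb. (Y has_vector_derivative (v t + of_real (\<tau> t) * Y t)) (at t)" using P(7) by (simp add: v_def)
  have dv: "AE t in unit_leb. (v has_vector_derivative (\<zeta> * (- \<zeta> * Y t - of_real (\<tau> t) * U t + 2 * of_real (p t) * Y t))) (at t)"
    using P(8) unfolding v_def[abs_def] by eventually_elim (rule has_vector_derivative_mult_right)
  note S = system_quasi[OF P(5) va dY dv]
  have el: "AE t in unit_leb. \<zeta>\<^sup>2 * Y t + of_real (p t) * (- 2 * \<zeta> * Y t) = ell r Y t"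
    using S(3) by eventually_elim (simp add: v_def power2_eq_square algebra_simps)
  have "L2 (\<lambda>t. \<zeta>\<^sup>2 * Y t + of_real (p t) * (- 2 * \<zeta> * Y t))"
    by (intro L2_add L2_continuous L2_times_continuous p_L2 continuous_intros P(1))
  then have "L2 (ell r Y)" using el by (rule L2_cong_AE)
  then have dom: "Y \<in> dom_A r" using P(3,5) S(1) Y1 by (auto simp: dom_A_def dom_ell_def)
  have nz: "\<not> L2_eq Y (\<lambda>t. 0)"
  proof
    assume "L2_eq Y (\<lambda>t. 0)"
    then have Y0: "Y x = 0" if "x \<in> {0..1}" for x
      using AE_eq_continuous[OF P(1), of "\<lambda>t. 0", OF _ _ that] by (simp add: L2_eq_def)
    have "AE t in unit_leb. U t = 0"
      using P(7) AE_space
    proof eventually_elim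
      case (elim t)
      then have t: "t \<in> {0<..<1}" by simp
      have "(Y has_vector_derivative 0) (at t)"
        by (rule has_vector_derivative_transform_within_open[OF has_vector_derivative_const[of 0] open_greaterThanLessThan t]) (simp add: Y0)
      from vector_derivative_unique_at[OF elim(1) this] show ?case using \<zeta> Y0[of t] t by simp
    qed
    then have "U 0 = 0" using AE_eq_continuous[OF P(2), of "\<lambda>t. 0" 0] by simp
    then show False using P(4) by simp
  qed
  have "L2_eq (pencil p r \<zeta> Y) (\<lambda>t. 0)" unfolding L2_eq_def pencil_def using el by eventually_elim (simp add: algebra_simps)
  with dom nz show "pencil_eigenfunction p r \<zeta> Y" by (simp add: pencil_eigenfunction_def)
  show "quasi_deriv r Y 0 = \<zeta>" using S(2)[of 0] P(3,4) by (simp add: vq_def v_def)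
qed

lemma dom_A_system:
  assumes "y \<in> dom_A r"
  shows "abs_cont y" "abs_cont (vq y)" "y 0 = 0" "y 1 = 0" "L2 (ell r y)"
    and "AE t in unit_leb. (y has_vector_derivative (vq y t + of_real (\<tau> t) * y t)) (at t)"
    and "AE t in unit_leb. (vq y has_vector_derivative (- ell r y t - of_real (\<tau> t) * vq y t)) (at t)"
    and "\<And>x. x \<in> {0..1} \<Longrightarrow> ((\<lambda>t. vq y t + of_real (\<tau> t) * y t) has_integral y x) {0..x}"
proof -
  show y: "abs_cont y" "y 0 = 0" "y 1 = 0" "L2 (ell r y)" using assms by (auto simp: dom_A_def dom_ell_def)
  obtain u where u: "is_quasi_deriv r y u" using assms by (auto simp: dom_A_def dom_ell_def)
  show "abs_cont (vq y)" by (rule quasi_system(2)[OF y(1) u])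
  show d: "AE t in unit_leb. (y has_vector_derivative (vq y t + of_real (\<tau> t) * y t)) (at t)" by (rule quasi_system(3)[OF y(1) u])
  show "AE t in unit_leb. (vq y has_vector_derivative (- ell r y t - of_real (\<tau> t) * vq y t)) (at t)" by (rule quasi_system(4)[OF y(1) u])
  have "AE t in unit_leb. vector_derivative y (at t) = vq y t + of_real (\<tau> t) * y t" using d by eventually_elim (rule vector_derivative_at)
  from abs_cont_AE(3)[OF y(1) this] show "((\<lambda>t. vq y t + of_real (\<tau> t) * y t) has_integral y x) {0..x}" if "x \<in> {0..1}" for x
    using that y(2) by simp
qed

text \<open>Here \<open>y' = \<tau> y\<close> with \<open>y 0 = 0\<close>: the first order factor is
  injective under the initial condition.\<close>

lemma vq_zero:
  assumes y: "y \<in> dom_A r" and v: "\<And>x. x \<in> {0..1} \<Longrightarrow> vq y x = 0"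
  shows "L2_eq y (\<lambda>t. 0)"
proof -
  note S = dom_A_system[OF y]
  have "y x = 0" if "x \<in> {0..1}" for x
  proof (rule volterra_zero[OF abs_cont_AE(4)[OF S(1)] \<tau>_int _ that])
    fix x :: real assume x: "x \<in> {0..1}"
    show "((\<lambda>t. of_real (\<tau> t) * y t) has_integral y x) {0..x}"
      by (rule has_integral_eq[OF _ S(8)[OF x]]) (use x v in auto)
  qed
  then show ?thesis unfolding L2_eq_def by (intro AE_I2) auto
qed

lemma eigenfunction_dirac_sol:
  assumes e: "pencil_eigenfunction p r \<zeta> y" and q: "quasi_deriv r y 0 = \<zeta>"
  shows "\<zeta> \<noteq> 0" "\<exists>u. dirac_sol \<tau> p \<zeta> y u" "y 1 = 0"
proof -
  have y: "y \<in> dom_A r" "\<not> L2_eq y (\<lambda>t. 0)" and pe: "AE t in unit_leb. pencil p r \<zeta> y t = 0"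
    using e by (auto simp: pencil_eigenfunction_def L2_eq_def)
  note S = dom_A_system[OF y(1)]
  show "y 1 = 0" by (rule S(4))
  have v0: "vq y 0 = \<zeta>" using q S(3) by (simp add: vq_def)
  have "AE t in unit_leb. vector_derivative (vq y) (at t) = - (\<zeta>\<^sup>2 * y t - 2 * \<zeta> * (of_real (p t) * y t)) - of_real (\<tau> t) * vq y t"
    using S(7) pe
  proof eventually_elim
    case (elim t)
    have "ell r y t = \<zeta>\<^sup>2 * y t - 2 * \<zeta> * (of_real (p t) * y t)" using elim(2) by (simp add: pencil_def)
    then show ?case using vector_derivative_at[OF elim(1)] by simp
  qed
  from abs_cont_AE(3)[OF S(2) this] have vi: "((\<lambda>t. - (\<zeta>\<^sup>2 * y t - 2 * \<zeta> * (of_real (p t) * y t)) - of_real (\<tau> t) * vq y t) has_integral (vq y x - \<zeta>)) {0..x}" if "x \<in> {0..1}" for x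
    using that v0 by simp
  \<comment> \<open>At \<open>\<zeta> = 0\<close> the function \<open>vq y\<close> solves
    \<open>v' = - \<tau> v\<close> with \<open>v 0 = 0\<close>; so it vanishes, and then
    \<open>y\<close> does.\<close>
  show z: "\<zeta> \<noteq> 0"
  proof
    assume z: "\<zeta> = 0"
    have mt: "(\<lambda>t. - \<tau> t) absolutely_integrable_on {0..1}" using set_integrable_mult_right[of "-1" lebesgue "{0..1}" \<tau>] \<tau>_int by simp
    have "vq y x = 0" if "x \<in> {0..1}" for x
      by (rule volterra_zero[OF abs_cont_AE(4)[OF S(2)] mt _ that]) (use vi z in simp)
    then show False using vq_zero[OF y(1)] y(2) by blast
  qed
  have "dirac_sol \<tau> p \<zeta> y (\<lambda>x. vq y x / \<zeta>)"
    unfolding dirac_sol_def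
  proof (intro conjI ballI)
    show "continuous_on {0..1} y" by (rule abs_cont_AE(4)[OF S(1)])
    show "continuous_on {0..1} (\<lambda>x. vq y x / \<zeta>)" by (intro continuous_intros abs_cont_AE(4)[OF S(2)]) (use z in simp)
    fix x :: real assume x: "x \<in> {0..1}"
    show "y x = integral {0..x} (\<lambda>t. \<zeta> * (vq y t / \<zeta>) + of_real (\<tau> t) * y t)"
      using integral_unique[OF S(8)[OF x]] z by simp
    have "((\<lambda>t. (- (\<zeta>\<^sup>2 * y t - 2 * \<zeta> * (of_real (p t) * y t)) - of_real (\<tau> t) * vq y t) / \<zeta>) has_integral ((vq y x - \<zeta>) / \<zeta>)) {0..x}"
      by (rule has_integral_divide[OF vi[OF x]])
    moreover have "(- (\<zeta>\<^sup>2 * y t - 2 * \<zeta> * (of_real (p t) * y t)) - of_real (\<tau> t) * vq y t) / \<zeta>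
      = - \<zeta> * y t - of_real (\<tau> t) * (vq y t / \<zeta>) + 2 * of_real (p t) * y t" for t
      using z by (simp add: field_simps power2_eq_square)
    ultimately have "integral {0..x} (\<lambda>t. - \<zeta> * y t - of_real (\<tau> t) * (vq y t / \<zeta>) + 2 * of_real (p t) * y t) = (vq y x - \<zeta>) / \<zeta>"
      by (simp only: integral_unique)
    then show "vq y x / \<zeta> = 1 + integral {0..x} (\<lambda>t. - \<zeta> * y t - of_real (\<tau> t) * (vq y t / \<zeta>) + 2 * of_real (p t) * y t)"
      using z by (simp add: diff_divide_distrib)
  qed
  then show "\<exists>u. dirac_sol \<tau> p \<zeta> y u" by blast
qed

text \<open>By the factorization \<open>(A y, y) = \<integral> |vq y|^2\<close>: integrate the
  derivative of \<open>vq y * cnj y\<close>, which vanishes at both ends. The value 0 would mean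
  \<open>vq y = 0\<close>.\<close>

lemma positive: "A_positive r"
  unfolding A_positive_def
proof (intro ballI impI)
  fix y assume y: "y \<in> dom_A r" and nz: "\<not> L2_eq y (\<lambda>t. 0)"
  note S = dom_A_system[OF y]
  have cy: "continuous_on {0..1} y" and cv: "continuous_on {0..1} (vq y)" using abs_cont_AE(4) S(1,2) by auto
  have wa: "abs_cont (\<lambda>x. vq y x * cnj (y x))" by (intro abs_cont_mult abs_cont_cnj S)
  have ae: "AE t in unit_leb. vector_derivative (\<lambda>x. vq y x * cnj (y x)) (at t) = of_real ((cmod (vq y t))\<^sup>2) - ell r y t * cnj (y t)"
    using S(6,7)
  proof eventually_elim
    case (elim t)
    have "((\<lambda>x. vq y x * cnj (y x)) has_vector_derivative (vq y t * cnj (vq y t + of_real (\<tau> t) * y t) + (- ell r y t - of_real (\<tau> t) * vq y t) * cnj (y t))) (at t)"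
      by (intro has_vector_derivative_mult has_vector_derivative_cnj elim)
    then show ?case using mult_cnj_norm[of "vq y t"] by (simp add: vector_derivative_at algebra_simps)
  qed
  have c2: "continuous_on {0..1} (\<lambda>t. (cmod (vq y t))\<^sup>2)" by (intro continuous_intros cv)
  define E where "E = integral {0..1} (\<lambda>t. (cmod (vq y t))\<^sup>2)"
  have i1: "(\<lambda>t. complex_of_real ((cmod (vq y t))\<^sup>2)) absolutely_integrable_on {0..1}"
    by (intro absolutely_integrable_of_real absolutely_integrable_continuous_real c2)
  have h1: "((\<lambda>t. complex_of_real ((cmod (vq y t))\<^sup>2)) has_integral of_real E) {0..1}"
    unfolding E_def by (intro has_integral_of_real integrable_integral integrable_continuous_real c2)
  have "(\<lambda>t. of_real ((cmod (vq y t))\<^sup>2) - (of_real ((cmod (vq y t))\<^sup>2) - ell r y t * cnj (y t))) absolutely_integrable_on {0..1}"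
    by (rule set_integral_diff(1)[OF i1 abs_cont_AE(2)[OF wa ae]])
  then have i2: "(\<lambda>t. ell r y t * cnj (y t)) absolutely_integrable_on {0..1}" by simp
  have "((\<lambda>t. of_real ((cmod (vq y t))\<^sup>2) - (of_real ((cmod (vq y t))\<^sup>2) - ell r y t * cnj (y t))) has_integral (of_real E - (vq y 1 * cnj (y 1) - vq y 0 * cnj (y 0)))) {0..1}"
    by (rule has_integral_diff[OF h1 abs_cont_AE(3)[OF wa ae]]) simp
  then have "((\<lambda>t. ell r y t * cnj (y t)) has_integral of_real E) {0..1}" using S(3,4) by simp
  then have ip: "L2_inner (ell r y) y = of_real E"
    unfolding L2_inner_def absolutely_integrable_unit(2)[OF i2] by (rule integral_unique)
  have "E \<ge> 0" unfolding E_def by (intro Henstock_Kurzweil_Integration.integral_nonneg integrable_continuous_real c2) auto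
  moreover have "E \<noteq> 0"
  proof
    assume "E = 0"
    then have "vq y x = 0" if "x \<in> {0..1}" for x using integral_eq_0_iff[OF c2] that by (auto simp: E_def)
    then show False using vq_zero[OF y] nz by blast
  qed
  ultimately show "L2_inner (ell r y) y \<in> \<real> \<and> 0 < Re (L2_inner (ell r y) y)" by (simp add: ip)
qed

text \<open>\<open>(U Y)' = \<zeta> U^2 - \<zeta> Y^2 + 2 p Y^2\<close> has integral 0 because
  \<open>Y\<close> vanishes at both ends; this trades the integral with \<open>p\<close> for that of
  \<open>U^2\<close>.\<close>

lemma norming_identity:
  assumes s: "dirac_sol \<tau> p \<zeta> Y U" and Y1: "Y 1 = 0" and \<zeta>: "\<zeta> \<noteq> 0"
  shows "2 * (LINT t|unit_leb. (Y t)\<^sup>2) - 2 / \<zeta> * (LINT t|unit_leb. of_real (p t) * (Y t)\<^sup>2) = integral {0..1} (\<lambda>t. (Y t)\<^sup>2 + (U t)\<^sup>2)"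
proof -
  note P = dirac_sol_properties[OF s]
  have c: "continuous_on {0..1} (\<lambda>t. (Y t)\<^sup>2)" "continuous_on {0..1} (\<lambda>t. (U t)\<^sup>2)" by (intro continuous_intros P)+
  have i: "(\<lambda>t. (Y t)\<^sup>2) absolutely_integrable_on {0..1}" "(\<lambda>t. (U t)\<^sup>2) absolutely_integrable_on {0..1}"
    "(\<lambda>t. of_real (p t) * (Y t)\<^sup>2) absolutely_integrable_on {0..1}"
    by (intro absolutely_integrable_continuous_real absolutely_integrable_comm_times p_int c)+
  define a b d where "a = integral {0..1} (\<lambda>t. (Y t)\<^sup>2)" and "b = integral {0..1} (\<lambda>t. (U t)\<^sup>2)"
    and "d = integral {0..1} (\<lambda>t. of_real (p t) * (Y t)\<^sup>2)"
  have h: "((\<lambda>t. (Y t)\<^sup>2) has_integral a) {0..1}" "((\<lambda>t. (U t)\<^sup>2) has_integral b) {0..1}" "((\<lambda>t. of_real (p t) * (Y t)\<^sup>2) has_integral d) {0..1}"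
    unfolding a_def b_def d_def using i set_lebesgue_integral_eq_integral(1) by (blast intro: integrable_integral)+
  have wa: "abs_cont (\<lambda>x. U x * Y x)" by (intro abs_cont_mult P)
  have "AE t in unit_leb. vector_derivative (\<lambda>x. U x * Y x) (at t) = \<zeta> * (U t)\<^sup>2 - \<zeta> * (Y t)\<^sup>2 + 2 * (of_real (p t) * (Y t)\<^sup>2)"
    using P(7,8)
  proof eventually_elim
    case (elim t)
    show ?case using vector_derivative_at[OF has_vector_derivative_mult[OF elim(2,1)]] by (simp add: power2_eq_square algebra_simps)
  qed
  from abs_cont_AE(3)[OF wa this, of 1] have "((\<lambda>t. \<zeta> * (U t)\<^sup>2 - \<zeta> * (Y t)\<^sup>2 + 2 * (of_real (p t) * (Y t)\<^sup>2)) has_integral 0) {0..1}"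
    using Y1 P(3) by simp
  moreover have "((\<lambda>t. \<zeta> * (U t)\<^sup>2 - \<zeta> * (Y t)\<^sup>2 + 2 * (of_real (p t) * (Y t)\<^sup>2)) has_integral (\<zeta> * b - \<zeta> * a + 2 * d)) {0..1}"
    by (intro has_integral_add has_integral_diff has_integral_mult_right h)
  ultimately have "\<zeta> * b - \<zeta> * a + 2 * d = 0" by (rule has_integral_unique[symmetric])
  then have "2 * d = \<zeta> * (a - b)" by (simp add: algebra_simps)
  then have "2 / \<zeta> * d = a - b" using \<zeta> by (simp add: field_simps)
  moreover have "integral {0..1} (\<lambda>t. (Y t)\<^sup>2 + (U t)\<^sup>2) = a + b" by (intro integral_unique has_integral_add h)
  ultimately show ?thesis
    unfolding absolutely_integrable_unit(2)[OF i(1)] absolutely_integrable_unit(2)[OF i(3)] a_def[symmetric] d_def[symmetric] by simp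
qed

text \<open>An eigenfunction contradicts the injectivity clause of the resolvent set.\<close>

lemma eigenvalue_in_spectrum:
  assumes "pencil_eigenfunction p r \<zeta> y" shows "\<zeta> \<in> pencil_spectrum p r"
proof -
  have y: "y \<in> dom_A r" "\<not> L2_eq y (\<lambda>t. 0)" "L2_eq (\<lambda>t. pencil p r \<zeta> y t - 0 * y t) (\<lambda>t. 0)"
    using assms by (simp_all add: pencil_eigenfunction_def)
  have "0 \<notin> resolvent_set (dom_A r) (pencil p r \<zeta>)"
  proof
    assume "0 \<in> resolvent_set (dom_A r) (pencil p r \<zeta>)"
    from conjunct1[OF CollectD[OF this[unfolded resolvent_set_def]]] y show False by blast
  qed
  then show ?thesis by (simp add: pencil_spectrum_def op_spectrum_def)
qed

end

section \<open>The spectral data of the constructed pencil\<close>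

lemma norming_cong:
  fixes y Y :: "real \<Rightarrow> complex"
  assumes "\<And>x. x \<in> {0..1} \<Longrightarrow> y x = Y x"
  shows "(LINT t|unit_leb. (y t)\<^sup>2) = (LINT t|unit_leb. (Y t)\<^sup>2)" "(LINT t|unit_leb. of_real (p t) * (y t)\<^sup>2) = (LINT t|unit_leb. of_real (p t) * (Y t)\<^sup>2)"
  by (rule Bochner_Integration.integral_cong; simp add: assms)+

lemma summable_on_UNIV_if_Zstar:
  fixes f :: "int \<Rightarrow> real"
  assumes "f summable_on Zstar" shows "f summable_on UNIV"
proof -
  have "f summable_on {0} \<union> Zstar" using assms by (intro summable_on_Un_disjoint) auto
  moreover have "{0} \<union> Zstar = UNIV" by auto
  ultimately show ?thesis by (simp only:)
qed

theorem theorem2p7: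
  fixes lam \<alpha> :: "int \<Rightarrow> real"
  assumes "\<forall>n\<in>Zstar. lam n \<noteq> 0"
    and "strict_mono_on Zstar lam"
    and "\<exists>h \<mu>. l2_Zstar \<mu> \<and> (\<forall>n\<in>Zstar. lam n = pi * of_int n + h + \<mu> n)"
    and "\<forall>n\<in>Zstar. \<alpha> n > 0"
    and "l2_Zstar (\<lambda>n. \<alpha> n - 1)"
  shows "\<exists>(p :: real \<Rightarrow> real) (q :: (real \<Rightarrow> real) \<Rightarrow> real) (r :: real \<Rightarrow> real).
    L2 p \<and> is_L2_primitive r q \<and> A_positive r \<and>
    spectral_data p r = (\<lambda>n. (complex_of_real (lam n), complex_of_real (\<alpha> n))) ` Zstar"
proof -
  obtain h \<mu> where h: "l2_Zstar \<mu>" "\<And>n. n \<in> Zstar \<Longrightarrow> lam n = pi * of_int n + h + \<mu> n" using assms(3) by blast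
  \<comment> \<open>Injectivity at the added index 0 is where the frequencies being nonzero
    enters.\<close>
  define lam' \<alpha>' where "lam' = lam(0 := 0)" and "\<alpha>' = \<alpha>(0 := 1)"
  have "spectral_input lam' \<alpha>' h"
  proof
    have "strict_mono_on Zstar lam" by (rule assms(2))
    then have "inj_on lam Zstar" by (rule strict_mono_on_imp_inj_on)
    then show "inj lam'" using assms(1) unfolding inj_on_def lam'_def by (metis DiffI UNIV_I fun_upd_apply singletonD)
    show "lam' 0 = 0" by (simp add: lam'_def)
    show "\<alpha>' n > 0" for n using assms(4) by (simp add: \<alpha>'_def)
    have "(\<lambda>n. (\<mu> n)\<^sup>2) summable_on Zstar" using h(1) by (simp add: l2_Zstar_def)
    then have "(\<lambda>n. (lam' n - free_freq h n)\<^sup>2) summable_on Zstar" by (rule summable_on_cong[THEN iffD1, rotated]) (simp add: lam'_def free_freq_def h(2))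
    then show "(\<lambda>n. (lam' n - free_freq h n)\<^sup>2) summable_on UNIV" by (rule summable_on_UNIV_if_Zstar)
    have "(\<lambda>n. (\<alpha> n - 1)\<^sup>2) summable_on Zstar" using assms(5) by (simp add: l2_Zstar_def)
    then have "(\<lambda>n. (\<alpha>' n - 1)\<^sup>2) summable_on Zstar" by (rule summable_on_cong[THEN iffD1, rotated]) (simp add: \<alpha>'_def)
    then show "(\<lambda>n. (\<alpha>' n - 1)\<^sup>2) summable_on UNIV" by (rule summable_on_UNIV_if_Zstar)
  qed
  then obtain K C Tp Pp \<tau> p where "dirac_approx lam' \<alpha>' h K C Tp Pp \<tau> p" using spectral_input.dirac_approx_exists by blast
  then interpret da: dirac_approx lam' \<alpha>' h K C Tp Pp \<tau> p .
  interpret dp: dirac_potential \<tau> p by unfold_locales (rule da.\<tau> da.p)+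
  define q where "q \<phi> = - (LINT t|unit_leb. dp.r t * deriv \<phi> t)" for \<phi>
  \<comment> \<open>For real parameters both components are real, so the squared modulus of
    \<open>U + i Y\<close> is \<open>Y^2 + U^2\<close>.\<close>
  have energy: "integral {0..1} (\<lambda>t. (da.Ys (of_real (lam' i)) t)\<^sup>2 + (da.Us (of_real (lam' i)) t)\<^sup>2) = of_real (\<alpha>' i)" for i
  proof -
    let ?Y = "da.Ys (of_real (lam' i))" and ?U = "da.Us (of_real (lam' i))"
    have c: "continuous_on {0..1} ?Y" "continuous_on {0..1} ?U" using da.sol(1)[of "of_real (lam' i)"] by (auto simp: dirac_sol_def)
    have "(\<lambda>t. (cmod (?U t + \<i> * ?Y t))\<^sup>2) integrable_on {0..1}" by (intro integrable_continuous_real continuous_intros c)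
    then have "((\<lambda>t. (cmod (?U t + \<i> * ?Y t))\<^sup>2) has_integral \<alpha>' i) {0..1}"
      unfolding da.norming[of i, symmetric] by (rule integrable_integral)
    then have "((\<lambda>t. complex_of_real ((cmod (?U t + \<i> * ?Y t))\<^sup>2)) has_integral of_real (\<alpha>' i)) {0..1}" by (rule has_integral_of_real)
    then have "((\<lambda>t. (?Y t)\<^sup>2 + (?U t)\<^sup>2) has_integral of_real (\<alpha>' i)) {0..1}"
    proof (rule has_integral_eq[rotated])
      fix t :: real assume t: "t \<in> {0..1}"
      obtain a b where ab: "?Y t = of_real a" "?U t = of_real b"
        using da.sol_real[OF t, of "lam' i"] by (metis complex_is_Real_iff Reals_cases)
      show "complex_of_real ((cmod (?U t + \<i> * ?Y t))\<^sup>2) = (?Y t)\<^sup>2 + (?U t)\<^sup>2"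
        unfolding ab by (simp add: cmod_power2)
    qed
    then show ?thesis by (rule integral_unique)
  qed
  have norming: "2 * (LINT t|unit_leb. (da.Ys (of_real (lam' i)) t)\<^sup>2) - 2 / of_real (lam' i) * (LINT t|unit_leb. of_real (p t) * (da.Ys (of_real (lam' i)) t)\<^sup>2) = of_real (\<alpha>' i)"
    if "lam' i \<noteq> 0" for i
    using dp.norming_identity[OF da.sol(1) da.eigenvalue[of i]] that energy[of i] by simp
  \<comment> \<open>A pair in the spectral data brings a normalized eigenfunction with its norming
    constant; by uniqueness for the Dirac system this is \<open>Ys\<close>, so everything is decided
    by the zeros of \<open>Ys \<zeta> 1\<close>.\<close>
  have data: "(\<zeta>, a) \<in> spectral_data p dp.r \<longleftrightarrow> (\<exists>i\<in>Zstar. \<zeta> = of_real (lam i) \<and> a = of_real (\<alpha> i))" for \<zeta> a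
  proof
    assume "(\<zeta>, a) \<in> spectral_data p dp.r"
    then obtain y where y: "pencil_eigenfunction p dp.r \<zeta> y" "quasi_deriv dp.r y 0 = \<zeta>"
      "a = 2 * (LINT t|unit_leb. (y t)\<^sup>2) - 2 / \<zeta> * (LINT t|unit_leb. of_real (p t) * (y t)\<^sup>2)"
      by (auto simp: spectral_data_def is_norming_constant_def)
    obtain u where u: "dirac_sol \<tau> p \<zeta> y u" using dp.eigenfunction_dirac_sol(2)[OF y(1,2)] by blast
    have yY: "y x = da.Ys \<zeta> x" if "x \<in> {0..1}" for x
      using dirac_sol_unique[OF da.\<tau>(2) da.p(2) u da.sol(1) that] by simp
    have "da.Ys \<zeta> 1 = 0" using yY[of 1] dp.eigenfunction_dirac_sol(3)[OF y(1,2)] by simp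
    then obtain i where i: "\<zeta> = of_real (lam' i)" using da.no_other_eigenvalue[of \<zeta>] by blast
    have z: "\<zeta> \<noteq> 0" by (rule dp.eigenfunction_dirac_sol(1)[OF y(1,2)])
    \<comment> \<open>The added index drops out here, since its frequency 0 is not an eigenvalue of
      the pencil.\<close>
    then have i0: "i \<noteq> 0" using i da.lam_0 by auto
    have nc: "(LINT t|unit_leb. (y t)\<^sup>2) = (LINT t|unit_leb. (da.Ys \<zeta> t)\<^sup>2)"
      "(LINT t|unit_leb. of_real (p t) * (y t)\<^sup>2) = (LINT t|unit_leb. of_real (p t) * (da.Ys \<zeta> t)\<^sup>2)"
      by (rule norming_cong[OF yY]; assumption)+
    have "a = of_real (\<alpha>' i)"
      unfolding y(3) nc using norming[of i] z unfolding i by simp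
    then show "\<exists>i\<in>Zstar. \<zeta> = of_real (lam i) \<and> a = of_real (\<alpha> i)"
      using i i0 by (intro bexI[of _ i]) (auto simp: lam'_def \<alpha>'_def)
  next
    assume "\<exists>i\<in>Zstar. \<zeta> = of_real (lam i) \<and> a = of_real (\<alpha> i)"
    then obtain i where i: "i \<noteq> 0" "\<zeta> = of_real (lam' i)" "a = of_real (\<alpha>' i)" "lam' i \<noteq> 0"
      using assms(1) by (auto simp: lam'_def \<alpha>'_def)
    have z: "\<zeta> \<noteq> 0" using i by simp
    have Y1: "da.Ys \<zeta> 1 = 0" unfolding i(2) by (rule da.eigenvalue)
    note e = dp.dirac_sol_eigenfunction[OF da.sol(1) Y1 z]
    have "da.Ys \<zeta> 0 = 0" using dp.dirac_sol_properties(3)[OF da.sol(1)] .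
    then have "is_norming_constant p dp.r \<zeta> a"
      unfolding is_norming_constant_def using e norming[OF i(4)] i(2,3) by (intro exI[of _ "da.Ys \<zeta>"]) simp
    then show "(\<zeta>, a) \<in> spectral_data p dp.r"
      using dp.eigenvalue_in_spectrum[OF e(1)] by (simp add: spectral_data_def)
  qed
  show ?thesis
  proof (intro exI conjI)
    show "L2 p" by (rule da.p(1))
    show "is_L2_primitive dp.r q" using dp.r_L2 by (simp add: is_L2_primitive_def q_def)
    show "A_positive dp.r" by (rule dp.positive)
    show "spectral_data p dp.r = (\<lambda>n. (complex_of_real (lam n), complex_of_real (\<alpha> n))) ` Zstar"
      using data by (auto simp: image_iff)
  qed
qed

end
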